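(* Let $n\ge1$ be an integer, let $\Lambda\subset\mathbb{R}^2$ be a lattice and $\mathbf{h}_n=(h_0,\dots,h_{n-1})$. Then $\mathcal{G}(\mathbf{h}_n,\Lambda)=\{M_\omega T_x\mathbf{h}_n:(x,\omega)\in\Lambda\}$ is a Riesz sequence in $L^2(\mathbb{R},\mathbb{C}^n)$ if and only if $D(\Lambda)<n$.
   Context: Hermite functions: $h_j(t)=c_je^{\pi t^2}\frac{d^j}{dt^j}e^{-2\pi t^2}$ with $c_j>0$ chosen so that $\|h_j\|_{L^2(\mathbb{R})}=1$. $T_xf(t)=f(t-x)$, $M_\omega f(t)=e^{2\pi i\omega t}f(t)$, acting coordinatewise. $L^2(\mathbb{R},\mathbb{C}^n)$ consists of $\mathbf{f}=(f_0,\dots,f_{n-1})$ with $\langle\mathbf{f},\mathbf{g}\rangle=\sum_k\langle f_k,g_k\rangle_{L^2(\mathbb{R})}$. A family $(g_i)$ is a Riesz sequence if there are $A,B>0$ with $A\sum|c_i|^2\le\|\sum c_ig_i\|^2\le B\sum|c_i|^2$ for all finitely supported $(c_i)$. A lattice is $\Lambda=A\mathbb{Z}^2$ with $A$ invertible, and $D(\Lambda)=|\det A|^{-1}$. *)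

theory Defs
  imports "HOL-Analysis.Analysis"
begin

definition hermite_raw :: "nat \<Rightarrow> real \<Rightarrow> real" where
  "hermite_raw j t = exp (pi * t\<^sup>2) * (deriv ^^ j) (\<lambda>s. exp (- 2 * pi * s\<^sup>2)) t"

definition hermite_const :: "nat \<Rightarrow> real" where
  "hermite_const j = 1 / sqrt (\<integral>t. (hermite_raw j t)\<^sup>2 \<partial>lborel)"

definition hermite :: "nat \<Rightarrow> real \<Rightarrow> real" where
  "hermite j t = hermite_const j * hermite_raw j t"

text \<open>Elements of L2(R, C^n) are represented as f :: nat => real => complex,
  component k < n being f k. Squared norm: sum of the component L2 norms.\<close>
definition vec_L2_norm_sq :: "nat \<Rightarrow> (nat \<Rightarrow> real \<Rightarrow> complex) \<Rightarrow> real" where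
  "vec_L2_norm_sq n f = (\<Sum>k<n. \<integral>t. (cmod (f k t))\<^sup>2 \<partial>lborel)"

definition riesz_sequence :: "nat \<Rightarrow> ('i \<Rightarrow> nat \<Rightarrow> real \<Rightarrow> complex) \<Rightarrow> bool" where
  "riesz_sequence n g \<longleftrightarrow>
     (\<exists>A B. A > 0 \<and> B > 0 \<and>
       (\<forall>c :: 'i \<Rightarrow> complex. finite {i. c i \<noteq> 0} \<longrightarrow>
          A * (\<Sum>i\<in>{i. c i \<noteq> 0}. (cmod (c i))\<^sup>2)
            \<le> vec_L2_norm_sq n (\<lambda>k t. \<Sum>i\<in>{i. c i \<noteq> 0}. c i * g i k t) \<and>
          vec_L2_norm_sq n (\<lambda>k t. \<Sum>i\<in>{i. c i \<noteq> 0}. c i * g i k t)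
            \<le> B * (\<Sum>i\<in>{i. c i \<noteq> 0}. (cmod (c i))\<^sup>2)))"

definition lattice_point :: "real^2^2 \<Rightarrow> int \<times> int \<Rightarrow> real^2" where
  "lattice_point A ml = A *v vector [of_int (fst ml), of_int (snd ml)]"

definition lattice_density :: "real^2^2 \<Rightarrow> real" where
  "lattice_density A = 1 / \<bar>det A\<bar>"

definition gabor_hermite :: "real^2^2 \<Rightarrow> int \<times> int \<Rightarrow> nat \<Rightarrow> real \<Rightarrow> complex" where
  "gabor_hermite A ml k t =
     (let p = lattice_point A ml; x = p $ 1; \<omega> = p $ 2 in
      exp (2 * pi * \<i> * complex_of_real (\<omega> * t)) * complex_of_real (hermite k (t - x)))"

end

theory Submission
  imports Defs "HOL-Probability.Probability" "HOL-Complex_Analysis.Complex_Analysis" "HOL-Real_Asymp.Real_Asymp"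
begin

text \<open>
  With \<open>z = x - i \<omega>\<close> the Bargmann transform carries \<open>M\<^sub>\<omega> T\<^sub>x h\<^sub>k\<close> to a multiple of
  \<open>(w - z)\<^sup>k exp (\<pi> cnj z w - \<pi> \<bar>z\<bar>\<^sup>2/2 - \<pi> \<bar>w\<bar>\<^sup>2/2)\<close>, so the claim concerns the \<open>L\<^sup>2\<close> norms of
  \<open>S\<^sub>k(w) = \<Sum>\<^sub>\<lambda> c\<^sub>\<lambda> (w - \<lambda>)\<^sup>k exp (\<dots>)\<close> for \<open>k < n\<close>. Let \<open>D\<close> be the density of \<open>\<Lambda>\<close>, \<open>M = D \<Lambda>\<close> the dual
  lattice, of covolume \<open>D\<close>, and \<open>\<sigma>\<close> an entire function vanishing simply on \<open>M\<close> for which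
  \<open>\<bar>\<sigma>(z)\<bar> exp (- \<pi> \<bar>z\<bar>\<^sup>2 / (2 D))\<close> is \<open>M\<close>-periodic.

  If \<open>D < n\<close>, then \<open>\<sigma>\<^sup>n\<close> outgrows \<open>exp (\<pi> \<bar>z\<bar>\<^sup>2 / 2)\<close>, and the Cauchy formula for \<open>U / \<sigma>\<^sup>n\<close> bounds an entire
  function \<open>U\<close> by its jets of order \<open>n\<close> on \<open>M\<close>. Applied to the exponential sum
  \<open>v \<mapsto> \<Sum>\<^sub>\<lambda> c\<^sub>\<lambda> exp (\<dots>)\<close> whose jets on \<open>M\<close> are, up to conjugation, the translates \<open>S\<^sub>k(z + \<mu>)\<close>, and combined with Parseval over a
  fundamental domain of \<open>M\<close>, this gives the lower Riesz bound.

  If \<open>D \<ge> n\<close>, the bounded coefficients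
  \<open>b\<^sub>\<lambda> = cnj (\<sigma>(\<lambda> + a)\<^sup>n) exp (- \<pi> cnj a \<lambda> - \<pi> \<bar>\<lambda>\<bar>\<^sup>2/2)\<close> satisfy \<open>S\<^sub>k = 0\<close> for all \<open>k < n\<close>: by Poisson
  summation the sum turns into Gaussian integrals centred at the zeros of \<open>\<sigma>\<^sup>n\<close>, where the zero of order \<open>n > k\<close>
  makes them vanish by rotational averaging. Cutting \<open>b\<close> off at radius \<open>R\<close> yields finite sums violating
  every lower bound as \<open>R \<rightarrow> \<infinity>\<close>.
\<close>

section \<open>A quasi-periodic entire function for a lattice\<close>

text \<open>The number \<open>n\<close> meets the density D through growth alone: the n-th power of
  \<sigma> has Gaussian exponent n pi / (2 D), Fock space has pi / 2. A strict surplus acts as a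
  Gaussian convergence factor, which makes the contour series absolutely convergent and the sampling
  bound local. For D = n nothing is left over, and this borderline shapes the negative half: there
  the coefficients \<open>b\<close> are bounded but do not decay. A cutoff of slope 1/R, applied to
  a series with sum zero, leaves values of size 1/R on a region of area R^2. The energy thus stays
  bounded in R while the sum of the squared coefficients grows. For D > n the coefficients decay and
  the energy itself tends to 0. The shift \<open>a\<close> keeps \<open>b\<close> from vanishing:
  for D = n = 1 both lattices coincide, and a = 0 would make every coefficient zero. In the positive
  half the j-th coefficient is reached at v = cnj z - cnj (l j): in the coordinates of z the
  weighted modulus there is that of a trigonometric polynomial whose j-th coefficient has modulus |c
  j|.\<close>

definition theta_factor :: "complex \<Rightarrow> complex \<Rightarrow> nat \<Rightarrow> complex" where
  "theta_factor \<tau> u m =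
     (1 - exp (2 * pi * \<i> * \<tau>) ^ Suc m * exp (2 * pi * \<i> * u)) *
     (1 - exp (2 * pi * \<i> * \<tau>) ^ Suc m * exp (- (2 * pi * \<i> * u)))"

definition theta_cofactor :: "complex \<Rightarrow> complex \<Rightarrow> complex" where
  "theta_cofactor \<tau> u = prodinf (theta_factor \<tau> u)"

text \<open>By the Jacobi triple product this is a constant times exp (pi i u) times the odd theta
  function. The factor responsible for the zeros at the integers stays outside the infinite product,
  so that the derivative at 0 is immediate.\<close>

definition theta_prod :: "complex \<Rightarrow> complex \<Rightarrow> complex" where
  "theta_prod \<tau> u = (1 - exp (2 * pi * \<i> * u)) * theta_cofactor \<tau> u"

context
  fixes \<tau> :: complex
  assumes \<tau>: "0 < Im \<tau>"
begin

lemma nome_less_one: "norm (exp (2 * pi * \<i> * \<tau>)) < 1"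
  using \<tau> by (simp add: norm_exp_eq_Re)

text \<open>The bound is geometric in \<open>m\<close> and depends on \<open>u\<close> only through
  \<open>r\<close>; it therefore serves pointwise convergence as well as the M-test on balls. One
  power of the nome is given away to have exponent \<open>m\<close>.\<close>

lemma norm_theta_factor_le:
  assumes "norm u \<le> r"
  shows "norm (theta_factor \<tau> u m - 1) \<le> (2 * exp (2 * pi * r) + exp (2 * pi * r) ^ 2) * norm (exp (2 * pi * \<i> * \<tau>)) ^ m"
proof -
  define q where "q = exp (2 * pi * \<i> * \<tau>)"
  define X where "X = exp (2 * pi * \<i> * u)"
  define Y where "Y = exp (- (2 * pi * \<i> * u))"
  have q1: "norm q < 1" using nome_less_one by (simp add: q_def)
  have "\<bar>Im u\<bar> \<le> r" using assms abs_Im_le_cmod[of u] by linarith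
  hence X: "norm X \<le> exp (2 * pi * r)" and Y: "norm Y \<le> exp (2 * pi * r)"
    using mult_left_mono[of "- Im u" r pi] mult_left_mono[of "Im u" r pi]
    by (auto simp: X_def Y_def abs_le_iff)
  have qq: "norm q ^ Suc m \<le> norm q ^ m" using q1 by (intro power_decreasing) auto
  have qq2: "norm q ^ Suc m * norm q ^ Suc m \<le> norm q ^ m * 1"
    using q1 qq by (intro mult_mono) (auto intro!: mult_le_one power_le_one)
  have "theta_factor \<tau> u m - 1 = - (q ^ Suc m * X) - q ^ Suc m * Y + (q ^ Suc m * q ^ Suc m) * (X * Y)"
    by (simp add: theta_factor_def q_def X_def Y_def algebra_simps)
  also have "norm \<dots> \<le> norm q ^ Suc m * norm X + norm q ^ Suc m * norm Y + (norm q ^ Suc m * norm q ^ Suc m) * (norm X * norm Y)"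
    by (intro order.trans[OF norm_triangle_ineq] add_mono order.trans[OF norm_triangle_ineq4])
       (auto simp: norm_mult norm_power)
  also have "\<dots> \<le> norm q ^ m * exp (2 * pi * r) + norm q ^ m * exp (2 * pi * r) + norm q ^ m * (exp (2 * pi * r) * exp (2 * pi * r))"
    using X Y qq qq2 by (intro add_mono mult_mono) auto
  finally show ?thesis by (simp add: q_def power2_eq_square algebra_simps)
qed

lemma theta_factor_convergent: "convergent_prod (theta_factor \<tau> u)"
proof -
  have "summable (\<lambda>m. norm (theta_factor \<tau> u m - 1))"
  proof (rule summable_comparison_test'[where N = 0])
    show "summable (\<lambda>m. (2 * exp (2 * pi * norm u) + exp (2 * pi * norm u) ^ 2) * norm (exp (2 * pi * \<i> * \<tau>)) ^ m)"
      using nome_less_one by (intro summable_mult summable_geometric) simp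
  qed (use norm_theta_factor_le[of u "norm u"] in auto)
  thus ?thesis by (intro abs_convergent_prod_imp_convergent_prod summable_imp_abs_convergent_prod)
qed

text \<open>The partial products are entire and converge uniformly on every closed unit ball, where
  the deviations of the factors from 1 are dominated by one geometric series.\<close>

lemma holomorphic_theta_cofactor: "theta_cofactor \<tau> holomorphic_on UNIV"
proof (rule holomorphic_uniform_sequence)
  show "(\<lambda>u. \<Prod>m<N. theta_factor \<tau> u m) holomorphic_on UNIV" for N
    unfolding theta_factor_def by (intro holomorphic_intros)
  fix u :: complex
  have bd: "norm (theta_factor \<tau> x m - 1) \<le> (2 * exp (2 * pi * (norm u + 1)) + exp (2 * pi * (norm u + 1)) ^ 2) * norm (exp (2 * pi * \<i> * \<tau>)) ^ m"
    if "x \<in> cball u 1" for x m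
  proof (rule norm_theta_factor_le)
    show "norm x \<le> norm u + 1" using that norm_triangle_ineq2[of x u] by (simp add: dist_norm norm_minus_commute)
  qed
  have "uniformly_convergent_on (cball u 1) (\<lambda>N x. \<Sum>m<N. norm (theta_factor \<tau> x m - 1))"
    by (rule Weierstrass_m_test'[where M = "\<lambda>m. (2 * exp (2 * pi * (norm u + 1)) + exp (2 * pi * (norm u + 1)) ^ 2) * norm (exp (2 * pi * \<i> * \<tau>)) ^ m"])
       (use bd nome_less_one in \<open>auto intro!: summable_mult summable_geometric\<close>)
  hence "uniformly_convergent_on (cball u 1) (\<lambda>N x. \<Prod>m<N. theta_factor \<tau> x m)"
    by (intro uniformly_convergent_on_prod') (auto simp: theta_factor_def intro!: continuous_intros)
  then obtain l where l: "uniform_limit (cball u 1) (\<lambda>N x. \<Prod>m<N. theta_factor \<tau> x m) l sequentially"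
    by (auto simp: uniformly_convergent_on_def)
  have "uniform_limit (cball u 1) (\<lambda>N x. \<Prod>m<N. theta_factor \<tau> x m) (theta_cofactor \<tau>) sequentially"
  proof (rule uniform_limit_cong'[THEN iffD1, OF _ _ l])
    fix x assume x: "x \<in> cball u 1"
    have "(\<lambda>N. \<Prod>m<N. theta_factor \<tau> x m) \<longlonglongrightarrow> l x" using tendsto_uniform_limitI[OF l x] .
    moreover have "(\<lambda>N. \<Prod>m<N. theta_factor \<tau> x m) \<longlonglongrightarrow> theta_cofactor \<tau> x"
      using convergent_prod_LIMSEQ[OF theta_factor_convergent[of x]]
      unfolding theta_cofactor_def by (subst (asm) LIMSEQ_lessThan_iff_atMost[symmetric])
    ultimately show "l x = theta_cofactor \<tau> x" by (rule LIMSEQ_unique)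
  qed simp
  thus "\<exists>d>0. cball u d \<subseteq> UNIV \<and> uniform_limit (cball u d) (\<lambda>N u. \<Prod>m<N. theta_factor \<tau> u m) (theta_cofactor \<tau>) sequentially"
    by (intro exI[of _ 1]) auto
qed auto

lemma theta_cofactor_limit: "(\<lambda>N. \<Prod>m<N. theta_factor \<tau> u m) \<longlonglongrightarrow> theta_cofactor \<tau> u"
  using convergent_prod_LIMSEQ[OF theta_factor_convergent[of u]]
  unfolding theta_cofactor_def by (subst (asm) LIMSEQ_lessThan_iff_atMost[symmetric])

text \<open>Convergence in the sense of \<open>convergent_prod\<close> demands a nonzero limit once
  finitely many factors are dropped, so the product can vanish only through a single factor.\<close>

lemma theta_cofactor_eq_0_iff: "theta_cofactor \<tau> u = 0 \<longleftrightarrow> (\<exists>m. theta_factor \<tau> u m = 0)"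
proof
  assume "\<exists>m. theta_factor \<tau> u m = 0"
  then obtain m where m: "theta_factor \<tau> u m = 0" by blast
  have "\<forall>\<^sub>F N in sequentially. (\<Prod>m<N. theta_factor \<tau> u m) = 0"
    using eventually_gt_at_top[of m] by eventually_elim (use m in auto)
  thus "theta_cofactor \<tau> u = 0"
    using LIMSEQ_unique[OF theta_cofactor_limit[of u] tendsto_eventually] by blast
qed (use prodinf_nonzero[OF theta_factor_convergent[of u]] in \<open>auto simp: theta_cofactor_def\<close>)

lemma theta_prod_shift_1: "theta_prod \<tau> (u + 1) = theta_prod \<tau> u"
proof -
  have "exp (2 * pi * \<i> * (u + 1)) = exp (2 * pi * \<i> * u)"
       "exp (- (2 * pi * \<i> * (u + 1))) = exp (- (2 * pi * \<i> * u))"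
    by (simp_all add: distrib_left exp_add exp_minus exp_diff)
  thus ?thesis by (simp add: theta_prod_def theta_cofactor_def theta_factor_def[abs_def])
qed

text \<open>Adding \<tau> multiplies X by the nome and divides Y by it, so the factors of the
  product merely move by one place and only boundary factors change.\<close>

lemma theta_prod_shift_tau: "theta_prod \<tau> (u + \<tau>) = - exp (- (2 * pi * \<i> * u)) * theta_prod \<tau> u"
proof -
  define q where "q = exp (2 * pi * \<i> * \<tau>)"
  define X where "X = exp (2 * pi * \<i> * u)"
  define Y where "Y = exp (- (2 * pi * \<i> * u))"
  have XY: "X * Y = 1" by (simp add: X_def Y_def exp_minus)
  have q0: "q \<noteq> 0" by (simp add: q_def)
  have e1: "exp (2 * pi * \<i> * (u + \<tau>)) = q * X" 
    by (simp add: q_def X_def exp_add[symmetric] algebra_simps)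
  have e2: "exp (- (2 * pi * \<i> * (u + \<tau>))) = Y / q"
    unfolding q_def Y_def exp_diff[symmetric] by (rule arg_cong[where f = exp]) (simp add: algebra_simps)
  \<comment> \<open>The telescoping identity is cross-multiplied, because the boundary factors may
    be zero.\<close>
  have fin: "(\<Prod>m<N. theta_factor \<tau> (u + \<tau>) m) * ((1 - q * X) * (1 - q ^ N * Y))
           = (\<Prod>m<N. theta_factor \<tau> u m) * ((1 - q ^ Suc N * X) * (1 - Y))" for N
  proof (induction N)
    case (Suc N)
    have t1: "theta_factor \<tau> (u + \<tau>) N = (1 - q ^ Suc (Suc N) * X) * (1 - q ^ N * Y)"
      unfolding theta_factor_def e1 e2 q_def[symmetric] using q0 by (simp add: mult_ac)
    have t2: "theta_factor \<tau> u N = (1 - q ^ Suc N * X) * (1 - q ^ Suc N * Y)"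
      by (simp add: theta_factor_def q_def X_def Y_def)
    have "(\<Prod>m<Suc N. theta_factor \<tau> (u + \<tau>) m) * ((1 - q * X) * (1 - q ^ Suc N * Y))
      = ((\<Prod>m<N. theta_factor \<tau> (u + \<tau>) m) * ((1 - q * X) * (1 - q ^ N * Y))) * ((1 - q ^ Suc (Suc N) * X) * (1 - q ^ Suc N * Y))"
      by (simp add: t1 mult_ac)
    also have "\<dots> = (\<Prod>m<Suc N. theta_factor \<tau> u m) * ((1 - q ^ Suc (Suc N) * X) * (1 - Y))"
      unfolding Suc.IH by (simp add: t2 mult_ac)
    finally show ?case .
  qed simp
  have qlim: "(\<lambda>N. q ^ N) \<longlonglongrightarrow> 0" using nome_less_one by (intro LIMSEQ_power_zero) (simp add: q_def)
  have "(\<lambda>N. (\<Prod>m<N. theta_factor \<tau> (u + \<tau>) m) * ((1 - q * X) * (1 - q ^ N * Y)))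
      \<longlonglongrightarrow> theta_cofactor \<tau> (u + \<tau>) * ((1 - q * X) * (1 - 0 * Y))"
    by (intro tendsto_intros theta_cofactor_limit qlim)
  moreover have "(\<lambda>N. (\<Prod>m<N. theta_factor \<tau> u m) * ((1 - q ^ Suc N * X) * (1 - Y)))
      \<longlonglongrightarrow> theta_cofactor \<tau> u * ((1 - 0 * X) * (1 - Y))"
    by (intro tendsto_intros theta_cofactor_limit LIMSEQ_Suc[OF qlim])
  ultimately have "theta_cofactor \<tau> (u + \<tau>) * ((1 - q * X) * (1 - 0 * Y)) = theta_cofactor \<tau> u * ((1 - 0 * X) * (1 - Y))"
    unfolding fin by (rule LIMSEQ_unique)
  hence "theta_cofactor \<tau> (u + \<tau>) * (1 - q * X) = theta_cofactor \<tau> u * (1 - Y)" by simp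
  moreover have "1 - Y = - Y * (1 - X)" using XY by (simp add: algebra_simps)
  ultimately show ?thesis
    unfolding theta_prod_def e1 Y_def[symmetric] X_def[symmetric] by (simp add: algebra_simps)
qed

text \<open>The outer factor and the two kinds of factors in the product account for the lattice
  points with \<open>b\<close> zero, negative and positive respectively.\<close>

lemma theta_prod_eq_0_iff: "theta_prod \<tau> u = 0 \<longleftrightarrow> (\<exists>a b :: int. u = of_int a + of_int b * \<tau>)"
proof -
  have fac: "1 - exp (2 * pi * \<i> * \<tau>) ^ k * exp (2 * pi * \<i> * v) = 0 \<longleftrightarrow> (\<exists>a :: int. v = of_int a - of_nat k * \<tau>)" for k v
  proof -
    have "exp (2 * pi * \<i> * \<tau>) ^ k * exp (2 * pi * \<i> * v) = exp (2 * pi * \<i> * (of_nat k * \<tau> + v))"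
      by (simp add: exp_add distrib_left exp_of_nat_mult[symmetric] mult_ac)
    hence "1 - exp (2 * pi * \<i> * \<tau>) ^ k * exp (2 * pi * \<i> * v) = 0 \<longleftrightarrow> exp (2 * pi * \<i> * (of_nat k * \<tau> + v)) = exp 0"
      by auto
    also have "\<dots> \<longleftrightarrow> (\<exists>a :: int. 2 * pi * \<i> * (of_nat k * \<tau> + v) = 2 * pi * \<i> * of_int a)"
      unfolding exp_eq by (simp add: mult_ac)
    also have "\<dots> \<longleftrightarrow> (\<exists>a :: int. of_nat k * \<tau> + v = of_int a)" by simp
    also have "\<dots> \<longleftrightarrow> (\<exists>a :: int. v = of_int a - of_nat k * \<tau>)" by (auto simp: algebra_simps)
    finally show ?thesis .
  qed
  have fac0: "1 - exp (2 * pi * \<i> * u) = 0 \<longleftrightarrow> (\<exists>a :: int. u = of_int a)"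
    using fac[of 0 u] by simp
  have facm: "1 - exp (2 * pi * \<i> * \<tau>) ^ k * exp (- (2 * pi * \<i> * u)) = 0 \<longleftrightarrow> (\<exists>a :: int. u = of_int a + of_nat k * \<tau>)" for k
  proof -
    have "1 - exp (2 * pi * \<i> * \<tau>) ^ k * exp (- (2 * pi * \<i> * u)) = 0 \<longleftrightarrow> (\<exists>a :: int. - u = of_int a - of_nat k * \<tau>)"
      using fac[of k "- u"] by simp
    also have "\<dots> \<longleftrightarrow> (\<exists>a :: int. u = of_int (- a) + of_nat k * \<tau>)" by (intro ex_cong1) (auto simp: algebra_simps minus_equation_iff)
    also have "\<dots> \<longleftrightarrow> (\<exists>a :: int. u = of_int a + of_nat k * \<tau>)" by (metis minus_minus)
    finally show ?thesis .
  qed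
  have "theta_prod \<tau> u = 0 \<longleftrightarrow> (\<exists>a :: int. u = of_int a) \<or> (\<exists>m. \<exists>a :: int. u = of_int a - of_nat (Suc m) * \<tau>) \<or> (\<exists>m. \<exists>a :: int. u = of_int a + of_nat (Suc m) * \<tau>)"
    unfolding theta_prod_def mult_eq_0_iff theta_cofactor_eq_0_iff theta_factor_def fac0 fac facm by blast
  also have "\<dots> \<longleftrightarrow> (\<exists>a b :: int. u = of_int a + of_int b * \<tau>)"
  proof
    assume "(\<exists>a :: int. u = of_int a) \<or> (\<exists>m. \<exists>a :: int. u = of_int a - of_nat (Suc m) * \<tau>) \<or> (\<exists>m. \<exists>a :: int. u = of_int a + of_nat (Suc m) * \<tau>)"
    then consider a :: int where "u = of_int a + of_int 0 * \<tau>"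
      | a :: int and m where "u = of_int a + of_int (- int (Suc m)) * \<tau>"
      | a :: int and m where "u = of_int a + of_int (int (Suc m)) * \<tau>"
      by (fastforce simp: algebra_simps)
    thus "\<exists>a b :: int. u = of_int a + of_int b * \<tau>" by cases blast+
  next
    assume "\<exists>a b :: int. u = of_int a + of_int b * \<tau>"
    then obtain a b :: int where ab: "u = of_int a + of_int b * \<tau>" by blast
    consider "b = 0" | m where "b = int (Suc m)" | m where "b = - int (Suc m)"
      by (cases b rule: int_cases3) (metis Suc_pred)+
    thus "(\<exists>a :: int. u = of_int a) \<or> (\<exists>m. \<exists>a :: int. u = of_int a - of_nat (Suc m) * \<tau>) \<or> (\<exists>m. \<exists>a :: int. u = of_int a + of_nat (Suc m) * \<tau>)"
    proof cases
      case 1 thus ?thesis using ab by auto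
    next
      case (2 m) hence "u = of_int a + of_nat (Suc m) * \<tau>" using ab by simp
      thus ?thesis by blast
    next
      case (3 m)
      have "u = of_int a - of_nat (Suc m) * \<tau>" unfolding ab 3 by (simp add: algebra_simps)
      thus ?thesis by blast
    qed
  qed
  finally show ?thesis .
qed

text \<open>The outer factor vanishes at 0, so only its own derivative - 2 pi i times the cofactor
  survives; the latter is nonzero because powers of the nome have modulus below 1.\<close>

lemma deriv_theta_prod_0: "deriv (theta_prod \<tau>) 0 \<noteq> 0"
proof -
  have d: "(theta_cofactor \<tau> has_field_derivative deriv (theta_cofactor \<tau>) 0) (at 0)"
    using holomorphic_theta_cofactor by (intro holomorphic_derivI[of _ UNIV]) auto
  have "((\<lambda>u. (1 - exp (2 * pi * \<i> * u)) * theta_cofactor \<tau> u) has_field_derivative - (2 * pi * \<i>) * theta_cofactor \<tau> 0) (at 0)"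
    by (auto intro!: derivative_eq_intros d)
  hence "deriv (theta_prod \<tau>) 0 = - (2 * pi * \<i>) * theta_cofactor \<tau> 0"
    unfolding theta_prod_def[abs_def] by (rule DERIV_imp_deriv)
  moreover have "theta_cofactor \<tau> 0 \<noteq> 0"
  proof -
    have "theta_factor \<tau> 0 m \<noteq> 0" for m
    proof -
      have "norm (exp (2 * pi * \<i> * \<tau>) ^ Suc m) < 1"
        unfolding norm_power using nome_less_one by (intro power_Suc_less_one) auto
      hence "exp (2 * pi * \<i> * \<tau>) ^ Suc m \<noteq> 1" by (metis less_irrefl norm_one)
      thus ?thesis by (simp add: theta_factor_def)
    qed
    thus ?thesis by (simp add: theta_cofactor_eq_0_iff)
  qed
  ultimately show ?thesis by simp
qed

lemma holomorphic_theta_prod: "theta_prod \<tau> holomorphic_on UNIV"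
  unfolding theta_prod_def[abs_def] by (intro holomorphic_intros holomorphic_theta_cofactor)

text \<open>Under the shift by \<tau> the quadratic term of the exponent cancels the multiplier exp
  (2 pi Im u), and the linear term cancels the constant exp (- pi Im \<tau>) left over from
  completing the square.\<close>

lemma theta_modulus_periodic:
  defines "p \<equiv> \<lambda>u. norm (theta_prod \<tau> u) * exp (pi * Im u - pi * (Im u)\<^sup>2 / Im \<tau>)"
  shows "p (u + (of_int a + of_int b * \<tau>)) = p u"
proof -
  have p1: "p (v + 1) = p v" for v by (simp add: p_def theta_prod_shift_1)
  have p2: "p (v + \<tau>) = p v" for v
  proof -
    have "norm (theta_prod \<tau> (v + \<tau>)) = exp (2 * pi * Im v) * norm (theta_prod \<tau> v)"
      by (simp add: theta_prod_shift_tau norm_mult norm_exp_eq_Re)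
    moreover have "pi * Im (v + \<tau>) - pi * (Im (v + \<tau>))\<^sup>2 / Im \<tau> = - (2 * pi * Im v) + (pi * Im v - pi * (Im v)\<^sup>2 / Im \<tau>)"
      using \<tau> by (simp add: field_simps power2_eq_square)
    ultimately show ?thesis unfolding p_def by (simp only: exp_add) (simp add: exp_minus)
  qed
  have "p (v + of_int a) = p v" for v a
  proof (induction a rule: int_induct[where k = 0])
    case (step1 i) thus ?case using p1[of "v + of_int i"] by (simp add: add_ac)
  next
    case (step2 i) thus ?case using p1[of "v + of_int i - 1"] by (simp add: algebra_simps)
  qed simp
  moreover have "p (v + of_int b * \<tau>) = p v" for v b
  proof (induction b rule: int_induct[where k = 0])
    case (step1 i) thus ?case using p2[of "v + of_int i * \<tau>"] by (simp add: algebra_simps)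
  next
    case (step2 i) thus ?case using p2[of "v + of_int i * \<tau> - \<tau>"] by (simp add: algebra_simps)
  qed simp
  ultimately show ?thesis by (metis add.assoc)
qed

end

text \<open>Up to a constant and a factor exp (c z^2) this is the Weierstrass sigma function of the
  lattice. The rate \<open>\<kappa>\<close> is pi divided by twice the area of a period
  cell.\<close>

lemma lattice_sigma_exists:
  fixes \<alpha> \<beta> :: complex
  assumes V: "0 < Im (cnj \<alpha> * \<beta>)"
  defines "\<kappa> \<equiv> pi / (2 * Im (cnj \<alpha> * \<beta>))"
  obtains \<sigma> where "\<sigma> holomorphic_on UNIV"
    and "\<And>z. \<sigma> z = 0 \<longleftrightarrow> (\<exists>a b :: int. z = of_int a * \<alpha> + of_int b * \<beta>)"
    and "deriv \<sigma> 0 \<noteq> 0"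
    and "\<And>z a b. norm (\<sigma> (z + (of_int a * \<alpha> + of_int b * \<beta>))) * exp (- \<kappa> * (norm (z + (of_int a * \<alpha> + of_int b * \<beta>)))\<^sup>2)
           = norm (\<sigma> z) * exp (- \<kappa> * (norm z)\<^sup>2)"
proof -
  define \<tau> where "\<tau> = \<beta> / \<alpha>"
  have \<alpha>0: "\<alpha> \<noteq> 0" using V by auto
  have Im\<tau>: "Im \<tau> = Im (cnj \<alpha> * \<beta>) / (norm \<alpha>)\<^sup>2"
    by (simp add: \<tau>_def Im_divide cmod_power2 algebra_simps)
  have \<tau>: "0 < Im \<tau>" using V \<alpha>0 unfolding Im\<tau> by (intro divide_pos_pos) auto
  \<comment> \<open>Because |u|^2 = Re (u^2) + 2 (Im u)^2, the factor with u^2 turns the strip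
    weight in Im u into a rotation invariant Gaussian; the linear term has real part pi Im u and
    restores the odd theta function.\<close>
  define \<sigma> where "\<sigma> = (\<lambda>z. theta_prod \<tau> (z / \<alpha>) * exp (pi * (z / \<alpha>)\<^sup>2 / (2 * Im \<tau>) - \<i> * pi * (z / \<alpha>)))"
  have key: "norm (\<sigma> z) * exp (- \<kappa> * (norm z)\<^sup>2)
        = norm (theta_prod \<tau> (z / \<alpha>)) * exp (pi * Im (z / \<alpha>) - pi * (Im (z / \<alpha>))\<^sup>2 / Im \<tau>)" for z
  proof -
    define u where "u = z / \<alpha>"
    have z: "z = \<alpha> * u" using \<alpha>0 by (simp add: u_def)
    have "\<kappa> * (norm z)\<^sup>2 = pi * (norm u)\<^sup>2 / (2 * Im \<tau>)"
      using V \<alpha>0 by (simp add: z Im\<tau> \<kappa>_def norm_mult power_mult_distrib field_simps)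
    moreover have "(norm u)\<^sup>2 = Re (u\<^sup>2) + 2 * (Im u)\<^sup>2"
      by (simp only: cmod_power2) (simp add: power2_eq_square)
    ultimately have *: "\<kappa> * (norm z)\<^sup>2 = pi * Re (u\<^sup>2) / (2 * Im \<tau>) + pi * (Im u)\<^sup>2 / Im \<tau>"
      using \<tau> by (simp add: field_simps)
    have "Re (pi * u\<^sup>2 / (2 * Im \<tau>) - \<i> * pi * u) = pi * Re (u\<^sup>2) / (2 * Im \<tau>) + pi * Im u"
      using \<tau> by (simp add: Re_divide power2_eq_square field_simps)
    hence "norm (\<sigma> z) = norm (theta_prod \<tau> u) * exp (pi * Re (u\<^sup>2) / (2 * Im \<tau>) + pi * Im u)"
      by (simp only: \<sigma>_def u_def[symmetric] norm_mult norm_exp_eq_Re)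
    thus ?thesis unfolding u_def[symmetric] by (simp add: * mult.assoc flip: exp_add)
  qed
  have sh: "(z + (of_int a * \<alpha> + of_int b * \<beta>)) / \<alpha> = z / \<alpha> + (of_int a + of_int b * \<tau>)" for z a b
    using \<alpha>0 by (simp add: \<tau>_def field_simps)
  show thesis
  proof (rule that[of \<sigma>])
    have "(\<lambda>z. theta_prod \<tau> (z / \<alpha>)) holomorphic_on UNIV"
      using \<alpha>0 by (intro holomorphic_on_compose_gen[OF _ holomorphic_theta_prod[OF \<tau>], unfolded o_def, of "\<lambda>z. z / \<alpha>" UNIV])
         (auto intro!: holomorphic_intros)
    thus "\<sigma> holomorphic_on UNIV" using \<alpha>0 \<tau> unfolding \<sigma>_def by (intro holomorphic_intros) auto
    show "\<sigma> z = 0 \<longleftrightarrow> (\<exists>a b :: int. z = of_int a * \<alpha> + of_int b * \<beta>)" for z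
    proof -
      have "\<sigma> z = 0 \<longleftrightarrow> (\<exists>a b :: int. z / \<alpha> = of_int a + of_int b * \<tau>)"
        by (simp add: \<sigma>_def theta_prod_eq_0_iff[OF \<tau>])
      also have "\<dots> \<longleftrightarrow> (\<exists>a b :: int. z = of_int a * \<alpha> + of_int b * \<beta>)"
        using \<alpha>0 by (simp add: \<tau>_def field_simps)
      finally show ?thesis .
    qed
    have d: "(theta_prod \<tau> has_field_derivative deriv (theta_prod \<tau>) (0 / \<alpha>)) (at (0 / \<alpha>))"
      using holomorphic_theta_prod[OF \<tau>] by (intro holomorphic_derivI[of _ UNIV]) auto
    have t0: "theta_prod \<tau> 0 = 0" by (simp add: theta_prod_def)
    have d1: "((\<lambda>z. theta_prod \<tau> (z / \<alpha>)) has_field_derivative deriv (theta_prod \<tau>) (0 / \<alpha>) * (1 / \<alpha>)) (at 0)"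
      using \<alpha>0 by (intro DERIV_chain2[where g = "\<lambda>z. z / \<alpha>" and x = 0, OF d]) (auto intro!: derivative_eq_intros)
    have d2: "(\<lambda>z. exp (pi * (z / \<alpha>)\<^sup>2 / (2 * Im \<tau>) - \<i> * pi * (z / \<alpha>))) field_differentiable at 0"
      using \<alpha>0 \<tau> by (intro holomorphic_on_imp_differentiable_at[of _ UNIV] holomorphic_intros) auto
    then obtain E where E: "((\<lambda>z. exp (pi * (z / \<alpha>)\<^sup>2 / (2 * Im \<tau>) - \<i> * pi * (z / \<alpha>))) has_field_derivative E) (at 0)"
      by (auto simp: field_differentiable_def)
    have "(\<sigma> has_field_derivative deriv (theta_prod \<tau>) 0 / \<alpha>) (at 0)"
      unfolding \<sigma>_def using DERIV_mult[OF d1 E] t0 by simp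
    thus "deriv \<sigma> 0 \<noteq> 0" using deriv_theta_prod_0[OF \<tau>] \<alpha>0 by (simp add: DERIV_imp_deriv)
    show "norm (\<sigma> (z + (of_int a * \<alpha> + of_int b * \<beta>))) * exp (- \<kappa> * (norm (z + (of_int a * \<alpha> + of_int b * \<beta>)))\<^sup>2)
           = norm (\<sigma> z) * exp (- \<kappa> * (norm z)\<^sup>2)" for z a b
      unfolding key sh by (rule theta_modulus_periodic[OF \<tau>])
  qed
qed

section \<open>Lattice points and Gaussian lattice sums\<close>

definition lpt :: "complex \<Rightarrow> complex \<Rightarrow> int \<times> int \<Rightarrow> complex" where
  "lpt \<alpha> \<beta> i = of_int (fst i) * \<alpha> + of_int (snd i) * \<beta>"

lemma lpt_0 [simp]: "lpt \<alpha> \<beta> 0 = 0"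
  by (simp add: lpt_def)

text \<open>Cramer's rule: Im (cnj a * b) is the determinant of a and b as real vectors.\<close>

lemma lattice_coordinates:
  assumes V: "Im (cnj \<alpha> * \<beta>) \<noteq> 0"
  shows "z = of_real (Im (cnj z * \<beta>) / Im (cnj \<alpha> * \<beta>)) * \<alpha> + of_real (Im (cnj \<alpha> * z) / Im (cnj \<alpha> * \<beta>)) * \<beta>"
proof -
  have "Im (cnj \<alpha> * \<beta>) * Re z = Im (cnj z * \<beta>) * Re \<alpha> + Im (cnj \<alpha> * z) * Re \<beta>"
       "Im (cnj \<alpha> * \<beta>) * Im z = Im (cnj z * \<beta>) * Im \<alpha> + Im (cnj \<alpha> * z) * Im \<beta>"
    by (simp_all add: algebra_simps)
  moreover have "Re (of_real (a / d) * \<alpha> + of_real (b / d) * \<beta>) = (a * Re \<alpha> + b * Re \<beta>) / d"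
    "Im (of_real (a / d) * \<alpha> + of_real (b / d) * \<beta>) = (a * Im \<alpha> + b * Im \<beta>) / d" for a b d :: real
    by (simp_all add: add_divide_distrib)
  ultimately show ?thesis using V by (intro complex_eqI) (metis nonzero_mult_div_cancel_left)+
qed

text \<open>Pairing the combination with one generator isolates the other coordinate times the cell
  area. Bounding both pairings by products of norms and adding the squares gives the
  constant.\<close>

lemma norm_lattice_combination_ge:
  fixes s t :: real
  assumes V: "Im (cnj \<alpha> * \<beta>) \<noteq> 0"
  defines "c \<equiv> (Im (cnj \<alpha> * \<beta>))\<^sup>2 / ((norm \<alpha>)\<^sup>2 + (norm \<beta>)\<^sup>2)"
  shows "c > 0" "c * (s\<^sup>2 + t\<^sup>2) \<le> (norm (of_real s * \<alpha> + of_real t * \<beta>))\<^sup>2"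
proof -
  have "\<alpha> \<noteq> 0" using V by auto
  hence pos: "(norm \<alpha>)\<^sup>2 + (norm \<beta>)\<^sup>2 > 0" by (simp add: add_pos_nonneg)
  thus "c > 0" using V unfolding c_def by (intro divide_pos_pos) auto
  define z where "z = of_real s * \<alpha> + of_real t * \<beta>"
  have "s * Im (cnj \<alpha> * \<beta>) = Im (cnj z * \<beta>)" "t * Im (cnj \<alpha> * \<beta>) = Im (cnj \<alpha> * z)"
    by (simp_all add: z_def algebra_simps)
  hence "\<bar>s * Im (cnj \<alpha> * \<beta>)\<bar> \<le> norm z * norm \<beta>" "\<bar>t * Im (cnj \<alpha> * \<beta>)\<bar> \<le> norm \<alpha> * norm z"
    using abs_Im_le_cmod[of "cnj z * \<beta>"] abs_Im_le_cmod[of "cnj \<alpha> * z"] by (simp_all add: norm_mult)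
  hence "(s * Im (cnj \<alpha> * \<beta>))\<^sup>2 \<le> (norm z * norm \<beta>)\<^sup>2" "(t * Im (cnj \<alpha> * \<beta>))\<^sup>2 \<le> (norm \<alpha> * norm z)\<^sup>2"
    by (metis abs_le_square_iff abs_of_nonneg mult_nonneg_nonneg norm_ge_zero)+
  hence "(s\<^sup>2 + t\<^sup>2) * (Im (cnj \<alpha> * \<beta>))\<^sup>2 \<le> (norm z)\<^sup>2 * ((norm \<alpha>)\<^sup>2 + (norm \<beta>)\<^sup>2)"
    unfolding power_mult_distrib by (simp only: distrib_left distrib_right mult.commute)
  thus "c * (s\<^sup>2 + t\<^sup>2) \<le> (norm (of_real s * \<alpha> + of_real t * \<beta>))\<^sup>2"
    using pos unfolding c_def z_def[symmetric] by (simp add: field_simps)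
qed

lemma lpt_coord_inj:
  fixes s t :: real
  assumes V: "Im (cnj \<alpha> * \<beta>) \<noteq> 0" and eq: "of_real s * \<alpha> + of_real t * \<beta> = of_int a * \<alpha> + of_int b * \<beta>"
  shows "s = of_int a \<and> t = of_int b"
proof -
  have "of_real (s - of_int a) * \<alpha> + of_real (t - of_int b) * \<beta> = 0" using eq by (simp add: algebra_simps)
  hence "\<exists>c>0. c * ((s - of_int a)\<^sup>2 + (t - of_int b)\<^sup>2) \<le> 0"
    using norm_lattice_combination_ge(1)[OF V] norm_lattice_combination_ge(2)[OF V, of "s - of_int a" "t - of_int b"]
    by (metis norm_zero power_zero_numeral)
  hence "(s - of_int a)\<^sup>2 + (t - of_int b)\<^sup>2 \<le> 0" by (auto simp: mult_le_0_iff)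
  thus ?thesis by (simp add: sum_power2_le_zero_iff)
qed

lemma nn_integral_count_int_exp:
  assumes "\<delta> > 0"
  shows "(\<integral>\<^sup>+k. ennreal (exp (- \<delta> * \<bar>real_of_int k\<bar>)) \<partial>count_space UNIV) < \<infinity>"
proof -
  let ?f = "\<lambda>k :: int. ennreal (exp (- \<delta> * \<bar>real_of_int k\<bar>))"
  have nat: "(\<integral>\<^sup>+m. ennreal (exp (- \<delta> * real m)) \<partial>count_space UNIV) < \<infinity>"
  proof -
    have s: "summable (\<lambda>m. exp (- \<delta>) ^ m)" using assms by (intro summable_geometric) auto
    have "(\<integral>\<^sup>+m. ennreal (exp (- \<delta> * real m)) \<partial>count_space UNIV) = (\<Sum>m. ennreal (exp (- \<delta>) ^ m))"
      by (subst nn_integral_count_space_nat) (simp add: mult.commute flip: exp_of_nat_mult)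
    also have "\<dots> = ennreal (\<Sum>m. exp (- \<delta>) ^ m)" using s by (intro suminf_ennreal2) auto
    finally show ?thesis by simp
  qed
  have "(\<integral>\<^sup>+k. ?f k \<partial>count_space UNIV) \<le> (\<integral>\<^sup>+k. ?f k * indicator (range int) k + ?f k * indicator (range (\<lambda>m. - int m)) k \<partial>count_space UNIV)"
  proof (intro nn_integral_mono)
    fix k :: int
    show "?f k \<le> ?f k * indicator (range int) k + ?f k * indicator (range (\<lambda>m. - int m)) k"
      by (cases k rule: int_cases2) (auto simp: indicator_def)
  qed
  also have "\<dots> = (\<integral>\<^sup>+k. ?f k \<partial>count_space (range int)) + (\<integral>\<^sup>+k. ?f k \<partial>count_space (range (\<lambda>m. - int m)))"
    by (subst nn_integral_add) (simp_all add: nn_integral_count_space_indicator)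
  also have "\<dots> = (\<integral>\<^sup>+m. ennreal (exp (- \<delta> * real m)) \<partial>count_space UNIV) + (\<integral>\<^sup>+m. ennreal (exp (- \<delta> * real m)) \<partial>count_space UNIV)"
    by (subst (1 2) nn_integral_bij_count_space[symmetric, OF inj_on_imp_bij_betw]) (auto simp: inj_on_def)
  also have "\<dots> < \<infinity>" using nat by simp
  finally show ?thesis .
qed

text \<open>The point is uniformity in \<open>s\<close>. Translating the index by the floor of
  \<open>s\<close> leaves a distance x >= |k| - 1, and x^2 >= 2 x - 1 >= 2 |k| - 3 turns the
  Gaussian into a geometric series at the price exp (3 \<delta>).\<close>

lemma nn_integral_count_int_gaussian:
  assumes "\<delta> > 0"
  obtains C where "C \<ge> 0" "\<And>s. (\<integral>\<^sup>+k. ennreal (exp (- \<delta> * (s - real_of_int k)\<^sup>2)) \<partial>count_space UNIV) \<le> ennreal C"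
proof -
  let ?S = "\<integral>\<^sup>+k. ennreal (exp (- (2 * \<delta>) * \<bar>real_of_int k\<bar>)) \<partial>count_space UNIV"
  have fin: "?S < \<infinity>" using nn_integral_count_int_exp[of "2 * \<delta>"] assms by simp
  have *: "(\<integral>\<^sup>+k. ennreal (exp (- \<delta> * (s - real_of_int k)\<^sup>2)) \<partial>count_space UNIV) \<le> ennreal (exp (3 * \<delta>)) * ?S" for s
  proof -
    have "(\<integral>\<^sup>+k. ennreal (exp (- \<delta> * (s - real_of_int k)\<^sup>2)) \<partial>count_space UNIV)
        = (\<integral>\<^sup>+k. ennreal (exp (- \<delta> * (s - real_of_int (\<lfloor>s\<rfloor> + k))\<^sup>2)) \<partial>count_space UNIV)"
      by (rule nn_integral_bij_count_space[symmetric, where g = "\<lambda>k. \<lfloor>s\<rfloor> + k"])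
         (rule bij_betwI[where g = "\<lambda>k. k - \<lfloor>s\<rfloor>"], auto)
    also have "\<dots> \<le> (\<integral>\<^sup>+k. ennreal (exp (3 * \<delta>)) * ennreal (exp (- (2 * \<delta>) * \<bar>real_of_int k\<bar>)) \<partial>count_space UNIV)"
    proof (intro nn_integral_mono)
      fix k :: int
      define x where "x = \<bar>s - real_of_int (\<lfloor>s\<rfloor> + k)\<bar>"
      have "\<bar>s - real_of_int \<lfloor>s\<rfloor>\<bar> \<le> 1" by linarith
      hence "\<bar>real_of_int k\<bar> - 1 \<le> x" unfolding x_def by (simp add: abs_if split: if_splits; linarith)
      moreover have "2 * x - 1 \<le> x\<^sup>2" using sum_squares_ge_zero[of "x - 1" 0] by (simp add: power2_eq_square algebra_simps)
      ultimately have "2 * \<bar>real_of_int k\<bar> - 3 \<le> x\<^sup>2" by linarith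
      hence "\<delta> * (2 * \<bar>real_of_int k\<bar> - 3) \<le> \<delta> * x\<^sup>2" using assms by (intro mult_left_mono) auto
      hence "exp (- \<delta> * x\<^sup>2) \<le> exp (3 * \<delta>) * exp (- (2 * \<delta>) * \<bar>real_of_int k\<bar>)"
        by (simp add: algebra_simps flip: exp_add)
      thus "ennreal (exp (- \<delta> * (s - real_of_int (\<lfloor>s\<rfloor> + k))\<^sup>2)) \<le> ennreal (exp (3 * \<delta>)) * ennreal (exp (- (2 * \<delta>) * \<bar>real_of_int k\<bar>))"
        by (simp add: x_def ennreal_mult[symmetric] ennreal_leI)
    qed
    also have "\<dots> = ennreal (exp (3 * \<delta>)) * ?S" by (rule nn_integral_cmult) simp
    finally show ?thesis .
  qed
  have "ennreal (exp (3 * \<delta>)) * ?S < \<infinity>" using fin by (simp add: ennreal_mult_less_top)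
  then obtain C where "ennreal (exp (3 * \<delta>)) * ?S = ennreal C" "C \<ge> 0" by (cases "ennreal (exp (3 * \<delta>)) * ?S") auto
  thus thesis using that[of C] * by simp
qed

text \<open>In lattice coordinates the exponent dominates a multiple of a sum of two squares, so the
  sum is at most a product of two one-dimensional sums, uniformly in the centre.\<close>

lemma gaussian_lattice_sum_bounded:
  assumes V: "Im (cnj \<alpha> * \<beta>) \<noteq> 0" and \<epsilon>: "\<epsilon> > 0"
  obtains C where "C > 0" "\<And>w. (\<integral>\<^sup>+i. ennreal (exp (- \<epsilon> * (norm (w - lpt \<alpha> \<beta> i))\<^sup>2)) \<partial>count_space UNIV) \<le> ennreal C"
proof -
  define c where "c = (Im (cnj \<alpha> * \<beta>))\<^sup>2 / ((norm \<alpha>)\<^sup>2 + (norm \<beta>)\<^sup>2)"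
  have c: "c > 0" "\<And>s t :: real. c * (s\<^sup>2 + t\<^sup>2) \<le> (norm (of_real s * \<alpha> + of_real t * \<beta>))\<^sup>2"
    unfolding c_def using norm_lattice_combination_ge[OF V] by auto
  obtain C where C: "C \<ge> 0" "\<And>s. (\<integral>\<^sup>+k. ennreal (exp (- (\<epsilon> * c) * (s - real_of_int k)\<^sup>2)) \<partial>count_space UNIV) \<le> ennreal C"
    using nn_integral_count_int_gaussian[of "\<epsilon> * c"] c \<epsilon> by auto
  have "(\<integral>\<^sup>+i. ennreal (exp (- \<epsilon> * (norm (w - lpt \<alpha> \<beta> i))\<^sup>2)) \<partial>count_space UNIV) \<le> ennreal (C * C + 1)" for w
  proof -
    obtain s t :: real where w: "w = of_real s * \<alpha> + of_real t * \<beta>" using lattice_coordinates[OF V, of w] by blast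
    have "(\<integral>\<^sup>+i. ennreal (exp (- \<epsilon> * (norm (w - lpt \<alpha> \<beta> i))\<^sup>2)) \<partial>count_space UNIV)
       \<le> (\<integral>\<^sup>+i. ennreal (exp (- (\<epsilon> * c) * (s - real_of_int (fst i))\<^sup>2)) * ennreal (exp (- (\<epsilon> * c) * (t - real_of_int (snd i))\<^sup>2)) \<partial>count_space UNIV)"
    proof (intro nn_integral_mono)
      fix i :: "int \<times> int"
      have "w - lpt \<alpha> \<beta> i = of_real (s - real_of_int (fst i)) * \<alpha> + of_real (t - real_of_int (snd i)) * \<beta>"
        by (simp add: w lpt_def algebra_simps)
      hence "\<epsilon> * (c * ((s - real_of_int (fst i))\<^sup>2 + (t - real_of_int (snd i))\<^sup>2)) \<le> \<epsilon> * (norm (w - lpt \<alpha> \<beta> i))\<^sup>2"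
        using c(2)[of "s - real_of_int (fst i)" "t - real_of_int (snd i)"] \<epsilon> by (intro mult_left_mono) auto
      hence "exp (- \<epsilon> * (norm (w - lpt \<alpha> \<beta> i))\<^sup>2) \<le> exp (- (\<epsilon> * c) * (s - real_of_int (fst i))\<^sup>2) * exp (- (\<epsilon> * c) * (t - real_of_int (snd i))\<^sup>2)"
        by (simp add: algebra_simps flip: exp_add)
      thus "ennreal (exp (- \<epsilon> * (norm (w - lpt \<alpha> \<beta> i))\<^sup>2)) \<le> ennreal (exp (- (\<epsilon> * c) * (s - real_of_int (fst i))\<^sup>2)) * ennreal (exp (- (\<epsilon> * c) * (t - real_of_int (snd i))\<^sup>2))"
        by (simp add: ennreal_mult[symmetric] ennreal_leI)
    qed
    also have "\<dots> = (\<integral>\<^sup>+a. \<integral>\<^sup>+b. ennreal (exp (- (\<epsilon> * c) * (s - real_of_int a)\<^sup>2)) * ennreal (exp (- (\<epsilon> * c) * (t - real_of_int b)\<^sup>2)) \<partial>count_space UNIV \<partial>count_space UNIV)"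
      by (subst nn_integral_fst_count_space[symmetric]) simp
    also have "\<dots> = (\<integral>\<^sup>+a. ennreal (exp (- (\<epsilon> * c) * (s - real_of_int a)\<^sup>2)) \<partial>count_space UNIV) * (\<integral>\<^sup>+b. ennreal (exp (- (\<epsilon> * c) * (t - real_of_int b)\<^sup>2)) \<partial>count_space UNIV)"
      by (subst nn_integral_cmult, simp, subst nn_integral_multc) simp_all
    also have "\<dots> \<le> ennreal C * ennreal C" by (intro mult_mono C) auto
    also have "\<dots> \<le> ennreal (C * C + 1)" using C by (simp add: ennreal_mult[symmetric] ennreal_leI)
    finally show ?thesis .
  qed
  thus thesis using that[of "C * C + 1"] by (simp add: add_nonneg_pos)
qed

text \<open>The remainder is taken as the shifted power series, hence it is entire from the start
  and its value at 0 can be read off. That value decides whether a zero has exact order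
  \<open>n\<close>.\<close>

lemma entire_taylor_remainder:
  assumes f: "f holomorphic_on UNIV"
  obtains R where "R holomorphic_on UNIV" "\<And>z. f z = (\<Sum>k<n. (deriv ^^ k) f 0 / fact k * z ^ k) + z ^ n * R z"
    "R 0 = (deriv ^^ n) f 0 / fact n"
proof -
  define a where "a = (\<lambda>k. (deriv ^^ k) f 0 / fact k)"
  have sums: "(\<lambda>k. a k * z ^ k) sums f z" for z
    using holomorphic_power_series[of f 0 "norm z + 1" z] holomorphic_on_subset[OF f] by (simp add: a_def)
  define R where "R = (\<lambda>z. \<Sum>k. a (k + n) * z ^ k)"
  have sR: "(\<lambda>k. a (k + n) * z ^ k) sums R z" for z
  proof -
    have "summable (\<lambda>k. a (k + n) * z ^ k)"
    proof (cases "z = 0")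
      case True
      have "summable (\<lambda>k. a (k + n) * (0 :: complex) ^ k)" by (rule summable_finite[of "{0}"]) (auto simp: power_0_left)
      thus ?thesis using True by simp
    next
      case False
      have "summable (\<lambda>k. a (k + n) * z ^ (k + n))" using sums[of z] sums_summable summable_iff_shift by blast
      hence "summable (\<lambda>k. a (k + n) * z ^ (k + n) * (1 / z ^ n))" by (rule summable_mult2)
      thus ?thesis using False by (simp add: power_add)
    qed
    thus ?thesis unfolding R_def by (rule summable_sums)
  qed
  show thesis
  proof (rule that[of R])
    have "R holomorphic_on ball 0 r" for r
      by (rule power_series_holomorphic[where a = "\<lambda>k. a (k + n)"]) (use sR in auto)
    hence "R field_differentiable at z" for z
      by (rule holomorphic_on_imp_differentiable_at[of _ "ball 0 (norm z + 1)"]) auto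
    thus "R holomorphic_on UNIV" by (simp add: holomorphic_on_def field_differentiable_at_within)
    show "f z = (\<Sum>k<n. (deriv ^^ k) f 0 / fact k * z ^ k) + z ^ n * R z" for z
    proof -
      have "(\<lambda>k. a (k + n) * z ^ (k + n)) sums (z ^ n * R z)"
        using sums_mult[OF sR[of z], of "z ^ n"] by (simp add: power_add mult_ac)
      hence "(\<lambda>k. a k * z ^ k) sums (z ^ n * R z + (\<Sum>k<n. a k * z ^ k))"
        by (subst (asm) sums_iff_shift)
      thus ?thesis using sums[of z] sums_unique2 by (fastforce simp: a_def add.commute)
    qed
    have "(\<lambda>k. a (k + n) * 0 ^ k) sums (a (0 + n) * 0 ^ 0)"
      using sums_finite[of "{0 :: nat}" "\<lambda>k. a (k + n) * 0 ^ k"] by simp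
    thus "R 0 = (deriv ^^ n) f 0 / fact n" using sR[of 0] sums_unique2 by (fastforce simp: a_def)
  qed
qed

section \<open>Sampling of entire functions and their jets\<close>

definition quad_integral :: "(complex \<Rightarrow> complex) \<Rightarrow> complex \<Rightarrow> complex \<Rightarrow> complex \<Rightarrow> complex \<Rightarrow> complex" where
  "quad_integral f p q r s = contour_integral (linepath p q) f + contour_integral (linepath q r) f
     + contour_integral (linepath r s) f + contour_integral (linepath s p) f"

text \<open>The four sides are kept as separate integrals so that sides shared by neighbouring cells
  can be cancelled; the closed path serves only Cauchy's theorem and the winding number.\<close>

lemma quad_integral_eq_contour_integral:
  assumes "continuous_on (closed_segment p q \<union> closed_segment q r \<union> closed_segment r s \<union> closed_segment s p) f"
  shows "contour_integral (linepath p q +++ linepath q r +++ linepath r s +++ linepath s p) f = quad_integral f p q r s"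
proof -
  have "f contour_integrable_on linepath p q" "f contour_integrable_on linepath q r"
       "f contour_integrable_on linepath r s" "f contour_integrable_on linepath s p"
    by (intro contour_integrable_continuous_linepath continuous_on_subset[OF assms]; auto)+
  thus ?thesis by (simp add: quad_integral_def valid_path_join contour_integrable_joinI)
qed

lemma quad_integral_cauchy:
  assumes "f holomorphic_on S" "convex S" "p \<in> S" "q \<in> S" "r \<in> S" "s \<in> S"
  shows "quad_integral f p q r s = 0"
proof -
  let ?g = "linepath p q +++ linepath q r +++ linepath r s +++ linepath s p"
  have sub: "closed_segment p q \<subseteq> S" "closed_segment q r \<subseteq> S" "closed_segment r s \<subseteq> S" "closed_segment s p \<subseteq> S"
    using assms by (auto intro: closed_segment_subset[THEN subsetD])
  have "(f has_contour_integral 0) ?g"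
    using sub by (intro Cauchy_theorem_convex_simple[OF assms(1,2)]) (auto simp: path_image_join valid_path_join)
  hence "contour_integral ?g f = 0" by (rule contour_integral_unique)
  thus ?thesis using sub by (subst quad_integral_eq_contour_integral[symmetric])
    (auto intro!: continuous_on_subset[OF holomorphic_on_imp_continuous_on[OF assms(1)]])
qed

text \<open>The hypothesis says that \<open>v\<close> lies strictly to the left of the directed
  line. The quantity is constant along the segment, since (q - p) * cnj (q - p) is real, so the
  argument increases all the way.\<close>

lemma winding_number_linepath_pos:
  assumes "Im ((q - p) * cnj (p - v)) > 0"
  shows "v \<notin> path_image (linepath p q)" "0 < Re (winding_number (linepath p q) v)"
proof -
  have *: "Im ((q - p) * cnj (linepath p q x - v)) = Im ((q - p) * cnj (p - v))" for x
  proof -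
    have "linepath p q x - v = (p - v) + of_real x * (q - p)"
      by (simp add: linepath_def scaleR_conv_of_real algebra_simps)
    hence "(q - p) * cnj (linepath p q x - v) = (q - p) * cnj (p - v) + of_real x * ((q - p) * cnj (q - p))"
      by (simp only:) (simp add: algebra_simps)
    thus ?thesis by (simp only:) (simp add: algebra_simps)
  qed
  show v: "v \<notin> path_image (linepath p q)"
  proof
    assume "v \<in> path_image (linepath p q)"
    then obtain x where "v = linepath p q x" by (auto simp: path_image_def)
    thus False using *[of x] assms by simp
  qed
  show "0 < Re (winding_number (linepath p q) v)"
    by (rule winding_number_pos_lt[OF _ v assms]) (use * in auto)
qed

text \<open>Each side contributes a positive real part, and the winding number of a closed path is
  an integer, so it is at least 1. This is all that an upper bound for |h v| requires.\<close>

lemma quad_integral_cauchy_formula: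
  assumes h: "h holomorphic_on S" and S: "convex S" "open S" "p \<in> S" "q \<in> S" "r \<in> S" "s \<in> S" "v \<in> S"
    and pos: "Im ((q - p) * cnj (p - v)) > 0" "Im ((r - q) * cnj (q - v)) > 0"
             "Im ((s - r) * cnj (r - v)) > 0" "Im ((p - s) * cnj (s - v)) > 0"
  obtains w where "norm w \<ge> 1" "quad_integral (\<lambda>\<xi>. h \<xi> / (\<xi> - v)) p q r s = 2 * pi * \<i> * w * h v"
proof -
  let ?g = "linepath p q +++ linepath q r +++ linepath r s +++ linepath s p"
  have sub: "closed_segment p q \<subseteq> S" "closed_segment q r \<subseteq> S" "closed_segment r s \<subseteq> S" "closed_segment s p \<subseteq> S"
    using S by (auto intro: closed_segment_subset[THEN subsetD])
  note W = winding_number_linepath_pos[OF pos(1)] winding_number_linepath_pos[OF pos(2)]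
    winding_number_linepath_pos[OF pos(3)] winding_number_linepath_pos[OF pos(4)]
  have 1: "valid_path (linepath r s +++ linepath s p) \<and> v \<notin> path_image (linepath r s +++ linepath s p) \<and> 0 < Re (winding_number (linepath r s +++ linepath s p) v)"
    using W by (intro winding_number_join_pos_combined) auto
  have 2: "valid_path (linepath q r +++ linepath r s +++ linepath s p) \<and> v \<notin> path_image (linepath q r +++ linepath r s +++ linepath s p) \<and> 0 < Re (winding_number (linepath q r +++ linepath r s +++ linepath s p) v)"
    using W 1 by (intro winding_number_join_pos_combined) auto
  have 3: "valid_path ?g \<and> v \<notin> path_image ?g \<and> 0 < Re (winding_number ?g v)"
    using W 2 by (intro winding_number_join_pos_combined) auto
  have "winding_number ?g v \<in> \<int>" using 3 by (intro integer_winding_number valid_path_imp_path) auto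
  then obtain m :: int where m: "winding_number ?g v = of_int m" by (auto elim: Ints_cases)
  have "m \<ge> 1" using 3 m by simp
  hence nw: "norm (winding_number ?g v) \<ge> 1" unfolding m by simp
  have "((\<lambda>\<xi>. h \<xi> / (\<xi> - v)) has_contour_integral (complex_of_real (2 * pi) * \<i> * winding_number ?g v * h v)) ?g"
    using 3 sub S W by (intro Cauchy_integral_formula_convex_simple[OF S(1) h]) (auto simp: interior_open path_image_join)
  hence "contour_integral ?g (\<lambda>\<xi>. h \<xi> / (\<xi> - v)) = 2 * pi * \<i> * winding_number ?g v * h v"
    by (simp add: contour_integral_unique)
  moreover have "contour_integral ?g (\<lambda>\<xi>. h \<xi> / (\<xi> - v)) = quad_integral (\<lambda>\<xi>. h \<xi> / (\<xi> - v)) p q r s"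
    using sub W by (intro quad_integral_eq_contour_integral continuous_intros
       continuous_on_subset[OF holomorphic_on_imp_continuous_on[OF h]]) auto
  ultimately show thesis using that[OF nw] by simp
qed

section \<open>The function \<sigma> of a fixed lattice: periodic modulus and simple zeros\<close>

locale lattice_sigma =
  fixes \<alpha> \<beta> :: complex and \<sigma> :: "complex \<Rightarrow> complex" and \<kappa> :: real
  assumes V: "0 < Im (cnj \<alpha> * \<beta>)"
    and \<kappa>: "\<kappa> = pi / (2 * Im (cnj \<alpha> * \<beta>))"
    and holomorphic_sigma: "\<sigma> holomorphic_on UNIV"
    and sigma_eq_0_iff: "\<sigma> z = 0 \<longleftrightarrow> z \<in> range (lpt \<alpha> \<beta>)"
    and deriv_sigma_0: "deriv \<sigma> 0 \<noteq> 0"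
    and sigma_modulus_periodic:
      "norm (\<sigma> (z + lpt \<alpha> \<beta> i)) * exp (- \<kappa> * (norm (z + lpt \<alpha> \<beta> i))\<^sup>2) = norm (\<sigma> z) * exp (- \<kappa> * (norm z)\<^sup>2)"

lemma lattice_sigma_interpretation:
  assumes "0 < Im (cnj \<alpha> * \<beta>)"
  obtains \<sigma> where "lattice_sigma \<alpha> \<beta> \<sigma> (pi / (2 * Im (cnj \<alpha> * \<beta>)))"
proof -
  obtain \<sigma> where \<sigma>: "\<sigma> holomorphic_on UNIV"
    "\<And>z. \<sigma> z = 0 \<longleftrightarrow> (\<exists>a b :: int. z = of_int a * \<alpha> + of_int b * \<beta>)" "deriv \<sigma> 0 \<noteq> 0"
    "\<And>z a b. norm (\<sigma> (z + (of_int a * \<alpha> + of_int b * \<beta>))) * exp (- (pi / (2 * Im (cnj \<alpha> * \<beta>))) * (norm (z + (of_int a * \<alpha> + of_int b * \<beta>)))\<^sup>2)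
           = norm (\<sigma> z) * exp (- (pi / (2 * Im (cnj \<alpha> * \<beta>))) * (norm z)\<^sup>2)"
    using lattice_sigma_exists[OF assms] by metis
  have "\<sigma> z = 0 \<longleftrightarrow> z \<in> range (lpt \<alpha> \<beta>)" for z
    unfolding \<sigma>(2) by (auto simp: lpt_def image_iff)
  thus thesis using assms \<sigma> by (intro that[of \<sigma>], unfold_locales) (auto simp: lpt_def)
qed

lemma holomorphic_on_UNIV_compose:
  "f holomorphic_on UNIV \<Longrightarrow> g holomorphic_on UNIV \<Longrightarrow> (\<lambda>z. f (g z)) holomorphic_on UNIV"
  using holomorphic_on_compose_gen[of g UNIV f UNIV] by (simp add: o_def)

context lattice_sigma
begin

definition "per z = norm (\<sigma> z) * exp (- \<kappa> * (norm z)\<^sup>2)"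

lemma per_lpt: "per (z + lpt \<alpha> \<beta> i) = per z"
  unfolding per_def by (rule sigma_modulus_periodic)

lemma norm_sigma: "norm (\<sigma> z) = per z * exp (\<kappa> * (norm z)\<^sup>2)"
  by (simp add: per_def exp_minus)

lemma V0: "Im (cnj \<alpha> * \<beta>) \<noteq> 0" using V by simp

lemma \<kappa>_pos: "\<kappa> > 0" using V unfolding \<kappa> by (intro divide_pos_pos) auto

lemma continuous_per: "continuous_on A per"
  unfolding per_def by (intro continuous_intros holomorphic_on_imp_continuous_on holomorphic_on_subset[OF holomorphic_sigma]) auto

lemma per_frac: "per (of_real s * \<alpha> + of_real t * \<beta>) = per (of_real (frac s) * \<alpha> + of_real (frac t) * \<beta>)"
proof -
  have "of_real s * \<alpha> + of_real t * \<beta> = of_real (frac s) * \<alpha> + of_real (frac t) * \<beta> + lpt \<alpha> \<beta> (\<lfloor>s\<rfloor>, \<lfloor>t\<rfloor>)"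
    by (simp add: lpt_def frac_def algebra_simps)
  thus ?thesis by (metis per_lpt)
qed

definition "cell_map st = of_real (fst st) * \<alpha> + of_real (snd st) * \<beta>"

lemma continuous_cell_map: "continuous_on A cell_map"
  unfolding cell_map_def by (intro continuous_intros)

lemma per_bounded: obtains P where "P > 0" "\<And>z. per z \<le> P"
proof -
  have "compact (cell_map ` ({0..1} \<times> {0..1}))"
    by (intro compact_continuous_image continuous_cell_map compact_Times) auto
  hence "bounded (per ` cell_map ` ({0..1} \<times> {0..1}))"
    by (intro compact_imp_bounded compact_continuous_image[OF continuous_per])
  then obtain P where P: "P > 0" "\<And>x. x \<in> per ` cell_map ` ({0..1} \<times> {0..1}) \<Longrightarrow> norm x \<le> P"
    unfolding bounded_pos by blast
  have "per z \<le> P" for z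
  proof -
    obtain s t :: real where z: "z = of_real s * \<alpha> + of_real t * \<beta>" using lattice_coordinates[OF V0, of z] by blast
    have "per z = per (cell_map (frac s, frac t))" unfolding z cell_map_def fst_conv snd_conv by (rule per_frac)
    moreover have "(frac s, frac t) \<in> {0..1} \<times> {0..1}" using frac_lt_1[of s] frac_lt_1[of t] by (auto intro: less_imp_le)
    ultimately have "per z \<in> per ` cell_map ` ({0..1} \<times> {0..1})" by blast
    from P(2)[OF this] show ?thesis by simp
  qed
  thus thesis using that P(1) by blast
qed

text \<open>Lines with fractional coordinate 1/3 or 2/3 will carry the integration grid. They avoid
  the lattice, and by periodicity the minimum over the compact part in one cell is a bound
  everywhere.\<close>

lemma per_lower_bound:
  obtains p where "p > 0" "\<And>s t. frac s \<in> {1/3, 2/3} \<or> frac t \<in> {1/3, 2/3} \<Longrightarrow> p \<le> per (of_real s * \<alpha> + of_real t * \<beta>)"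
proof -
  define K where "K = ({0..1} \<times> {1/3, 2/3} \<union> {1/3, 2/3} \<times> {0..1} :: (real \<times> real) set)"
  have "compact (per ` cell_map ` K)" unfolding K_def
    by (intro compact_continuous_image continuous_cell_map continuous_per compact_Un compact_Times) auto
  moreover have "per ` cell_map ` K \<noteq> {}" by (auto simp: K_def)
  ultimately obtain p where p: "p \<in> per ` cell_map ` K" "\<And>x. x \<in> per ` cell_map ` K \<Longrightarrow> p \<le> x"
    using compact_attains_inf by metis
  obtain s t where st: "(s, t) \<in> K" "p = per (cell_map (s, t))" using p(1) by auto
  have "\<sigma> (cell_map (s, t)) \<noteq> 0"
  proof
    assume "\<sigma> (cell_map (s, t)) = 0"
    then obtain i where "cell_map (s, t) = lpt \<alpha> \<beta> i" unfolding sigma_eq_0_iff by auto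
    hence "s = of_int (fst i) \<and> t = of_int (snd i)"
      by (intro lpt_coord_inj[OF V0]) (simp add: cell_map_def lpt_def)
    moreover have "s = 1/3 \<or> s = 2/3 \<or> t = 1/3 \<or> t = 2/3" using st(1) by (auto simp: K_def)
    moreover have "real_of_int m \<noteq> 1/3" "real_of_int m \<noteq> 2/3" for m
      by (cases "m \<le> 0"; simp)+
    ultimately show False by metis
  qed
  hence "p > 0" unfolding st(2) by (simp add: per_def)
  moreover have "p \<le> per (of_real s * \<alpha> + of_real t * \<beta>)" if "frac s \<in> {1/3, 2/3} \<or> frac t \<in> {1/3, 2/3}" for s t
  proof -
    have "(frac s, frac t) \<in> K" using that frac_lt_1[of s] frac_lt_1[of t] by (auto simp: K_def intro: less_imp_le)
    hence "p \<le> per (cell_map (frac s, frac t))" by (intro p(2)) auto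
    thus ?thesis using per_frac[of s t] by (simp add: cell_map_def)
  qed
  ultimately show thesis using that by blast
qed

text \<open>Simplicity is assumed only at 0 and is transported by the periodic modulus: the
  quotients of \<sigma> by the linear factor at 0 and at the given lattice point have proportional
  moduli, with a continuous positive ratio, and the relation survives the limit at the zero.\<close>

lemma sigma_factor:
  obtains s where "s holomorphic_on UNIV" "\<And>z. \<sigma> z = (z - lpt \<alpha> \<beta> i) * s z"
    "\<And>z. s z = 0 \<Longrightarrow> z \<in> range (lpt \<alpha> \<beta>) - {lpt \<alpha> \<beta> i}"
proof -
  have "0 = lpt \<alpha> \<beta> 0" by simp
  hence z0: "\<sigma> (lpt \<alpha> \<beta> i) = 0" "\<sigma> 0 = 0" unfolding sigma_eq_0_iff by blast+
  have "(\<lambda>z. \<sigma> (lpt \<alpha> \<beta> i + z)) holomorphic_on UNIV"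
    by (intro holomorphic_on_UNIV_compose[OF holomorphic_sigma] holomorphic_intros)
  from entire_taylor_remainder[OF this, of 1] obtain R where
    R: "R holomorphic_on UNIV" "\<And>z. \<sigma> (lpt \<alpha> \<beta> i + z) = z * R z"
    by (auto simp: z0)
  from entire_taylor_remainder[OF holomorphic_sigma, of 1] obtain R0 where
    R0: "R0 holomorphic_on UNIV" "\<And>z. \<sigma> z = z * R0 z" "R0 0 = deriv \<sigma> 0"
    by (auto simp: z0)
  have eq: "norm (R z) = norm (R0 z) * (exp (- \<kappa> * (norm z)\<^sup>2) * exp (\<kappa> * (norm (z + lpt \<alpha> \<beta> i))\<^sup>2))" if "z \<noteq> 0" for z
  proof -
    have "norm (\<sigma> (z + lpt \<alpha> \<beta> i)) = norm (\<sigma> z) * exp (- \<kappa> * (norm z)\<^sup>2) * exp (\<kappa> * (norm (z + lpt \<alpha> \<beta> i))\<^sup>2)"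
      using sigma_modulus_periodic[of z i] by (simp add: exp_minus field_simps)
    thus ?thesis using that R(2)[of z] R0(2)[of z] by (simp add: add.commute norm_mult mult_ac)
  qed
  have cR: "isCont R 0" "isCont R0 0"
    using holomorphic_on_imp_continuous_on[OF R(1)] holomorphic_on_imp_continuous_on[OF R0(1)]
    by (simp_all add: continuous_on_eq_continuous_at)
  have "((\<lambda>z. norm (R0 z) * (exp (- \<kappa> * (norm z)\<^sup>2) * exp (\<kappa> * (norm (z + lpt \<alpha> \<beta> i))\<^sup>2))) \<longlongrightarrow> norm (R0 0) * (exp (- \<kappa> * (norm (0::complex))\<^sup>2) * exp (\<kappa> * (norm (0 + lpt \<alpha> \<beta> i))\<^sup>2))) (at 0)"
    by (intro tendsto_intros isContD cR)
  moreover have "\<forall>\<^sub>F z in at 0. norm (R0 z) * (exp (- \<kappa> * (norm z)\<^sup>2) * exp (\<kappa> * (norm (z + lpt \<alpha> \<beta> i))\<^sup>2)) = norm (R z)"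
    unfolding eventually_at_filter using eq by (intro always_eventually) auto
  ultimately have "((\<lambda>z. norm (R z)) \<longlongrightarrow> norm (R0 0) * (exp (- \<kappa> * (norm (0::complex))\<^sup>2) * exp (\<kappa> * (norm (0 + lpt \<alpha> \<beta> i))\<^sup>2))) (at 0)"
    by (rule Lim_transform_eventually)
  moreover have "((\<lambda>z. norm (R z)) \<longlongrightarrow> norm (R 0)) (at 0)" by (intro tendsto_intros isContD cR)
  ultimately have "norm (R 0) = norm (R0 0) * (exp (- \<kappa> * (norm (0::complex))\<^sup>2) * exp (\<kappa> * (norm (0 + lpt \<alpha> \<beta> i))\<^sup>2))"
    by (intro tendsto_unique[OF trivial_limit_at])
  hence Rz: "R 0 \<noteq> 0" using R0(3) deriv_sigma_0 by auto
  show thesis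
  proof (rule that[of "\<lambda>z. R (z - lpt \<alpha> \<beta> i)"])
    show "(\<lambda>z. R (z - lpt \<alpha> \<beta> i)) holomorphic_on UNIV"
      by (intro holomorphic_on_UNIV_compose[OF R(1)] holomorphic_intros)
    show *: "\<sigma> z = (z - lpt \<alpha> \<beta> i) * R (z - lpt \<alpha> \<beta> i)" for z using R(2)[of "z - lpt \<alpha> \<beta> i"] by simp
    show "z \<in> range (lpt \<alpha> \<beta>) - {lpt \<alpha> \<beta> i}" if "R (z - lpt \<alpha> \<beta> i) = 0" for z
      using that Rz *[of z] by (auto simp flip: sigma_eq_0_iff)
  qed
qed

end

text \<open>Derivatives at \<open>0\<close> of the Fock-space translate of \<open>U\<close> by \<open>\<nu>\<close>; with this normalisation Taylor expansion is
  covariant under translations.\<close>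
definition cjet :: "(complex \<Rightarrow> complex) \<Rightarrow> complex \<Rightarrow> nat \<Rightarrow> complex" where
  "cjet U \<nu> k = (deriv ^^ k) (\<lambda>\<zeta>. U (\<nu> + \<zeta>) * exp (- pi * cnj \<nu> * \<zeta> - pi * (norm \<nu>)\<^sup>2 / 2)) 0"

definition cjet_poly :: "nat \<Rightarrow> (complex \<Rightarrow> complex) \<Rightarrow> complex \<Rightarrow> complex \<Rightarrow> complex" where
  "cjet_poly n U \<nu> \<xi> = (\<Sum>k<n. cjet U \<nu> k / fact k * (\<xi> - \<nu>) ^ k) * exp (pi * cnj \<nu> * (\<xi> - \<nu>) + pi * (norm \<nu>)\<^sup>2 / 2)"

text \<open>Completing the square gives the exponential factor the modulus exp (pi |\<xi>|^2 / 2 -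
  pi |\<xi> - \<nu>|^2 / 2). The constant is therefore the same for all centres
  \<open>\<nu>\<close>, which a plain Taylor polynomial of \<open>U\<close> would not
  provide.\<close>

lemma norm_cjet_poly_le:
  assumes "norm (\<xi> - \<nu>) \<le> d"
  shows "norm (cjet_poly n U \<nu> \<xi>) \<le> (1 + d) ^ n * exp (pi * (norm \<xi>)\<^sup>2 / 2) * (\<Sum>k<n. norm (cjet U \<nu> k))"
proof -
  have d: "d \<ge> 0" using assms norm_ge_zero order_trans by blast
  have "Re (pi * cnj \<nu> * (\<xi> - \<nu>) + pi * (norm \<nu>)\<^sup>2 / 2) = pi * (norm \<xi>)\<^sup>2 / 2 - pi * (norm (\<xi> - \<nu>))\<^sup>2 / 2"
    unfolding cmod_power2 by (simp add: power2_eq_square algebra_simps diff_divide_distrib add_divide_distrib)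
  hence e: "norm (exp (pi * cnj \<nu> * (\<xi> - \<nu>) + pi * (norm \<nu>)\<^sup>2 / 2)) \<le> exp (pi * (norm \<xi>)\<^sup>2 / 2)"
    by (simp only: norm_exp_eq_Re) simp
  have "norm (\<Sum>k<n. cjet U \<nu> k / fact k * (\<xi> - \<nu>) ^ k) \<le> (\<Sum>k<n. norm (cjet U \<nu> k) * (1 + d) ^ n)"
  proof (rule sum_norm_le)
    fix k assume k: "k \<in> {..<n}"
    have "norm (cjet U \<nu> k / fact k * (\<xi> - \<nu>) ^ k) = norm (cjet U \<nu> k) / fact k * norm (\<xi> - \<nu>) ^ k"
      by (simp add: norm_mult norm_divide norm_power)
    also have "\<dots> \<le> norm (cjet U \<nu> k) * (1 + d) ^ n"
    proof (intro mult_mono)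
      show "norm (cjet U \<nu> k) / fact k \<le> norm (cjet U \<nu> k)"
        using fact_ge_1[of k, where ?'a = real] by (simp add: divide_le_eq mult_le_cancel_left1)
      have "norm (\<xi> - \<nu>) ^ k \<le> (1 + d) ^ k" using assms by (intro power_mono) auto
      also have "\<dots> \<le> (1 + d) ^ n" using k d by (intro power_increasing) auto
      finally show "norm (\<xi> - \<nu>) ^ k \<le> (1 + d) ^ n" .
    qed auto
    finally show "norm (cjet U \<nu> k / fact k * (\<xi> - \<nu>) ^ k) \<le> norm (cjet U \<nu> k) * (1 + d) ^ n" .
  qed
  also have "\<dots> = (1 + d) ^ n * (\<Sum>k<n. norm (cjet U \<nu> k))" by (simp add: sum_distrib_left mult.commute)
  finally have "norm (cjet_poly n U \<nu> \<xi>) \<le> ((1 + d) ^ n * (\<Sum>k<n. norm (cjet U \<nu> k))) * exp (pi * (norm \<xi>)\<^sup>2 / 2)"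
    unfolding cjet_poly_def norm_mult using d by (intro mult_mono[OF _ e]) (auto intro!: mult_nonneg_nonneg sum_nonneg)
  thus ?thesis by (simp add: mult_ac)
qed

lemma cjet_poly_remainder:
  assumes U: "U holomorphic_on UNIV"
  obtains R where "R holomorphic_on UNIV" "\<And>\<xi>. U \<xi> = cjet_poly n U \<nu> \<xi> + (\<xi> - \<nu>) ^ n * R \<xi>"
proof -
  let ?E = "\<lambda>\<zeta>. exp (- pi * cnj \<nu> * \<zeta> - pi * (norm \<nu>)\<^sup>2 / 2)"
  have "(\<lambda>\<zeta>. U (\<nu> + \<zeta>)) holomorphic_on UNIV"
    by (intro holomorphic_on_UNIV_compose[OF U] holomorphic_intros)
  hence "(\<lambda>\<zeta>. U (\<nu> + \<zeta>) * ?E \<zeta>) holomorphic_on UNIV" by (intro holomorphic_intros) auto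
  from entire_taylor_remainder[OF this, of n] obtain R where
    R: "R holomorphic_on UNIV" "\<And>z. U (\<nu> + z) * ?E z = (\<Sum>k<n. cjet U \<nu> k / fact k * z ^ k) + z ^ n * R z"
    unfolding cjet_def by blast
  let ?F = "\<lambda>\<zeta>. exp (pi * cnj \<nu> * \<zeta> + pi * (norm \<nu>)\<^sup>2 / 2)"
  have EF: "?E \<zeta> * ?F \<zeta> = 1" for \<zeta> by (simp flip: exp_add)
  show thesis
  proof (rule that[of "\<lambda>\<xi>. R (\<xi> - \<nu>) * ?F (\<xi> - \<nu>)"])
    have "(\<lambda>\<xi>. R (\<xi> - \<nu>)) holomorphic_on UNIV"
      by (intro holomorphic_on_UNIV_compose[OF R(1)] holomorphic_intros)
    thus "(\<lambda>\<xi>. R (\<xi> - \<nu>) * ?F (\<xi> - \<nu>)) holomorphic_on UNIV" by (intro holomorphic_intros) auto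
    fix \<xi>
    have "U \<xi> = (U (\<nu> + (\<xi> - \<nu>)) * ?E (\<xi> - \<nu>)) * ?F (\<xi> - \<nu>)" using EF[of "\<xi> - \<nu>"] by (simp add: mult.assoc)
    also have "\<dots> = cjet_poly n U \<nu> \<xi> + (\<xi> - \<nu>) ^ n * (R (\<xi> - \<nu>) * ?F (\<xi> - \<nu>))"
      unfolding R(2) cjet_poly_def by (simp add: algebra_simps)
    finally show "U \<xi> = cjet_poly n U \<nu> \<xi> + (\<xi> - \<nu>) ^ n * (R (\<xi> - \<nu>) * ?F (\<xi> - \<nu>))" .
  qed
qed

lemma holomorphic_cjet_poly: "cjet_poly n U \<nu> holomorphic_on A"
  unfolding cjet_poly_def[abs_def] by (intro holomorphic_intros) auto

text \<open>After subtraction of the jet polynomial the numerator vanishes to order \<open>n\<close>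
  at the lattice point and cancels the n-fold zero of the denominator. The relation is stated
  multiplied out, so that it also holds at the lattice point itself.\<close>

lemma (in lattice_sigma) quotient_extends:
  assumes U: "U holomorphic_on UNIV" and g: "g holomorphic_on UNIV"
    and S: "\<And>j. lpt \<alpha> \<beta> j \<in> S \<Longrightarrow> j = i"
  obtains h where "h holomorphic_on S" "\<And>\<xi>. \<xi> \<in> S \<Longrightarrow> h \<xi> * \<sigma> \<xi> ^ n = (U \<xi> - cjet_poly n U (lpt \<alpha> \<beta> i) \<xi>) * g \<xi>"
proof -
  obtain R where R: "R holomorphic_on UNIV" "\<And>\<xi>. U \<xi> = cjet_poly n U (lpt \<alpha> \<beta> i) \<xi> + (\<xi> - lpt \<alpha> \<beta> i) ^ n * R \<xi>"
    using cjet_poly_remainder[OF U] by metis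
  obtain s where s: "s holomorphic_on UNIV" "\<And>z. \<sigma> z = (z - lpt \<alpha> \<beta> i) * s z"
    "\<And>z. s z = 0 \<Longrightarrow> z \<in> range (lpt \<alpha> \<beta>) - {lpt \<alpha> \<beta> i}"
    using sigma_factor by metis
  have s0: "s \<xi> \<noteq> 0" if "\<xi> \<in> S" for \<xi> using s(3)[of \<xi>] S that by auto
  show thesis
  proof (rule that[of "\<lambda>\<xi>. R \<xi> * g \<xi> / s \<xi> ^ n"])
    show "(\<lambda>\<xi>. R \<xi> * g \<xi> / s \<xi> ^ n) holomorphic_on S"
      using s0 by (intro holomorphic_intros holomorphic_on_subset[OF R(1)] holomorphic_on_subset[OF g] holomorphic_on_subset[OF s(1)]) auto
    show "R \<xi> * g \<xi> / s \<xi> ^ n * \<sigma> \<xi> ^ n = (U \<xi> - cjet_poly n U (lpt \<alpha> \<beta> i) \<xi>) * g \<xi>" if "\<xi> \<in> S" for \<xi>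
      using s0[OF that] R(2)[of \<xi>] by (simp add: s(2) power_mult_distrib)
  qed
qed

text \<open>Every side belongs to two neighbouring cells and is traversed in opposite directions.
  Absolute summability of the side integrals permits the index shifts by which they cancel.\<close>

lemma quad_integral_grid_sum:
  fixes q :: "int \<times> int \<Rightarrow> complex"
  assumes q: "\<And>i. q (i + (1, 0)) = q i + \<alpha>" "\<And>i. q (i + (0, 1)) = q i + \<beta>"
    and cont: "\<And>i. continuous_on (closed_segment (q i) (q i + \<alpha>)) f" "\<And>i. continuous_on (closed_segment (q i) (q i + \<beta>)) f"
    and X: "integrable (count_space UNIV) (\<lambda>i. contour_integral (linepath (q i) (q i + \<alpha>)) f)"
    and Y: "integrable (count_space UNIV) (\<lambda>i. contour_integral (linepath (q i) (q i + \<beta>)) f)"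
  shows "integrable (count_space UNIV) (\<lambda>i. quad_integral f (q i) (q i + \<alpha>) (q i + \<alpha> + \<beta>) (q i + \<beta>))"
    and "(\<integral>i. quad_integral f (q i) (q i + \<alpha>) (q i + \<alpha> + \<beta>) (q i + \<beta>) \<partial>count_space UNIV) = 0"
proof -
  define X' where "X' = (\<lambda>i. contour_integral (linepath (q i) (q i + \<alpha>)) f)"
  define Y' where "Y' = (\<lambda>i. contour_integral (linepath (q i) (q i + \<beta>)) f)"
  have bij: "bij_betw (\<lambda>i. i + j) UNIV UNIV" for j :: "int \<times> int"
    by (rule bij_betwI[where g = "\<lambda>i. i - j"]) auto
  have eq: "quad_integral f (q i) (q i + \<alpha>) (q i + \<alpha> + \<beta>) (q i + \<beta>) = X' i + Y' (i + (1, 0)) - X' (i + (0, 1)) - Y' i" for i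
  proof -
    have "contour_integral (linepath (q i + \<alpha> + \<beta>) (q i + \<beta>)) f = - X' (i + (0, 1))"
      using cont(1)[of "i + (0, 1)"] contour_integral_reverse_linepath[of "q i + \<beta>" "q i + \<beta> + \<alpha>" f]
      by (simp add: X'_def q add_ac)
    moreover have "contour_integral (linepath (q i + \<beta>) (q i)) f = - Y' i"
      using cont(2)[of i] contour_integral_reverse_linepath[of "q i" "q i + \<beta>" f] by (simp add: Y'_def)
    moreover have "contour_integral (linepath (q i + \<alpha>) (q i + \<alpha> + \<beta>)) f = Y' (i + (1, 0))"
      by (simp add: Y'_def q)
    ultimately show ?thesis by (simp add: quad_integral_def X'_def)
  qed
  have Xi: "integrable (count_space UNIV) X'" and Yi: "integrable (count_space UNIV) Y'"
    using X Y by (simp_all add: X'_def Y'_def)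
  have Xs: "integrable (count_space UNIV) (\<lambda>i. X' (i + j))" "(\<integral>i. X' (i + j) \<partial>count_space UNIV) = (\<integral>i. X' i \<partial>count_space UNIV)"
    and Ys: "integrable (count_space UNIV) (\<lambda>i. Y' (i + j))" "(\<integral>i. Y' (i + j) \<partial>count_space UNIV) = (\<integral>i. Y' i \<partial>count_space UNIV)" for j
    using Xi Yi by (simp_all add: integrable_bij_count_space[OF bij[of j]] integral_bij_count_space[OF bij[of j]])
  show "integrable (count_space UNIV) (\<lambda>i. quad_integral f (q i) (q i + \<alpha>) (q i + \<alpha> + \<beta>) (q i + \<beta>))"
    unfolding eq using Xs Ys Xi Yi by (intro Bochner_Integration.integrable_diff Bochner_Integration.integrable_add) auto
  show "(\<integral>i. quad_integral f (q i) (q i + \<alpha>) (q i + \<alpha> + \<beta>) (q i + \<beta>) \<partial>count_space UNIV) = 0"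
    unfolding eq using Xs Ys Xi Yi
    by simp
qed

lemma quad_integral_cong:
  assumes "\<And>\<xi>. \<xi> \<in> closed_segment p q \<union> closed_segment q r \<union> closed_segment r s \<union> closed_segment s p \<Longrightarrow> f \<xi> = g \<xi>"
  shows "quad_integral f p q r s = quad_integral g p q r s"
  unfolding quad_integral_def using assms by (intro arg_cong2[where f = "(+)"] contour_integral_cong) auto

lemma quad_integral_diff:
  assumes "continuous_on (closed_segment p q \<union> closed_segment q r \<union> closed_segment r s \<union> closed_segment s p) f"
    "continuous_on (closed_segment p q \<union> closed_segment q r \<union> closed_segment r s \<union> closed_segment s p) g"
  shows "quad_integral (\<lambda>\<xi>. f \<xi> - g \<xi>) p q r s = quad_integral f p q r s - quad_integral g p q r s"
proof -
  have "h contour_integrable_on linepath p q" "h contour_integrable_on linepath q r"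
       "h contour_integrable_on linepath r s" "h contour_integrable_on linepath s p" if "h = f \<or> h = g" for h
    by (intro contour_integrable_continuous_linepath continuous_on_subset[OF assms(1)] continuous_on_subset[OF assms(2)];
        use that assms in \<open>auto intro: continuous_on_subset\<close>)+
  thus ?thesis unfolding quad_integral_def by (simp add: contour_integral_diff)
qed

lemma norm_quad_integral_le:
  assumes "continuous_on (closed_segment p q \<union> closed_segment q r \<union> closed_segment r s \<union> closed_segment s p) f" "B \<ge> 0"
    "\<And>\<xi>. \<xi> \<in> closed_segment p q \<union> closed_segment q r \<union> closed_segment r s \<union> closed_segment s p \<Longrightarrow> norm (f \<xi>) \<le> B"
  shows "norm (quad_integral f p q r s) \<le> B * (norm (q - p) + norm (r - q) + norm (s - r) + norm (p - s))"
proof -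
  have i: "f contour_integrable_on linepath p q" "f contour_integrable_on linepath q r"
       "f contour_integrable_on linepath r s" "f contour_integrable_on linepath s p"
    by (intro contour_integrable_continuous_linepath continuous_on_subset[OF assms(1)]; auto)+
  have "norm (quad_integral f p q r s) \<le> norm (contour_integral (linepath p q) f) + norm (contour_integral (linepath q r) f)
     + norm (contour_integral (linepath r s) f) + norm (contour_integral (linepath s p) f)"
    unfolding quad_integral_def by (intro order.trans[OF norm_triangle_ineq] add_mono order.refl)
  also have "\<dots> \<le> B * norm (q - p) + B * norm (r - q) + B * norm (s - r) + B * norm (p - s)"
    using assms by (intro add_mono contour_integral_bound_linepath i) auto
  finally show ?thesis by (simp add: algebra_simps)
qed

section \<open>The shifted grid and the sampling estimate\<close>

lemma grid_offset_exists:
  fixes s :: real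
  obtains \<phi> where "\<phi> \<in> {1/3, 2/3}" "\<And>m :: int. \<bar>s + \<phi> - m\<bar> \<ge> 1/6"
proof -
  define x where "x = frac s"
  have x: "0 \<le> x" "x < 1" "s = of_int \<lfloor>s\<rfloor> + x" by (auto simp: x_def frac_lt_1) (simp add: frac_def)
  \<comment> \<open>The values for the offsets 1/3 and 2/3 differ by 1/3, so they cannot both be
    closer than 1/6 to an integer; 1/3 fails only if x + 1/3 is within 1/6 of 1.\<close>
  define \<phi> :: real where "\<phi> = (if x \<ge> 1/2 \<and> x \<le> 5/6 then 2/3 else 1/3)"
  have "\<bar>s + \<phi> - m\<bar> \<ge> 1/6" for m :: int
  proof -
    define k where "k = m - \<lfloor>s\<rfloor>"
    have e: "s + \<phi> - m = x + \<phi> - k" using x(3) by (simp add: k_def)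
    consider "k \<le> 0" | "k = 1" | "k \<ge> 2" by linarith
    thus ?thesis unfolding e
    proof cases
      case 1 hence "real_of_int k \<le> 0" by simp
      thus "1/6 \<le> \<bar>x + \<phi> - k\<bar>" using x by (simp add: \<phi>_def)
    next
      case 2 thus "1/6 \<le> \<bar>x + \<phi> - k\<bar>" using x by (auto simp: \<phi>_def abs_if)
    next
      case 3 hence "real_of_int k \<ge> 2" by simp
      thus "1/6 \<le> \<bar>x + \<phi> - k\<bar>" using x by (simp add: \<phi>_def abs_if)
    qed
  qed
  thus thesis using that[of \<phi>] by (simp add: \<phi>_def)
qed

context lattice_sigma
begin

text \<open>By Cramer's rule \<open>cs\<close> and \<open>ct\<close> are the real coordinates in the
  basis \<alpha>, \<beta>, which serve as grid coordinates below.\<close>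

definition "cs z = Im (cnj z * \<beta>) / Im (cnj \<alpha> * \<beta>)"
definition "ct z = Im (cnj \<alpha> * z) / Im (cnj \<alpha> * \<beta>)"

lemma cs_ct: "z = of_real (cs z) * \<alpha> + of_real (ct z) * \<beta>"
  unfolding cs_def ct_def by (rule lattice_coordinates[OF V0])

lemma cs_ct_combination [simp]:
  "cs (of_real s * \<alpha> + of_real t * \<beta>) = s" "ct (of_real s * \<alpha> + of_real t * \<beta>) = t"
proof -
  have "Im (cnj (of_real s * \<alpha> + of_real t * \<beta>) * \<beta>) = s * Im (cnj \<alpha> * \<beta>)"
       "Im (cnj \<alpha> * (of_real s * \<alpha> + of_real t * \<beta>)) = t * Im (cnj \<alpha> * \<beta>)"
    by (simp_all add: algebra_simps)
  thus "cs (of_real s * \<alpha> + of_real t * \<beta>) = s" "ct (of_real s * \<alpha> + of_real t * \<beta>) = t"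
    unfolding cs_def ct_def using V0 by simp_all
qed

lemma cs_ct_linear: "linear cs" "linear ct"
  by (rule linearI; simp add: cs_def ct_def algebra_simps add_divide_distrib diff_divide_distrib)+

lemma cs_ct_diff: "cs (x - y) = cs x - cs y" "ct (x - y) = ct x - ct y"
  using cs_ct_linear by (simp_all add: linear_diff)

lemma cs_ct_lpt: "cs (lpt \<alpha> \<beta> i) = of_int (fst i)" "ct (lpt \<alpha> \<beta> i) = of_int (snd i)"
  using cs_ct_combination[of "of_int (fst i)" "of_int (snd i)"] by (simp_all add: lpt_def)

lemma abs_cs_ct_le: "\<bar>cs z\<bar> * Im (cnj \<alpha> * \<beta>) \<le> (norm \<alpha> + norm \<beta>) * norm z" "\<bar>ct z\<bar> * Im (cnj \<alpha> * \<beta>) \<le> (norm \<alpha> + norm \<beta>) * norm z"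
proof -
  have "\<bar>cs z\<bar> * Im (cnj \<alpha> * \<beta>) = \<bar>Im (cnj z * \<beta>)\<bar>" "\<bar>ct z\<bar> * Im (cnj \<alpha> * \<beta>) = \<bar>Im (cnj \<alpha> * z)\<bar>"
    unfolding cs_def ct_def abs_divide using V by simp_all
  thus "\<bar>cs z\<bar> * Im (cnj \<alpha> * \<beta>) \<le> (norm \<alpha> + norm \<beta>) * norm z" "\<bar>ct z\<bar> * Im (cnj \<alpha> * \<beta>) \<le> (norm \<alpha> + norm \<beta>) * norm z"
    using abs_Im_le_cmod[of "cnj z * \<beta>"] abs_Im_le_cmod[of "cnj \<alpha> * z"]
    by (simp_all add: norm_mult algebra_simps add_increasing add_increasing2)
qed

lemma open_convex_box:
  "open {\<xi>. a < cs \<xi> \<and> cs \<xi> < b \<and> c < ct \<xi> \<and> ct \<xi> < d}" "convex {\<xi>. a < cs \<xi> \<and> cs \<xi> < b \<and> c < ct \<xi> \<and> ct \<xi> < d}"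
proof -
  have eq: "{\<xi>. a < cs \<xi> \<and> cs \<xi> < b \<and> c < ct \<xi> \<and> ct \<xi> < d} = cs -` {a<..<b} \<inter> ct -` {c<..<d}" by auto
  have "continuous_on UNIV cs" "continuous_on UNIV ct" using cs_ct_linear by (simp_all add: linear_continuous_on linear_conv_bounded_linear)
  thus "open {\<xi>. a < cs \<xi> \<and> cs \<xi> < b \<and> c < ct \<xi> \<and> ct \<xi> < d}" unfolding eq
    by (intro open_Int) (auto intro!: open_vimage)
  show "convex {\<xi>. a < cs \<xi> \<and> cs \<xi> < b \<and> c < ct \<xi> \<and> ct \<xi> < d}" unfolding eq
    by (intro convex_Int convex_linear_vimage cs_ct_linear) auto
qed

text \<open>The kernel \<open>g(\<xi>) / \<sigma>(\<xi>)\<^sup>n\<close> is integrated around the cells of a grid that avoids both the lattice and \<open>v\<close>, after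
  subtracting from \<open>U\<close> in each cell its jet polynomial at the lattice point inside. The entire factor \<open>g\<close> absorbs the
  excess growth of \<open>\<sigma>\<^sup>n\<close> and leaves a Gaussian weight centred at \<open>v\<close>.\<close>
lemma sampling_estimate:
  assumes n: "Im (cnj \<alpha> * \<beta>) < real n"
  obtains C \<epsilon> where "C > 0" "\<epsilon> > 0"
    "\<And>U v B a. U holomorphic_on UNIV \<Longrightarrow> (\<And>z. norm (U z) \<le> B * exp (a * norm z)) \<Longrightarrow>
       ennreal (norm (U v) * exp (- pi * (norm v)\<^sup>2 / 2)) \<le>
       ennreal C * (\<integral>\<^sup>+i. ennreal ((\<Sum>k<n. norm (cjet U (lpt \<alpha> \<beta> i) k)) * exp (- \<epsilon> * (norm (v - lpt \<alpha> \<beta> i))\<^sup>2)) \<partial>count_space UNIV)"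
proof -
  define d where "d = norm \<alpha> + norm \<beta>"
  have "\<alpha> \<noteq> 0" using V by auto
  hence d: "d > 0" by (simp add: d_def add_pos_nonneg)
  define \<delta> where "\<delta> = Im (cnj \<alpha> * \<beta>) / (6 * d)"
  have \<delta>: "\<delta> > 0" using V d unfolding \<delta>_def by (intro divide_pos_pos) auto
  \<comment> \<open>Since \<open>\<kappa>\<close> times the cell area equals pi / 2, this surplus of
    growth is positive exactly when the cell area is less than \<open>n\<close>.\<close>
  define \<epsilon>0 where "\<epsilon>0 = n * \<kappa> - pi / 2"
  have \<epsilon>0: "\<epsilon>0 > 0"
  proof -
    have "pi / 2 = c * (pi / (2 * c))" if "c \<noteq> 0" for c :: real using that by simp
    from this[OF V0] have "pi / 2 = Im (cnj \<alpha> * \<beta>) * \<kappa>" unfolding \<kappa> .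
    also have "\<dots> < n * \<kappa>" using n \<kappa>_pos by (intro mult_strict_right_mono) auto
    finally show ?thesis by (simp add: \<epsilon>0_def)
  qed
  obtain p0 where p0: "p0 > 0" "\<And>s t. frac s \<in> {1/3, 2/3} \<or> frac t \<in> {1/3, 2/3} \<Longrightarrow> p0 \<le> per (of_real s * \<alpha> + of_real t * \<beta>)"
    using per_lower_bound by blast
  obtain P where P: "P > 0" "\<And>z. per z \<le> P" using per_bounded by blast
  \<comment> \<open>Half the rate is spent on replacing the distance from \<open>v\<close> to a
    boundary point of a cell by the distance from \<open>v\<close> to the lattice point of that
    cell.\<close>
  define \<epsilon> where "\<epsilon> = \<epsilon>0 / 2"
  define K0 where "K0 = exp (\<epsilon>0 * d\<^sup>2) / (p0 ^ n * \<delta>)"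
  have K0: "K0 > 0" using p0 \<delta> by (simp add: K0_def)
  \<comment> \<open>The perimeter of a cell is 2 d, and (1 + d) ^ n bounds the powers in a jet
    polynomial on it.\<close>
  define K where "K = K0 * (1 + d) ^ n * (2 * d)"
  have K: "K > 0" using K0 d by (simp add: K_def)
  \<comment> \<open>The first summand is for the jet polynomial of the cell of \<open>v\<close>, the
    second for the remainder, which is bounded through the residue at \<open>v\<close>.\<close>
  define C where "C = (1 + d) ^ n * exp (\<epsilon> * d\<^sup>2) + P ^ n * K"
  have C: "C > 0" unfolding C_def using d P K by (intro add_pos_pos mult_pos_pos) auto
  have "ennreal (norm (U v) * exp (- pi * (norm v)\<^sup>2 / 2)) \<le>
       ennreal C * (\<integral>\<^sup>+i. ennreal ((\<Sum>k<n. norm (cjet U (lpt \<alpha> \<beta> i) k)) * exp (- \<epsilon> * (norm (v - lpt \<alpha> \<beta> i))\<^sup>2)) \<partial>count_space UNIV)"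
    if U: "U holomorphic_on UNIV" and Ub: "\<And>z. norm (U z) \<le> B * exp (a * norm z)" for U v B a
  proof -
    define D where "D = (\<lambda>i. (\<Sum>k<n. norm (cjet U (lpt \<alpha> \<beta> i) k)) * exp (- \<epsilon> * (norm (v - lpt \<alpha> \<beta> i))\<^sup>2))"
    have D0: "D i \<ge> 0" for i by (auto simp: D_def intro!: mult_nonneg_nonneg sum_nonneg)
    \<comment> \<open>The grid depends on \<open>v\<close>: each coordinate gets an offset that
      keeps the grid lines away from \<open>v\<close>. The resulting distance
      \<open>\<delta>\<close> is the same for every \<open>v\<close>.\<close>
    obtain \<phi>1 where \<phi>1: "\<phi>1 \<in> {1/3, 2/3}" "\<And>m :: int. \<bar>cs v + \<phi>1 - m\<bar> \<ge> 1/6" using grid_offset_exists by blast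
    obtain \<phi>2 where \<phi>2: "\<phi>2 \<in> {1/3, 2/3}" "\<And>m :: int. \<bar>ct v + \<phi>2 - m\<bar> \<ge> 1/6" using grid_offset_exists by blast
    define q where "q = (\<lambda>i. lpt \<alpha> \<beta> i - (of_real \<phi>1 * \<alpha> + of_real \<phi>2 * \<beta>))"
    \<comment> \<open>The real part of 2 cnj v \<xi> - |v|^2 is |\<xi>|^2 - |\<xi> - v|^2, so this
      holomorphic factor has the modulus of a non-holomorphic Gaussian weight.\<close>
    define g where "g = (\<lambda>\<xi>. exp (of_real \<epsilon>0 * (2 * cnj v * \<xi> - of_real ((norm v)\<^sup>2))))"
    have hg: "g holomorphic_on A" for A unfolding g_def by (intro holomorphic_intros)
    have ng: "norm (g \<xi>) = exp (\<epsilon>0 * (norm \<xi>)\<^sup>2 - \<epsilon>0 * (norm (\<xi> - v))\<^sup>2)" for \<xi>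
      unfolding g_def norm_exp_eq_Re by (rule arg_cong[where f = exp]) (simp only: cmod_power2, simp add: power2_eq_square algebra_simps)
    define T where "T = (\<lambda>i. cjet_poly n U (lpt \<alpha> \<beta> i))"
    \<comment> \<open>\<open>Ed\<close> is the union of all grid lines and \<open>Ce i\<close> the
      closed cell around the lattice point of index i.\<close>
    define Ed where "Ed = {\<xi>. (\<exists>m :: int. cs \<xi> = m - \<phi>1) \<or> (\<exists>m :: int. ct \<xi> = m - \<phi>2)}"
    define Ce where "Ce = (\<lambda>i :: int \<times> int. {\<xi>. real_of_int (fst i) - \<phi>1 \<le> cs \<xi> \<and> cs \<xi> \<le> real_of_int (fst i) - \<phi>1 + 1 \<and> real_of_int (snd i) - \<phi>2 \<le> ct \<xi> \<and> ct \<xi> \<le> real_of_int (snd i) - \<phi>2 + 1})"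
    have frac\<phi>: "frac (of_int m - \<phi>) \<in> {1/3, 2/3}" if "\<phi> \<in> {1/3, 2/3 :: real}" for m \<phi>
    proof -
      have "frac (of_int m - \<phi>) = 1 - \<phi>"
        unfolding frac_unique_iff using that by auto
      thus ?thesis using that by auto
    qed
    have Ed_per: "p0 \<le> per \<xi>" if "\<xi> \<in> Ed" for \<xi>
    proof -
      have "frac (cs \<xi>) \<in> {1/3, 2/3} \<or> frac (ct \<xi>) \<in> {1/3, 2/3}"
        using that frac\<phi>[OF \<phi>1(1)] frac\<phi>[OF \<phi>2(1)] unfolding Ed_def mem_Collect_eq by metis
      from p0(2)[OF this] show ?thesis using cs_ct[of \<xi>] by simp
    qed
    have Ed_\<sigma>: "\<sigma> \<xi> \<noteq> 0" if "\<xi> \<in> Ed" for \<xi>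
      using Ed_per[OF that] p0(1) by (auto simp: per_def)
    have Ed_v: "\<delta> \<le> norm (\<xi> - v)" if "\<xi> \<in> Ed" for \<xi>
    proof -
      from that consider m :: int where "cs \<xi> = m - \<phi>1" | m :: int where "ct \<xi> = m - \<phi>2" unfolding Ed_def by blast
      hence "1/6 \<le> \<bar>cs (\<xi> - v)\<bar> \<or> 1/6 \<le> \<bar>ct (\<xi> - v)\<bar>"
      proof cases
        case (1 m) thus ?thesis using \<phi>1(2)[of m] unfolding cs_ct_diff by linarith
      next
        case (2 m) thus ?thesis using \<phi>2(2)[of m] unfolding cs_ct_diff by linarith
      qed
      hence "1/6 * Im (cnj \<alpha> * \<beta>) \<le> d * norm (\<xi> - v)"
        using abs_cs_ct_le[of "\<xi> - v"] V mult_right_mono[of "1/6" "\<bar>cs (\<xi> - v)\<bar>" "Im (cnj \<alpha> * \<beta>)"]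
          mult_right_mono[of "1/6" "\<bar>ct (\<xi> - v)\<bar>" "Im (cnj \<alpha> * \<beta>)"] unfolding d_def by linarith
      thus ?thesis using d unfolding \<delta>_def by (simp add: field_simps)
    qed
    have Ed_nv: "\<xi> \<noteq> v" if "\<xi> \<in> Ed" for \<xi> using Ed_v[OF that] \<delta> by auto
    have Ce_d: "norm (\<xi> - lpt \<alpha> \<beta> i) \<le> d" if "\<xi> \<in> Ce i" for \<xi> i
    proof -
      have "\<xi> - lpt \<alpha> \<beta> i = of_real (cs \<xi> - fst i) * \<alpha> + of_real (ct \<xi> - snd i) * \<beta>"
        using cs_ct[of "\<xi> - lpt \<alpha> \<beta> i"] by (simp add: cs_ct_diff cs_ct_lpt)
      also have "norm \<dots> \<le> \<bar>cs \<xi> - fst i\<bar> * norm \<alpha> + \<bar>ct \<xi> - snd i\<bar> * norm \<beta>"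
        by (intro order.trans[OF norm_triangle_ineq]) (simp only: norm_mult norm_of_real order.refl)
      also have "\<dots> \<le> 1 * norm \<alpha> + 1 * norm \<beta>"
        using that \<phi>1(1) \<phi>2(1) by (intro add_mono mult_right_mono) (auto simp: Ce_def abs_if)
      finally show ?thesis by (simp add: d_def)
    qed
    have Gauss: "exp (- \<epsilon>0 * (norm (\<xi> - v))\<^sup>2) \<le> exp (\<epsilon>0 * d\<^sup>2) * exp (- \<epsilon> * (norm (v - lpt \<alpha> \<beta> i))\<^sup>2)" if "\<xi> \<in> Ce i" for \<xi> i
    proof -
      have "norm (v - lpt \<alpha> \<beta> i) \<le> norm (\<xi> - v) + d"
        using Ce_d[OF that] norm_triangle_ineq[of "v - \<xi>" "\<xi> - lpt \<alpha> \<beta> i"] by (simp add: norm_minus_commute)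
      hence "(norm (v - lpt \<alpha> \<beta> i))\<^sup>2 \<le> (norm (\<xi> - v) + d)\<^sup>2" by (intro power_mono) auto
      also have "\<dots> \<le> 2 * (norm (\<xi> - v))\<^sup>2 + 2 * d\<^sup>2"
        using zero_le_power2[of "norm (\<xi> - v) - d"] by (simp add: power2_eq_square algebra_simps)
      finally have "\<epsilon> * (norm (v - lpt \<alpha> \<beta> i))\<^sup>2 \<le> \<epsilon> * (2 * (norm (\<xi> - v))\<^sup>2 + 2 * d\<^sup>2)"
        using \<epsilon>0 by (intro mult_left_mono) (auto simp: \<epsilon>_def)
      thus ?thesis unfolding exp_add[symmetric] by (simp add: \<epsilon>_def algebra_simps)
    qed
    \<comment> \<open>With \<open>\<epsilon>0\<close> = n \<open>\<kappa>\<close> - pi / 2 the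
      exponents of \<open>g\<close> and of the power of \<sigma> add up to - pi |\<xi>|^2 / 2 -
      \<open>\<epsilon>0\<close> |\<xi> - v|^2: the Fock weight times a Gaussian about
      \<open>v\<close>.\<close>
    have kern: "norm (g \<xi> / (\<sigma> \<xi> ^ n * (\<xi> - v))) \<le> exp (- pi * (norm \<xi>)\<^sup>2 / 2) * K0 * exp (- \<epsilon> * (norm (v - lpt \<alpha> \<beta> i))\<^sup>2)"
      if \<xi>: "\<xi> \<in> Ed" "\<xi> \<in> Ce i" for \<xi> i
    proof -
      have "norm (g \<xi> / (\<sigma> \<xi> ^ n * (\<xi> - v))) = exp (\<epsilon>0 * (norm \<xi>)\<^sup>2 - \<epsilon>0 * (norm (\<xi> - v))\<^sup>2) / (per \<xi> ^ n * exp (n * (\<kappa> * (norm \<xi>)\<^sup>2)) * norm (\<xi> - v))"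
        by (simp add: norm_divide norm_mult norm_power ng norm_sigma power_mult_distrib flip: exp_of_nat_mult)
      also have "\<dots> = exp (\<epsilon>0 * (norm \<xi>)\<^sup>2 - \<epsilon>0 * (norm (\<xi> - v))\<^sup>2 - n * (\<kappa> * (norm \<xi>)\<^sup>2)) / (per \<xi> ^ n * norm (\<xi> - v))"
        by (simp add: exp_diff)
      also have "\<epsilon>0 * (norm \<xi>)\<^sup>2 - \<epsilon>0 * (norm (\<xi> - v))\<^sup>2 - n * (\<kappa> * (norm \<xi>)\<^sup>2) = - pi * (norm \<xi>)\<^sup>2 / 2 + (- \<epsilon>0 * (norm (\<xi> - v))\<^sup>2)"
        by (simp add: \<epsilon>0_def algebra_simps)
      also have "exp (- pi * (norm \<xi>)\<^sup>2 / 2 + (- \<epsilon>0 * (norm (\<xi> - v))\<^sup>2)) / (per \<xi> ^ n * norm (\<xi> - v))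
          \<le> (exp (- pi * (norm \<xi>)\<^sup>2 / 2) * (exp (\<epsilon>0 * d\<^sup>2) * exp (- \<epsilon> * (norm (v - lpt \<alpha> \<beta> i))\<^sup>2))) / (p0 ^ n * \<delta>)"
        unfolding exp_add using Ed_per[OF \<xi>(1)] Ed_v[OF \<xi>(1)] Gauss[OF \<xi>(2)] p0(1) \<delta>
        by (intro frac_le mult_mono power_mono mult_pos_pos) auto
      finally show ?thesis by (simp add: K0_def)
    qed
    have seg: "closed_segment (q i) (q i + \<alpha>) \<subseteq> Ed \<inter> Ce i" "closed_segment (q i) (q i + \<beta>) \<subseteq> Ed \<inter> Ce i"
      "closed_segment (q i + \<alpha>) (q i + \<alpha> + \<beta>) \<subseteq> Ed \<inter> Ce i" "closed_segment (q i + \<alpha> + \<beta>) (q i + \<beta>) \<subseteq> Ed \<inter> Ce i"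
      "closed_segment (q i + \<beta>) (q i) \<subseteq> Ed \<inter> Ce i" for i
    proof -
      have *: "q i + of_real x * \<alpha> + of_real y * \<beta> \<in> Ed \<inter> Ce i" if "0 \<le> x" "x \<le> 1" "0 \<le> y" "y \<le> 1" "x = 0 \<or> x = 1 \<or> y = 0 \<or> y = 1" for x y :: real
      proof -
        have "q i + of_real x * \<alpha> + of_real y * \<beta> = of_real (fst i - \<phi>1 + x) * \<alpha> + of_real (snd i - \<phi>2 + y) * \<beta>"
          by (simp add: q_def lpt_def algebra_simps)
        hence c: "cs (q i + of_real x * \<alpha> + of_real y * \<beta>) = fst i - \<phi>1 + x" "ct (q i + of_real x * \<alpha> + of_real y * \<beta>) = snd i - \<phi>2 + y"
          by (metis cs_ct_combination)+
        have "\<exists>m :: int. fst i - \<phi>1 + x = m - \<phi>1" if "x = 0 \<or> x = 1"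
          using that by (intro exI[of _ "fst i + (if x = 0 then 0 else 1)"]) auto
        moreover have "\<exists>m :: int. snd i - \<phi>2 + y = m - \<phi>2" if "y = 0 \<or> y = 1"
          using that by (intro exI[of _ "snd i + (if y = 0 then 0 else 1)"]) auto
        ultimately show ?thesis using that unfolding Ed_def Ce_def by (auto simp: c)
      qed
      have eqs: "(1 - u) *\<^sub>R q i + u *\<^sub>R (q i + \<alpha>) = q i + of_real u * \<alpha> + of_real 0 * \<beta>"
        "(1 - u) *\<^sub>R q i + u *\<^sub>R (q i + \<beta>) = q i + of_real 0 * \<alpha> + of_real u * \<beta>"
        "(1 - u) *\<^sub>R (q i + \<alpha>) + u *\<^sub>R (q i + \<alpha> + \<beta>) = q i + of_real 1 * \<alpha> + of_real u * \<beta>"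
        "(1 - u) *\<^sub>R (q i + \<alpha> + \<beta>) + u *\<^sub>R (q i + \<beta>) = q i + of_real (1 - u) * \<alpha> + of_real 1 * \<beta>"
        "(1 - u) *\<^sub>R (q i + \<beta>) + u *\<^sub>R (q i) = q i + of_real 0 * \<alpha> + of_real (1 - u) * \<beta>" for u
        by (simp_all add: scaleR_conv_of_real algebra_simps)
      show "closed_segment (q i) (q i + \<alpha>) \<subseteq> Ed \<inter> Ce i" "closed_segment (q i) (q i + \<beta>) \<subseteq> Ed \<inter> Ce i"
        "closed_segment (q i + \<alpha>) (q i + \<alpha> + \<beta>) \<subseteq> Ed \<inter> Ce i" "closed_segment (q i + \<alpha> + \<beta>) (q i + \<beta>) \<subseteq> Ed \<inter> Ce i"
        "closed_segment (q i + \<beta>) (q i) \<subseteq> Ed \<inter> Ce i"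
        unfolding closed_segment_def eqs by (auto simp del: of_real_diff of_real_0 of_real_1 intro!: *[THEN IntD1] *[THEN IntD2])
    qed
    have segs: "closed_segment (q i) (q i + \<alpha>) \<union> closed_segment (q i + \<alpha>) (q i + \<alpha> + \<beta>) \<union> closed_segment (q i + \<alpha> + \<beta>) (q i + \<beta>) \<union> closed_segment (q i + \<beta>) (q i) \<subseteq> Ed \<inter> Ce i" for i
      using seg by blast
    have contEd: "continuous_on Ed (\<lambda>\<xi>. F \<xi> * (g \<xi> / (\<sigma> \<xi> ^ n * (\<xi> - v))))" if "F holomorphic_on UNIV" for F
      using Ed_\<sigma> Ed_nv by (intro continuous_intros holomorphic_on_imp_continuous_on[OF holomorphic_on_subset[OF that]]
        holomorphic_on_imp_continuous_on[OF hg] holomorphic_on_imp_continuous_on[OF holomorphic_on_subset[OF holomorphic_sigma]]) auto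
    define f where "f = (\<lambda>\<xi>. U \<xi> * (g \<xi> / (\<sigma> \<xi> ^ n * (\<xi> - v))))"
    define fT where "fT = (\<lambda>i \<xi>. T i \<xi> * (g \<xi> / (\<sigma> \<xi> ^ n * (\<xi> - v))))"
    have cf: "continuous_on Ed f" and cT: "continuous_on Ed (fT i)" for i
      unfolding f_def fT_def T_def by (intro contEd U holomorphic_cjet_poly)+
    obtain CG where CG: "CG > 0" "\<And>w. (\<integral>\<^sup>+i. ennreal (exp (- \<epsilon> * (norm (w - lpt \<alpha> \<beta> i))\<^sup>2)) \<partial>count_space UNIV) \<le> ennreal CG"
      using gaussian_lattice_sum_bounded[OF V0, of \<epsilon>] \<epsilon>0 by (auto simp: \<epsilon>_def)
    have Gint: "integrable (count_space UNIV) (\<lambda>i. c * exp (- \<epsilon> * (norm (v - lpt \<alpha> \<beta> i))\<^sup>2))" for c :: real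
    proof -
      have "integrable (count_space UNIV) (\<lambda>i. exp (- \<epsilon> * (norm (v - lpt \<alpha> \<beta> i))\<^sup>2))"
        using CG(2)[of v] by (intro integrableI_bounded) (auto intro: le_less_trans)
      thus ?thesis by simp
    qed
    have B0: "B \<ge> 0" using order.trans[OF norm_ge_zero Ub[of 0]] by simp
    \<comment> \<open>From a x <= pi x^2 / 2 + a^2 / (2 pi). The growth bound on \<open>U\<close>
      enters only here, to make the series of side integrals absolutely convergent; the final
      constant is free of \<open>B\<close> and \<open>a\<close>.\<close>
    define B' where "B' = B * exp (a\<^sup>2 / (2 * pi)) * K0"
    have B': "B' \<ge> 0" using B0 K0 by (simp add: B'_def)
    have fb: "norm (f \<xi>) \<le> B' * exp (- \<epsilon> * (norm (v - lpt \<alpha> \<beta> i))\<^sup>2)" if "\<xi> \<in> Ed" "\<xi> \<in> Ce i" for \<xi> i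
    proof -
      have "0 \<le> (pi * norm \<xi> - a)\<^sup>2 / (2 * pi)" by simp
      also have "\<dots> = pi * (norm \<xi>)\<^sup>2 / 2 - a * norm \<xi> + a\<^sup>2 / (2 * pi)" by (simp add: field_simps power2_eq_square)
      finally have "exp (a * norm \<xi>) \<le> exp (a\<^sup>2 / (2 * pi)) * exp (pi * (norm \<xi>)\<^sup>2 / 2)" by (simp flip: exp_add)
      hence "B * exp (a * norm \<xi>) \<le> B * (exp (a\<^sup>2 / (2 * pi)) * exp (pi * (norm \<xi>)\<^sup>2 / 2))" using B0 by (rule mult_left_mono)
      hence "norm (f \<xi>) \<le> (B * (exp (a\<^sup>2 / (2 * pi)) * exp (pi * (norm \<xi>)\<^sup>2 / 2))) * (exp (- pi * (norm \<xi>)\<^sup>2 / 2) * K0 * exp (- \<epsilon> * (norm (v - lpt \<alpha> \<beta> i))\<^sup>2))"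
        unfolding f_def norm_mult using Ub[of \<xi>] B0 K0 by (intro mult_mono kern[OF that]) auto
      also have "\<dots> = B' * exp (- \<epsilon> * (norm (v - lpt \<alpha> \<beta> i))\<^sup>2)" by (simp add: B'_def exp_minus)
      finally show ?thesis .
    qed
    have X: "integrable (count_space UNIV) (\<lambda>i. contour_integral (linepath (q i) (q i + \<alpha>)) f)"
    proof (rule Bochner_Integration.integrable_bound[OF Gint[of "B' * norm \<alpha>"]], simp, rule AE_I2)
      fix i :: "int \<times> int"
      have "norm (contour_integral (linepath (q i) (q i + \<alpha>)) f) \<le> (B' * exp (- \<epsilon> * (norm (v - lpt \<alpha> \<beta> i))\<^sup>2)) * norm (q i + \<alpha> - q i)"
        using seg(1)[of i] B' fb[of _ i] cf
        by (intro contour_integral_bound_linepath contour_integrable_continuous_linepath) (auto intro: continuous_on_subset)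
      thus "norm (contour_integral (linepath (q i) (q i + \<alpha>)) f) \<le> norm (B' * norm \<alpha> * exp (- \<epsilon> * (norm (v - lpt \<alpha> \<beta> i))\<^sup>2))"
        using B' by (simp add: mult_ac)
    qed
    have Y: "integrable (count_space UNIV) (\<lambda>i. contour_integral (linepath (q i) (q i + \<beta>)) f)"
    proof (rule Bochner_Integration.integrable_bound[OF Gint[of "B' * norm \<beta>"]], simp, rule AE_I2)
      fix i :: "int \<times> int"
      have "norm (contour_integral (linepath (q i) (q i + \<beta>)) f) \<le> (B' * exp (- \<epsilon> * (norm (v - lpt \<alpha> \<beta> i))\<^sup>2)) * norm (q i + \<beta> - q i)"
        using seg(2)[of i] B' fb[of _ i] cf
        by (intro contour_integral_bound_linepath contour_integrable_continuous_linepath) (auto intro: continuous_on_subset)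
      thus "norm (contour_integral (linepath (q i) (q i + \<beta>)) f) \<le> norm (B' * norm \<beta> * exp (- \<epsilon> * (norm (v - lpt \<alpha> \<beta> i))\<^sup>2))"
        using B' by (simp add: mult_ac)
    qed
    define Q where "Q = (\<lambda>F i. quad_integral F (q i) (q i + \<alpha>) (q i + \<alpha> + \<beta>) (q i + \<beta>))"
    have J: "integrable (count_space UNIV) (Q f)" "(\<integral>i. Q f i \<partial>count_space UNIV) = 0"
      unfolding Q_def
      by (intro quad_integral_grid_sum[OF _ _ _ _ X Y] continuous_on_subset[OF cf] order.trans[OF seg(1) Int_lower1] order.trans[OF seg(2) Int_lower1];
          simp add: q_def lpt_def algebra_simps)+
    have QT: "norm (Q (fT i) i) \<le> K * D i" for i
    proof -
      let ?W = "(1 + d) ^ n * (\<Sum>k<n. norm (cjet U (lpt \<alpha> \<beta> i) k)) * (K0 * exp (- \<epsilon> * (norm (v - lpt \<alpha> \<beta> i))\<^sup>2))"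
      have "norm (Q (fT i) i) \<le> ?W * (norm (q i + \<alpha> - q i) + norm (q i + \<alpha> + \<beta> - (q i + \<alpha>)) + norm (q i + \<beta> - (q i + \<alpha> + \<beta>)) + norm (q i - (q i + \<beta>)))"
        unfolding Q_def
      proof (rule norm_quad_integral_le)
        show "0 \<le> ?W" using d K0 by (intro mult_nonneg_nonneg sum_nonneg) auto
        show "continuous_on (closed_segment (q i) (q i + \<alpha>) \<union> closed_segment (q i + \<alpha>) (q i + \<alpha> + \<beta>) \<union> closed_segment (q i + \<alpha> + \<beta>) (q i + \<beta>) \<union> closed_segment (q i + \<beta>) (q i)) (fT i)"
          using segs[of i] by (intro continuous_on_subset[OF cT]) auto
        fix \<xi> assume "\<xi> \<in> closed_segment (q i) (q i + \<alpha>) \<union> closed_segment (q i + \<alpha>) (q i + \<alpha> + \<beta>) \<union> closed_segment (q i + \<alpha> + \<beta>) (q i + \<beta>) \<union> closed_segment (q i + \<beta>) (q i)"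
        hence \<xi>: "\<xi> \<in> Ed" "\<xi> \<in> Ce i" using segs by blast+
        have "norm (fT i \<xi>) \<le> ((1 + d) ^ n * exp (pi * (norm \<xi>)\<^sup>2 / 2) * (\<Sum>k<n. norm (cjet U (lpt \<alpha> \<beta> i) k))) *
            (exp (- pi * (norm \<xi>)\<^sup>2 / 2) * K0 * exp (- \<epsilon> * (norm (v - lpt \<alpha> \<beta> i))\<^sup>2))"
          unfolding fT_def norm_mult T_def using d
          by (intro mult_mono kern \<xi> norm_cjet_poly_le Ce_d) (auto intro!: mult_nonneg_nonneg sum_nonneg)
        also have "\<dots> = ?W" by (simp add: exp_minus)
        finally show "norm (fT i \<xi>) \<le> ?W" .
      qed
      also have "\<dots> = K * D i" by (simp add: K_def D_def d_def mult_ac)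
      finally show ?thesis .
    qed
    \<comment> \<open>The index of the cell containing \<open>v\<close>: cells begin at integer
      minus offset, whence the floor of coordinate plus offset.\<close>
    define i0 where "i0 = (\<lfloor>cs v + \<phi>1\<rfloor>, \<lfloor>ct v + \<phi>2\<rfloor>)"
    \<comment> \<open>Open cells enlarged by 1/12. This is less than the distance 1/6 of
      \<open>v\<close> and the distance 1/3 of lattice points from the grid lines, so no new
      singularity enters.\<close>
    define Sb where "Sb = (\<lambda>i :: int \<times> int. {\<xi>. real_of_int (fst i) - \<phi>1 - 1/12 < cs \<xi> \<and> cs \<xi> < real_of_int (fst i) - \<phi>1 + 1 + 1/12 \<and> real_of_int (snd i) - \<phi>2 - 1/12 < ct \<xi> \<and> ct \<xi> < real_of_int (snd i) - \<phi>2 + 1 + 1/12})"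
    have CeSb: "Ce i \<subseteq> Sb i" for i by (auto simp: Ce_def Sb_def)
    have Sb: "open (Sb i)" "convex (Sb i)" for i unfolding Sb_def by (rule open_convex_box)+
    have near: "m = k" if "real_of_int k - \<phi> - 1/12 < m" "real_of_int m < k - \<phi> + 1 + 1/12" "\<phi> \<in> {1/3, 2/3}" for k m :: int and \<phi> :: real
      using that by auto
    have uniq: "j = i" if "lpt \<alpha> \<beta> j \<in> Sb i" for i j
      using that near[of "fst i" \<phi>1 "fst j"] near[of "snd i" \<phi>2 "snd j"] \<phi>1(1) \<phi>2(1) by (simp add: Sb_def cs_ct_lpt prod_eq_iff)
    have flo: "\<lfloor>x + \<phi>\<rfloor> = k" if "real_of_int k - \<phi> - 1/12 < x" "x < k - \<phi> + 1 + 1/12" "\<And>m :: int. \<bar>x + \<phi> - m\<bar> \<ge> 1/6" for k :: int and x \<phi> :: real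
      using that(1,2) that(3)[of k] that(3)[of "k + 1"] by (intro floor_unique) (auto simp: abs_if split: if_splits)
    have vSb: "v \<notin> Sb i" if "i \<noteq> i0" for i
      using that flo[of "fst i" \<phi>1 "cs v", OF _ _ \<phi>1(2)] flo[of "snd i" \<phi>2 "ct v", OF _ _ \<phi>2(2)] by (auto simp: Sb_def i0_def prod_eq_iff)
    have cornersCe: "q i \<in> Ce i" "q i + \<alpha> \<in> Ce i" "q i + \<alpha> + \<beta> \<in> Ce i" "q i + \<beta> \<in> Ce i" for i
      using seg(1,2,3)[of i] ends_in_segment by blast+
    have QU: "Q f i - Q (fT i) i = quad_integral (\<lambda>\<xi>. h \<xi> / (\<xi> - v)) (q i) (q i + \<alpha>) (q i + \<alpha> + \<beta>) (q i + \<beta>)"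
      if h: "\<And>\<xi>. \<xi> \<in> Sb i \<Longrightarrow> h \<xi> * \<sigma> \<xi> ^ n = (U \<xi> - T i \<xi>) * g \<xi>" for i h
    proof -
      have "Q f i - Q (fT i) i = quad_integral (\<lambda>\<xi>. f \<xi> - fT i \<xi>) (q i) (q i + \<alpha>) (q i + \<alpha> + \<beta>) (q i + \<beta>)"
        unfolding Q_def using segs[of i] by (intro quad_integral_diff[symmetric] continuous_on_subset[OF cf] continuous_on_subset[OF cT]) auto
      also have "\<dots> = quad_integral (\<lambda>\<xi>. h \<xi> / (\<xi> - v)) (q i) (q i + \<alpha>) (q i + \<alpha> + \<beta>) (q i + \<beta>)"
      proof (rule quad_integral_cong)
        fix \<xi> assume "\<xi> \<in> closed_segment (q i) (q i + \<alpha>) \<union> closed_segment (q i + \<alpha>) (q i + \<alpha> + \<beta>) \<union> closed_segment (q i + \<alpha> + \<beta>) (q i + \<beta>) \<union> closed_segment (q i + \<beta>) (q i)"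
        hence \<xi>: "\<xi> \<in> Ed" "\<xi> \<in> Sb i" using segs CeSb by blast+
        have "f \<xi> - fT i \<xi> = ((U \<xi> - T i \<xi>) * g \<xi>) / (\<sigma> \<xi> ^ n * (\<xi> - v))"
          by (simp add: f_def fT_def algebra_simps diff_divide_distrib)
        also have "\<dots> = h \<xi> / (\<xi> - v)" using h[OF \<xi>(2)] Ed_\<sigma>[OF \<xi>(1)] by (simp flip: h[OF \<xi>(2)])
        finally show "f \<xi> - fT i \<xi> = h \<xi> / (\<xi> - v)" .
      qed
      finally show ?thesis .
    qed
    \<comment> \<open>Away from the cell of \<open>v\<close> the difference of the two integrands is
      holomorphic on the enlarged cell, so \<open>f\<close> may be replaced by its jet version
      there.\<close>
    have QJ: "Q f i = Q (fT i) i" if "i \<noteq> i0" for i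
    proof -
      obtain h where h: "h holomorphic_on Sb i" "\<And>\<xi>. \<xi> \<in> Sb i \<Longrightarrow> h \<xi> * \<sigma> \<xi> ^ n = (U \<xi> - T i \<xi>) * g \<xi>"
        using quotient_extends[OF U hg, where S = "Sb i" and i = i and n = n] uniq unfolding T_def by blast
      have "quad_integral (\<lambda>\<xi>. h \<xi> / (\<xi> - v)) (q i) (q i + \<alpha>) (q i + \<alpha> + \<beta>) (q i + \<beta>) = 0"
        using vSb[OF that] CeSb[of i] cornersCe[of i] by (intro quad_integral_cauchy[OF _ Sb(2)[of i]] holomorphic_intros h(1)) auto
      thus ?thesis using QU[OF h(2)] by simp
    qed
    obtain h where h: "h holomorphic_on Sb i0" "\<And>\<xi>. \<xi> \<in> Sb i0 \<Longrightarrow> h \<xi> * \<sigma> \<xi> ^ n = (U \<xi> - T i0 \<xi>) * g \<xi>"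
      using quotient_extends[OF U hg, where S = "Sb i0" and i = i0 and n = n] uniq unfolding T_def by blast
    \<comment> \<open>The relative position of \<open>v\<close> in its cell. The offsets keep it
      strictly inside, so \<open>v\<close> lies to the left of all four sides, as the winding number
      argument requires.\<close>
    define s' where "s' = cs v - (fst i0 - \<phi>1)"
    define t' where "t' = ct v - (snd i0 - \<phi>2)"
    have st: "0 < s'" "s' < 1" "0 < t'" "t' < 1"
      using \<phi>1(2)[of "fst i0"] \<phi>2(2)[of "snd i0"] unfolding s'_def t'_def i0_def by (simp_all add: abs_if split: if_splits) linarith+
    have v: "v = q i0 + (of_real s' * \<alpha> + of_real t' * \<beta>)"
      using cs_ct[of v] by (simp add: q_def lpt_def s'_def t'_def algebra_simps)
    have vCe: "v \<in> Ce i0" using st by (simp add: Ce_def s'_def t'_def)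
    obtain w where w: "norm w \<ge> 1" "quad_integral (\<lambda>\<xi>. h \<xi> / (\<xi> - v)) (q i0) (q i0 + \<alpha>) (q i0 + \<alpha> + \<beta>) (q i0 + \<beta>) = 2 * pi * \<i> * w * h v"
    proof (rule quad_integral_cauchy_formula[OF h(1) Sb(2,1)])
      have W: "Im (cnj \<alpha> * \<beta>) = Re \<alpha> * Im \<beta> - Im \<alpha> * Re \<beta>" by simp
      have "Im ((q i0 + \<alpha> - q i0) * cnj (q i0 - v)) = t' * Im (cnj \<alpha> * \<beta>)"
        "Im ((q i0 + \<alpha> + \<beta> - (q i0 + \<alpha>)) * cnj (q i0 + \<alpha> - v)) = (1 - s') * Im (cnj \<alpha> * \<beta>)"
        "Im ((q i0 + \<beta> - (q i0 + \<alpha> + \<beta>)) * cnj (q i0 + \<alpha> + \<beta> - v)) = (1 - t') * Im (cnj \<alpha> * \<beta>)"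
        "Im ((q i0 - (q i0 + \<beta>)) * cnj (q i0 + \<beta> - v)) = s' * Im (cnj \<alpha> * \<beta>)"
        unfolding v W by (simp_all add: algebra_simps)
      thus "Im ((q i0 + \<alpha> - q i0) * cnj (q i0 - v)) > 0"
        "Im ((q i0 + \<alpha> + \<beta> - (q i0 + \<alpha>)) * cnj (q i0 + \<alpha> - v)) > 0"
        "Im ((q i0 + \<beta> - (q i0 + \<alpha> + \<beta>)) * cnj (q i0 + \<alpha> + \<beta> - v)) > 0"
        "Im ((q i0 - (q i0 + \<beta>)) * cnj (q i0 + \<beta> - v)) > 0"
        using st V by (simp_all only: mult_pos_pos diff_gt_0_iff_gt)
    qed (use cornersCe[of i0] CeSb[of i0] vCe that in auto)
    have hv: "Q f i0 = Q (fT i0) i0 + 2 * pi * \<i> * w * h v" using QU[OF h(2)] w(2) by (simp add: diff_eq_eq add.commute)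
    let ?c = "2 * pi * \<i> * w * h v"
    \<comment> \<open>Only one cell carries a residue, and the cell integrals of \<open>f\<close>
      sum to zero. Hence the integrals of the jet polynomials sum to minus that residue and control
      it.\<close>
    have QTeq: "Q (fT i) i = Q f i - indicator {i0} i *\<^sub>R ?c" for i
      using QJ[of i] hv by (cases "i = i0") auto
    have ind: "integrable (count_space UNIV) (\<lambda>i. indicator {i0} i *\<^sub>R ?c)" "(\<integral>i. indicator {i0} i *\<^sub>R ?c \<partial>count_space UNIV) = ?c"
      by (auto simp: measure_def intro!: integrable_real_indicator)
    have "(\<integral>i. Q (fT i) i \<partial>count_space UNIV) = - ?c" and QTi: "integrable (count_space UNIV) (\<lambda>i. Q (fT i) i)"
      unfolding QTeq using ind J by simp_all
    hence "norm ?c \<le> (\<integral>i. norm (Q (fT i) i) \<partial>count_space UNIV)"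
      using integral_norm_bound[of "count_space UNIV" "\<lambda>i. Q (fT i) i"] by simp
    moreover have "norm (h v) \<le> norm ?c"
    proof -
      have "1 * 1 \<le> (2 * pi) * norm w" using w(1) pi_gt3 by (intro mult_mono) auto
      hence "1 * norm (h v) \<le> (2 * pi) * norm w * norm (h v)" by (intro mult_right_mono) auto
      thus ?thesis by (simp add: norm_mult)
    qed
    ultimately have "ennreal (norm (h v)) \<le> ennreal (\<integral>i. norm (Q (fT i) i) \<partial>count_space UNIV)" by (intro ennreal_leI) linarith
    also have "\<dots> = (\<integral>\<^sup>+i. ennreal (norm (Q (fT i) i)) \<partial>count_space UNIV)"
      using QTi by (intro nn_integral_eq_integral[symmetric]) auto
    also have "\<dots> \<le> (\<integral>\<^sup>+i. ennreal K * ennreal (D i) \<partial>count_space UNIV)"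
      using QT D0 K by (intro nn_integral_mono) (simp add: ennreal_mult[symmetric] ennreal_leI)
    also have "\<dots> = ennreal K * (\<integral>\<^sup>+i. ennreal (D i) \<partial>count_space UNIV)" by (rule nn_integral_cmult) simp
    finally have hbound: "ennreal (norm (h v)) \<le> ennreal K * (\<integral>\<^sup>+i. ennreal (D i) \<partial>count_space UNIV)" .
    \<comment> \<open>At \<xi> = v the weight of \<open>g\<close> is the full surplus exp
      (\<open>\<epsilon>0\<close> |v|^2), which is exactly what separates the power of \<sigma> from
      the Fock weight; only the bounded periodic modulus remains.\<close>
    have UT: "norm (U v - T i0 v) * exp (- pi * (norm v)\<^sup>2 / 2) = norm (h v) * per v ^ n"
    proof -
      have "norm (U v - T i0 v) * norm (g v) = norm (h v) * norm (\<sigma> v) ^ n"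
        using h(2)[of v] vCe CeSb by (metis norm_mult norm_power subsetD)
      moreover have "norm (g v) = exp (\<epsilon>0 * (norm v)\<^sup>2)" by (simp add: ng)
      moreover have "norm (\<sigma> v) ^ n = per v ^ n * exp (n * (\<kappa> * (norm v)\<^sup>2))"
        by (simp add: norm_sigma power_mult_distrib flip: exp_of_nat_mult)
      moreover have "exp (n * (\<kappa> * (norm v)\<^sup>2)) = exp (\<epsilon>0 * (norm v)\<^sup>2) * exp (pi * (norm v)\<^sup>2 / 2)"
        unfolding exp_add[symmetric] by (simp add: \<epsilon>0_def algebra_simps)
      ultimately have "norm (U v - T i0 v) = norm (h v) * per v ^ n * exp (pi * (norm v)\<^sup>2 / 2)"
        by simp
      thus ?thesis by (simp add: exp_minus)
    qed
    have Tb: "norm (T i0 v) * exp (- pi * (norm v)\<^sup>2 / 2) \<le> (1 + d) ^ n * exp (\<epsilon> * d\<^sup>2) * D i0"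
    proof -
      have "norm (T i0 v) * exp (- pi * (norm v)\<^sup>2 / 2) \<le> ((1 + d) ^ n * exp (pi * (norm v)\<^sup>2 / 2) * (\<Sum>k<n. norm (cjet U (lpt \<alpha> \<beta> i0) k))) * exp (- pi * (norm v)\<^sup>2 / 2)"
        unfolding T_def by (intro mult_right_mono norm_cjet_poly_le Ce_d vCe) auto
      also have "\<dots> = (1 + d) ^ n * (\<Sum>k<n. norm (cjet U (lpt \<alpha> \<beta> i0) k)) * 1" by (simp add: exp_minus)
      also have "\<dots> \<le> (1 + d) ^ n * (\<Sum>k<n. norm (cjet U (lpt \<alpha> \<beta> i0) k)) * (exp (\<epsilon> * d\<^sup>2) * exp (- \<epsilon> * (norm (v - lpt \<alpha> \<beta> i0))\<^sup>2))"
      proof (intro mult_left_mono)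
        have "(norm (v - lpt \<alpha> \<beta> i0))\<^sup>2 \<le> d\<^sup>2" using Ce_d[OF vCe] by (intro power_mono) auto
        hence "\<epsilon> * (norm (v - lpt \<alpha> \<beta> i0))\<^sup>2 \<le> \<epsilon> * d\<^sup>2" using \<epsilon>0 by (intro mult_left_mono) (auto simp: \<epsilon>_def)
        thus "1 \<le> exp (\<epsilon> * d\<^sup>2) * exp (- \<epsilon> * (norm (v - lpt \<alpha> \<beta> i0))\<^sup>2)" by (simp flip: exp_add)
      qed (use d in \<open>auto intro!: mult_nonneg_nonneg sum_nonneg\<close>)
      finally show ?thesis by (simp add: D_def mult_ac)
    qed
    have "norm (U v) * exp (- pi * (norm v)\<^sup>2 / 2) \<le> (norm (T i0 v) + norm (U v - T i0 v)) * exp (- pi * (norm v)\<^sup>2 / 2)"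
      using norm_triangle_ineq[of "T i0 v" "U v - T i0 v"] by (intro mult_right_mono) auto
    also have "\<dots> \<le> (1 + d) ^ n * exp (\<epsilon> * d\<^sup>2) * D i0 + P ^ n * norm (h v)"
    proof -
      have "norm (h v) * per v ^ n \<le> norm (h v) * P ^ n"
        by (intro mult_left_mono power_mono P) (auto simp: per_def)
      thus ?thesis using Tb UT by (simp add: distrib_right mult.commute)
    qed
    finally have "ennreal (norm (U v) * exp (- pi * (norm v)\<^sup>2 / 2)) \<le> ennreal ((1 + d) ^ n * exp (\<epsilon> * d\<^sup>2) * D i0 + P ^ n * norm (h v))"
      by (rule ennreal_leI)
    also have "\<dots> = ennreal ((1 + d) ^ n * exp (\<epsilon> * d\<^sup>2)) * ennreal (D i0) + ennreal (P ^ n) * ennreal (norm (h v))"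
      using d D0 P by (simp add: ennreal_plus ennreal_mult)
    also have "\<dots> \<le> ennreal ((1 + d) ^ n * exp (\<epsilon> * d\<^sup>2)) * (\<integral>\<^sup>+i. ennreal (D i) \<partial>count_space UNIV) + ennreal (P ^ n) * (ennreal K * (\<integral>\<^sup>+i. ennreal (D i) \<partial>count_space UNIV))"
      by (intro add_mono mult_left_mono hbound nn_integral_ge_point) auto
    also have "\<dots> = ennreal C * (\<integral>\<^sup>+i. ennreal (D i) \<partial>count_space UNIV)"
      using d P K by (simp add: C_def ennreal_plus ennreal_mult distrib_right mult.assoc)
    finally show ?thesis unfolding D_def .
  qed
  moreover have "\<epsilon> > 0" using \<epsilon>0 by (simp add: \<epsilon>_def)
  ultimately show thesis using that C by blast
qed

end

section \<open>Integration over the plane by periodisation\<close>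

lemma measurable_pair_continuous:
  fixes f :: "real \<times> real \<Rightarrow> 'b :: topological_space"
  shows "continuous_on UNIV f \<Longrightarrow> f \<in> borel_measurable (lborel \<Otimes>\<^sub>M lborel)"
  by (simp add: lborel_prod borel_measurable_continuous_onI)

lemma lborel_complex_eq: "lborel = distr (lborel \<Otimes>\<^sub>M lborel) borel (\<lambda>(x, y). Complex x y)"
proof (rule lborel_eqI)
  have meas: "(\<lambda>(x, y). Complex x y) \<in> borel_measurable (lborel \<Otimes>\<^sub>M lborel)"
    unfolding case_prod_unfold Complex_eq by (intro measurable_pair_continuous continuous_intros)
  show "sets (distr (lborel \<Otimes>\<^sub>M lborel) borel (\<lambda>(x, y). Complex x y)) = sets borel" by simp
  fix l u :: complex
  assume le: "\<And>b. b \<in> Basis \<Longrightarrow> l \<bullet> b \<le> u \<bullet> b"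
  have le': "Re l \<le> Re u" "Im l \<le> Im u" using le[of 1] le[of \<i>] by (auto simp: Basis_complex_def inner_complex_def)
  have "(\<lambda>(x, y). Complex x y) -` box l u = {Re l<..<Re u} \<times> {Im l<..<Im u}"
    by (auto simp: box_def Basis_complex_def inner_complex_def)
  hence "emeasure (distr (lborel \<Otimes>\<^sub>M lborel) borel (\<lambda>(x, y). Complex x y)) (box l u) = emeasure (lborel \<Otimes>\<^sub>M lborel) ({Re l<..<Re u} \<times> {Im l<..<Im u})"
    by (subst emeasure_distr[OF meas]) (auto simp: space_pair_measure)
  also have "\<dots> = emeasure lborel {Re l<..<Re u} * emeasure lborel {Im l<..<Im u}"
    by (rule lborel.emeasure_pair_measure_Times) auto
  also have "\<dots> = ennreal ((Re u - Re l) * (Im u - Im l))" using le' by (simp add: ennreal_mult)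
  also have "(Re u - Re l) * (Im u - Im l) = (\<Prod>b\<in>Basis. (u - l) \<bullet> b)"
    by (simp add: Basis_complex_def inner_complex_def)
  finally show "emeasure (distr (lborel \<Otimes>\<^sub>M lborel) borel (\<lambda>(x, y). Complex x y)) (box l u) = ennreal (\<Prod>b\<in>Basis. (u - l) \<bullet> b)" .
qed

lemma nn_integral_complex:
  assumes [measurable]: "g \<in> borel_measurable borel"
  shows "(\<integral>\<^sup>+z. g z \<partial>lborel) = (\<integral>\<^sup>+x. \<integral>\<^sup>+y. g (Complex x y) \<partial>lborel \<partial>lborel)"
proof -
  have [measurable]: "(\<lambda>(x, y). Complex x y) \<in> borel_measurable (lborel \<Otimes>\<^sub>M lborel)"
    unfolding case_prod_unfold Complex_eq by (intro measurable_pair_continuous continuous_intros)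
  have "(\<integral>\<^sup>+z. g z \<partial>lborel) = (\<integral>\<^sup>+p. g (case p of (x, y) \<Rightarrow> Complex x y) \<partial>(lborel \<Otimes>\<^sub>M lborel))"
    by (subst lborel_complex_eq, subst nn_integral_distr) auto
  also have "\<dots> = (\<integral>\<^sup>+x. \<integral>\<^sup>+y. g (Complex x y) \<partial>lborel \<partial>lborel)"
    by (subst lborel.nn_integral_fst[symmetric]) auto
  finally show ?thesis .
qed

lemma measurable_combination [measurable]:
  fixes \<alpha> \<beta> :: complex
  shows "(\<lambda>(s, t). of_real s * \<alpha> + of_real t * \<beta>) \<in> borel_measurable (lborel \<Otimes>\<^sub>M lborel)"
  unfolding case_prod_unfold by (intro measurable_pair_continuous continuous_intros)

text \<open>The linear substitution is done as two one-dimensional affine ones, first along the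
  imaginary and then along the real direction, with factors |v / Re \<alpha>| and |Re \<alpha>|.
  This shearing needs Re \<alpha> nonzero; otherwise the generators change roles.\<close>

lemma nn_integral_complex_basis_aux:
  assumes [measurable]: "g \<in> borel_measurable borel" and V: "Im (cnj \<alpha> * \<beta>) \<noteq> 0" and a: "Re \<alpha> \<noteq> 0"
  shows "(\<integral>\<^sup>+z. g z \<partial>lborel) = ennreal \<bar>Im (cnj \<alpha> * \<beta>)\<bar> * (\<integral>\<^sup>+t. \<integral>\<^sup>+s. g (of_real s * \<alpha> + of_real t * \<beta>) \<partial>lborel \<partial>lborel)"
proof -
  define v where "v = Im (cnj \<alpha> * \<beta>)"
  have v: "v = Re \<alpha> * Im \<beta> - Im \<alpha> * Re \<beta>" by (simp add: v_def)
  have v0: "v \<noteq> 0" unfolding v_def by (rule V)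
  have [measurable]: "(\<lambda>(x, t). Complex x (Im \<alpha> / Re \<alpha> * x + v / Re \<alpha> * t)) \<in> borel_measurable (lborel \<Otimes>\<^sub>M lborel)"
    unfolding case_prod_unfold Complex_eq by (intro measurable_pair_continuous continuous_intros)
  have Cm [measurable]: "(\<lambda>y. Complex x y) \<in> borel_measurable borel" "(\<lambda>y. Complex y (f y)) \<in> borel_measurable borel"
    if "f \<in> borel_measurable borel" for x and f :: "real \<Rightarrow> real"
    using that by (simp_all add: Complex_eq)
  have "(\<integral>\<^sup>+z. g z \<partial>lborel) = (\<integral>\<^sup>+x. \<integral>\<^sup>+y. g (Complex x y) \<partial>lborel \<partial>lborel)"
    by (rule nn_integral_complex) simp
  also have "\<dots> = (\<integral>\<^sup>+x. ennreal \<bar>v / Re \<alpha>\<bar> * (\<integral>\<^sup>+t. g (Complex x (Im \<alpha> / Re \<alpha> * x + v / Re \<alpha> * t)) \<partial>lborel) \<partial>lborel)"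
    using a v0 by (intro nn_integral_cong nn_integral_real_affine) (auto intro!: measurable_compose[OF Cm(1)[OF borel_measurable_const]])
  also have "\<dots> = ennreal \<bar>v / Re \<alpha>\<bar> * (\<integral>\<^sup>+x. \<integral>\<^sup>+t. g (Complex x (Im \<alpha> / Re \<alpha> * x + v / Re \<alpha> * t)) \<partial>lborel \<partial>lborel)"
    by (rule nn_integral_cmult) measurable
  also have "(\<integral>\<^sup>+x. \<integral>\<^sup>+t. g (Complex x (Im \<alpha> / Re \<alpha> * x + v / Re \<alpha> * t)) \<partial>lborel \<partial>lborel) = (\<integral>\<^sup>+t. \<integral>\<^sup>+x. g (Complex x (Im \<alpha> / Re \<alpha> * x + v / Re \<alpha> * t)) \<partial>lborel \<partial>lborel)"
    by (rule lborel_pair.Fubini'[symmetric]) measurable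
  also have "\<dots> = (\<integral>\<^sup>+t. ennreal \<bar>Re \<alpha>\<bar> * (\<integral>\<^sup>+s. g (of_real s * \<alpha> + of_real t * \<beta>) \<partial>lborel) \<partial>lborel)"
  proof (rule nn_integral_cong)
    fix t :: real
    have m: "(\<lambda>x. g (Complex x (Im \<alpha> / Re \<alpha> * x + v / Re \<alpha> * t))) \<in> borel_measurable borel"
      by (rule measurable_compose[OF Cm(2)]) auto
    have "(\<integral>\<^sup>+x. g (Complex x (Im \<alpha> / Re \<alpha> * x + v / Re \<alpha> * t)) \<partial>lborel)
       = ennreal \<bar>Re \<alpha>\<bar> * (\<integral>\<^sup>+s. g (Complex (Re \<beta> * t + Re \<alpha> * s) (Im \<alpha> / Re \<alpha> * (Re \<beta> * t + Re \<alpha> * s) + v / Re \<alpha> * t)) \<partial>lborel)"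
      by (rule nn_integral_real_affine[OF m a])
    also have "\<dots> = ennreal \<bar>Re \<alpha>\<bar> * (\<integral>\<^sup>+s. g (of_real s * \<alpha> + of_real t * \<beta>) \<partial>lborel)"
    proof -
      have "Complex (Re \<beta> * t + Re \<alpha> * s) (Im \<alpha> / Re \<alpha> * (Re \<beta> * t + Re \<alpha> * s) + v / Re \<alpha> * t) = of_real s * \<alpha> + of_real t * \<beta>" for s
        using a by (simp add: complex_eq_iff v field_simps)
      thus ?thesis by simp
    qed
    finally show "(\<integral>\<^sup>+x. g (Complex x (Im \<alpha> / Re \<alpha> * x + v / Re \<alpha> * t)) \<partial>lborel) = ennreal \<bar>Re \<alpha>\<bar> * (\<integral>\<^sup>+s. g (of_real s * \<alpha> + of_real t * \<beta>) \<partial>lborel)" .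
  qed
  also have "\<dots> = ennreal \<bar>Re \<alpha>\<bar> * (\<integral>\<^sup>+t. \<integral>\<^sup>+s. g (of_real s * \<alpha> + of_real t * \<beta>) \<partial>lborel \<partial>lborel)"
    by (rule nn_integral_cmult) measurable
  finally have "(\<integral>\<^sup>+z. g z \<partial>lborel) = (ennreal \<bar>v / Re \<alpha>\<bar> * ennreal \<bar>Re \<alpha>\<bar>) * (\<integral>\<^sup>+t. \<integral>\<^sup>+s. g (of_real s * \<alpha> + of_real t * \<beta>) \<partial>lborel \<partial>lborel)"
    by (simp add: mult.assoc)
  also have "ennreal \<bar>v / Re \<alpha>\<bar> * ennreal \<bar>Re \<alpha>\<bar> = ennreal \<bar>v\<bar>" using a by (simp add: abs_divide flip: ennreal_mult)
  finally show ?thesis by (simp add: v_def)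
qed

lemma nn_integral_complex_basis:
  assumes g [measurable]: "g \<in> borel_measurable borel" and V: "Im (cnj \<alpha> * \<beta>) \<noteq> 0"
  shows "(\<integral>\<^sup>+z. g z \<partial>lborel) = ennreal \<bar>Im (cnj \<alpha> * \<beta>)\<bar> * (\<integral>\<^sup>+p. g (of_real (fst p) * \<alpha> + of_real (snd p) * \<beta>) \<partial>(lborel \<Otimes>\<^sub>M lborel))"
proof -
  have m: "(\<lambda>p. g (of_real (fst p) * \<alpha> + of_real (snd p) * \<beta>)) \<in> borel_measurable (lborel \<Otimes>\<^sub>M lborel)"
    by (rule measurable_compose[OF measurable_combination[unfolded case_prod_unfold] g])
  have ts: "(\<integral>\<^sup>+t. \<integral>\<^sup>+s. g (of_real s * \<alpha> + of_real t * \<beta>) \<partial>lborel \<partial>lborel) = (\<integral>\<^sup>+p. g (of_real (fst p) * \<alpha> + of_real (snd p) * \<beta>) \<partial>(lborel \<Otimes>\<^sub>M lborel))"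
    using lborel_pair.nn_integral_snd[OF m] by simp
  have st: "(\<integral>\<^sup>+s. \<integral>\<^sup>+t. g (of_real s * \<alpha> + of_real t * \<beta>) \<partial>lborel \<partial>lborel) = (\<integral>\<^sup>+p. g (of_real (fst p) * \<alpha> + of_real (snd p) * \<beta>) \<partial>(lborel \<Otimes>\<^sub>M lborel))"
    using lborel.nn_integral_fst[OF m] by simp
  show ?thesis
  proof (cases "Re \<alpha> = 0")
    case False
    show ?thesis using nn_integral_complex_basis_aux[OF g V False] unfolding ts .
  next
    case True
    hence b: "Re \<beta> \<noteq> 0" using V by auto
    have e: "Im (cnj \<beta> * \<alpha>) = - Im (cnj \<alpha> * \<beta>)" by simp
    have "(\<integral>\<^sup>+z. g z \<partial>lborel) = ennreal \<bar>Im (cnj \<beta> * \<alpha>)\<bar> * (\<integral>\<^sup>+t. \<integral>\<^sup>+s. g (of_real s * \<beta> + of_real t * \<alpha>) \<partial>lborel \<partial>lborel)"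
    proof (rule nn_integral_complex_basis_aux[OF g _ b])
      show "Im (cnj \<beta> * \<alpha>) \<noteq> 0" unfolding e using V by (simp only: neg_equal_0_iff_equal not_False_eq_True)
    qed
    moreover have "\<bar>Im (cnj \<beta> * \<alpha>)\<bar> = \<bar>Im (cnj \<alpha> * \<beta>)\<bar>" unfolding e by (rule abs_minus_cancel)
    ultimately show ?thesis unfolding st[symmetric] by (simp only: add.commute)
  qed
qed

text \<open>The half-open square is used because its integer translates tile the plane without
  overlap; as a density of the product measure it inherits Fubini.\<close>

definition unit_square :: "(real \<times> real) measure" where
  "unit_square = density (lborel \<Otimes>\<^sub>M lborel) (indicator ({0..<1} \<times> {0..<1}))"

lemma sets_unit_square [simp, measurable_cong]: "sets unit_square = sets borel"
  by (simp add: unit_square_def lborel_prod)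

lemma measurable_unit_square [simp]: "measurable unit_square N = measurable borel N"
  by (rule measurable_cong_sets) simp_all

lemma space_unit_square [simp]: "space unit_square = UNIV"
  by (simp add: unit_square_def lborel_prod)

lemma emeasure_unit_square: "emeasure unit_square UNIV = 1"
proof -
  have "emeasure unit_square UNIV = emeasure (lborel \<Otimes>\<^sub>M lborel) ({0..<1} \<times> {0..<1} :: (real \<times> real) set)"
    unfolding unit_square_def using sets.top[of "lborel \<Otimes>\<^sub>M lborel :: (real \<times> real) measure"]
    by (subst emeasure_density) (auto simp: space_pair_measure)
  also have "\<dots> = emeasure lborel {0..<1::real} * emeasure lborel {0..<1::real}"
    by (rule lborel.emeasure_pair_measure_Times) auto
  finally show ?thesis by simp
qed

interpretation unit_square: prob_space unit_square
  by (rule prob_spaceI) (simp add: emeasure_unit_square)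

interpretation lattice_count: sigma_finite_measure "count_space (UNIV :: (int \<times> int) set)"
  by (rule sigma_finite_measure_count_space_countable) simp

interpretation square_lattice: pair_sigma_finite unit_square "count_space (UNIV :: (int \<times> int) set)" ..

text \<open>The translates of the indicator of [0, 1) form a partition of unity on the line;
  inserting it and translating each piece back gives the periodisation.\<close>

lemma nn_integral_unfold_1:
  fixes f :: "real \<Rightarrow> ennreal"
  assumes [measurable]: "f \<in> borel_measurable borel"
  shows "(\<integral>\<^sup>+s. f s \<partial>lborel) = (\<integral>\<^sup>+k. \<integral>\<^sup>+s. f (s + of_int k) * indicator {0..<1} s \<partial>lborel \<partial>count_space (UNIV :: int set))"
proof -
  have one: "(\<integral>\<^sup>+k. indicator {0..<1} (s - real_of_int k) \<partial>count_space (UNIV :: int set)) = (1 :: ennreal)" for s :: real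
  proof -
    have "indicator {0..<1} (s - real_of_int k) = (indicator {\<lfloor>s\<rfloor>} k :: ennreal)" for k :: int
      by (auto simp: indicator_def floor_eq_iff) linarith+
    thus ?thesis by simp
  qed
  have "(\<integral>\<^sup>+s. f s \<partial>lborel) = (\<integral>\<^sup>+s. \<integral>\<^sup>+k. f s * indicator {0..<1} (s - real_of_int k) \<partial>count_space (UNIV :: int set) \<partial>lborel)"
    by (subst nn_integral_cmult) (simp_all add: one)
  also have "\<dots> = (\<integral>\<^sup>+k. \<integral>\<^sup>+s. f s * indicator {0..<1} (s - real_of_int k) \<partial>lborel \<partial>count_space (UNIV :: int set))"
    by (rule nn_integral_count_space_nn_integral) auto
  also have "\<dots> = (\<integral>\<^sup>+k. \<integral>\<^sup>+s. f (s + of_int k) * indicator {0..<1} s \<partial>lborel \<partial>count_space (UNIV :: int set))"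
  proof (rule nn_integral_cong)
    fix k :: int
    show "(\<integral>\<^sup>+s. f s * indicator {0..<1} (s - real_of_int k) \<partial>lborel) = (\<integral>\<^sup>+s. f (s + of_int k) * indicator {0..<1} s \<partial>lborel)"
      by (subst nn_integral_real_affine[where c = 1 and t = "of_int k"]) (auto simp: add.commute)
  qed
  finally show ?thesis .
qed

lemma nn_integral_unfold_2:
  fixes f :: "real \<times> real \<Rightarrow> ennreal"
  assumes f [measurable]: "f \<in> borel_measurable borel"
  shows "(\<integral>\<^sup>+p. f p \<partial>(lborel \<Otimes>\<^sub>M lborel)) = (\<integral>\<^sup>+p. \<integral>\<^sup>+i. f (fst p + of_int (fst i), snd p + of_int (snd i)) \<partial>count_space (UNIV :: (int \<times> int) set) \<partial>unit_square)"
proof -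
  let ?I = "indicator {0..<1::real} :: real \<Rightarrow> ennreal"
  have fm [measurable]: "f \<in> borel_measurable (lborel \<Otimes>\<^sub>M lborel)" by (simp add: lborel_prod)
  have sh [measurable]: "(\<lambda>p. (fst p + a, snd p + b)) \<in> borel_measurable (lborel \<Otimes>\<^sub>M lborel)" for a b :: real
    by (intro measurable_pair_continuous continuous_intros)
  have fs [measurable]: "(\<lambda>p. f (fst p + a, snd p + b)) \<in> borel_measurable (lborel \<Otimes>\<^sub>M lborel)" for a b :: real
    by (rule measurable_compose[OF sh f])
  have f1 [measurable]: "(\<lambda>t. f (s, t)) \<in> borel_measurable borel" for s
    by (rule measurable_compose[OF _ f]) simp
  have "(\<integral>\<^sup>+p. f p \<partial>(lborel \<Otimes>\<^sub>M lborel)) = (\<integral>\<^sup>+s. \<integral>\<^sup>+t. f (s, t) \<partial>lborel \<partial>lborel)"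
    by (subst lborel.nn_integral_fst[symmetric]) auto
  also have "\<dots> = (\<integral>\<^sup>+a. \<integral>\<^sup>+s. (\<integral>\<^sup>+t. f (s + of_int a, t) \<partial>lborel) * ?I s \<partial>lborel \<partial>count_space (UNIV :: int set))"
    by (rule nn_integral_unfold_1) (use lborel.borel_measurable_nn_integral_fst[OF fm] in simp)
  also have "\<dots> = (\<integral>\<^sup>+a. \<integral>\<^sup>+s. (\<integral>\<^sup>+b. \<integral>\<^sup>+t. f (s + of_int a, t + of_int b) * ?I t \<partial>lborel \<partial>count_space (UNIV :: int set)) * ?I s \<partial>lborel \<partial>count_space (UNIV :: int set))"
    by (subst nn_integral_unfold_1) auto
  also have "\<dots> = (\<integral>\<^sup>+a. \<integral>\<^sup>+s. \<integral>\<^sup>+b. (\<integral>\<^sup>+t. f (s + of_int a, t + of_int b) * (?I s * ?I t) \<partial>lborel) \<partial>count_space (UNIV :: int set) \<partial>lborel \<partial>count_space (UNIV :: int set))"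
    by (intro nn_integral_cong) (simp add: indicator_def)
  also have "\<dots> = (\<integral>\<^sup>+a. \<integral>\<^sup>+b. \<integral>\<^sup>+s. (\<integral>\<^sup>+t. f (s + of_int a, t + of_int b) * (?I s * ?I t) \<partial>lborel) \<partial>lborel \<partial>count_space (UNIV :: int set) \<partial>count_space (UNIV :: int set))"
    by (intro nn_integral_cong nn_integral_count_space_nn_integral) measurable
  also have "\<dots> = (\<integral>\<^sup>+i. \<integral>\<^sup>+s. (\<integral>\<^sup>+t. f (s + of_int (fst i), t + of_int (snd i)) * (?I s * ?I t) \<partial>lborel) \<partial>lborel \<partial>count_space (UNIV :: (int \<times> int) set))"
    by (subst nn_integral_fst_count_space[symmetric]) simp
  also have "\<dots> = (\<integral>\<^sup>+i. \<integral>\<^sup>+p. f (fst p + of_int (fst i), snd p + of_int (snd i)) \<partial>unit_square \<partial>count_space (UNIV :: (int \<times> int) set))"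
  proof (rule nn_integral_cong)
    fix i :: "int \<times> int"
    have "(\<integral>\<^sup>+p. f (fst p + of_int (fst i), snd p + of_int (snd i)) \<partial>unit_square)
       = (\<integral>\<^sup>+p. indicator ({0..<1} \<times> {0..<1}) p * f (fst p + of_int (fst i), snd p + of_int (snd i)) \<partial>(lborel \<Otimes>\<^sub>M lborel))"
      unfolding unit_square_def by (rule nn_integral_density) (auto intro!: borel_measurable_indicator pair_measureI fs)
    also have "\<dots> = (\<integral>\<^sup>+s. \<integral>\<^sup>+t. indicator ({0..<1} \<times> {0..<1}) (s, t) * f (s + of_int (fst i), t + of_int (snd i)) \<partial>lborel \<partial>lborel)"
      by (subst lborel.nn_integral_fst[symmetric]) (auto intro!: borel_measurable_times borel_measurable_indicator pair_measureI fs)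
    also have "\<dots> = (\<integral>\<^sup>+s. (\<integral>\<^sup>+t. f (s + of_int (fst i), t + of_int (snd i)) * (?I s * ?I t) \<partial>lborel) \<partial>lborel)"
      by (simp add: indicator_times mult.commute)
    finally show "(\<integral>\<^sup>+s. (\<integral>\<^sup>+t. f (s + of_int (fst i), t + of_int (snd i)) * (?I s * ?I t) \<partial>lborel) \<partial>lborel) = (\<integral>\<^sup>+p. f (fst p + of_int (fst i), snd p + of_int (snd i)) \<partial>unit_square)" by simp
  qed
  also have "\<dots> = (\<integral>\<^sup>+p. \<integral>\<^sup>+i. f (fst p + of_int (fst i), snd p + of_int (snd i)) \<partial>count_space (UNIV :: (int \<times> int) set) \<partial>unit_square)"
    by (rule nn_integral_count_space_nn_integral[symmetric]) (auto intro!: measurable_compose[OF borel_measurable_continuous_onI f] continuous_intros)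
  finally show ?thesis .
qed

lemma nn_integral_complex_unfold:
  assumes g [measurable]: "g \<in> borel_measurable borel" and V: "Im (cnj \<alpha> * \<beta>) \<noteq> 0"
  shows "(\<integral>\<^sup>+z. g z \<partial>lborel) = ennreal \<bar>Im (cnj \<alpha> * \<beta>)\<bar> *
    (\<integral>\<^sup>+p. \<integral>\<^sup>+i. g (of_real (fst p) * \<alpha> + of_real (snd p) * \<beta> + lpt \<alpha> \<beta> i) \<partial>count_space UNIV \<partial>unit_square)"
proof -
  have m: "(\<lambda>p. g (of_real (fst p) * \<alpha> + of_real (snd p) * \<beta>)) \<in> borel_measurable borel"
    by (intro measurable_compose[OF _ g] borel_measurable_continuous_onI continuous_intros)
  show ?thesis
    unfolding nn_integral_complex_basis[OF g V]
    by (subst nn_integral_unfold_2[OF m]) (simp add: lpt_def algebra_simps)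
qed

text \<open>Stated as an identity of measures, unfolding also becomes available for Bochner
  integrals of complex functions, through \<open>integral_density\<close> and
  \<open>integral_distr\<close>.\<close>

lemma lborel_complex_unfold:
  assumes V: "Im (cnj \<alpha> * \<beta>) \<noteq> 0"
  shows "lborel = density (distr (unit_square \<Otimes>\<^sub>M count_space (UNIV :: (int \<times> int) set)) borel
    (\<lambda>(p, i). of_real (fst p) * \<alpha> + of_real (snd p) * \<beta> + lpt \<alpha> \<beta> i)) (\<lambda>_. ennreal \<bar>Im (cnj \<alpha> * \<beta>)\<bar>)" (is "_ = density (distr ?M borel ?T) _")
proof (rule measure_eqI)
  have T [measurable]: "?T \<in> borel_measurable ?M"
  proof -
    have "(\<lambda>x. of_real (fst (fst x)) * \<alpha> + of_real (snd (fst x)) * \<beta> + lpt \<alpha> \<beta> (snd x)) \<in> borel_measurable ?M"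
    proof (intro borel_measurable_add borel_measurable_times borel_measurable_const)
      have f: "(\<lambda>x. fst x :: real \<times> real) \<in> borel_measurable ?M"
        using measurable_fst[of unit_square "count_space UNIV"] measurable_cong_sets[OF refl sets_unit_square] by blast
      have "(\<lambda>p :: real \<times> real. complex_of_real (fst p)) \<in> borel_measurable borel" "(\<lambda>p :: real \<times> real. complex_of_real (snd p)) \<in> borel_measurable borel"
        by (intro borel_measurable_continuous_onI continuous_intros)+
      from this[THEN measurable_compose[OF f]]
      show "(\<lambda>x. complex_of_real (fst (fst x))) \<in> borel_measurable ?M" "(\<lambda>x. complex_of_real (snd (fst x))) \<in> borel_measurable ?M" .
      show "(\<lambda>x. lpt \<alpha> \<beta> (snd x)) \<in> borel_measurable ?M" by measurable
    qed
    thus ?thesis by (simp add: case_prod_unfold)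
  qed
  show "sets lborel = sets (density (distr ?M borel ?T) (\<lambda>_. ennreal \<bar>Im (cnj \<alpha> * \<beta>)\<bar>))" by simp
  fix A :: "complex set" assume "A \<in> sets lborel"
  hence A [measurable]: "A \<in> sets borel" by simp
  have "emeasure lborel A = (\<integral>\<^sup>+z. indicator A z \<partial>lborel)" by simp
  also have "\<dots> = ennreal \<bar>Im (cnj \<alpha> * \<beta>)\<bar> *
    (\<integral>\<^sup>+p. \<integral>\<^sup>+i. indicator A (of_real (fst p) * \<alpha> + of_real (snd p) * \<beta> + lpt \<alpha> \<beta> i) \<partial>count_space UNIV \<partial>unit_square)"
    by (rule nn_integral_complex_unfold[OF _ V]) simp
  also have "(\<integral>\<^sup>+p. \<integral>\<^sup>+i. indicator A (of_real (fst p) * \<alpha> + of_real (snd p) * \<beta> + lpt \<alpha> \<beta> i) \<partial>count_space UNIV \<partial>unit_square)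
     = (\<integral>\<^sup>+x. indicator A (?T x) \<partial>?M)"
    by (subst lattice_count.nn_integral_fst[symmetric]) auto
  also have "ennreal \<bar>Im (cnj \<alpha> * \<beta>)\<bar> * (\<integral>\<^sup>+x. indicator A (?T x) \<partial>?M) = emeasure (density (distr ?M borel ?T) (\<lambda>_. ennreal \<bar>Im (cnj \<alpha> * \<beta>)\<bar>)) A"
  proof -
    have "(\<integral>\<^sup>+x. indicator A (?T x) \<partial>?M) = emeasure (distr ?M borel ?T) A"
      using nn_integral_distr[OF T, of "indicator A"] by simp
    thus ?thesis by (subst emeasure_density) (auto simp: nn_integral_cmult)
  qed
  finally show "emeasure lborel A = emeasure (density (distr ?M borel ?T) (\<lambda>_. ennreal \<bar>Im (cnj \<alpha> * \<beta>)\<bar>)) A" .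
qed

section \<open>Functions of Gaussian decay\<close>

text \<open>All three follow from the standard normal distribution by the scaling x = sqrt (2 a) t;
  the Fourier transform is its characteristic function.\<close>

lemma gaussian_fourier_integral:
  fixes a b :: real
  assumes a: "a > 0"
  shows "integrable lborel (\<lambda>t. exp (- a * t\<^sup>2))"
    and "(\<integral>t. exp (- a * t\<^sup>2) \<partial>lborel) = sqrt (pi / a)"
    and "(\<integral>t. exp (- a * t\<^sup>2) *\<^sub>R exp (\<i> * of_real (b * t)) \<partial>lborel) = of_real (sqrt (pi / a) * exp (- b\<^sup>2 / (4 * a)))"
proof -
  define c where "c = sqrt (2 * a)"
  have c: "c > 0" "c\<^sup>2 = 2 * a" using a by (auto simp: c_def)
  have dens: "std_normal_density (c * t) = exp (- a * t\<^sup>2) / sqrt (2 * pi)" for t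
    by (simp add: std_normal_density_def power_mult_distrib c)
  have k: "sqrt (2 * pi) / c = sqrt (pi / a)" unfolding c_def using a by (simp flip: real_sqrt_divide)
  have "integrable lborel (\<lambda>t. std_normal_density (0 + c * t))"
    using c by (intro lborel_integrable_real_affine) (auto intro: integrable_normal_density)
  hence "integrable lborel (\<lambda>t. exp (- a * t\<^sup>2) / sqrt (2 * pi) * sqrt (2 * pi))"
    unfolding dens add_0 by (rule integrable_mult_left)
  thus int: "integrable lborel (\<lambda>t. exp (- a * t\<^sup>2))" by simp
  have "char std_normal_distribution (b / c) = (\<integral>x. std_normal_density x *\<^sub>R exp (\<i> * of_real (b / c * x)) \<partial>lborel)"
    unfolding char_def by (subst integral_density) auto
  also have "\<dots> = \<bar>c\<bar> *\<^sub>R (\<integral>t. std_normal_density (0 + c * t) *\<^sub>R exp (\<i> * of_real (b / c * (0 + c * t))) \<partial>lborel)"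
    using c by (intro lborel_integral_real_affine) auto
  also have "\<dots> = c *\<^sub>R (\<integral>t. (1 / sqrt (2 * pi)) *\<^sub>R (exp (- a * t\<^sup>2) *\<^sub>R exp (\<i> * of_real (b * t))) \<partial>lborel)"
    using c(1) by (simp add: dens)
  also have "\<dots> = (c / sqrt (2 * pi)) *\<^sub>R (\<integral>t. exp (- a * t\<^sup>2) *\<^sub>R exp (\<i> * of_real (b * t)) \<partial>lborel)"
    by (subst integral_scaleR_right) (simp only: scaleR_scaleR times_divide_eq_right mult_1_right)
  finally have "(c / sqrt (2 * pi)) *\<^sub>R (\<integral>t. exp (- a * t\<^sup>2) *\<^sub>R exp (\<i> * of_real (b * t)) \<partial>lborel) = of_real (exp (- (b / c)\<^sup>2 / 2))"
    by (simp add: char_std_normal_distribution)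
  hence "(sqrt (2 * pi) / c) *\<^sub>R ((c / sqrt (2 * pi)) *\<^sub>R (\<integral>t. exp (- a * t\<^sup>2) *\<^sub>R exp (\<i> * of_real (b * t)) \<partial>lborel)) = (sqrt (2 * pi) / c) *\<^sub>R of_real (exp (- (b / c)\<^sup>2 / 2))"
    by (rule arg_cong)
  hence "(\<integral>t. exp (- a * t\<^sup>2) *\<^sub>R exp (\<i> * of_real (b * t)) \<partial>lborel) = (sqrt (2 * pi) / c) *\<^sub>R of_real (exp (- (b / c)\<^sup>2 / 2))"
    using c(1) by (simp only: scaleR_scaleR) simp
  also have "\<dots> = of_real (sqrt (pi / a) * exp (- b\<^sup>2 / (4 * a)))"
    unfolding k by (simp add: scaleR_conv_of_real power_divide c(2))
  finally show F: "(\<integral>t. exp (- a * t\<^sup>2) *\<^sub>R exp (\<i> * of_real (b * t)) \<partial>lborel) = of_real (sqrt (pi / a) * exp (- b\<^sup>2 / (4 * a)))" .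
  have "(\<integral>x. std_normal_density x \<partial>lborel) = 1" by simp
  also have "(\<integral>x. std_normal_density x \<partial>lborel) = \<bar>c\<bar> *\<^sub>R (\<integral>t. std_normal_density (0 + c * t) \<partial>lborel)"
    using c by (intro lborel_integral_real_affine) auto
  finally have "sqrt (2 * pi) = c * (\<integral>t. exp (- a * t\<^sup>2) \<partial>lborel)" using c(1) by (simp add: dens)
  hence "(\<integral>t. exp (- a * t\<^sup>2) \<partial>lborel) = sqrt (2 * pi) / c" using c(1) by (simp add: field_simps)
  thus "(\<integral>t. exp (- a * t\<^sup>2) \<partial>lborel) = sqrt (pi / a)" unfolding k .
qed

lemma gaussian_shift_bound:
  fixes t x :: real
  assumes "c \<ge> 0"
  shows "exp (- c * (t - x)\<^sup>2) \<le> exp (c * x\<^sup>2) * exp (- (c / 2) * t\<^sup>2)"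
proof -
  have "t\<^sup>2 / 2 - x\<^sup>2 \<le> (t - x)\<^sup>2" using zero_le_power2[of "t - 2 * x"] by (simp add: power2_eq_square algebra_simps)
  hence "c * (t\<^sup>2 / 2 - x\<^sup>2) \<le> c * (t - x)\<^sup>2" using assms by (rule mult_left_mono)
  thus ?thesis unfolding exp_add[symmetric] by (simp add: algebra_simps)
qed

text \<open>A class closed under the operations used below and small enough that every interchange
  of integrals and every boundary term is harmless.\<close>

definition gaussian_decay :: "(real \<Rightarrow> complex) \<Rightarrow> bool" where
  "gaussian_decay g \<longleftrightarrow> continuous_on UNIV g \<and> (\<exists>C c. c > 0 \<and> (\<forall>t. norm (g t) \<le> C * exp (- c * t\<^sup>2)))"

lemma gaussian_decay_integrable:
  assumes "gaussian_decay g" shows "integrable lborel g"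
proof -
  obtain C c where c: "c > 0" "\<And>t. norm (g t) \<le> C * exp (- c * t\<^sup>2)" and g: "continuous_on UNIV g" using assms unfolding gaussian_decay_def by blast
  have i: "integrable lborel (\<lambda>t. C * exp (- c * t\<^sup>2))" using gaussian_fourier_integral(1)[OF c(1)] by simp
  show ?thesis by (rule Bochner_Integration.integrable_bound[OF i]) (use c g in \<open>auto intro!: borel_measurable_continuous_onI order.trans[OF c(2)]\<close>)
qed

lemma gaussian_decay_mult_bounded:
  assumes "gaussian_decay g" "continuous_on UNIV h" "\<And>t. norm (h t) \<le> B"
  shows "gaussian_decay (\<lambda>t. h t * g t)"
proof -
  obtain C c where c: "c > 0" "\<And>t. norm (g t) \<le> C * exp (- c * t\<^sup>2)" and g: "continuous_on UNIV g" using assms unfolding gaussian_decay_def by blast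
  have "norm (h t * g t) \<le> (B * C) * exp (- c * t\<^sup>2)" for t
    using mult_mono[OF assms(3)[of t] c(2)[of t]] assms(3)[of t] norm_ge_zero[of "h t"] by (simp add: norm_mult mult.assoc order.trans)
  thus ?thesis using assms(2) g c(1) unfolding gaussian_decay_def by (auto intro!: continuous_intros)
qed

lemma gaussian_decay_add:
  assumes "gaussian_decay f" "gaussian_decay g" shows "gaussian_decay (\<lambda>t. f t + g t)"
proof -
  obtain C c where c: "c > 0" "\<And>t. norm (f t) \<le> C * exp (- c * t\<^sup>2)" and f: "continuous_on UNIV f" using assms unfolding gaussian_decay_def by blast
  obtain D d where d: "d > 0" "\<And>t. norm (g t) \<le> D * exp (- d * t\<^sup>2)" and g: "continuous_on UNIV g" using assms unfolding gaussian_decay_def by blast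
  have C0: "C \<ge> 0" "D \<ge> 0" using order.trans[OF norm_ge_zero c(2)[of 0]] order.trans[OF norm_ge_zero d(2)[of 0]] by auto
  have "norm (f t + g t) \<le> (C + D) * exp (- min c d * t\<^sup>2)" for t
  proof -
    have "exp (- c * t\<^sup>2) \<le> exp (- min c d * t\<^sup>2)" "exp (- d * t\<^sup>2) \<le> exp (- min c d * t\<^sup>2)"
      by (auto intro!: mult_right_mono)
    hence "C * exp (- c * t\<^sup>2) + D * exp (- d * t\<^sup>2) \<le> C * exp (- min c d * t\<^sup>2) + D * exp (- min c d * t\<^sup>2)"
      using C0 by (intro add_mono mult_left_mono) auto
    thus ?thesis using norm_triangle_ineq[of "f t" "g t"] c(2)[of t] d(2)[of t] by (simp add: distrib_right)
  qed
  thus ?thesis using f g c(1) d(1) unfolding gaussian_decay_def by (intro conjI continuous_intros exI[of _ "C + D"] exI[of _ "min c d"]) auto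
qed

lemma gaussian_decay_sum:
  "finite F \<Longrightarrow> (\<And>i. i \<in> F \<Longrightarrow> gaussian_decay (f i)) \<Longrightarrow> gaussian_decay (\<lambda>t. \<Sum>i\<in>F. f i t)"
proof (induction F rule: finite_induct)
  case empty
  have "gaussian_decay (\<lambda>t. 0)" unfolding gaussian_decay_def by (auto intro!: exI[of _ 0] exI[of _ 1])
  thus ?case by simp
qed (auto intro: gaussian_decay_add)

text \<open>A polynomial is dominated by exp (d t^2) for every d > 0. The rate is universally
  quantified in the induction, because each further degree spends half of it on the factor
  t.\<close>

lemma gaussian_decay_poly:
  fixes p :: "real poly"
  assumes "c > 0"
  shows "gaussian_decay (\<lambda>t. of_real (poly p (t - x) * exp (- c * (t - x)\<^sup>2)))"
proof -
  have "\<exists>C. \<forall>t. \<bar>poly p t\<bar> \<le> C * exp (d * t\<^sup>2)" if "d > 0" for d :: real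
    using that
  proof (induction p arbitrary: d)
    case 0 show ?case by (intro exI[of _ 0]) simp
  next
    case (pCons a p)
    obtain C where C: "\<And>t. \<bar>poly p t\<bar> \<le> C * exp (d / 2 * t\<^sup>2)" using pCons.IH[of "d / 2"] pCons.prems by auto
    have C0: "C \<ge> 0" using order.trans[OF abs_ge_zero C[of 0]] by simp
    have "\<bar>poly (pCons a p) t\<bar> \<le> (\<bar>a\<bar> + (1 + 2 / d) * C) * exp (d * t\<^sup>2)" for t
    proof -
      have e1: "1 \<le> exp (d / 2 * t\<^sup>2)" "1 \<le> exp (d * t\<^sup>2)" using pCons.prems by auto
      have "\<bar>t\<bar> \<le> 1 + t\<^sup>2" using zero_le_power2[of "\<bar>t\<bar> - 1"] zero_le_power2[of t] by (simp add: power2_eq_square algebra_simps)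
      also have "t\<^sup>2 \<le> 2 / d * exp (d / 2 * t\<^sup>2)"
        using exp_ge_add_one_self[of "d / 2 * t\<^sup>2"] pCons.prems by (simp add: field_simps)
      finally have "\<bar>t\<bar> \<le> 1 + 2 / d * exp (d / 2 * t\<^sup>2)" by simp
      hence t: "\<bar>t\<bar> \<le> (1 + 2 / d) * exp (d / 2 * t\<^sup>2)" unfolding distrib_right using e1(1) by linarith
      have "\<bar>poly (pCons a p) t\<bar> \<le> \<bar>a\<bar> + \<bar>t\<bar> * \<bar>poly p t\<bar>" using abs_triangle_ineq[of a "t * poly p t"] by (simp add: abs_mult)
      also have "\<bar>t\<bar> * \<bar>poly p t\<bar> \<le> ((1 + 2 / d) * exp (d / 2 * t\<^sup>2)) * (C * exp (d / 2 * t\<^sup>2))"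
        by (intro mult_mono t C) (use pCons.prems C0 in auto)
      also have "\<dots> = ((1 + 2 / d) * C) * exp (d * t\<^sup>2)" by (simp flip: exp_add)
      also have "\<bar>a\<bar> \<le> \<bar>a\<bar> * exp (d * t\<^sup>2)" using e1 by (simp add: mult_le_cancel_left1)
      finally show ?thesis by (simp add: distrib_right)
    qed
    thus ?case by blast
  qed
  from this[of "c / 2"] assms obtain C where C: "\<And>t. \<bar>poly p t\<bar> \<le> C * exp (c / 2 * t\<^sup>2)" by auto
  have C0: "C \<ge> 0" using order.trans[OF abs_ge_zero C[of 0]] by simp
  have "norm (complex_of_real (poly p (t - x) * exp (- c * (t - x)\<^sup>2))) \<le> (C * exp (c / 2 * x\<^sup>2)) * exp (- (c / 4) * t\<^sup>2)" for t
  proof -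
    have "norm (complex_of_real (poly p (t - x) * exp (- c * (t - x)\<^sup>2))) \<le> (C * exp (c / 2 * (t - x)\<^sup>2)) * exp (- c * (t - x)\<^sup>2)"
      unfolding norm_of_real abs_mult using C0 by (intro mult_mono C) auto
    also have "\<dots> = C * exp (- (c / 2) * (t - x)\<^sup>2)" by (simp flip: exp_add)
    also have "\<dots> \<le> C * (exp (c / 2 * x\<^sup>2) * exp (- (c / 2 / 2) * t\<^sup>2))"
      using C0 assms by (intro mult_left_mono gaussian_shift_bound) auto
    finally show ?thesis by (simp add: mult.assoc)
  qed
  moreover have "continuous_on UNIV (\<lambda>t. complex_of_real (poly p (t - x) * exp (- c * (t - x)\<^sup>2)))" by (intro continuous_intros)
  ultimately show ?thesis unfolding gaussian_decay_def using assms by (intro conjI exI[of _ "C * exp (c / 2 * x\<^sup>2)"] exI[of _ "c / 4"]) auto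
qed

lemma gaussian_decay_tendsto:
  assumes "gaussian_decay g" shows "(g \<longlongrightarrow> 0) at_top" "(g \<longlongrightarrow> 0) at_bot"
proof -
  obtain C c where c: "c > 0" "\<And>t. norm (g t) \<le> C * exp (- c * t\<^sup>2)" using assms unfolding gaussian_decay_def by blast
  have "((\<lambda>t. C * exp (- c * t\<^sup>2)) \<longlongrightarrow> 0) at_top" "((\<lambda>t. C * exp (- c * t\<^sup>2)) \<longlongrightarrow> 0) at_bot"
    using c(1) by real_asymp+
  thus "(g \<longlongrightarrow> 0) at_top" "(g \<longlongrightarrow> 0) at_bot"
    using Lim_null_comparison[of g "\<lambda>t. C * exp (- c * t\<^sup>2)"] c(2) by (simp_all add: always_eventually)
qed

text \<open>The fundamental theorem on the whole line: the primitive tends to 0 at both ends. It is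
  the form in which integration by parts is used for Hermite functions.\<close>

lemma gaussian_decay_integral_deriv:
  assumes F: "gaussian_decay F" and f: "gaussian_decay f" and d: "\<And>t. (F has_vector_derivative f t) (at t)"
  shows "(\<integral>t. f t \<partial>lborel) = 0"
proof -
  have cf: "isCont f x" for x using f by (simp add: gaussian_decay_def continuous_on_eq_continuous_at)
  have "(LBINT t = -\<infinity>..\<infinity>. f t) = 0 - 0"
  proof (rule interval_integral_FTC_integrable)
    show "set_integrable lborel (einterval (-\<infinity>) \<infinity>) f"
      using gaussian_decay_integrable[OF f] by (simp add: set_integrable_def einterval_eq_UNIV)
    show "((F \<circ> real_of_ereal) \<longlongrightarrow> 0) (at_right (-\<infinity>))" "((F \<circ> real_of_ereal) \<longlongrightarrow> 0) (at_left \<infinity>)"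
      using gaussian_decay_tendsto[OF F] by (simp_all add: ereal_tendsto_simps)
  qed (use d cf in auto)
  thus ?thesis by (simp add: interval_lebesgue_integral_def set_lebesgue_integral_def einterval_eq_UNIV)
qed

section \<open>The upper bound\<close>

lemma integral_unit_interval_exp:
  "(\<integral>t. indicator {0..<1} t *\<^sub>R exp (2 * pi * \<i> * of_int m * of_real t) \<partial>lborel) = (if m = 0 then 1 else 0 :: complex)"
proof -
  let ?f = "\<lambda>t :: real. exp (2 * pi * \<i> * of_int m * of_real t)"
  have eq: "(\<integral>t. indicator {0..<1} t *\<^sub>R ?f t \<partial>lborel) = (\<integral>t. indicator {0..1} t *\<^sub>R ?f t \<partial>lborel)"
  proof (rule integral_cong_AE)
    show "AE t in lborel. indicator {0..<1} t *\<^sub>R ?f t = indicator {0..1} t *\<^sub>R ?f t"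
      using AE_lborel_singleton[of "1::real"] by eventually_elim (auto simp: indicator_def)
  qed (auto intro!: borel_measurable_scaleR borel_measurable_continuous_onI continuous_intros)
  show ?thesis
  proof (cases "m = 0")
    case True
    show ?thesis unfolding eq using True by simp
  next
    case False
    define a where "a = 2 * pi * \<i> * of_int m"
    have a: "a \<noteq> 0" using False by (simp add: a_def)
    have "(\<integral>t. indicator {0..1} t *\<^sub>R exp (a * of_real t) \<partial>lborel) = exp (a * of_real 1) / a - exp (a * of_real 0) / a"
    proof (rule integral_FTC_Icc)
      fix x :: real
      have "((\<lambda>z. exp (a * z) / a) has_field_derivative exp (a * of_real x)) (at (of_real x))"
        using a by (auto intro!: derivative_eq_intros)
      thus "((\<lambda>t. exp (a * of_real t) / a) has_vector_derivative exp (a * of_real x)) (at x within {0..1})"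
        by (rule has_vector_derivative_real_field)
    qed (auto intro!: continuous_intros)
    also have "exp (a * of_real 1) = 1" unfolding a_def by (simp add: exp_eq_1)
    finally show ?thesis unfolding eq using False by (simp add: a_def)
  qed
qed

lemma integral_unit_square_exp:
  "(\<integral>p. exp (2 * pi * \<i> * (of_int m * of_real (snd p) - of_int l * of_real (fst p))) \<partial>unit_square) = (if m = 0 \<and> l = 0 then 1 else 0 :: complex)"
proof -
  let ?e = "\<lambda>p :: real \<times> real. exp (2 * pi * \<i> * (of_int m * of_real (snd p) - of_int l * of_real (fst p))) :: complex"
  let ?S = "{0..<1} \<times> {0..<1} :: (real \<times> real) set"
  have m: "?e \<in> borel_measurable (lborel \<Otimes>\<^sub>M lborel)"
    by (intro measurable_pair_continuous continuous_intros)
  have S: "?S \<in> sets (lborel \<Otimes>\<^sub>M lborel)" by (intro pair_measureI) auto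
  have eq: "unit_square = density (lborel \<Otimes>\<^sub>M lborel) (\<lambda>p. ennreal (indicator ?S p))"
    unfolding unit_square_def by (simp add: ennreal_indicator)
  have int: "integrable (lborel \<Otimes>\<^sub>M lborel) (\<lambda>p. indicator ?S p *\<^sub>R ?e p)"
  proof -
    have "integrable unit_square ?e"
      by (rule unit_square.integrable_const_bound[of _ 1]) (auto simp: norm_exp_eq_Re intro!: borel_measurable_continuous_onI continuous_intros)
    thus ?thesis unfolding eq by (subst (asm) integrable_density) (use m S in auto)
  qed
  have "(\<integral>p. ?e p \<partial>unit_square) = (\<integral>p. indicator ?S p *\<^sub>R ?e p \<partial>(lborel \<Otimes>\<^sub>M lborel))"
    unfolding eq by (rule integral_density) (use m S in auto)
  also have "\<dots> = (\<integral>s. \<integral>t. indicator ?S (s, t) *\<^sub>R ?e (s, t) \<partial>lborel \<partial>lborel)"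
    using lborel_pair.integral_fst'[OF int] by simp
  also have "\<dots> = (\<integral>s. (indicator {0..<1} s *\<^sub>R exp (2 * pi * \<i> * of_int (- l) * of_real s)) * (\<integral>t. indicator {0..<1} t *\<^sub>R exp (2 * pi * \<i> * of_int m * of_real t) \<partial>lborel) \<partial>lborel)"
  proof (rule Bochner_Integration.integral_cong[OF refl])
    fix s :: real
    have "indicator ?S (s, t) *\<^sub>R ?e (s, t) = (indicator {0..<1} s *\<^sub>R exp (2 * pi * \<i> * of_int (- l) * of_real s)) * (indicator {0..<1} t *\<^sub>R exp (2 * pi * \<i> * of_int m * of_real t))" for t
      by (simp add: indicator_times mult_ac right_diff_distrib flip: exp_add)
    thus "(\<integral>t. indicator ?S (s, t) *\<^sub>R ?e (s, t) \<partial>lborel) = (indicator {0..<1} s *\<^sub>R exp (2 * pi * \<i> * of_int (- l) * of_real s)) * (\<integral>t. indicator {0..<1} t *\<^sub>R exp (2 * pi * \<i> * of_int m * of_real t) \<partial>lborel)"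
      by (simp only: integral_mult_right_zero)
  qed
  also have "\<dots> = (\<integral>s. indicator {0..<1} s *\<^sub>R exp (2 * pi * \<i> * of_int (- l) * of_real s) \<partial>lborel) * (\<integral>t. indicator {0..<1} t *\<^sub>R exp (2 * pi * \<i> * of_int m * of_real t) \<partial>lborel)"
    by (rule integral_mult_left_zero)
  also have "\<dots> = (if m = 0 \<and> l = 0 then 1 else 0)"
    unfolding integral_unit_interval_exp by simp
  finally show ?thesis .
qed

text \<open>Bessel's inequality for one coefficient, via Cauchy-Schwarz on a probability space. A
  single coefficient suffices since in the application the polynomial itself varies with
  \<open>j\<close>.\<close>

lemma trig_coefficient_le:
  fixes d :: "int \<times> int \<Rightarrow> complex"
  assumes F: "finite F" and j: "j \<in> F"
  shows "ennreal ((norm (d j))\<^sup>2) \<le> (\<integral>\<^sup>+p. ennreal ((norm (\<Sum>i\<in>F. d i * exp (2 * pi * \<i> * (of_int (fst i) * of_real (snd p) - of_int (snd i) * of_real (fst p)))))\<^sup>2) \<partial>unit_square)"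
proof -
  define e where "e = (\<lambda>i (p :: real \<times> real). exp (2 * pi * \<i> * (of_int (fst i) * of_real (snd p) - of_int (snd i) * of_real (fst p))) :: complex)"
  define f where "f = (\<lambda>p. \<Sum>i\<in>F. d i * e i p)"
  have ce: "continuous_on UNIV (e i)" for i unfolding e_def by (intro continuous_intros)
  have ne: "norm (e i p) = 1" for i p by (simp add: e_def norm_exp_eq_Re)
  have ie: "integrable unit_square (\<lambda>p. e i p * cnj (e j p))" for i
    by (rule unit_square.integrable_const_bound[of _ 1]) (auto simp: norm_mult ne intro!: borel_measurable_continuous_onI continuous_intros ce)
  have ee: "(\<integral>p. e i p * cnj (e j p) \<partial>unit_square) = (if i = j then 1 else 0)" for i
  proof -
    have "e i p * cnj (e j p) = exp (2 * pi * \<i> * (of_int (fst i - fst j) * of_real (snd p) - of_int (snd i - snd j) * of_real (fst p)))" for p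
      by (simp add: e_def exp_cnj flip: exp_add) (simp add: algebra_simps)
    thus ?thesis using integral_unit_square_exp[of "fst i - fst j" "snd i - snd j"] by (simp add: prod_eq_iff)
  qed
  have "(\<integral>p. f p * cnj (e j p) \<partial>unit_square) = (\<integral>p. (\<Sum>i\<in>F. d i * (e i p * cnj (e j p))) \<partial>unit_square)"
    unfolding f_def by (simp add: sum_distrib_right mult.assoc)
  also have "\<dots> = (\<Sum>i\<in>F. d i * (if i = j then 1 else 0))"
    using ie by (subst Bochner_Integration.integral_sum) (auto simp: ee)
  also have "\<dots> = d j" using F j by (simp add: sum.delta' if_distrib cong: if_cong)
  finally have dj: "d j = (\<integral>p. f p * cnj (e j p) \<partial>unit_square)" by simp
  have "integrable unit_square (\<lambda>p. f p * cnj (e j p))"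
    unfolding f_def sum_distrib_right using ie by (intro Bochner_Integration.integrable_sum) (simp add: mult.assoc)
  hence "ennreal (norm (d j)) \<le> (\<integral>\<^sup>+p. ennreal (norm (f p * cnj (e j p))) \<partial>unit_square)"
    unfolding dj by (rule integral_norm_bound_ennreal)
  also have "\<dots> = (\<integral>\<^sup>+p. ennreal (norm (f p)) * 1 \<partial>unit_square)" by (simp add: norm_mult ne)
  finally have "(ennreal (norm (d j)))\<^sup>2 \<le> (\<integral>\<^sup>+p. ennreal (norm (f p)) * 1 \<partial>unit_square)\<^sup>2" by (rule power_mono) simp
  also have "\<dots> \<le> (\<integral>\<^sup>+p. (ennreal (norm (f p)))\<^sup>2 \<partial>unit_square) * (\<integral>\<^sup>+p. 1\<^sup>2 \<partial>unit_square)"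
    by (rule Cauchy_Schwarz_nn_integral) (auto simp: f_def intro!: borel_measurable_continuous_onI continuous_intros ce)
  also have "\<dots> = (\<integral>\<^sup>+p. ennreal ((norm (f p))\<^sup>2) \<partial>unit_square)"
    by (simp add: emeasure_unit_square ennreal_power)
  finally show ?thesis by (simp add: f_def e_def ennreal_power)
qed

section \<open>Weighted sums of Fock kernels\<close>

lemma count_space_weighted_Cauchy_Schwarz:
  fixes a \<rho> :: "'i \<Rightarrow> real"
  assumes "\<And>i. a i \<ge> 0" "\<And>i. \<rho> i \<ge> 0"
  shows "(\<integral>\<^sup>+i. ennreal (a i * \<rho> i) \<partial>count_space UNIV)\<^sup>2 \<le> (\<integral>\<^sup>+i. ennreal ((a i)\<^sup>2 * \<rho> i) \<partial>count_space UNIV) * (\<integral>\<^sup>+i. ennreal (\<rho> i) \<partial>count_space UNIV)"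
proof -
  have "(\<integral>\<^sup>+i. ennreal (a i * \<rho> i) \<partial>count_space UNIV) = (\<integral>\<^sup>+i. ennreal (a i * sqrt (\<rho> i)) * ennreal (sqrt (\<rho> i)) \<partial>count_space UNIV)"
    using assms by (intro nn_integral_cong) (simp flip: ennreal_mult)
  also have "(\<dots>)\<^sup>2 \<le> (\<integral>\<^sup>+i. (ennreal (a i * sqrt (\<rho> i)))\<^sup>2 \<partial>count_space UNIV) * (\<integral>\<^sup>+i. (ennreal (sqrt (\<rho> i)))\<^sup>2 \<partial>count_space UNIV)"
    by (rule Cauchy_Schwarz_nn_integral) auto
  also have "\<dots> = (\<integral>\<^sup>+i. ennreal ((a i)\<^sup>2 * \<rho> i) \<partial>count_space UNIV) * (\<integral>\<^sup>+i. ennreal (\<rho> i) \<partial>count_space UNIV)"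
    using assms by (simp add: ennreal_power power_mult_distrib)
  finally show ?thesis .
qed

lemma sum_le_nn_integral_count_space:
  fixes f :: "'i \<Rightarrow> ennreal"
  assumes "finite F"
  shows "(\<Sum>i\<in>F. f i) \<le> (\<integral>\<^sup>+i. f i \<partial>count_space UNIV)"
proof -
  have "(\<Sum>i\<in>F. f i) = (\<integral>\<^sup>+i. f i * indicator F i \<partial>count_space UNIV)"
    using assms by (simp add: nn_integral_count_space_indicator[symmetric] nn_integral_count_space_finite)
  also have "\<dots> \<le> (\<integral>\<^sup>+i. f i \<partial>count_space UNIV)" by (intro nn_integral_mono) (auto simp: indicator_def)
  finally show ?thesis .
qed

text \<open>The normalised reproducing kernel of Fock space at \<open>l\<close>, already multiplied
  by the weight exp (- pi |w|^2 / 2), so that plain Lebesgue measure can be used.\<close>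

definition fock_kernel :: "complex \<Rightarrow> complex \<Rightarrow> complex" where
  "fock_kernel l w = exp (pi * cnj l * w - pi * (norm l)\<^sup>2 / 2 - pi * (norm w)\<^sup>2 / 2)"

definition fock_sum :: "nat \<Rightarrow> 'i set \<Rightarrow> ('i \<Rightarrow> complex) \<Rightarrow> ('i \<Rightarrow> complex) \<Rightarrow> complex \<Rightarrow> complex" where
  "fock_sum k F c l w = (\<Sum>i\<in>F. c i * (w - l i) ^ k * fock_kernel (l i) w)"

abbreviation fock_norm_sq :: "nat \<Rightarrow> 'i set \<Rightarrow> ('i \<Rightarrow> complex) \<Rightarrow> ('i \<Rightarrow> complex) \<Rightarrow> ennreal" where
  "fock_norm_sq k F c l \<equiv> \<integral>\<^sup>+w. ennreal ((norm (fock_sum k F c l w))\<^sup>2) \<partial>lborel"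

lemma norm_fock_kernel: "norm (fock_kernel l w) = exp (- pi * (norm (w - l))\<^sup>2 / 2)"
  unfolding fock_kernel_def norm_exp_eq_Re
  by (rule arg_cong[where f = exp]) (simp only: cmod_power2, simp add: power2_eq_square algebra_simps add_divide_distrib diff_divide_distrib)

lemma continuous_fock_sum: "continuous_on A (fock_sum k F c l)"
  unfolding fock_sum_def[abs_def] fock_kernel_def by (intro continuous_intros) auto

lemma fock_sum_measurable [measurable]: "fock_sum k F c l \<in> borel_measurable borel"
  by (intro borel_measurable_continuous_onI continuous_fock_sum)

text \<open>From x ^ k <= k! exp x and, as pi > 3, x - pi x^2 / 2 <= 1/2 - x^2. The constant with
  fact n is common to all orders up to \<open>n\<close>.\<close>

lemma power_mult_gaussian_le:
  fixes x :: real
  assumes "x \<ge> 0" "k \<le> n"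
  shows "x ^ k * exp (- pi * x\<^sup>2 / 2) \<le> (fact n * exp (1/2)) * exp (- x\<^sup>2)"
proof -
  have "x ^ k / fact k \<le> exp x"
  proof -
    have "(\<Sum>i\<in>{k}. x ^ i /\<^sub>R fact i) \<le> (\<Sum>i. x ^ i /\<^sub>R fact i)"
      using assms(1) summable_exp_generic[of x] by (intro sum_le_suminf) auto
    thus ?thesis by (simp add: exp_def field_simps)
  qed
  hence "x ^ k \<le> fact k * exp x" by (simp add: field_simps)
  also have "\<dots> \<le> fact n * exp x" using assms(2) by (intro mult_right_mono fact_mono) auto
  finally have "x ^ k * exp (- pi * x\<^sup>2 / 2) \<le> fact n * exp x * exp (- pi * x\<^sup>2 / 2)" by (intro mult_right_mono) auto
  also have "\<dots> = fact n * exp (x - pi * x\<^sup>2 / 2)" by (simp add: mult.assoc flip: exp_add)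
  also have "\<dots> \<le> fact n * exp (1/2 - x\<^sup>2)"
  proof (intro mult_left_mono)
    have "x \<le> x\<^sup>2 / 2 + 1/2" using zero_le_power2[of "x - 1"] by (simp add: power2_eq_square algebra_simps)
    moreover have "3 * x\<^sup>2 \<le> pi * x\<^sup>2" using pi_gt3 by (intro mult_right_mono) auto
    ultimately show "exp (x - pi * x\<^sup>2 / 2) \<le> exp (1/2 - x\<^sup>2)" by simp
  qed auto
  finally show ?thesis by (simp add: mult.assoc flip: exp_add)
qed

lemma nn_integral_gaussian_plane:
  fixes l :: complex
  assumes "\<epsilon> > 0"
  shows "(\<integral>\<^sup>+w. ennreal (exp (- \<epsilon> * (norm (w - l))\<^sup>2)) \<partial>lborel) = ennreal (pi / \<epsilon>)"
proof -
  have g: "(\<integral>\<^sup>+x. ennreal (exp (- \<epsilon> * (x - a)\<^sup>2)) \<partial>lborel) = ennreal (sqrt (pi / \<epsilon>))" for a :: real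
  proof -
    have "(\<integral>\<^sup>+x. ennreal (exp (- \<epsilon> * (x - a)\<^sup>2)) \<partial>lborel) = (\<integral>\<^sup>+x. ennreal (exp (- \<epsilon> * x\<^sup>2)) \<partial>lborel)"
      by (subst nn_integral_real_affine[where c = 1 and t = a]) auto
    also have "\<dots> = ennreal (sqrt (pi / \<epsilon>))"
      using gaussian_fourier_integral(1,2)[OF assms] by (subst nn_integral_eq_integral) auto
    finally show ?thesis .
  qed
  have "(\<integral>\<^sup>+w. ennreal (exp (- \<epsilon> * (norm (w - l))\<^sup>2)) \<partial>lborel) = (\<integral>\<^sup>+x. \<integral>\<^sup>+y. ennreal (exp (- \<epsilon> * (norm (Complex x y - l))\<^sup>2)) \<partial>lborel \<partial>lborel)"
    by (rule nn_integral_complex) (intro measurable_compose[OF borel_measurable_continuous_onI measurable_ennreal] continuous_intros)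
  also have "\<dots> = (\<integral>\<^sup>+x. \<integral>\<^sup>+y. ennreal (exp (- \<epsilon> * (x - Re l)\<^sup>2)) * ennreal (exp (- \<epsilon> * (y - Im l)\<^sup>2)) \<partial>lborel \<partial>lborel)"
    by (intro nn_integral_cong) (simp add: cmod_power2 algebra_simps flip: exp_add ennreal_mult)
  also have "\<dots> = ennreal (sqrt (pi / \<epsilon>)) * ennreal (sqrt (pi / \<epsilon>))"
    using g by (simp add: nn_integral_cmult nn_integral_multc)
  also have "\<dots> = ennreal (pi / \<epsilon>)" using assms by (simp flip: ennreal_mult)
  finally show ?thesis .
qed

text \<open>A Schur test: the Gaussian weight is split evenly in Cauchy-Schwarz. One half is summed
  over the lattice uniformly in w, the other is integrated over the plane term by term.\<close>

lemma fock_upper_bound: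
  assumes V: "Im (cnj \<alpha> * \<beta>) \<noteq> 0"
  obtains B where "B > 0" "\<And>F c. finite F \<Longrightarrow>
    (\<Sum>k<n. fock_norm_sq k F c (lpt \<alpha> \<beta>)) \<le> ennreal (B * (\<Sum>i\<in>F. (norm (c i))\<^sup>2))"
proof -
  define C where "C = (fact n * exp (1/2) :: real)"
  have C: "C > 0" by (simp add: C_def)
  obtain G where G: "G > 0" "\<And>w. (\<integral>\<^sup>+i. ennreal (exp (- 1 * (norm (w - lpt \<alpha> \<beta> i))\<^sup>2)) \<partial>count_space UNIV) \<le> ennreal G"
    using gaussian_lattice_sum_bounded[OF V, of 1] by auto
  have one: "(fock_norm_sq k F c (lpt \<alpha> \<beta>)) \<le> ennreal (C\<^sup>2 * G * pi * (\<Sum>i\<in>F. (norm (c i))\<^sup>2))"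
    if F: "finite F" and k: "k < n" for F c k
  proof -
    have pt: "(norm (fock_sum k F c (lpt \<alpha> \<beta>) w))\<^sup>2 \<le> C\<^sup>2 * G * (\<Sum>i\<in>F. (norm (c i))\<^sup>2 * exp (- (norm (w - lpt \<alpha> \<beta> i))\<^sup>2))" for w
    proof -
      let ?\<rho> = "\<lambda>i. exp (- (norm (w - lpt \<alpha> \<beta> i))\<^sup>2)"
      have "norm (fock_sum k F c (lpt \<alpha> \<beta>) w) \<le> (\<Sum>i\<in>F. norm (c i) * (C * ?\<rho> i))"
        unfolding fock_sum_def
      proof (rule sum_norm_le)
        fix i assume "i \<in> F"
        have "norm (c i * (w - lpt \<alpha> \<beta> i) ^ k * fock_kernel (lpt \<alpha> \<beta> i) w) = norm (c i) * (norm (w - lpt \<alpha> \<beta> i) ^ k * exp (- pi * (norm (w - lpt \<alpha> \<beta> i))\<^sup>2 / 2))"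
          by (simp add: norm_mult norm_power norm_fock_kernel)
        also have "\<dots> \<le> norm (c i) * (C * ?\<rho> i)"
          unfolding C_def using k by (intro mult_left_mono power_mult_gaussian_le) auto
        finally show "norm (c i * (w - lpt \<alpha> \<beta> i) ^ k * fock_kernel (lpt \<alpha> \<beta> i) w) \<le> norm (c i) * (C * ?\<rho> i)" .
      qed
      also have "\<dots> = C * (\<Sum>i\<in>F. (norm (c i) * sqrt (?\<rho> i)) * sqrt (?\<rho> i))" by (simp add: sum_distrib_left mult_ac)
      finally have "(norm (fock_sum k F c (lpt \<alpha> \<beta>) w))\<^sup>2 \<le> (C * (\<Sum>i\<in>F. (norm (c i) * sqrt (?\<rho> i)) * sqrt (?\<rho> i)))\<^sup>2"
        by (intro power_mono) auto
      also have "\<dots> = C\<^sup>2 * (\<Sum>i\<in>F. (norm (c i) * sqrt (?\<rho> i)) * sqrt (?\<rho> i))\<^sup>2" by (simp add: power_mult_distrib)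
      also have "\<dots> \<le> C\<^sup>2 * ((\<Sum>i\<in>F. (norm (c i) * sqrt (?\<rho> i))\<^sup>2) * (\<Sum>i\<in>F. (sqrt (?\<rho> i))\<^sup>2))"
        by (intro mult_left_mono Cauchy_Schwarz_ineq_sum) auto
      also have "\<dots> = C\<^sup>2 * ((\<Sum>i\<in>F. (norm (c i))\<^sup>2 * ?\<rho> i) * (\<Sum>i\<in>F. ?\<rho> i))" by (simp add: power_mult_distrib)
      also have "\<dots> \<le> C\<^sup>2 * ((\<Sum>i\<in>F. (norm (c i))\<^sup>2 * ?\<rho> i) * G)"
      proof (intro mult_left_mono)
        have "ennreal (\<Sum>i\<in>F. ?\<rho> i) \<le> ennreal G"
          using order.trans[OF sum_le_nn_integral_count_space[OF F] G(2)[of w]] by (simp add: sum_ennreal)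
        thus "(\<Sum>i\<in>F. ?\<rho> i) \<le> G" using G(1) by (simp add: ennreal_le_iff)
      qed (auto intro!: sum_nonneg)
      finally show ?thesis by (simp add: mult_ac)
    qed
    have "(fock_norm_sq k F c (lpt \<alpha> \<beta>)) \<le> (\<integral>\<^sup>+w. (\<Sum>i\<in>F. ennreal (C\<^sup>2 * G * (norm (c i))\<^sup>2) * ennreal (exp (- 1 * (norm (w - lpt \<alpha> \<beta> i))\<^sup>2))) \<partial>lborel)"
    proof (rule nn_integral_mono)
      fix w
      have "ennreal ((norm (fock_sum k F c (lpt \<alpha> \<beta>) w))\<^sup>2) \<le> ennreal (C\<^sup>2 * G * (\<Sum>i\<in>F. (norm (c i))\<^sup>2 * exp (- (norm (w - lpt \<alpha> \<beta> i))\<^sup>2)))"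
        by (rule ennreal_leI[OF pt])
      also have "\<dots> = (\<Sum>i\<in>F. ennreal (C\<^sup>2 * G * (norm (c i))\<^sup>2) * ennreal (exp (- 1 * (norm (w - lpt \<alpha> \<beta> i))\<^sup>2)))"
        using C G(1) by (simp add: sum_distrib_left mult.assoc sum_ennreal flip: ennreal_mult)
      finally show "ennreal ((norm (fock_sum k F c (lpt \<alpha> \<beta>) w))\<^sup>2) \<le> (\<Sum>i\<in>F. ennreal (C\<^sup>2 * G * (norm (c i))\<^sup>2) * ennreal (exp (- 1 * (norm (w - lpt \<alpha> \<beta> i))\<^sup>2)))" .
    qed
    also have "\<dots> = (\<Sum>i\<in>F. ennreal (C\<^sup>2 * G * (norm (c i))\<^sup>2) * ennreal (pi / 1))"
    proof (subst nn_integral_sum)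
      have m: "(\<lambda>w. ennreal (exp (- 1 * (norm (w - lpt \<alpha> \<beta> i))\<^sup>2))) \<in> borel_measurable lborel" for i
        by (simp only: measurable_lborel2, intro measurable_compose[OF borel_measurable_continuous_onI measurable_ennreal] continuous_intros)
      show "(\<lambda>w. ennreal (C\<^sup>2 * G * (norm (c i))\<^sup>2) * ennreal (exp (- 1 * (norm (w - lpt \<alpha> \<beta> i))\<^sup>2))) \<in> borel_measurable lborel" for i
        by (intro borel_measurable_times_ennreal m) auto
      show "(\<Sum>i\<in>F. \<integral>\<^sup>+w. ennreal (C\<^sup>2 * G * (norm (c i))\<^sup>2) * ennreal (exp (- 1 * (norm (w - lpt \<alpha> \<beta> i))\<^sup>2)) \<partial>lborel) = (\<Sum>i\<in>F. ennreal (C\<^sup>2 * G * (norm (c i))\<^sup>2) * ennreal (pi / 1))"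
        by (intro sum.cong refl, subst nn_integral_cmult[OF m], subst nn_integral_gaussian_plane) auto
    qed
    also have "\<dots> = ennreal (C\<^sup>2 * G * pi * (\<Sum>i\<in>F. (norm (c i))\<^sup>2))"
      using C G(1) by (simp add: sum_distrib_left mult_ac sum_ennreal flip: ennreal_mult)
    finally show ?thesis .
  qed
  have "(\<Sum>k<n. fock_norm_sq k F c (lpt \<alpha> \<beta>)) \<le> ennreal ((n * (C\<^sup>2 * G * pi) + 1) * (\<Sum>i\<in>F. (norm (c i))\<^sup>2))"
    if F: "finite F" for F c
  proof -
    have "(\<Sum>k<n. fock_norm_sq k F c (lpt \<alpha> \<beta>)) \<le> (\<Sum>k<n. ennreal (C\<^sup>2 * G * pi * (\<Sum>i\<in>F. (norm (c i))\<^sup>2)))"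
      using one[OF F] by (intro sum_mono) auto
    also have "\<dots> = ennreal (n * (C\<^sup>2 * G * pi) * (\<Sum>i\<in>F. (norm (c i))\<^sup>2))"
      using C G(1) by (simp add: ennreal_of_nat_eq_real_of_nat sum_nonneg mult.assoc flip: ennreal_mult)
    also have "\<dots> \<le> ennreal ((n * (C\<^sup>2 * G * pi) + 1) * (\<Sum>i\<in>F. (norm (c i))\<^sup>2))"
      by (intro ennreal_leI mult_right_mono) (auto intro!: sum_nonneg)
    finally show ?thesis .
  qed
  moreover have "n * (C\<^sup>2 * G * pi) + 1 > 0" using C G(1) by (intro add_nonneg_pos mult_nonneg_nonneg) auto
  ultimately show thesis using that by blast
qed

section \<open>Plancherel for functions of Gaussian decay\<close>

lemma borel_measurable_cnj [measurable]:
  "f \<in> borel_measurable M \<Longrightarrow> (\<lambda>x. cnj (f x)) \<in> borel_measurable M"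
  by (rule borel_measurable_continuous_on[of cnj]) (intro continuous_intros)

lemma integral_swap_bounded:
  fixes u v :: "real \<Rightarrow> complex" and h :: "real \<Rightarrow> real \<Rightarrow> complex"
  assumes u: "integrable lborel u" and v: "integrable lborel v"
    and h: "continuous_on UNIV (\<lambda>(x, y). h x y)" "\<And>x y. norm (h x y) \<le> 1"
  shows "(\<integral>x. u x * (\<integral>y. v y * h x y \<partial>lborel) \<partial>lborel) = (\<integral>y. v y * (\<integral>x. u x * h x y \<partial>lborel) \<partial>lborel)"
proof -
  have um [measurable]: "u \<in> borel_measurable lborel" and vm [measurable]: "v \<in> borel_measurable lborel" using u v by auto
  have hm [measurable]: "(\<lambda>(x, y). h x y) \<in> borel_measurable (lborel \<Otimes>\<^sub>M lborel)" by (rule measurable_pair_continuous[OF h(1)])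
  have fm: "(\<lambda>(x, y). u x * v y * h x y) \<in> borel_measurable (lborel \<Otimes>\<^sub>M lborel)" by measurable
  have int: "integrable (lborel \<Otimes>\<^sub>M lborel) (\<lambda>(x, y). u x * v y)"
    using u v by (intro lborel_pair.Fubini_integrable) (auto simp: norm_mult intro!: integrable_mult_left integrable_norm)
  have f: "integrable (lborel \<Otimes>\<^sub>M lborel) (\<lambda>(x, y). u x * v y * h x y)"
    by (rule Bochner_Integration.integrable_bound[OF int fm], rule AE_I2) (auto simp: norm_mult intro!: mult_left_le mult_nonneg_nonneg h(2))
  have "(\<integral>x. u x * (\<integral>y. v y * h x y \<partial>lborel) \<partial>lborel) = (\<integral>x. (\<integral>y. u x * v y * h x y \<partial>lborel) \<partial>lborel)"
    by (simp only: mult.assoc integral_mult_right_zero)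
  also have "\<dots> = (\<integral>y. (\<integral>x. u x * v y * h x y \<partial>lborel) \<partial>lborel)"
    by (rule lborel_pair.Fubini_integral[OF f, symmetric])
  also have "\<dots> = (\<integral>y. v y * (\<integral>x. u x * h x y \<partial>lborel) \<partial>lborel)"
  proof (rule Bochner_Integration.integral_cong[OF refl])
    fix y
    have "u x * v y * h x y = v y * (u x * h x y)" for x by (simp add: mult_ac)
    thus "(\<integral>x. u x * v y * h x y \<partial>lborel) = v y * (\<integral>x. u x * h x y \<partial>lborel)" by (simp only: integral_mult_right_zero)
  qed
  finally show ?thesis .
qed

text \<open>Square integrability of \<open>G\<close> is not known beforehand, so a Gaussian damping
  is inserted. Fubini turns the damped integral into \<open>g\<close> tested against its smoothing
  by an approximate identity, and the damping is removed by monotone convergence on one side and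
  dominated convergence on the other.\<close>

lemma plancherel_gaussian_decay:
  fixes g :: "real \<Rightarrow> complex"
  assumes g: "gaussian_decay g"
  defines "G \<equiv> \<lambda>\<eta>. \<integral>t. g t * exp (- 2 * pi * \<i> * of_real (\<eta> * t)) \<partial>lborel"
  shows "(\<integral>\<^sup>+\<eta>. ennreal ((norm (G \<eta>))\<^sup>2) \<partial>lborel) = (\<integral>\<^sup>+t. ennreal ((norm (g t))\<^sup>2) \<partial>lborel)"
proof -
  have gi: "integrable lborel g" by (rule gaussian_decay_integrable[OF g])
  have gc: "continuous_on UNIV g" using g by (simp add: gaussian_decay_def)
  obtain C c where c: "c > 0" "\<And>t. norm (g t) \<le> C * exp (- c * t\<^sup>2)" using g unfolding gaussian_decay_def by blast
  have C0: "C \<ge> 0" using order.trans[OF norm_ge_zero c(2)[of 0]] by simp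
  have gb: "norm (g t) \<le> C" for t
    using c(2)[of t] c(1) C0 mult_left_mono[of "exp (- c * t\<^sup>2)" 1 C] by simp
  have Gm [measurable]: "G \<in> borel_measurable lborel"
  proof -
    have "(\<lambda>(\<eta>, t). g t * exp (- 2 * pi * \<i> * of_real (\<eta> * t))) \<in> borel_measurable (lborel \<Otimes>\<^sub>M lborel)"
      by (intro measurable_pair_continuous) (auto simp: case_prod_unfold intro!: continuous_intros continuous_on_compose2[OF gc])
    thus ?thesis unfolding G_def by (rule lborel.borel_measurable_lebesgue_integral)
  qed
  have Gb: "norm (G \<eta>) \<le> (\<integral>t. norm (g t) \<partial>lborel)" for \<eta>
    unfolding G_def by (rule order.trans[OF integral_norm_bound]) (simp add: norm_mult)
  define B where "B = (\<integral>t. norm (g t) \<partial>lborel)"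
  have cG: "cnj (G \<eta>) = (\<integral>s. cnj (g s) * exp (2 * pi * \<i> * of_real (\<eta> * s)) \<partial>lborel)" for \<eta>
    unfolding G_def by (subst Bochner_Integration.integral_cnj[symmetric]) (simp add: exp_cnj)
  \<comment> \<open>Two applications of Fubini; the inner Gaussian Fourier integral is a bump of
    width \<open>\<epsilon>\<close>, rescaled by s = t - \<open>\<epsilon>\<close> r to a fixed
    Gaussian of mass 1.\<close>
  have main: "(\<integral>\<eta>. exp (- pi * \<epsilon>\<^sup>2 * \<eta>\<^sup>2) *\<^sub>R (G \<eta> * cnj (G \<eta>)) \<partial>lborel) = (\<integral>t. g t * (\<integral>r. cnj (g (t - \<epsilon> * r)) * of_real (exp (- pi * r\<^sup>2)) \<partial>lborel) \<partial>lborel)"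
    if \<epsilon>: "\<epsilon> > 0" for \<epsilon> :: real
  proof -
    have e: "integrable lborel (\<lambda>\<eta>. exp (- (pi * \<epsilon>\<^sup>2) * \<eta>\<^sup>2))" using \<epsilon> by (intro gaussian_fourier_integral(1)) auto
    have u1: "integrable lborel (\<lambda>\<eta>. of_real (exp (- pi * \<epsilon>\<^sup>2 * \<eta>\<^sup>2)) * cnj (G \<eta>))"
    proof (rule Bochner_Integration.integrable_bound[where f = "\<lambda>\<eta>. B * exp (- (pi * \<epsilon>\<^sup>2) * \<eta>\<^sup>2)"])
      show "AE \<eta> in lborel. norm (of_real (exp (- pi * \<epsilon>\<^sup>2 * \<eta>\<^sup>2)) * cnj (G \<eta>)) \<le> norm (B * exp (- (pi * \<epsilon>\<^sup>2) * \<eta>\<^sup>2))"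
        using Gb by (intro AE_I2) (auto simp: norm_mult B_def abs_mult)
    qed (use e in auto)
    have u2: "integrable lborel (\<lambda>\<eta>. of_real (exp (- pi * \<epsilon>\<^sup>2 * \<eta>\<^sup>2)) * exp (- 2 * pi * \<i> * of_real (\<eta> * t)))" for t
      by (rule Bochner_Integration.integrable_bound[OF e]) (auto simp: norm_mult)
    have "(\<integral>\<eta>. exp (- pi * \<epsilon>\<^sup>2 * \<eta>\<^sup>2) *\<^sub>R (G \<eta> * cnj (G \<eta>)) \<partial>lborel) = (\<integral>\<eta>. (of_real (exp (- pi * \<epsilon>\<^sup>2 * \<eta>\<^sup>2)) * cnj (G \<eta>)) * (\<integral>t. g t * exp (- 2 * pi * \<i> * of_real (\<eta> * t)) \<partial>lborel) \<partial>lborel)"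
      by (intro Bochner_Integration.integral_cong[OF refl]) (simp only: G_def scaleR_conv_of_real mult_ac)
    also have "\<dots> = (\<integral>t. g t * (\<integral>\<eta>. (of_real (exp (- pi * \<epsilon>\<^sup>2 * \<eta>\<^sup>2)) * cnj (G \<eta>)) * exp (- 2 * pi * \<i> * of_real (\<eta> * t)) \<partial>lborel) \<partial>lborel)"
      by (rule integral_swap_bounded[OF u1 gi]) (auto simp: case_prod_unfold intro!: continuous_intros)
    also have "\<dots> = (\<integral>t. g t * (\<integral>r. cnj (g (t - \<epsilon> * r)) * of_real (exp (- pi * r\<^sup>2)) \<partial>lborel) \<partial>lborel)"
    proof (rule Bochner_Integration.integral_cong[OF refl])
      fix t :: real
      have "(\<integral>\<eta>. (of_real (exp (- pi * \<epsilon>\<^sup>2 * \<eta>\<^sup>2)) * cnj (G \<eta>)) * exp (- 2 * pi * \<i> * of_real (\<eta> * t)) \<partial>lborel)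
          = (\<integral>\<eta>. (of_real (exp (- pi * \<epsilon>\<^sup>2 * \<eta>\<^sup>2)) * exp (- 2 * pi * \<i> * of_real (\<eta> * t))) * (\<integral>s. cnj (g s) * exp (2 * pi * \<i> * of_real (\<eta> * s)) \<partial>lborel) \<partial>lborel)"
        by (simp add: cG mult_ac)
      also have "\<dots> = (\<integral>s. cnj (g s) * (\<integral>\<eta>. (of_real (exp (- pi * \<epsilon>\<^sup>2 * \<eta>\<^sup>2)) * exp (- 2 * pi * \<i> * of_real (\<eta> * t))) * exp (2 * pi * \<i> * of_real (\<eta> * s)) \<partial>lborel) \<partial>lborel)"
        by (rule integral_swap_bounded[OF u2]) (use gi in \<open>auto simp: case_prod_unfold intro!: continuous_intros\<close>)
      also have "\<dots> = (\<integral>s. cnj (g s) * of_real (1 / \<epsilon> * exp (- pi * (t - s)\<^sup>2 / \<epsilon>\<^sup>2)) \<partial>lborel)"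
      proof (rule Bochner_Integration.integral_cong[OF refl])
        fix s :: real
        have "(\<integral>\<eta>. (of_real (exp (- pi * \<epsilon>\<^sup>2 * \<eta>\<^sup>2)) * exp (- 2 * pi * \<i> * of_real (\<eta> * t))) * exp (2 * pi * \<i> * of_real (\<eta> * s)) \<partial>lborel)
            = (\<integral>\<eta>. exp (- (pi * \<epsilon>\<^sup>2) * \<eta>\<^sup>2) *\<^sub>R exp (\<i> * of_real ((2 * pi * (s - t)) * \<eta>)) \<partial>lborel)"
          by (intro Bochner_Integration.integral_cong[OF refl]) (simp add: scaleR_conv_of_real mult.assoc flip: exp_add exp_of_real; simp add: algebra_simps)
        also have "\<dots> = of_real (sqrt (pi / (pi * \<epsilon>\<^sup>2)) * exp (- (2 * pi * (s - t))\<^sup>2 / (4 * (pi * \<epsilon>\<^sup>2))))"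
          using \<epsilon> by (intro gaussian_fourier_integral(3)) auto
        also have "sqrt (pi / (pi * \<epsilon>\<^sup>2)) = 1 / \<epsilon>" using \<epsilon> by (simp add: real_sqrt_divide)
        also have "- (2 * pi * (s - t))\<^sup>2 / (4 * (pi * \<epsilon>\<^sup>2)) = - pi * (t - s)\<^sup>2 / \<epsilon>\<^sup>2"
          using \<epsilon> by (simp add: power2_eq_square field_simps)
        finally show "cnj (g s) * (\<integral>\<eta>. (of_real (exp (- pi * \<epsilon>\<^sup>2 * \<eta>\<^sup>2)) * exp (- 2 * pi * \<i> * of_real (\<eta> * t))) * exp (2 * pi * \<i> * of_real (\<eta> * s)) \<partial>lborel)
           = cnj (g s) * of_real (1 / \<epsilon> * exp (- pi * (t - s)\<^sup>2 / \<epsilon>\<^sup>2))" by simp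
      qed
      also have "\<dots> = \<bar>- \<epsilon>\<bar> *\<^sub>R (\<integral>r. cnj (g (t + (- \<epsilon>) * r)) * of_real (1 / \<epsilon> * exp (- pi * (t - (t + (- \<epsilon>) * r))\<^sup>2 / \<epsilon>\<^sup>2)) \<partial>lborel)"
        using \<epsilon> by (intro lborel_integral_real_affine) auto
      also have "\<dots> = (\<integral>r. \<epsilon> *\<^sub>R (cnj (g (t + (- \<epsilon>) * r)) * of_real (1 / \<epsilon> * exp (- pi * (t - (t + (- \<epsilon>) * r))\<^sup>2 / \<epsilon>\<^sup>2))) \<partial>lborel)"
        using \<epsilon> by (simp only: integral_scaleR_right) simp
      also have "\<dots> = (\<integral>r. cnj (g (t - \<epsilon> * r)) * of_real (exp (- pi * r\<^sup>2)) \<partial>lborel)"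
        using \<epsilon> by (intro Bochner_Integration.integral_cong[OF refl]) (simp add: scaleR_conv_of_real power_mult_distrib)
      finally show "g t * (\<integral>\<eta>. (of_real (exp (- pi * \<epsilon>\<^sup>2 * \<eta>\<^sup>2)) * cnj (G \<eta>)) * exp (- 2 * pi * \<i> * of_real (\<eta> * t)) \<partial>lborel)
         = g t * (\<integral>r. cnj (g (t - \<epsilon> * r)) * of_real (exp (- pi * r\<^sup>2)) \<partial>lborel)" by simp
    qed
    finally show ?thesis .
  qed
  define \<epsilon> where "\<epsilon> = (\<lambda>m. 1 / real (Suc m))"
  have \<epsilon>: "\<epsilon> m > 0" "\<epsilon> \<longlonglongrightarrow> 0" for m unfolding \<epsilon>_def by (simp, rule LIMSEQ_Suc[OF lim_const_over_n[of 1]])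
  have pi1: "integrable lborel (\<lambda>r. exp (- pi * r\<^sup>2))" "(\<integral>r. exp (- pi * r\<^sup>2) \<partial>lborel) = 1"
    using gaussian_fourier_integral(1,2)[of pi] by simp_all
  have inner: "(\<lambda>m. \<integral>r. cnj (g (t - \<epsilon> m * r)) * of_real (exp (- pi * r\<^sup>2)) \<partial>lborel) \<longlonglongrightarrow> cnj (g t)" for t
  proof -
    have "(\<lambda>m. \<integral>r. cnj (g (t - \<epsilon> m * r)) * of_real (exp (- pi * r\<^sup>2)) \<partial>lborel) \<longlonglongrightarrow> (\<integral>r. cnj (g t) * of_real (exp (- pi * r\<^sup>2)) \<partial>lborel)"
    proof (rule integral_dominated_convergence[where w = "\<lambda>r. C * exp (- pi * r\<^sup>2)"])
      show "integrable lborel (\<lambda>r. C * exp (- pi * r\<^sup>2))" using pi1 by simp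
      show "AE r in lborel. norm (cnj (g (t - \<epsilon> m * r)) * of_real (exp (- pi * r\<^sup>2))) \<le> C * exp (- pi * r\<^sup>2)" for m
        using gb by (intro AE_I2) (simp add: norm_mult)
      show "AE r in lborel. (\<lambda>m. cnj (g (t - \<epsilon> m * r)) * of_real (exp (- pi * r\<^sup>2))) \<longlonglongrightarrow> cnj (g t) * of_real (exp (- pi * r\<^sup>2))"
      proof (intro AE_I2 tendsto_intros)
        fix r
        have "(\<lambda>m. t - \<epsilon> m * r) \<longlonglongrightarrow> t - 0 * r" by (intro tendsto_intros \<epsilon>)
        thus "(\<lambda>m. g (t - \<epsilon> m * r)) \<longlonglongrightarrow> g t"
          using continuous_on_tendsto_compose[OF gc, of "\<lambda>m. t - \<epsilon> m * r" t sequentially] by simp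
      qed
    qed (auto intro!: borel_measurable_continuous_onI continuous_intros continuous_on_compose2[OF gc])
    also have "(\<integral>r. cnj (g t) * of_real (exp (- pi * r\<^sup>2)) \<partial>lborel) = cnj (g t) * of_real (\<integral>r. exp (- pi * r\<^sup>2) \<partial>lborel)"
      by (simp only: integral_mult_right_zero integral_complex_of_real)
    finally show ?thesis by (simp only: pi1 of_real_1 mult_1_right)
  qed
  have ib: "norm (\<integral>r. cnj (g (t - \<epsilon> m * r)) * of_real (exp (- pi * r\<^sup>2)) \<partial>lborel) \<le> C" for t m
  proof -
    have "norm (\<integral>r. cnj (g (t - \<epsilon> m * r)) * of_real (exp (- pi * r\<^sup>2)) \<partial>lborel) \<le> (\<integral>r. C * exp (- pi * r\<^sup>2) \<partial>lborel)"
    proof (rule order.trans[OF integral_norm_bound integral_mono'])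
      show "integrable lborel (\<lambda>r. C * exp (- pi * r\<^sup>2))" using pi1 by simp
    qed (use gb C0 in \<open>auto simp: norm_mult\<close>)
    thus ?thesis using pi1(2) by simp
  qed
  have "(\<lambda>m. \<integral>t. g t * (\<integral>r. cnj (g (t - \<epsilon> m * r)) * of_real (exp (- pi * r\<^sup>2)) \<partial>lborel) \<partial>lborel) \<longlonglongrightarrow> (\<integral>t. g t * cnj (g t) \<partial>lborel)"
  proof (rule integral_dominated_convergence[where w = "\<lambda>t. norm (g t) * C"])
    show "integrable lborel (\<lambda>t. norm (g t) * C)" using gi by simp
    show "AE t in lborel. norm (g t * (\<integral>r. cnj (g (t - \<epsilon> m * r)) * of_real (exp (- pi * r\<^sup>2)) \<partial>lborel)) \<le> norm (g t) * C" for m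
      unfolding norm_mult by (intro AE_I2 mult_left_mono ib) auto
    show "AE t in lborel. (\<lambda>m. g t * (\<integral>r. cnj (g (t - \<epsilon> m * r)) * of_real (exp (- pi * r\<^sup>2)) \<partial>lborel)) \<longlonglongrightarrow> g t * cnj (g t)"
      by (intro AE_I2 tendsto_intros inner)
    show "(\<lambda>t. g t * cnj (g t)) \<in> borel_measurable lborel" using gc by (auto intro!: borel_measurable_continuous_onI continuous_intros)
    show "(\<lambda>t. g t * (\<integral>r. cnj (g (t - \<epsilon> m * r)) * of_real (exp (- pi * r\<^sup>2)) \<partial>lborel)) \<in> borel_measurable lborel" for m
    proof (intro borel_measurable_times)
      show "g \<in> borel_measurable lborel" using gi by auto
      have "(\<lambda>(t, r). cnj (g (t - \<epsilon> m * r)) * complex_of_real (exp (- pi * r\<^sup>2))) \<in> borel_measurable (lborel \<Otimes>\<^sub>M lborel)"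
        by (intro measurable_pair_continuous) (auto simp: case_prod_unfold intro!: continuous_intros continuous_on_compose2[OF gc])
      thus "(\<lambda>t. \<integral>r. cnj (g (t - \<epsilon> m * r)) * of_real (exp (- pi * r\<^sup>2)) \<partial>lborel) \<in> borel_measurable lborel"
        by (rule lborel.borel_measurable_lebesgue_integral)
    qed
  qed
  hence lim: "(\<lambda>m. \<integral>\<eta>. exp (- pi * (\<epsilon> m)\<^sup>2 * \<eta>\<^sup>2) *\<^sub>R (G \<eta> * cnj (G \<eta>)) \<partial>lborel) \<longlonglongrightarrow> (\<integral>t. g t * cnj (g t) \<partial>lborel)"
    by (simp only: main[OF \<epsilon>(1)])
  have sq: "z * cnj z = of_real ((norm z)\<^sup>2)" for z by (simp only: complex_norm_square)
  have "(\<lambda>m. complex_of_real (\<integral>\<eta>. exp (- pi * (\<epsilon> m)\<^sup>2 * \<eta>\<^sup>2) * (norm (G \<eta>))\<^sup>2 \<partial>lborel)) \<longlonglongrightarrow> of_real (\<integral>t. (norm (g t))\<^sup>2 \<partial>lborel)"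
    using lim by (simp only: sq scaleR_conv_of_real of_real_mult[symmetric] integral_complex_of_real)
  hence lim': "(\<lambda>m. \<integral>\<eta>. exp (- pi * (\<epsilon> m)\<^sup>2 * \<eta>\<^sup>2) * (norm (G \<eta>))\<^sup>2 \<partial>lborel) \<longlonglongrightarrow> (\<integral>t. (norm (g t))\<^sup>2 \<partial>lborel)"
    by (simp only: tendsto_of_real_iff)
  have nn: "(\<integral>\<^sup>+\<eta>. ennreal (exp (- pi * (\<epsilon> m)\<^sup>2 * \<eta>\<^sup>2) * (norm (G \<eta>))\<^sup>2) \<partial>lborel) = ennreal (\<integral>\<eta>. exp (- pi * (\<epsilon> m)\<^sup>2 * \<eta>\<^sup>2) * (norm (G \<eta>))\<^sup>2 \<partial>lborel)" for m
  proof (rule nn_integral_eq_integral)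
    have "integrable lborel (\<lambda>\<eta>. exp (- (pi * (\<epsilon> m)\<^sup>2) * \<eta>\<^sup>2) * B\<^sup>2)" using \<epsilon>(1)[of m] by (intro integrable_mult_left gaussian_fourier_integral(1)) auto
    thus "integrable lborel (\<lambda>\<eta>. exp (- pi * (\<epsilon> m)\<^sup>2 * \<eta>\<^sup>2) * (norm (G \<eta>))\<^sup>2)"
      by (rule Bochner_Integration.integrable_bound) (use Gb in \<open>auto simp: B_def intro!: mult_left_mono power_mono\<close>)
  qed auto
  have "(\<lambda>m. \<integral>\<^sup>+\<eta>. ennreal (exp (- pi * (\<epsilon> m)\<^sup>2 * \<eta>\<^sup>2) * (norm (G \<eta>))\<^sup>2) \<partial>lborel) \<longlonglongrightarrow> (\<integral>\<^sup>+\<eta>. ennreal ((norm (G \<eta>))\<^sup>2) \<partial>lborel)"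
  proof (rule nn_integral_LIMSEQ)
    show "incseq (\<lambda>m \<eta>. ennreal (exp (- pi * (\<epsilon> m)\<^sup>2 * \<eta>\<^sup>2) * (norm (G \<eta>))\<^sup>2))"
    proof (intro incseq_SucI le_funI ennreal_leI mult_right_mono)
      fix m and \<eta> :: real
      have "(\<epsilon> (Suc m))\<^sup>2 \<le> (\<epsilon> m)\<^sup>2" by (intro power_mono) (auto simp: \<epsilon>_def field_simps)
      hence "pi * (\<epsilon> (Suc m))\<^sup>2 * \<eta>\<^sup>2 \<le> pi * (\<epsilon> m)\<^sup>2 * \<eta>\<^sup>2" by (intro mult_right_mono mult_left_mono) auto
      thus "exp (- pi * (\<epsilon> m)\<^sup>2 * \<eta>\<^sup>2) \<le> exp (- pi * (\<epsilon> (Suc m))\<^sup>2 * \<eta>\<^sup>2)" by simp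
    qed auto
    fix \<eta> :: real
    have "(\<lambda>m. exp (- pi * (\<epsilon> m)\<^sup>2 * \<eta>\<^sup>2) * (norm (G \<eta>))\<^sup>2) \<longlonglongrightarrow> exp (- pi * 0\<^sup>2 * \<eta>\<^sup>2) * (norm (G \<eta>))\<^sup>2"
      by (intro tendsto_intros \<epsilon>)
    thus "(\<lambda>m. ennreal (exp (- pi * (\<epsilon> m)\<^sup>2 * \<eta>\<^sup>2) * (norm (G \<eta>))\<^sup>2)) \<longlonglongrightarrow> ennreal ((norm (G \<eta>))\<^sup>2)"
      by (intro tendsto_ennrealI) simp
  qed auto
  moreover have "(\<lambda>m. \<integral>\<^sup>+\<eta>. ennreal (exp (- pi * (\<epsilon> m)\<^sup>2 * \<eta>\<^sup>2) * (norm (G \<eta>))\<^sup>2) \<partial>lborel) \<longlonglongrightarrow> ennreal (\<integral>t. (norm (g t))\<^sup>2 \<partial>lborel)"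
    unfolding nn by (intro tendsto_ennrealI lim')
  ultimately have "(\<integral>\<^sup>+\<eta>. ennreal ((norm (G \<eta>))\<^sup>2) \<partial>lborel) = ennreal (\<integral>t. (norm (g t))\<^sup>2 \<partial>lborel)"
    by (rule LIMSEQ_unique)
  also have "\<dots> = (\<integral>\<^sup>+t. ennreal ((norm (g t))\<^sup>2) \<partial>lborel)"
  proof (rule nn_integral_eq_integral[symmetric])
    show "integrable lborel (\<lambda>t. (norm (g t))\<^sup>2)"
      by (rule Bochner_Integration.integrable_bound[OF integrable_mult_right[OF integrable_norm[OF gi], of C]])
         (use gb C0 gi in \<open>auto simp: power2_eq_square intro!: mult_right_mono\<close>)
  qed auto
  finally show ?thesis .
qed

section \<open>Vanishing Fourier coefficients and rotational averaging\<close>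

lemma integrable_unit_interval:
  fixes h :: "real \<Rightarrow> 'b :: euclidean_space"
  assumes "continuous_on {0..1} h"
  shows "integrable lborel (\<lambda>t. indicator {0..<1} t *\<^sub>R h t)"
proof -
  have "integrable lborel (\<lambda>t. indicator {0..1} t *\<^sub>R h t)" using assms by (intro borel_integrable_compact) auto
  hence "integrable lborel (\<lambda>t. indicator {0..<1} t *\<^sub>R (indicator {0..1} t *\<^sub>R h t))"
    by (rule integrable_mult_indicator[rotated]) simp
  moreover have "indicator {0..<1} t *\<^sub>R (indicator {0..1} t *\<^sub>R h t) = indicator {0..<1} t *\<^sub>R h t" for t by (auto simp: indicator_def)
  ultimately show ?thesis by (simp only:)
qed

text \<open>The test polynomials are powers of \<open>cos\<^sup>2 (\<pi> (t - t\<^sub>0))\<close>, which peak at \<open>t\<^sub>0\<close>.\<close>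
lemma continuous_trig_coefficients_zero_1:
  fixes f :: "real \<Rightarrow> complex"
  assumes f: "continuous_on {0..1} f"
    and coeff: "\<And>m :: int. (\<integral>t. indicator {0..<1} t *\<^sub>R (f t * exp (2 * pi * \<i> * of_int m * of_real t)) \<partial>lborel) = 0"
    and t0: "0 < t0" "t0 < 1"
  shows "f t0 = 0"
proof (rule ccontr)
  assume nz: "f t0 \<noteq> 0"
  let ?I = "indicator {0..<1} :: real \<Rightarrow> real"
  note int = integrable_unit_interval
  define T where "T = (\<lambda>t. (cos (pi * (t - t0)))\<^sup>2)"
  have Tc: "continuous_on A T" for A unfolding T_def by (intro continuous_intros)
  have zero: "(\<integral>t. ?I t *\<^sub>R (f t * of_real (T t ^ N)) \<partial>lborel) = 0" for N
  proof -
    \<comment> \<open>With z = exp (i pi (t - t0)) the cosine is (z^2 + 1) / (2 z). After the even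
      power 2 N only even powers of z occur, hence integer frequencies in t.\<close>
    have T4: "of_real (T t ^ N) = (\<Sum>j\<le>2*N. (of_nat (2 * N choose j) / 4 ^ N * exp (- (2 * pi * \<i> * of_int (int j - int N) * of_real t0))) * exp (2 * pi * \<i> * of_int (int j - int N) * of_real t))" for t
    proof -
      define z where "z = exp (\<i> * of_real (pi * (t - t0)))"
      have z0: "z \<noteq> 0" by (simp add: z_def)
      have "of_real (cos (pi * (t - t0))) = (z + inverse z) / 2"
        unfolding z_def cos_of_real[symmetric] cos_exp_eq by (simp add: exp_minus)
      also have "\<dots> = (z\<^sup>2 + 1) / (2 * z)" using z0 by (simp add: field_simps power2_eq_square)
      finally have "complex_of_real (T t ^ N) = ((z\<^sup>2 + 1) / (2 * z)) ^ (2 * N)"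
        by (simp add: T_def power_mult)
      also have "\<dots> = (z\<^sup>2 + 1) ^ (2 * N) / (4 ^ N * z ^ (2 * N))"
        by (simp add: power_divide power_mult_distrib power_mult)
      also have "(z\<^sup>2 + 1) ^ (2 * N) = (\<Sum>j\<le>2*N. of_nat (2 * N choose j) * (z\<^sup>2) ^ j)"
        unfolding binomial_ring by simp
      also have "\<dots> / (4 ^ N * z ^ (2 * N)) = (\<Sum>j\<le>2*N. (of_nat (2 * N choose j) / 4 ^ N * exp (- (2 * pi * \<i> * of_int (int j - int N) * of_real t0))) * exp (2 * pi * \<i> * of_int (int j - int N) * of_real t))"
        unfolding sum_divide_distrib
      proof (rule sum.cong[OF refl])
        fix j
        have zp: "z ^ (2 * k) = exp (2 * pi * \<i> * of_nat k * of_real (t - t0))" for k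
          unfolding z_def exp_of_nat_mult[symmetric] by (simp add: mult_ac)
        have "(z\<^sup>2) ^ j / z ^ (2 * N) = exp (2 * pi * \<i> * of_int (int j - int N) * of_real (t - t0))"
          unfolding power_mult[symmetric] zp exp_diff[symmetric] by (simp add: algebra_simps)
        also have "\<dots> = exp (- (2 * pi * \<i> * of_int (int j - int N) * of_real t0)) * exp (2 * pi * \<i> * of_int (int j - int N) * of_real t)"
          unfolding exp_add[symmetric] by (simp add: algebra_simps)
        finally have q: "(z\<^sup>2) ^ j / z ^ (2 * N) = exp (- (2 * pi * \<i> * of_int (int j - int N) * of_real t0)) * exp (2 * pi * \<i> * of_int (int j - int N) * of_real t)" .
        have "of_nat (2 * N choose j) * (z\<^sup>2) ^ j / (4 ^ N * z ^ (2 * N)) = of_nat (2 * N choose j) / 4 ^ N * ((z\<^sup>2) ^ j / z ^ (2 * N))" by simp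
        thus "of_nat (2 * N choose j) * (z\<^sup>2) ^ j / (4 ^ N * z ^ (2 * N)) = (of_nat (2 * N choose j) / 4 ^ N * exp (- (2 * pi * \<i> * of_int (int j - int N) * of_real t0))) * exp (2 * pi * \<i> * of_int (int j - int N) * of_real t)"
          unfolding q by (simp only: mult.assoc)
      qed
      finally show ?thesis .
    qed
    define b where "b = (\<lambda>j. of_nat (2 * N choose j) / 4 ^ N * exp (- (2 * pi * \<i> * of_int (int j - int N) * of_real t0)))"
    define E where "E = (\<lambda>j t. exp (2 * pi * \<i> * of_int (int j - int N) * of_real t))"
    have Ec: "continuous_on A (E j)" for A j unfolding E_def by (intro continuous_intros)
    have i: "integrable lborel (\<lambda>t. b j * (?I t *\<^sub>R (f t * E j t)))" for j
      by (intro integrable_mult_right int continuous_on_mult f Ec)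
    have "?I t *\<^sub>R (f t * of_real (T t ^ N)) = (\<Sum>j\<le>2*N. b j * (?I t *\<^sub>R (f t * E j t)))" for t
      unfolding T4 b_def E_def scaleR_conv_of_real sum_distrib_left by (intro sum.cong refl) (simp only: mult_ac)
    hence "(\<integral>t. ?I t *\<^sub>R (f t * of_real (T t ^ N)) \<partial>lborel) = (\<Sum>j\<le>2*N. b j * (\<integral>t. ?I t *\<^sub>R (f t * exp (2 * pi * \<i> * of_int (int j - int N) * of_real t)) \<partial>lborel))"
      by (simp only: Bochner_Integration.integral_sum[OF i] integral_mult_right_zero) (simp only: E_def)
    thus ?thesis by (simp only: coeff mult_zero_right sum.neutral_const)
  qed
  \<comment> \<open>Multiplying by cnj (f t0) makes the value at t0 real and positive; the real part
    inherits the vanishing moments.\<close>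
  define g where "g = (\<lambda>t. Re (cnj (f t0) * f t))"
  have gc: "continuous_on {0..1} g" unfolding g_def using f by (intro continuous_intros)
  have gzero: "(\<integral>t. ?I t * (g t * T t ^ N) \<partial>lborel) = 0" for N
  proof -
    have i: "integrable lborel (\<lambda>t. cnj (f t0) * (?I t *\<^sub>R (f t * of_real (T t ^ N))))"
      using f Tc by (intro integrable_mult_right int continuous_intros)
    have "?I t * (g t * T t ^ N) = Re (cnj (f t0) * (?I t *\<^sub>R (f t * of_real (T t ^ N))))" for t
      unfolding g_def by (simp add: algebra_simps)
    hence "(\<integral>t. ?I t * (g t * T t ^ N) \<partial>lborel) = (\<integral>t. Re (cnj (f t0) * (?I t *\<^sub>R (f t * of_real (T t ^ N)))) \<partial>lborel)" by presburger
    also have "\<dots> = Re (\<integral>t. cnj (f t0) * (?I t *\<^sub>R (f t * of_real (T t ^ N))) \<partial>lborel)" by (rule integral_Re[OF i])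
    also have "\<dots> = 0" by (simp only: integral_mult_right_zero zero mult_zero_right zero_complex.sel)
    finally show ?thesis .
  qed
  have g0: "g t0 > 0"
  proof -
    have "cnj (f t0) * f t0 = of_real ((norm (f t0))\<^sup>2)" by (metis complex_norm_square mult.commute)
    hence "g t0 = (norm (f t0))\<^sup>2" unfolding g_def by (simp only: Re_complex_of_real)
    thus ?thesis using nz by simp
  qed
  define h where "h = g t0 / 2"
  have h: "h > 0" using g0 by (simp add: h_def)
  obtain d where d: "d > 0" "\<And>t. t \<in> {0..1} \<Longrightarrow> dist t t0 < d \<Longrightarrow> dist (g t) (g t0) < h"
    using gc[unfolded continuous_on_iff, rule_format, of t0 h] t0 h by auto
  \<comment> \<open>Besides continuity at t0, \<open>\<delta>\<close> must keep the interval inside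
    (0, 1). As the test function has period 1, it must also exclude points at distance almost 1 from
    t0, where it peaks again.\<close>
  define \<delta> where "\<delta> = min (d / 2) (min (1/4) (min t0 (1 - t0) / 2))"
  have \<delta>: "\<delta> > 0" "\<delta> \<le> 1/4" "\<delta> < d" "\<delta> < t0" "\<delta> < 1 - t0" using d t0 by (auto simp: \<delta>_def min_def)
  have near: "g t \<ge> h" if "\<bar>t - t0\<bar> \<le> \<delta>" for t
  proof -
    have "t \<in> {0..1}" "dist t t0 < d" using that \<delta> by (auto simp: dist_real_def abs_if split: if_splits)
    from d(2)[OF this] show ?thesis by (simp add: dist_real_def h_def abs_if split: if_splits)
  qed
  have "bounded (g ` {0..1})" by (intro compact_imp_bounded compact_continuous_image gc) auto
  then obtain B where B: "B > 0" "\<And>t. t \<in> {0..1} \<Longrightarrow> \<bar>g t\<bar> \<le> B" unfolding bounded_pos by auto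
  \<comment> \<open>\<open>r\<close> bounds the test function outside the \<open>\<delta>\<close>
    interval, \<open>r'\<close> bounds it from below on half of that interval; r < r' drives the
    contradiction.\<close>
  define r where "r = (cos (pi * \<delta>))\<^sup>2"
  define r' where "r' = (cos (pi * (\<delta> / 2)))\<^sup>2"
  have c0: "cos (pi * \<delta>) > 0" using \<delta> pi_gt_zero by (intro cos_gt_zero_pi) (auto simp: mult_less_cancel_left_pos intro: order.strict_trans2[of _ 0])
  have rr: "0 < r" "r < r'"
  proof -
    show "0 < r" using c0 by (simp add: r_def)
    have "cos (pi * \<delta>) < cos (pi * (\<delta> / 2))" using \<delta> by (intro cos_monotone_0_pi) auto
    thus "r < r'" unfolding r_def r'_def using c0 by (intro power_strict_mono) auto
  qed
  have T_far: "T t \<le> r" if "t \<in> {0..<1}" "\<bar>t - t0\<bar> \<ge> \<delta>" for t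
  proof -
    have "\<bar>t - t0\<bar> \<le> 1 - \<delta>" using that \<delta> by (auto simp: abs_if)
    hence "\<bar>cos (pi * (t - t0))\<bar> \<le> cos (pi * \<delta>)"
    proof -
      define x where "x = \<bar>t - t0\<bar>"
      have x: "\<delta> \<le> x" "x \<le> 1 - \<delta>" using that \<open>\<bar>t - t0\<bar> \<le> 1 - \<delta>\<close> by (auto simp: x_def)
      have e: "cos (pi * (t - t0)) = cos (pi * x)" using cos_abs_real[of "pi * (t - t0)"] by (simp add: abs_mult x_def)
      have xpi: "pi * x \<le> pi" using x \<delta> by (simp add: mult_le_cancel_left1)
      have up: "cos (pi * x) \<le> cos (pi * \<delta>)" using x \<delta> xpi by (intro cos_monotone_0_pi_le) auto
      have "cos (pi * (1 - \<delta>)) \<le> cos (pi * x)" using x \<delta> by (intro cos_monotone_0_pi_le) (auto simp: mult_le_cancel_left1)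
      moreover have "cos (pi * (1 - \<delta>)) = - cos (pi * \<delta>)" by (simp add: right_diff_distrib cos_diff)
      ultimately show ?thesis unfolding e using up by (simp add: abs_le_iff)
    qed
    thus ?thesis unfolding T_def r_def by (metis abs_ge_zero power2_abs power_mono)
  qed
  have T_near: "r' \<le> T t" if "\<bar>t - t0\<bar> \<le> \<delta> / 2" for t
  proof -
    define x where "x = \<bar>t - t0\<bar>"
    have e: "cos (pi * (t - t0)) = cos (pi * x)" using cos_abs_real[of "pi * (t - t0)"] by (simp add: abs_mult x_def)
    have "pi * (\<delta> / 2) \<le> pi" using \<delta> by (simp add: mult_le_cancel_left1)
    hence "cos (pi * (\<delta> / 2)) \<le> cos (pi * x)" using that \<delta> by (intro cos_monotone_0_pi_le) (auto simp: x_def)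
    moreover have "cos (pi * (\<delta> / 2)) \<ge> 0" using c0 rr cos_monotone_0_pi[of "pi * (\<delta> / 2)" "pi * \<delta>"] \<delta> by auto
    ultimately show ?thesis unfolding T_def r'_def e by (intro power_mono) auto
  qed
  have T0: "0 \<le> T t" for t by (simp add: T_def)
  have pw: "?I t * (g t * T t ^ N) \<ge> (h * r' ^ N) * indicator {t0 - \<delta> / 2..t0 + \<delta> / 2} t - (B * r ^ N) * ?I t" for t N
  proof (cases "t \<in> {0..<1}")
    case False
    moreover have "t \<notin> {t0 - \<delta> / 2..t0 + \<delta> / 2}" using False \<delta> by auto
    ultimately show ?thesis by simp
  next
    case t: True
    consider "\<bar>t - t0\<bar> \<le> \<delta> / 2" | "\<delta> / 2 < \<bar>t - t0\<bar>" "\<bar>t - t0\<bar> < \<delta>" | "\<delta> \<le> \<bar>t - t0\<bar>" by linarith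
    thus ?thesis
    proof cases
      case 1
      have "h * r' ^ N \<le> g t * T t ^ N" using near[of t] T_near[OF 1] 1 \<delta> h rr by (intro mult_mono power_mono) auto
      moreover have "t \<in> {t0 - \<delta> / 2..t0 + \<delta> / 2}" using 1 unfolding atLeastAtMost_iff by arith
      moreover have "0 \<le> B * r ^ N" using B rr by simp
      ultimately show ?thesis using t by simp
    next
      case 2
      have "0 \<le> g t * T t ^ N" using near[of t] 2 h T0 by (intro mult_nonneg_nonneg) auto
      moreover have "t \<notin> {t0 - \<delta> / 2..t0 + \<delta> / 2}" using 2 unfolding atLeastAtMost_iff by arith
      moreover have "0 \<le> B * r ^ N" using B rr by simp
      ultimately show ?thesis using t by simp
    next
      case 3
      have "\<bar>g t * T t ^ N\<bar> \<le> B * r ^ N"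
        unfolding abs_mult using B(2)[of t] t T_far[OF t 3] T0[of t] B(1) by (intro mult_mono) (auto intro!: power_mono)
      moreover have "t \<notin> {t0 - \<delta> / 2..t0 + \<delta> / 2}" using 3 \<delta> by (auto simp: abs_if split: if_splits)
      ultimately show ?thesis using t by (simp add: abs_le_iff)
    qed
  qed
  \<comment> \<open>Integrating the pointwise bound against the vanishing moment: the peak
    contributes at least h \<delta> r' ^ N, the rest at most B r ^ N in modulus.\<close>
  have ineq: "h * \<delta> * r' ^ N \<le> B * r ^ N" for N
  proof -
    have "(\<integral>t. (h * r' ^ N) * indicator {t0 - \<delta> / 2..t0 + \<delta> / 2} t - (B * r ^ N) * ?I t \<partial>lborel) \<le> (\<integral>t. ?I t * (g t * T t ^ N) \<partial>lborel)"
    proof (rule integral_mono)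
      show "integrable lborel (\<lambda>t. ?I t * (g t * T t ^ N))" using int[OF continuous_on_mult[OF gc continuous_on_power[OF Tc]], of N] by (simp only: real_scaleR_def)
      show "integrable lborel (\<lambda>t. (h * r' ^ N) * indicator {t0 - \<delta> / 2..t0 + \<delta> / 2} t - (B * r ^ N) * ?I t)"
        by (intro Bochner_Integration.integrable_diff integrable_mult_right integrable_real_indicator) (simp_all add: emeasure_lborel_Icc_eq)
    qed (rule pw)
    also have "\<dots> = 0" by (rule gzero)
    finally have "(h * r' ^ N) * \<delta> - B * r ^ N \<le> 0"
      using \<delta> by (subst (asm) Bochner_Integration.integral_diff) (auto intro!: integrable_mult_right integrable_real_indicator simp: emeasure_lborel_Icc_eq)
    thus ?thesis by (simp add: mult_ac)
  qed
  have "(r' / r) ^ N \<le> B / (h * \<delta>)" for N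
    using ineq[of N] h \<delta> rr by (simp add: field_simps power_divide)
  moreover obtain N where "B / (h * \<delta>) < (r' / r) ^ N"
    using real_arch_pow[of "r' / r" "B / (h * \<delta>)"] rr by auto
  ultimately show False using not_less by blast
qed

text \<open>The one-dimensional result is applied twice, first to the partial Fourier coefficients
  \<open>G m\<close> and then to \<open>p\<close> on each vertical line. It reaches interior points
  only, so the corner follows by continuity.\<close>

lemma continuous_trig_coefficients_zero_2:
  fixes p :: "real \<times> real \<Rightarrow> complex"
  assumes p: "continuous_on UNIV p"
    and coeff: "\<And>m l :: int. (\<integral>q. p q * exp (2 * pi * \<i> * (of_int m * of_real (snd q) - of_int l * of_real (fst q))) \<partial>unit_square) = 0"
  shows "p (0, 0) = 0"
proof -
  let ?I = "indicator {0..<1} :: real \<Rightarrow> real"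
  let ?S = "{0..<1} \<times> {0..<1} :: (real \<times> real) set"
  define e where "e = (\<lambda>(m :: int) (t :: real). exp (2 * pi * \<i> * of_int m * of_real t) :: complex)"
  have ec: "continuous_on A (e m)" for A m unfolding e_def by (intro continuous_intros)
  have pc1: "continuous_on A (\<lambda>t. p (s, t))" for A s by (intro continuous_on_compose2[OF p] continuous_intros) auto
  define G where "G = (\<lambda>m s. \<integral>t. ?I t *\<^sub>R (p (s, t) * e m t) \<partial>lborel)"
  have Gc: "continuous_on {0..1} (G m)" for m
  proof -
    have "bounded (p ` ({0..1} \<times> {0..1}))" by (intro compact_imp_bounded compact_continuous_image compact_Times continuous_on_subset[OF p]) auto
    then obtain B where B: "B > 0" "\<And>s t. s \<in> {0..1} \<Longrightarrow> t \<in> {0..1} \<Longrightarrow> norm (p (s, t)) \<le> B" unfolding bounded_pos by auto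
    show ?thesis unfolding continuous_on_sequentially o_def
    proof safe
      fix s and x :: real assume s: "\<forall>k. s k \<in> {0..1}" "x \<in> {0..1}" "s \<longlonglongrightarrow> x"
      show "(\<lambda>k. G m (s k)) \<longlonglongrightarrow> G m x" unfolding G_def
      proof (rule integral_dominated_convergence[where w = "\<lambda>t. ?I t * B"])
        show "integrable lborel (\<lambda>t. ?I t * B)" by (intro integrable_mult_left integrable_real_indicator) auto
        show "AE t in lborel. norm (?I t *\<^sub>R (p (s k, t) * e m t)) \<le> ?I t * B" for k
          using B s(1) by (intro AE_I2) (auto simp: indicator_def norm_mult e_def norm_exp_eq_Re)
        show "AE t in lborel. (\<lambda>k. ?I t *\<^sub>R (p (s k, t) * e m t)) \<longlonglongrightarrow> ?I t *\<^sub>R (p (x, t) * e m t)"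
        proof (intro AE_I2 tendsto_intros)
          fix t :: real
          have "(\<lambda>k. (s k, t)) \<longlonglongrightarrow> (x, t)" by (intro tendsto_intros s)
          thus "(\<lambda>k. p (s k, t)) \<longlonglongrightarrow> p (x, t)" using continuous_on_tendsto_compose[OF p] by auto
        qed
      qed (intro borel_measurable_integrable integrable_unit_interval continuous_on_mult pc1 ec)+
    qed
  qed
  have eq: "unit_square = density (lborel \<Otimes>\<^sub>M lborel) (\<lambda>p. ennreal (indicator ?S p))"
    unfolding unit_square_def by (simp add: ennreal_indicator)
  have S: "?S \<in> sets (lborel \<Otimes>\<^sub>M lborel)" by (intro pair_measureI) auto
  have G0: "(\<integral>s. ?I s *\<^sub>R (G m s * e l s) \<partial>lborel) = 0" for m l
  proof -
    define F where "F = (\<lambda>q. p q * exp (2 * pi * \<i> * (of_int m * of_real (snd q) - of_int (- l) * of_real (fst q))))"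
    have Fc: "continuous_on A F" for A unfolding F_def by (intro continuous_intros continuous_on_subset[OF p]) auto
    have Fm: "F \<in> borel_measurable (lborel \<Otimes>\<^sub>M lborel)" by (rule measurable_pair_continuous[OF Fc])
    have "bounded (F ` ({0..1} \<times> {0..1}))" by (intro compact_imp_bounded compact_continuous_image compact_Times Fc) auto
    then obtain B where B: "B > 0" "\<And>q. q \<in> {0..1} \<times> {0..1} \<Longrightarrow> norm (F q) \<le> B" unfolding bounded_pos by auto
    have iS: "integrable (lborel \<Otimes>\<^sub>M lborel) (\<lambda>q. indicator ?S q * B)"
    proof (intro integrable_mult_left integrable_real_indicator S)
      have "emeasure (lborel \<Otimes>\<^sub>M lborel) ?S = emeasure lborel {0..<1::real} * emeasure lborel {0..<1::real}"
        by (rule lborel.emeasure_pair_measure_Times) auto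
      thus "emeasure (lborel \<Otimes>\<^sub>M lborel) ?S < \<infinity>" by simp
    qed
    have int2: "integrable (lborel \<Otimes>\<^sub>M lborel) (\<lambda>q. indicator ?S q *\<^sub>R F q)"
    proof (rule Bochner_Integration.integrable_bound[OF iS])
      show "AE q in lborel \<Otimes>\<^sub>M lborel. norm (indicator ?S q *\<^sub>R F q) \<le> norm (indicator ?S q * B)"
        using B by (intro AE_I2) (auto simp: indicator_def)
    qed (use Fm S in auto)
    have "0 = (\<integral>q. F q \<partial>unit_square)" unfolding F_def by (rule coeff[symmetric])
    also have "\<dots> = (\<integral>q. indicator ?S q *\<^sub>R F q \<partial>(lborel \<Otimes>\<^sub>M lborel))"
      unfolding eq by (rule integral_density) (use Fm S in auto)
    also have "\<dots> = (\<integral>s. \<integral>t. indicator ?S (s, t) *\<^sub>R F (s, t) \<partial>lborel \<partial>lborel)"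
      using lborel_pair.integral_fst'[OF int2] by simp
    also have "\<dots> = (\<integral>s. ?I s *\<^sub>R (G m s * e l s) \<partial>lborel)"
    proof (rule Bochner_Integration.integral_cong[OF refl])
      fix s
      have "indicator ?S (s, t) *\<^sub>R F (s, t) = (?I s *\<^sub>R e l s) * (?I t *\<^sub>R (p (s, t) * e m t))" for t
      proof -
        have "exp (2 * pi * \<i> * (of_int m * of_real t - of_int (- l) * of_real s)) = e l s * e m t"
          unfolding e_def exp_add[symmetric] by (simp add: algebra_simps)
        thus ?thesis unfolding F_def by (simp add: indicator_times scaleR_conv_of_real mult_ac)
      qed
      thus "(\<integral>t. indicator ?S (s, t) *\<^sub>R F (s, t) \<partial>lborel) = ?I s *\<^sub>R (G m s * e l s)"
        unfolding G_def by (simp only: integral_mult_right_zero) (simp add: scaleR_conv_of_real mult_ac)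
    qed
    finally show ?thesis by simp
  qed
  have Gz: "G m s = 0" if "0 < s" "s < 1" for m s
    by (rule continuous_trig_coefficients_zero_1[OF Gc _ that]) (use G0 in \<open>simp add: e_def\<close>)
  have pz: "p (s, t) = 0" if "0 < s" "s < 1" "0 < t" "t < 1" for s t
    by (rule continuous_trig_coefficients_zero_1[OF pc1 _ that(3,4)]) (use Gz[OF that(1,2)] in \<open>simp add: G_def e_def\<close>)
  \<comment> \<open>The double successor puts every term, including k = 0, strictly between 0 and
    1.\<close>
  have "(\<lambda>k. (1 / real (Suc (Suc k)), 1 / real (Suc (Suc k)))) \<longlonglongrightarrow> (0, 0)"
    by (intro tendsto_Pair LIMSEQ_Suc[OF LIMSEQ_Suc[OF lim_const_over_n]])
  hence "(\<lambda>k. p (1 / real (Suc (Suc k)), 1 / real (Suc (Suc k)))) \<longlonglongrightarrow> p (0, 0)"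
    using continuous_on_tendsto_compose[OF p] by auto
  moreover have "p (1 / real (Suc (Suc k)), 1 / real (Suc (Suc k))) = 0" for k by (intro pz) auto
  ultimately show ?thesis using LIMSEQ_unique[OF _ tendsto_const] by simp
qed

section \<open>Rotational averaging\<close>

lemma distr_lborel_rotation:
  assumes "norm (u :: complex) = 1"
  shows "distr lborel borel (\<lambda>z. u * z) = lborel"
proof (rule measure_eqI)
  fix A :: "complex set" assume "A \<in> sets (distr lborel borel (\<lambda>z. u * z))"
  hence A: "A \<in> sets borel" by simp
  have m: "(\<lambda>z. u * z) \<in> borel_measurable borel" by (intro borel_measurable_continuous_onI continuous_intros)
  have mA: "(\<lambda>z. indicator A (u * z) :: ennreal) \<in> borel_measurable borel"
    using measurable_compose[OF m borel_measurable_indicator[OF A]] by simp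
  \<comment> \<open>The numbers u and i u span a cell of area 1, so both sides are the same
    coordinate integral in two bases.\<close>
  have iu: "Im (cnj u * (\<i> * u)) = 1"
  proof -
    have "cnj u * (\<i> * u) = \<i> * (u * cnj u)" by simp
    also have "u * cnj u = 1" using assms by (simp add: complex_norm_square[symmetric])
    finally show ?thesis by (simp only: mult_1_right imaginary_unit.sel)
  qed
  have "emeasure (distr lborel borel (\<lambda>z. u * z)) A = (\<integral>\<^sup>+z. indicator A z \<partial>distr lborel borel (\<lambda>z. u * z))" using A by simp
  also have "\<dots> = (\<integral>\<^sup>+z. indicator A (u * z) \<partial>lborel)" by (rule nn_integral_distr) (use m A in auto)
  also have "\<dots> = ennreal \<bar>Im (cnj 1 * \<i>)\<bar> * (\<integral>\<^sup>+p. indicator A (u * (of_real (fst p) * 1 + of_real (snd p) * \<i>)) \<partial>(lborel \<Otimes>\<^sub>M lborel))"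
    by (rule nn_integral_complex_basis[OF mA]) simp
  also have "\<dots> = ennreal \<bar>Im (cnj u * (\<i> * u))\<bar> * (\<integral>\<^sup>+p. indicator A (of_real (fst p) * u + of_real (snd p) * (\<i> * u)) \<partial>(lborel \<Otimes>\<^sub>M lborel))"
    unfolding iu by (simp add: algebra_simps)
  also have "\<dots> = (\<integral>\<^sup>+z. indicator A z \<partial>lborel)"
    by (rule nn_integral_complex_basis[symmetric]) (use A iu in auto)
  finally show "emeasure (distr lborel borel (\<lambda>z. u * z)) A = emeasure lborel A" using A by simp
qed simp

lemma integral_rotation:
  fixes f :: "complex \<Rightarrow> complex"
  assumes "norm (u :: complex) = 1" "f \<in> borel_measurable borel"
  shows "(\<integral>z. f (u * z) \<partial>lborel) = (\<integral>z. f z \<partial>lborel)"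
proof -
  have "(\<integral>z. f z \<partial>distr lborel borel (\<lambda>z. u * z)) = (\<integral>z. f (u * z) \<partial>lborel)"
    by (rule integral_distr) (use assms(2) in \<open>auto intro!: borel_measurable_continuous_onI continuous_intros\<close>)
  thus ?thesis unfolding distr_lborel_rotation[OF assms(1)] by simp
qed

lemma circle_integral_zero:
  fixes h :: "complex \<Rightarrow> complex"
  assumes "h holomorphic_on UNIV"
  shows "(\<integral>\<theta>. indicator {0..1} \<theta> *\<^sub>R (exp (2 * pi * \<i> * of_real \<theta>) * h (exp (2 * pi * \<i> * of_real \<theta>))) \<partial>lborel) = 0"
proof -
  let ?e = "\<lambda>\<theta> :: real. exp (2 * pi * \<i> * of_real \<theta>) :: complex"
  have hc: "continuous_on UNIV h" by (rule holomorphic_on_imp_continuous_on[OF assms])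
  have c: "continuous_on {0..1} (\<lambda>\<theta>. ?e \<theta> * h (?e \<theta>))" by (intro continuous_intros continuous_on_compose2[OF hc]) auto
  have "(h has_contour_integral 0) (circlepath 0 1)"
    by (rule Cauchy_theorem_convex_simple[OF assms]) auto
  hence "((\<lambda>\<theta>. h (circlepath 0 1 \<theta>) * vector_derivative (circlepath 0 1) (at \<theta> within {0..1})) has_integral 0) {0..1}"
    by (simp add: has_contour_integral_def)
  hence "((\<lambda>\<theta>. (2 * pi * \<i>) * (?e \<theta> * h (?e \<theta>))) has_integral 0) {0..1}"
    by (rule has_integral_eq[rotated]) (simp only: vector_derivative_circlepath01 atLeastAtMost_iff, simp add: circlepath mult_ac)
  hence "integral {0..1} (\<lambda>\<theta>. (2 * pi * \<i>) * (?e \<theta> * h (?e \<theta>))) = 0" by (rule integral_unique)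
  hence "integral {0..1} (\<lambda>\<theta>. ?e \<theta> * h (?e \<theta>)) = 0" by simp
  moreover have "(LINT \<theta>:{0..1}|lborel. ?e \<theta> * h (?e \<theta>)) = integral {0..1} (\<lambda>\<theta>. ?e \<theta> * h (?e \<theta>))"
    using c by (intro set_borel_integral_eq_integral(2) borel_integrable_compact[unfolded set_integrable_def[symmetric]]) auto
  ultimately show ?thesis by (simp add: set_lebesgue_integral_def)
qed

text \<open>The integral is unchanged under rotation of \<open>y\<close>, hence equals its average
  over the circle. For fixed \<open>y\<close> the rotated integrand is an entire function of the
  rotation times one extra power, whose circle integral is zero by Cauchy's theorem.\<close>

lemma integral_vanishing_order:
  fixes R :: "complex \<Rightarrow> complex"
  assumes R: "R holomorphic_on UNIV" and k: "k < n" and \<epsilon>: "\<epsilon> > 0"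
    and bound: "\<And>y. norm (y ^ n * R y) \<le> B * exp ((pi - \<epsilon>) * (norm y)\<^sup>2)"
  shows "(\<integral>y. y ^ n * R y * (c - cnj y) ^ k * of_real (exp (- pi * (norm y)\<^sup>2)) \<partial>lborel) = 0"
proof -
  define \<Theta> where "\<Theta> = (\<lambda>y. y ^ n * R y * (c - cnj y) ^ k * of_real (exp (- pi * (norm y)\<^sup>2)))"
  have Rc: "continuous_on UNIV R" by (rule holomorphic_on_imp_continuous_on[OF R])
  have \<Theta>c: "continuous_on UNIV \<Theta>" unfolding \<Theta>_def by (intro continuous_intros continuous_on_subset[OF Rc]) auto
  let ?e = "\<lambda>\<theta> :: real. exp (2 * pi * \<i> * of_real \<theta>) :: complex"
  have ne: "norm (?e \<theta>) = 1" for \<theta> by (simp add: norm_exp_eq_Re)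
  have B0: "B \<ge> 0" using order.trans[OF norm_ge_zero bound[of 0]] by simp
  \<comment> \<open>Half of the margin \<open>\<epsilon>\<close> absorbs the polynomial factor; the
    other half keeps the integrand of Gaussian size, as Fubini requires.\<close>
  obtain C where C: "C \<ge> 0" "\<And>y :: complex. (norm c + norm y) ^ k \<le> C * exp (\<epsilon> / 2 * (norm y)\<^sup>2)"
  proof -
    have "gaussian_decay (\<lambda>t. of_real (poly ([:norm c, 1:] ^ k) (t - 0) * exp (- (\<epsilon> / 2) * (t - 0)\<^sup>2)))" using \<epsilon> by (intro gaussian_decay_poly) auto
    then obtain C d where C: "d > 0" "\<And>t. norm (complex_of_real (poly ([:norm c, 1:] ^ k) (t - 0) * exp (- (\<epsilon> / 2) * (t - 0)\<^sup>2))) \<le> C * exp (- d * t\<^sup>2)"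
      unfolding gaussian_decay_def by blast
    have C0: "C \<ge> 0" using order.trans[OF norm_ge_zero C(2)[of 0]] by simp
    have "(norm c + norm y) ^ k \<le> C * exp (\<epsilon> / 2 * (norm y)\<^sup>2)" for y :: complex
    proof -
      have "(norm c + norm y) ^ k * exp (- (\<epsilon> / 2) * (norm y)\<^sup>2) \<le> C * exp (- d * (norm y)\<^sup>2)"
        using C(2)[of "norm y"] unfolding norm_of_real abs_mult by simp
      also have "\<dots> \<le> C * 1" using C(1) C0 by (intro mult_left_mono) auto
      finally have "(norm c + norm y) ^ k * exp (- (\<epsilon> / 2) * (norm y)\<^sup>2) * exp (\<epsilon> / 2 * (norm y)\<^sup>2) \<le> C * 1 * exp (\<epsilon> / 2 * (norm y)\<^sup>2)"
        by (rule mult_right_mono) simp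
      moreover have "exp (- (\<epsilon> / 2) * (norm y)\<^sup>2) * exp (\<epsilon> / 2 * (norm y)\<^sup>2) = 1" unfolding exp_add[symmetric] by simp
      ultimately show ?thesis by (simp only: mult.assoc mult_1_right mult_1_left)
    qed
    thus thesis by (rule that[OF C0])
  qed
  have \<Theta>b: "norm (\<Theta> y) \<le> B * C * exp (- (\<epsilon> / 2) * (norm y)\<^sup>2)" for y
  proof -
    have "norm ((c - cnj y) ^ k) \<le> C * exp (\<epsilon> / 2 * (norm y)\<^sup>2)"
    proof -
      have "norm ((c - cnj y) ^ k) \<le> (norm c + norm y) ^ k" unfolding norm_power
        using norm_triangle_ineq4[of c "cnj y"] by (intro power_mono) auto
      thus ?thesis using C(2)[of y] by linarith
    qed
    hence "norm (\<Theta> y) \<le> (B * exp ((pi - \<epsilon>) * (norm y)\<^sup>2)) * (C * exp (\<epsilon> / 2 * (norm y)\<^sup>2)) * exp (- pi * (norm y)\<^sup>2)"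
      unfolding \<Theta>_def norm_mult[of "y ^ n * R y * (c - cnj y) ^ k"] norm_mult[of "y ^ n * R y"]
      using bound[of y] B0 C(1) by (intro mult_mono) auto
    also have "\<dots> = B * C * (exp ((pi - \<epsilon>) * (norm y)\<^sup>2) * exp (\<epsilon> / 2 * (norm y)\<^sup>2) * exp (- pi * (norm y)\<^sup>2))" by (simp only: mult_ac)
    also have "\<dots> = B * C * exp (- (\<epsilon> / 2) * (norm y)\<^sup>2)"
      unfolding exp_add[symmetric] by (simp add: algebra_simps)
    finally show ?thesis .
  qed
  have Gi: "integrable lborel (\<lambda>y :: complex. B * C * exp (- (\<epsilon> / 2) * (norm y)\<^sup>2))"
  proof -
    have m: "(\<lambda>y :: complex. exp (- (\<epsilon> / 2) * (norm y)\<^sup>2)) \<in> borel_measurable lborel"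
      by (simp only: measurable_lborel2, intro borel_measurable_continuous_onI continuous_intros)
    have "integrable lborel (\<lambda>y :: complex. exp (- (\<epsilon> / 2) * (norm y)\<^sup>2))"
      using nn_integral_gaussian_plane[of "\<epsilon> / 2" 0] \<epsilon> m by (intro integrableI_bounded) auto
    thus ?thesis by simp
  qed
  have rot: "(\<integral>y. \<Theta> (?e \<theta> * y) \<partial>lborel) = (\<integral>y. \<Theta> y \<partial>lborel)" for \<theta>
    by (rule integral_rotation[OF ne borel_measurable_continuous_onI[OF \<Theta>c]])
  have inner: "(\<integral>\<theta>. indicator {0..1} \<theta> *\<^sub>R \<Theta> (?e \<theta> * y) \<partial>lborel) = 0" for y
  proof -
    \<comment> \<open>Of the \<open>n\<close> powers of the rotation, \<open>k\<close> clear the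
      denominators from cnj (\<zeta> y) = cnj y / \<zeta> and one serves as the differential on the
      circle; n - Suc k are left, which needs k < n.\<close>
    define h where "h = (\<lambda>\<zeta>. \<zeta> ^ (n - Suc k) * (y ^ n * R (\<zeta> * y) * (c * \<zeta> - cnj y) ^ k * of_real (exp (- pi * (norm y)\<^sup>2))))"
    have hh: "h holomorphic_on UNIV"
      unfolding h_def by (intro holomorphic_intros holomorphic_on_compose_gen[OF _ R, unfolded o_def]) auto
    have "\<Theta> (?e \<theta> * y) = ?e \<theta> * h (?e \<theta>)" for \<theta>
    proof -
      define z where "z = ?e \<theta>"
      have z: "norm z = 1" "z \<noteq> 0" using ne by (auto simp: z_def)
      have "z * cnj z = 1" using z(1) by (simp add: complex_norm_square[symmetric])
      hence cz: "(c - cnj (z * y)) = (c * z - cnj y) / z" using z(2) by (simp add: field_simps)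
      have zn: "z ^ n = z * z ^ (n - Suc k) * z ^ k"
        using k by (simp flip: power_Suc power_add)
      have "\<Theta> (z * y) = z ^ n * y ^ n * R (z * y) * ((c * z - cnj y) / z) ^ k * of_real (exp (- pi * (norm y)\<^sup>2))"
        unfolding \<Theta>_def cz by (simp add: power_mult_distrib norm_mult z)
      also have "\<dots> = z * h z" unfolding h_def zn using z(2) by (simp add: power_divide)
      finally show ?thesis by (simp add: z_def)
    qed
    thus ?thesis using circle_integral_zero[OF hh] by simp
  qed
  have fm: "(\<lambda>(\<theta>, y). indicator {0..1} \<theta> *\<^sub>R \<Theta> (?e \<theta> * y)) \<in> borel_measurable (lborel \<Otimes>\<^sub>M lborel)"
  proof -
    have "(\<lambda>p :: real \<times> complex. \<Theta> (?e (fst p) * snd p)) \<in> borel_measurable (lborel \<Otimes>\<^sub>M lborel)"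
      unfolding lborel_prod by (simp, intro borel_measurable_continuous_onI continuous_on_compose2[OF \<Theta>c] continuous_intros) auto
    moreover have "(\<lambda>p :: real \<times> complex. indicator {0..1} (fst p) :: real) \<in> borel_measurable (lborel \<Otimes>\<^sub>M lborel)" by measurable
    ultimately show ?thesis unfolding case_prod_unfold by (intro borel_measurable_scaleR)
  qed
  have fi: "integrable (lborel \<Otimes>\<^sub>M lborel) (\<lambda>(\<theta>, y). indicator {0..1} \<theta> *\<^sub>R \<Theta> (?e \<theta> * y))"
  proof (rule lborel_pair.Fubini_integrable[OF fm])
    have I1: "integrable lborel (\<lambda>y. \<Theta> (?e \<theta> * y))" for \<theta>
      by (rule Bochner_Integration.integrable_bound[OF Gi])
         (use \<Theta>b[of "?e \<theta> * y" for y] in \<open>auto simp: norm_mult ne intro!: borel_measurable_continuous_onI continuous_on_compose2[OF \<Theta>c] continuous_intros order.trans[OF \<Theta>b]\<close>)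
    show "AE \<theta> in lborel. integrable lborel (\<lambda>y. case (\<theta>, y) of (\<theta>, y) \<Rightarrow> indicator {0..1} \<theta> *\<^sub>R \<Theta> (?e \<theta> * y))"
      using I1 by (intro AE_I2) simp
    have "(\<integral>y. norm (indicator {0..1} \<theta> *\<^sub>R \<Theta> (?e \<theta> * y)) \<partial>lborel) = indicator {0..1} \<theta> * (\<integral>y. norm (\<Theta> (?e \<theta> * y)) \<partial>lborel)" for \<theta> by simp
    also have "(\<integral>y. norm (\<Theta> (?e \<theta> * y)) \<partial>lborel) = (\<integral>y. norm (\<Theta> y) \<partial>lborel)" for \<theta>
    proof -
      have "complex_of_real (\<integral>y. norm (\<Theta> (?e \<theta> * y)) \<partial>lborel) = complex_of_real (\<integral>y. norm (\<Theta> y) \<partial>lborel)"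
        unfolding integral_complex_of_real[symmetric]
        by (rule integral_rotation[OF ne, of "\<lambda>y. of_real (norm (\<Theta> y))"]) (intro borel_measurable_continuous_onI continuous_intros \<Theta>c)
      thus ?thesis by simp
    qed
    finally have e: "(\<integral>y. norm (indicator {0..1} \<theta> *\<^sub>R \<Theta> (?e \<theta> * y)) \<partial>lborel) = indicator {0..1} \<theta> * (\<integral>y. norm (\<Theta> y) \<partial>lborel)" for \<theta> .
    show "integrable lborel (\<lambda>\<theta>. \<integral>y. norm (case (\<theta>, y) of (\<theta>, y) \<Rightarrow> indicator {0..1} \<theta> *\<^sub>R \<Theta> (?e \<theta> * y)) \<partial>lborel)"
      unfolding prod.case e by (intro integrable_mult_left integrable_real_indicator) auto
  qed
  have "(\<integral>\<theta>. \<integral>y. indicator {0..1} \<theta> *\<^sub>R \<Theta> (?e \<theta> * y) \<partial>lborel \<partial>lborel) = (\<integral>y. \<integral>\<theta>. indicator {0..1} \<theta> *\<^sub>R \<Theta> (?e \<theta> * y) \<partial>lborel \<partial>lborel)"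
    by (rule lborel_pair.Fubini_integral[OF fi, symmetric])
  also have "\<dots> = 0" by (simp only: inner Bochner_Integration.integral_zero)
  also have "(\<integral>\<theta>. \<integral>y. indicator {0..1} \<theta> *\<^sub>R \<Theta> (?e \<theta> * y) \<partial>lborel \<partial>lborel) = (\<integral>\<theta>. indicator {0..1 :: real} \<theta> *\<^sub>R (\<integral>y. \<Theta> y \<partial>lborel) \<partial>lborel)"
    by (simp only: rot integral_scaleR_right)
  also have "\<dots> = (\<integral>y. \<Theta> y \<partial>lborel)" by (simp add: measure_def)
  finally show ?thesis by (simp add: \<Theta>_def)
qed

section \<open>The lower bound below critical density\<close>

lemma diff_cnj_eq: "z - cnj z = 2 * \<i> * of_real (Im z)"
  by (simp add: complex_eq_iff)

lemma deriv_exp_sum: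
  "(deriv ^^ k) (\<lambda>v :: complex. \<Sum>i\<in>F. d i * exp (b i * v)) = (\<lambda>v. \<Sum>i\<in>F. d i * b i ^ k * exp (b i * v))"
proof (induction k)
  case (Suc k)
  have "((\<lambda>v. \<Sum>i\<in>F. d i * b i ^ k * exp (b i * v)) has_field_derivative (\<Sum>i\<in>F. d i * b i ^ Suc k * exp (b i * v))) (at v)" for v
    by (auto intro!: derivative_eq_intros sum.cong simp: mult_ac)
  thus ?case using Suc by (auto intro!: ext DERIV_imp_deriv)
qed simp

text \<open>As a function of \<open>v\<close> this is a generating function: its derivatives at 0
  are the sums \<open>fock_sum k\<close> at the fixed point \<open>z\<close>, up to powers of
  pi.\<close>

definition fock_orbit :: "'i set \<Rightarrow> ('i \<Rightarrow> complex) \<Rightarrow> ('i \<Rightarrow> complex) \<Rightarrow> complex \<Rightarrow> complex \<Rightarrow> complex" where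
  "fock_orbit F c l z v = (\<Sum>i\<in>F. (c i * fock_kernel (l i) z) * exp ((of_real pi * (z - l i)) * v))"

lemma deriv_fock_orbit: "(deriv ^^ k) (fock_orbit F c l z) 0 = of_real (pi ^ k) * fock_sum k F c l z"
proof -
  have e: "fock_orbit F c l z = (\<lambda>v. \<Sum>i\<in>F. (c i * fock_kernel (l i) z) * exp ((pi * (z - l i)) * v))"
    by (rule ext) (simp add: fock_orbit_def)
  show ?thesis unfolding e deriv_exp_sum fock_sum_def by (simp add: sum_distrib_left power_mult_distrib mult_ac)
qed

lemma holomorphic_fock_orbit: "fock_orbit F c l z holomorphic_on A"
proof -
  have e: "fock_orbit F c l z = (\<lambda>v. \<Sum>i\<in>F. (c i * fock_kernel (l i) z) * exp ((pi * (z - l i)) * v))"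
    by (rule ext) (simp add: fock_orbit_def)
  show ?thesis unfolding e by (intro holomorphic_intros)
qed

text \<open>Exponential type in \<open>v\<close> is the crude growth under which the sampling
  estimate applies.\<close>

lemma norm_fock_orbit_le:
  assumes "finite F"
  shows "norm (fock_orbit F c l z v) \<le> (\<Sum>i\<in>F. norm (c i * fock_kernel (l i) z)) * exp ((\<Sum>i\<in>F. pi * norm (z - l i)) * norm v)"
proof -
  have "norm (fock_orbit F c l z v) \<le> (\<Sum>i\<in>F. norm (c i * fock_kernel (l i) z) * exp ((\<Sum>i\<in>F. pi * norm (z - l i)) * norm v))"
    unfolding fock_orbit_def
  proof (rule sum_norm_le)
    fix i assume i: "i \<in> F"
    have "norm (exp ((pi * (z - l i)) * v)) \<le> exp (norm ((pi * (z - l i)) * v))" by (rule norm_exp)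
    also have "norm ((pi * (z - l i)) * v) \<le> (\<Sum>i\<in>F. pi * norm (z - l i)) * norm v"
    proof -
      have "pi * norm (z - l i) \<le> (\<Sum>i\<in>F. pi * norm (z - l i))" using assms i by (intro member_le_sum) auto
      thus ?thesis by (simp add: norm_mult mult_right_mono)
    qed
    finally have "norm (exp ((pi * (z - l i)) * v)) \<le> exp ((\<Sum>i\<in>F. pi * norm (z - l i)) * norm v)" by simp
    thus "norm ((c i * fock_kernel (l i) z) * exp ((pi * (z - l i)) * v)) \<le> norm (c i * fock_kernel (l i) z) * exp ((\<Sum>i\<in>F. pi * norm (z - l i)) * norm v)"
      unfolding norm_mult[of "c i * fock_kernel (l i) z"] by (rule mult_left_mono) simp
  qed
  thus ?thesis by (simp add: sum_distrib_right)
qed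

text \<open>For \<open>\<mu>\<close> in the symplectic dual of the lattice the phases \<open>exp (2 \<pi> i Im (l i * cnj \<mu>))\<close> are trivial, so shifting \<open>z\<close> by \<open>\<mu>\<close> is a
  covariant translation of the entire function by \<open>- cnj \<mu>\<close>.\<close>
lemma norm_cjet_fock_orbit:
  assumes \<mu>: "\<And>i. i \<in> F \<Longrightarrow> Im (l i * cnj \<mu>) \<in> \<int>"
  shows "norm (cjet (fock_orbit F c l z) (- cnj \<mu>) k) = pi ^ k * norm (fock_sum k F c l (z + \<mu>))"
proof -
  \<comment> \<open>The phase picked up by the translation. It is unimodular and the same for all
    terms, so it leaves the norm of the jet unchanged.\<close>
  define q where "q = exp (of_real pi * (of_real (Re (cnj z * \<mu>)) - z * cnj \<mu>))"
  have nq: "norm q = 1" by (simp add: q_def norm_exp_eq_Re)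
  have eq: "fock_orbit F c l z (- cnj \<mu> + \<zeta>) * exp (- pi * cnj (- cnj \<mu>) * \<zeta> - pi * (norm (- cnj \<mu>))\<^sup>2 / 2) = q * fock_orbit F c l (z + \<mu>) \<zeta>" for \<zeta>
  proof -
    have "(fock_kernel (l i) z * exp ((pi * (z - l i)) * (- cnj \<mu> + \<zeta>))) * exp (- pi * cnj (- cnj \<mu>) * \<zeta> - pi * (norm (- cnj \<mu>))\<^sup>2 / 2)
        = q * (fock_kernel (l i) (z + \<mu>) * exp ((pi * (z + \<mu> - l i)) * \<zeta>))" if i: "i \<in> F" for i
    proof -
      obtain m :: int where m: "Im (l i * cnj \<mu>) = of_int m" using \<mu>[OF i] by (auto elim: Ints_cases)
      \<comment> \<open>By duality the two products differ by 2 i times an integer; multiplied by pi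
        this is a full period of the exponential and disappears.\<close>
      have lm: "l i * cnj \<mu> = cnj (l i) * \<mu> + 2 * \<i> * of_int m"
      proof -
        have "l i * cnj \<mu> - cnj (l i) * \<mu> = 2 * \<i> * of_int m"
          using diff_cnj_eq[of "l i * cnj \<mu>"] by (simp only: m complex_cnj_mult complex_cnj_cnj of_real_of_int_eq)
        thus ?thesis by (simp only: diff_eq_eq add.commute)
      qed
      have nz: "complex_of_real ((norm (z + \<mu>))\<^sup>2) = of_real ((norm z)\<^sup>2) + of_real ((norm \<mu>)\<^sup>2) + 2 * of_real (Re (cnj z * \<mu>))"
        unfolding cmod_power2 by (simp add: power2_eq_square algebra_simps)
      have "(fock_kernel (l i) z * exp ((pi * (z - l i)) * (- cnj \<mu> + \<zeta>))) * exp (- pi * cnj (- cnj \<mu>) * \<zeta> - pi * (norm (- cnj \<mu>))\<^sup>2 / 2)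
         = exp ((pi * cnj (l i) * z - pi * (norm (l i))\<^sup>2 / 2 - pi * (norm z)\<^sup>2 / 2 + (pi * (z - l i)) * (- cnj \<mu> + \<zeta>)) + (- pi * cnj (- cnj \<mu>) * \<zeta> - pi * (norm (- cnj \<mu>))\<^sup>2 / 2))"
        unfolding fock_kernel_def exp_add[symmetric] by simp
      also have "(pi * cnj (l i) * z - pi * (norm (l i))\<^sup>2 / 2 - pi * (norm z)\<^sup>2 / 2 + (pi * (z - l i)) * (- cnj \<mu> + \<zeta>)) + (- pi * cnj (- cnj \<mu>) * \<zeta> - pi * (norm (- cnj \<mu>))\<^sup>2 / 2)
         = of_real pi * (of_real (Re (cnj z * \<mu>)) - z * cnj \<mu>) + ((pi * cnj (l i) * (z + \<mu>) - pi * (norm (l i))\<^sup>2 / 2 - pi * of_real ((norm (z + \<mu>))\<^sup>2) / 2) + (pi * (z + \<mu> - l i)) * \<zeta>) + (2 * of_int m * pi) * \<i>"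
        using lm by (simp add: algebra_simps) (use nz in \<open>simp add: algebra_simps\<close>)
      also have "exp \<dots> = q * (fock_kernel (l i) (z + \<mu>) * exp ((pi * (z + \<mu> - l i)) * \<zeta>)) * exp ((2 * of_int m * pi) * \<i>)"
        unfolding q_def fock_kernel_def exp_add by simp
      also have "exp ((2 * of_int m * pi) * \<i>) = 1" by (simp add: exp_eq_1)
      finally show ?thesis by simp
    qed
    hence "c i * (fock_kernel (l i) z * exp ((pi * (z - l i)) * (- cnj \<mu> + \<zeta>)) * exp (- pi * cnj (- cnj \<mu>) * \<zeta> - pi * (norm (- cnj \<mu>))\<^sup>2 / 2)) = q * (c i * (fock_kernel (l i) (z + \<mu>) * exp ((pi * (z + \<mu> - l i)) * \<zeta>)))" if "i \<in> F" for i
      using that by (simp only: mult.left_commute[of "c i" q])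
    thus ?thesis unfolding fock_orbit_def sum_distrib_right sum_distrib_left by (intro sum.cong refl) (simp only: mult.assoc)
  qed
  have "cjet (fock_orbit F c l z) (- cnj \<mu>) k = (deriv ^^ k) (\<lambda>\<zeta>. q * fock_orbit F c l (z + \<mu>) \<zeta>) 0"
    unfolding cjet_def eq ..
  also have "\<dots> = q * (deriv ^^ k) (fock_orbit F c l (z + \<mu>)) 0"
    by (rule higher_deriv_cmult[of _ UNIV]) (auto intro: holomorphic_fock_orbit)
  finally show ?thesis unfolding deriv_fock_orbit by (simp add: norm_mult nq norm_power)
qed

text \<open>For each z the sampling estimate bounds the generating function at every point v = cnj z
  - cnj (l j) by the values of the Fock sums on the translate of the dual lattice through z. Summing
  over j and integrating z over one dual cell reconstructs the full plane integral.\<close>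

lemma fock_lower_bound:
  assumes V: "0 < Im (cnj \<alpha> * \<beta>)" and n: "1 / Im (cnj \<alpha> * \<beta>) < real n"
  obtains A where "A > 0" "\<And>F c. finite F \<Longrightarrow>
    ennreal (A * (\<Sum>i\<in>F. (norm (c i))\<^sup>2)) \<le> (\<Sum>k<n. fock_norm_sq k F c (lpt \<alpha> \<beta>))"
proof -
  have V_neq: "Im (cnj \<alpha> * \<beta>) \<noteq> 0" using V by linarith
  define D where "D = 1 / Im (cnj \<alpha> * \<beta>)"
  have D: "D > 0" "D * Im (cnj \<alpha> * \<beta>) = 1" using V by (auto simp: D_def)
  define \<alpha>' where "\<alpha>' = of_real D * \<alpha>"
  define \<beta>' where "\<beta>' = of_real D * \<beta>"
  have "Im (cnj \<alpha>' * \<beta>') = D * (D * Im (cnj \<alpha> * \<beta>))" by (simp add: \<alpha>'_def \<beta>'_def algebra_simps)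
  hence V': "Im (cnj \<alpha>' * \<beta>') = D" by (simp only: D)
  \<comment> \<open>The jets live at the points - cnj \<mu>. Conjugation reverses the orientation,
    so the generators are exchanged to keep the oriented area positive.\<close>
  have "Im (cnj (- cnj \<beta>') * (- cnj \<alpha>')) = Im (cnj \<alpha>' * \<beta>')" by (simp add: algebra_simps)
  hence V'': "Im (cnj (- cnj \<beta>') * (- cnj \<alpha>')) = D" unfolding V' .
  obtain \<sigma> where "lattice_sigma (- cnj \<beta>') (- cnj \<alpha>') \<sigma> (pi / (2 * Im (cnj (- cnj \<beta>') * (- cnj \<alpha>'))))"
    using lattice_sigma_interpretation[of "- cnj \<beta>'" "- cnj \<alpha>'"] V'' D by metis
  then interpret lattice_sigma "- cnj \<beta>'" "- cnj \<alpha>'" \<sigma> "pi / (2 * Im (cnj (- cnj \<beta>') * (- cnj \<alpha>')))" .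
  have nD: "Im (cnj (- cnj \<beta>') * (- cnj \<alpha>')) < real n" unfolding V'' using n by (simp add: D_def)
  obtain C \<epsilon> where C: "C > 0" "\<epsilon> > 0" and samp:
    "\<And>U v B a. U holomorphic_on UNIV \<Longrightarrow> (\<And>z. norm (U z) \<le> B * exp (a * norm z)) \<Longrightarrow>
       ennreal (norm (U v) * exp (- pi * (norm v)\<^sup>2 / 2)) \<le>
       ennreal C * (\<integral>\<^sup>+i. ennreal ((\<Sum>k<n. norm (cjet U (lpt (- cnj \<beta>') (- cnj \<alpha>') i) k)) * exp (- \<epsilon> * (norm (v - lpt (- cnj \<beta>') (- cnj \<alpha>') i))\<^sup>2)) \<partial>count_space UNIV)"
    using sampling_estimate[OF nD] by blast
  obtain G1 where G1: "G1 > 0" "\<And>w. (\<integral>\<^sup>+i. ennreal (exp (- \<epsilon> * (norm (w - lpt \<alpha>' \<beta>' i))\<^sup>2)) \<partial>count_space UNIV) \<le> ennreal G1"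
    using gaussian_lattice_sum_bounded[of \<alpha>' \<beta>' \<epsilon>] V' D C(2) by auto
  obtain G2 where G2: "G2 > 0" "\<And>w. (\<integral>\<^sup>+i. ennreal (exp (- \<epsilon> * (norm (w - lpt \<alpha> \<beta> i))\<^sup>2)) \<partial>count_space UNIV) \<le> ennreal G2"
    using gaussian_lattice_sum_bounded[OF V_neq C(2)] by blast
  \<comment> \<open>\<open>G1\<close> bounds Gaussian sums over the dual lattice, \<open>G2\<close>
    those over the lattice itself; the last factor comes from Cauchy-Schwarz over \<open>k\<close>
    against the powers of pi in the jets.\<close>
  define K where "K = C\<^sup>2 * G1 * G2 * (n * pi ^ (2 * n) + 1)"
  have K: "K > 0" unfolding K_def using C G1 G2 by (intro mult_pos_pos add_nonneg_pos) auto
  have main: "ennreal (D / K * (\<Sum>i\<in>F. (norm (c i))\<^sup>2)) \<le> (\<Sum>k<n. fock_norm_sq k F c (lpt \<alpha> \<beta>))"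
    if F: "finite F" for F c
  proof -
    define l where "l = lpt \<alpha> \<beta>"
    define \<mu> where "\<mu> = lpt \<alpha>' \<beta>'"
    have \<mu>: "Im (l i * cnj (\<mu> j)) \<in> \<int>" for i j
    proof -
      have "Im (l i * cnj (\<mu> j)) = (of_int (snd i) * of_int (fst j) - of_int (fst i) * of_int (snd j)) * (D * Im (cnj \<alpha> * \<beta>))"
        by (simp add: l_def \<mu>_def lpt_def \<alpha>'_def \<beta>'_def algebra_simps)
      thus ?thesis by (simp only: D mult_1_right) auto
    qed
    have sw: "lpt (- cnj \<beta>') (- cnj \<alpha>') (prod.swap i) = - cnj (\<mu> i)" for i by (simp add: lpt_def \<mu>_def)
    define U where "U = fock_orbit F c l"
    define S where "S = (\<lambda>z i. \<Sum>k<n. pi ^ k * norm (fock_sum k F c l (z + \<mu> i)))"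
    define N where "N = (\<lambda>w. \<Sum>k<n. (norm (fock_sum k F c l w))\<^sup>2)"
    have S0: "S z i \<ge> 0" for z i by (auto simp: S_def intro!: sum_nonneg)
    have N0: "N z \<ge> 0" for z by (auto simp: N_def intro!: sum_nonneg)
    have bij: "bij_betw prod.swap (UNIV :: (int \<times> int) set) UNIV" by (simp add: bij_swap)
    have pt: "ennreal (norm (U z v) * exp (- pi * (norm v)\<^sup>2 / 2)) \<le> ennreal C * (\<integral>\<^sup>+i. ennreal (S z i * exp (- \<epsilon> * (norm (cnj v + \<mu> i))\<^sup>2)) \<partial>count_space UNIV)" for z v
    proof -
      have "ennreal (norm (U z v) * exp (- pi * (norm v)\<^sup>2 / 2)) \<le>
       ennreal C * (\<integral>\<^sup>+i. ennreal ((\<Sum>k<n. norm (cjet (U z) (lpt (- cnj \<beta>') (- cnj \<alpha>') i) k)) * exp (- \<epsilon> * (norm (v - lpt (- cnj \<beta>') (- cnj \<alpha>') i))\<^sup>2)) \<partial>count_space UNIV)"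
        unfolding U_def by (rule samp[OF holomorphic_fock_orbit norm_fock_orbit_le[OF F]])
      also have "(\<integral>\<^sup>+i. ennreal ((\<Sum>k<n. norm (cjet (U z) (lpt (- cnj \<beta>') (- cnj \<alpha>') i) k)) * exp (- \<epsilon> * (norm (v - lpt (- cnj \<beta>') (- cnj \<alpha>') i))\<^sup>2)) \<partial>count_space UNIV)
         = (\<integral>\<^sup>+i. ennreal ((\<Sum>k<n. norm (cjet (U z) (lpt (- cnj \<beta>') (- cnj \<alpha>') (prod.swap i)) k)) * exp (- \<epsilon> * (norm (v - lpt (- cnj \<beta>') (- cnj \<alpha>') (prod.swap i)))\<^sup>2)) \<partial>count_space UNIV)"
        by (rule nn_integral_bij_count_space[OF bij, symmetric])
      also have "\<dots> = (\<integral>\<^sup>+i. ennreal (S z i * exp (- \<epsilon> * (norm (cnj v + \<mu> i))\<^sup>2)) \<partial>count_space UNIV)"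
      proof (rule nn_integral_cong)
        fix i
        have "norm (v - - cnj (\<mu> i)) = norm (cnj v + \<mu> i)" by (metis complex_cnj_add complex_cnj_cnj complex_mod_cnj diff_minus_eq_add)
        moreover have "(\<Sum>k<n. norm (cjet (U z) (- cnj (\<mu> i)) k)) = S z i"
          unfolding S_def U_def by (intro sum.cong refl norm_cjet_fock_orbit \<mu>)
        ultimately show "ennreal ((\<Sum>k<n. norm (cjet (U z) (lpt (- cnj \<beta>') (- cnj \<alpha>') (prod.swap i)) k)) * exp (- \<epsilon> * (norm (v - lpt (- cnj \<beta>') (- cnj \<alpha>') (prod.swap i)))\<^sup>2)) = ennreal (S z i * exp (- \<epsilon> * (norm (cnj v + \<mu> i))\<^sup>2))"
          unfolding sw by simp
      qed
      finally show ?thesis .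
    qed
    have sq: "ennreal ((norm (U z v) * exp (- pi * (norm v)\<^sup>2 / 2))\<^sup>2) \<le> ennreal (C\<^sup>2 * G1) * (\<integral>\<^sup>+i. ennreal ((S z i)\<^sup>2 * exp (- \<epsilon> * (norm (cnj v + \<mu> i))\<^sup>2)) \<partial>count_space UNIV)" for z v
    proof -
      have "ennreal ((norm (U z v) * exp (- pi * (norm v)\<^sup>2 / 2))\<^sup>2) = (ennreal (norm (U z v) * exp (- pi * (norm v)\<^sup>2 / 2)))\<^sup>2"
        by (simp add: ennreal_power)
      also have "\<dots> \<le> (ennreal C * (\<integral>\<^sup>+i. ennreal (S z i * exp (- \<epsilon> * (norm (cnj v + \<mu> i))\<^sup>2)) \<partial>count_space UNIV))\<^sup>2"
        by (rule power_mono[OF pt]) simp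
      also have "\<dots> = ennreal (C\<^sup>2) * (\<integral>\<^sup>+i. ennreal (S z i * exp (- \<epsilon> * (norm (cnj v + \<mu> i))\<^sup>2)) \<partial>count_space UNIV)\<^sup>2"
        using C by (simp add: power_mult_distrib ennreal_power)
      also have "\<dots> \<le> ennreal (C\<^sup>2) * ((\<integral>\<^sup>+i. ennreal ((S z i)\<^sup>2 * exp (- \<epsilon> * (norm (cnj v + \<mu> i))\<^sup>2)) \<partial>count_space UNIV) * (\<integral>\<^sup>+i. ennreal (exp (- \<epsilon> * (norm (cnj v + \<mu> i))\<^sup>2)) \<partial>count_space UNIV))"
        by (intro mult_left_mono count_space_weighted_Cauchy_Schwarz S0) auto
      also have "\<dots> \<le> ennreal (C\<^sup>2) * ((\<integral>\<^sup>+i. ennreal ((S z i)\<^sup>2 * exp (- \<epsilon> * (norm (cnj v + \<mu> i))\<^sup>2)) \<partial>count_space UNIV) * ennreal G1)"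
      proof (intro mult_left_mono)
        have "(\<integral>\<^sup>+i. ennreal (exp (- \<epsilon> * (norm (cnj v + \<mu> i))\<^sup>2)) \<partial>count_space UNIV) = (\<integral>\<^sup>+i. ennreal (exp (- \<epsilon> * (norm ((- cnj v) - lpt \<alpha>' \<beta>' i))\<^sup>2)) \<partial>count_space UNIV)"
          by (intro nn_integral_cong) (simp add: \<mu>_def norm_minus_commute[of "- cnj v"] add.commute)
        also have "\<dots> \<le> ennreal G1" by (rule G1(2))
        finally show "(\<integral>\<^sup>+i. ennreal (exp (- \<epsilon> * (norm (cnj v + \<mu> i))\<^sup>2)) \<partial>count_space UNIV) \<le> ennreal G1" .
      qed auto
      finally show ?thesis using C G1(1) by (simp add: ennreal_mult mult_ac)
    qed
    \<comment> \<open>At v = cnj z - cnj (l j) the Gaussian centred at the i-th dual point has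
      argument z + \<mu> i - l j. The sum over j is then a Gaussian lattice sum, bounded
      independently of z and i.\<close>
    have sumj: "(\<Sum>j\<in>F. ennreal ((norm (U z (cnj z - cnj (l j))) * exp (- pi * (norm (cnj z - cnj (l j)))\<^sup>2 / 2))\<^sup>2)) \<le> ennreal K * (\<integral>\<^sup>+i. ennreal (N (z + \<mu> i)) \<partial>count_space UNIV)" for z
    proof -
      have "(\<Sum>j\<in>F. ennreal ((norm (U z (cnj z - cnj (l j))) * exp (- pi * (norm (cnj z - cnj (l j)))\<^sup>2 / 2))\<^sup>2))
         \<le> (\<Sum>j\<in>F. ennreal (C\<^sup>2 * G1) * (\<integral>\<^sup>+i. ennreal ((S z i)\<^sup>2 * exp (- \<epsilon> * (norm (cnj (cnj z - cnj (l j)) + \<mu> i))\<^sup>2)) \<partial>count_space UNIV))"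
        by (intro sum_mono sq)
      also have "\<dots> = ennreal (C\<^sup>2 * G1) * (\<integral>\<^sup>+i. (\<Sum>j\<in>F. ennreal ((S z i)\<^sup>2 * exp (- \<epsilon> * (norm (cnj (cnj z - cnj (l j)) + \<mu> i))\<^sup>2))) \<partial>count_space UNIV)"
        by (subst nn_integral_sum, simp, simp only: sum_distrib_left)
      also have "\<dots> \<le> ennreal (C\<^sup>2 * G1) * (\<integral>\<^sup>+i. ennreal (G2 * (n * pi ^ (2 * n) + 1)) * ennreal (N (z + \<mu> i)) \<partial>count_space UNIV)"
      proof (intro mult_left_mono nn_integral_mono)
        fix i
        have "(\<Sum>j\<in>F. ennreal ((S z i)\<^sup>2 * exp (- \<epsilon> * (norm (cnj (cnj z - cnj (l j)) + \<mu> i))\<^sup>2))) = ennreal ((S z i)\<^sup>2) * (\<Sum>j\<in>F. ennreal (exp (- \<epsilon> * (norm ((z + \<mu> i) - l j))\<^sup>2)))"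
          unfolding sum_distrib_left by (intro sum.cong refl) (simp add: algebra_simps flip: ennreal_mult)
        also have "\<dots> \<le> ennreal ((S z i)\<^sup>2) * ennreal G2"
          using order.trans[OF sum_le_nn_integral_count_space[OF F] G2(2)[of "z + \<mu> i"]] by (intro mult_left_mono) (auto simp: l_def)
        also have "\<dots> \<le> ennreal ((n * pi ^ (2 * n) + 1) * N (z + \<mu> i)) * ennreal G2"
        proof (intro mult_right_mono ennreal_leI)
          have "(S z i)\<^sup>2 \<le> (\<Sum>k<n. (pi ^ k)\<^sup>2) * (\<Sum>k<n. (norm (fock_sum k F c l (z + \<mu> i)))\<^sup>2)"
            unfolding S_def by (rule Cauchy_Schwarz_ineq_sum)
          also have "\<dots> \<le> (n * pi ^ (2 * n) + 1) * N (z + \<mu> i)"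
            unfolding N_def
          proof (intro mult_right_mono sum_nonneg)
            have "(\<Sum>k<n. (pi ^ k)\<^sup>2) \<le> (\<Sum>k<n. pi ^ (2 * n))"
              using pi_gt3 by (intro sum_mono) (auto simp: power_mult[symmetric] mult.commute intro!: power_increasing)
            thus "(\<Sum>k<n. (pi ^ k)\<^sup>2) \<le> n * pi ^ (2 * n) + 1" by simp
          qed auto
          finally show "(S z i)\<^sup>2 \<le> (n * pi ^ (2 * n) + 1) * N (z + \<mu> i)" .
        qed auto
        also have "\<dots> = ennreal (G2 * (n * pi ^ (2 * n) + 1)) * ennreal (N (z + \<mu> i))"
          using G2(1) N0 by (simp add: mult_ac flip: ennreal_mult)
        finally show "(\<Sum>j\<in>F. ennreal ((S z i)\<^sup>2 * exp (- \<epsilon> * (norm (cnj (cnj z - cnj (l j)) + \<mu> i))\<^sup>2))) \<le> ennreal (G2 * (n * pi ^ (2 * n) + 1)) * ennreal (N (z + \<mu> i))" .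
      qed auto
      also have "\<dots> = ennreal K * (\<integral>\<^sup>+i. ennreal (N (z + \<mu> i)) \<partial>count_space UNIV)"
        using C G1(1) G2(1) by (simp add: nn_integral_cmult K_def mult.assoc[symmetric] flip: ennreal_mult)
      finally show ?thesis .
    qed
    have lower: "ennreal ((norm (c j))\<^sup>2) \<le> (\<integral>\<^sup>+p. ennreal ((norm (U (of_real (fst p) * \<alpha>' + of_real (snd p) * \<beta>') (cnj (of_real (fst p) * \<alpha>' + of_real (snd p) * \<beta>') - cnj (l j)))
         * exp (- pi * (norm (cnj (of_real (fst p) * \<alpha>' + of_real (snd p) * \<beta>') - cnj (l j)))\<^sup>2 / 2))\<^sup>2) \<partial>unit_square)" if j: "j \<in> F" for j
    proof -
      \<comment> \<open>The coefficients depend on \<open>j\<close>. For the index \<open>j\<close>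
        itself the exponent is zero, which keeps |c j| intact; the others may be large but do not
        matter for a single coefficient.\<close>
      define d where "d = (\<lambda>i. c i * exp (of_real pi * (l i * cnj (l j) - (norm (l i))\<^sup>2 / 2 - (norm (l j))\<^sup>2 / 2)))"
      have dj: "norm (d j) = norm (c j)"
      proof -
        have "l j * cnj (l j) - (norm (l j))\<^sup>2 / 2 - (norm (l j))\<^sup>2 / 2 = 0" by (simp add: complex_norm_square[symmetric])
        thus ?thesis unfolding d_def by simp
      qed
      have key: "norm (U z (cnj z - cnj (l j))) * exp (- pi * (norm (cnj z - cnj (l j)))\<^sup>2 / 2) = norm (\<Sum>i\<in>F. d i * exp (2 * pi * \<i> * (of_int (fst i) * of_real t - of_int (snd i) * of_real s)))"
        if z: "z = of_real s * \<alpha>' + of_real t * \<beta>'" for z s t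
      proof -
        \<comment> \<open>The part of the exponent common to all i. Its modulus is exactly the
          inverse of the Fock weight at v, so what remains is a pure trigonometric polynomial in the
          cell coordinates.\<close>
        define Q where "Q = exp (of_real pi * ((norm z)\<^sup>2 / 2 - z * cnj (l j) + (norm (l j))\<^sup>2 / 2))"
        have nQ: "norm Q * exp (- pi * (norm (cnj z - cnj (l j)))\<^sup>2 / 2) = 1"
          unfolding Q_def norm_exp_eq_Re exp_add[symmetric] cmod_power2 by (simp add: power2_eq_square algebra_simps add_divide_distrib diff_divide_distrib)
        have "U z (cnj z - cnj (l j)) = Q * (\<Sum>i\<in>F. d i * exp (2 * pi * \<i> * (of_int (fst i) * of_real t - of_int (snd i) * of_real s)))"
          unfolding U_def fock_orbit_def sum_distrib_left
        proof (rule sum.cong[OF refl])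
          fix i
          have im: "cnj (l i) * z - l i * cnj z = 2 * \<i> * (of_int (fst i) * of_real t - of_int (snd i) * of_real s)"
          proof -
            have "Im (cnj (l i) * z) = (of_int (fst i) * t - of_int (snd i) * s) * (D * Im (cnj \<alpha> * \<beta>))"
              by (simp add: l_def z lpt_def \<alpha>'_def \<beta>'_def algebra_simps)
            hence "Im (cnj (l i) * z) = of_int (fst i) * t - of_int (snd i) * s" by (simp only: D mult_1_right)
            moreover have "cnj (l i) * z - l i * cnj z = 2 * \<i> * of_real (Im (cnj (l i) * z))"
              using diff_cnj_eq[of "cnj (l i) * z"] by (simp only: complex_cnj_mult complex_cnj_cnj)
            ultimately show ?thesis by simp
          qed
          have nn: "complex_of_real ((norm z)\<^sup>2) = z * cnj z" by (rule complex_norm_square)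
          have "pi * cnj (l i) * z - pi * (norm (l i))\<^sup>2 / 2 - pi * (norm z)\<^sup>2 / 2 + pi * (z - l i) * (cnj z - cnj (l j))
            = of_real pi * ((norm z)\<^sup>2 / 2 - z * cnj (l j) + (norm (l j))\<^sup>2 / 2) + (of_real pi * (l i * cnj (l j) - (norm (l i))\<^sup>2 / 2 - (norm (l j))\<^sup>2 / 2)) + of_real pi * (cnj (l i) * z - l i * cnj z)"
            using nn by (simp add: algebra_simps)
          hence "exp (pi * cnj (l i) * z - pi * (norm (l i))\<^sup>2 / 2 - pi * (norm z)\<^sup>2 / 2) * exp (pi * (z - l i) * (cnj z - cnj (l j)))
             = Q * (exp (of_real pi * (l i * cnj (l j) - (norm (l i))\<^sup>2 / 2 - (norm (l j))\<^sup>2 / 2)) * exp (of_real pi * (cnj (l i) * z - l i * cnj z)))"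
            unfolding Q_def exp_add[symmetric] by (simp only: add.assoc)
          thus "c i * fock_kernel (l i) z * exp (pi * (z - l i) * (cnj z - cnj (l j))) = Q * (d i * exp (2 * pi * \<i> * (of_int (fst i) * of_real t - of_int (snd i) * of_real s)))"
            unfolding im fock_kernel_def d_def by (simp add: mult_ac)
        qed
        thus ?thesis using nQ by (simp add: norm_mult mult_ac)
      qed
      show ?thesis using trig_coefficient_le[OF F j, of d] unfolding dj by (simp only: key[OF refl])
    qed
    have Nm: "(\<lambda>w. ennreal (N w)) \<in> borel_measurable borel"
      unfolding N_def by measurable
    have "ennreal (\<Sum>i\<in>F. (norm (c i))\<^sup>2) = (\<Sum>j\<in>F. ennreal ((norm (c j))\<^sup>2))" by (simp add: sum_ennreal)
    also have "\<dots> \<le> (\<Sum>j\<in>F. \<integral>\<^sup>+p. ennreal ((norm (U (of_real (fst p) * \<alpha>' + of_real (snd p) * \<beta>') (cnj (of_real (fst p) * \<alpha>' + of_real (snd p) * \<beta>') - cnj (l j)))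
         * exp (- pi * (norm (cnj (of_real (fst p) * \<alpha>' + of_real (snd p) * \<beta>') - cnj (l j)))\<^sup>2 / 2))\<^sup>2) \<partial>unit_square)"
      by (intro sum_mono lower)
    also have "\<dots> = (\<integral>\<^sup>+p. (\<Sum>j\<in>F. ennreal ((norm (U (of_real (fst p) * \<alpha>' + of_real (snd p) * \<beta>') (cnj (of_real (fst p) * \<alpha>' + of_real (snd p) * \<beta>') - cnj (l j)))
         * exp (- pi * (norm (cnj (of_real (fst p) * \<alpha>' + of_real (snd p) * \<beta>') - cnj (l j)))\<^sup>2 / 2))\<^sup>2)) \<partial>unit_square)"
    proof (rule nn_integral_sum[symmetric])
      fix j
      show "(\<lambda>p. ennreal ((norm (U (of_real (fst p) * \<alpha>' + of_real (snd p) * \<beta>') (cnj (of_real (fst p) * \<alpha>' + of_real (snd p) * \<beta>') - cnj (l j)))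
         * exp (- pi * (norm (cnj (of_real (fst p) * \<alpha>' + of_real (snd p) * \<beta>') - cnj (l j)))\<^sup>2 / 2))\<^sup>2)) \<in> borel_measurable unit_square"
        unfolding measurable_unit_square U_def fock_orbit_def fock_kernel_def
        by (intro measurable_compose[OF _ measurable_ennreal] borel_measurable_continuous_onI continuous_intros) auto
    qed
    also have "\<dots> \<le> (\<integral>\<^sup>+p. ennreal K * (\<integral>\<^sup>+i. ennreal (N (of_real (fst p) * \<alpha>' + of_real (snd p) * \<beta>' + \<mu> i)) \<partial>count_space UNIV) \<partial>unit_square)"
      by (intro nn_integral_mono sumj)
    also have "\<dots> = ennreal K * (\<integral>\<^sup>+p. \<integral>\<^sup>+i. ennreal (N (of_real (fst p) * \<alpha>' + of_real (snd p) * \<beta>' + \<mu> i)) \<partial>count_space UNIV \<partial>unit_square)"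
    proof -
      have m: "(\<lambda>p. ennreal (N (of_real (fst p) * \<alpha>' + of_real (snd p) * \<beta>' + \<mu> i))) \<in> borel_measurable unit_square" for i
        unfolding measurable_unit_square by (intro measurable_compose[OF borel_measurable_continuous_onI Nm] continuous_intros)
      have "(\<integral>\<^sup>+p. ennreal K * (\<integral>\<^sup>+i. ennreal (N (of_real (fst p) * \<alpha>' + of_real (snd p) * \<beta>' + \<mu> i)) \<partial>count_space UNIV) \<partial>unit_square)
         = (\<integral>\<^sup>+p. \<integral>\<^sup>+i. ennreal K * ennreal (N (of_real (fst p) * \<alpha>' + of_real (snd p) * \<beta>' + \<mu> i)) \<partial>count_space UNIV \<partial>unit_square)"
        by (simp add: nn_integral_cmult)
      also have "\<dots> = (\<integral>\<^sup>+i. \<integral>\<^sup>+p. ennreal K * ennreal (N (of_real (fst p) * \<alpha>' + of_real (snd p) * \<beta>' + \<mu> i)) \<partial>unit_square \<partial>count_space UNIV)"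
        using m by (intro nn_integral_count_space_nn_integral) auto
      also have "\<dots> = ennreal K * (\<integral>\<^sup>+i. \<integral>\<^sup>+p. ennreal (N (of_real (fst p) * \<alpha>' + of_real (snd p) * \<beta>' + \<mu> i)) \<partial>unit_square \<partial>count_space UNIV)"
        using m by (simp add: nn_integral_cmult)
      also have "(\<integral>\<^sup>+i. \<integral>\<^sup>+p. ennreal (N (of_real (fst p) * \<alpha>' + of_real (snd p) * \<beta>' + \<mu> i)) \<partial>unit_square \<partial>count_space UNIV)
         = (\<integral>\<^sup>+p. \<integral>\<^sup>+i. ennreal (N (of_real (fst p) * \<alpha>' + of_real (snd p) * \<beta>' + \<mu> i)) \<partial>count_space UNIV \<partial>unit_square)"
        using m by (intro nn_integral_count_space_nn_integral[symmetric]) auto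
      finally show ?thesis .
    qed
    finally have "ennreal (\<Sum>i\<in>F. (norm (c i))\<^sup>2) \<le> ennreal K * (\<integral>\<^sup>+p. \<integral>\<^sup>+i. ennreal (N (of_real (fst p) * \<alpha>' + of_real (snd p) * \<beta>' + \<mu> i)) \<partial>count_space UNIV \<partial>unit_square)" .
    hence "ennreal (D / K) * ennreal (\<Sum>i\<in>F. (norm (c i))\<^sup>2) \<le> ennreal (D / K) * (ennreal K * (\<integral>\<^sup>+p. \<integral>\<^sup>+i. ennreal (N (of_real (fst p) * \<alpha>' + of_real (snd p) * \<beta>' + \<mu> i)) \<partial>count_space UNIV \<partial>unit_square))"
      by (rule mult_left_mono) simp
    also have "\<dots> = ennreal D * (\<integral>\<^sup>+p. \<integral>\<^sup>+i. ennreal (N (of_real (fst p) * \<alpha>' + of_real (snd p) * \<beta>' + \<mu> i)) \<partial>count_space UNIV \<partial>unit_square)"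
      using D K by (simp add: mult.assoc[symmetric] flip: ennreal_mult)
    \<comment> \<open>The dual cell has area \<open>D\<close>, which turns the integral of the
      periodisation into the integral over the plane.\<close>
    also have "\<dots> = (\<integral>\<^sup>+w. ennreal (N w) \<partial>lborel)"
      using nn_integral_complex_unfold[OF Nm, of \<alpha>' \<beta>'] V' D unfolding \<mu>_def by simp
    also have "\<dots> = (\<integral>\<^sup>+w. (\<Sum>k<n. ennreal ((norm (fock_sum k F c l w))\<^sup>2)) \<partial>lborel)"
      by (simp add: N_def sum_ennreal)
    also have "\<dots> = (\<Sum>k<n. fock_norm_sq k F c l)"
      by (rule nn_integral_sum) measurable
    finally show ?thesis using D K by (simp add: l_def sum_nonneg flip: ennreal_mult)
  qed
  show thesis using that[of "D / K"] main D K by auto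
qed

section \<open>The Bargmann transform of Hermite functions\<close>

text \<open>The unnormalised polynomials with H_k(s) exp (- 2 pi s^2) equal to the k-th derivative
  of exp (- 2 pi s^2), without the usual alternating sign.\<close>

fun hermite_poly :: "nat \<Rightarrow> real poly" where
  "hermite_poly 0 = 1"
| "hermite_poly (Suc k) = pderiv (hermite_poly k) + smult (- 4 * pi) (pCons 0 (hermite_poly k))"

lemma hermite_raw_eq: "hermite_raw k t = poly (hermite_poly k) t * exp (- pi * t\<^sup>2)"
proof -
  have "(deriv ^^ k) (\<lambda>s :: real. exp (- 2 * pi * s\<^sup>2)) = (\<lambda>s. poly (hermite_poly k) s * exp (- 2 * pi * s\<^sup>2))"
  proof (induction k)
    case (Suc k)
    have "((\<lambda>s. poly (hermite_poly k) s * exp (- 2 * pi * s\<^sup>2)) has_real_derivative poly (hermite_poly (Suc k)) s * exp (- 2 * pi * s\<^sup>2)) (at s)" for s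
      by (auto intro!: derivative_eq_intros simp: algebra_simps power2_eq_square)
    thus ?case using Suc by (auto intro!: ext DERIV_imp_deriv)
  qed simp
  thus ?thesis unfolding hermite_raw_def by (simp add: mult.left_commute flip: exp_add)
qed

text \<open>The creation operator relation: differentiation raises the index up to a multiple of t,
  and this drives the recursion of the transforms.\<close>

lemma hermite_raw_has_derivative:
  "(hermite_raw k has_real_derivative (hermite_raw (Suc k) t + 2 * pi * t * hermite_raw k t)) (at t)"
proof -
  have "((\<lambda>t. poly (hermite_poly k) t * exp (- pi * t\<^sup>2)) has_real_derivative (hermite_raw (Suc k) t + 2 * pi * t * hermite_raw k t)) (at t)"
    unfolding hermite_raw_eq by (auto intro!: derivative_eq_intros simp: algebra_simps power2_eq_square)
  thus ?thesis by (simp add: hermite_raw_eq[abs_def])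
qed

lemma gaussian_decay_hermite_raw: "gaussian_decay (\<lambda>t. of_real (hermite_raw k (t - x)))"
  unfolding hermite_raw_eq by (rule gaussian_decay_poly) simp

text \<open>The short-time Fourier transform at (y, \<eta>), with window exp (- pi t^2), of the k-th
  unnormalised Hermite function shifted by (x, \<omega>).\<close>

definition stft_hermite :: "nat \<Rightarrow> real \<Rightarrow> real \<Rightarrow> real \<Rightarrow> real \<Rightarrow> complex" where
  "stft_hermite k x \<omega> y \<eta> = (\<integral>t. exp (2 * pi * \<i> * of_real ((\<omega> - \<eta>) * t)) * of_real (exp (- pi * (t - y)\<^sup>2)) * of_real (hermite_raw k (t - x)) \<partial>lborel)"

lemma gaussian_decay_stft_integrand:
  "gaussian_decay (\<lambda>t. exp (2 * pi * \<i> * of_real (\<xi> * t)) * of_real (exp (- pi * (t - y)\<^sup>2)) * of_real (hermite_raw k (t - x)))"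
  by (rule gaussian_decay_mult_bounded[OF gaussian_decay_hermite_raw, of _ 1])
     (auto simp: norm_mult norm_exp_eq_Re intro!: continuous_intros)

text \<open>Integration by parts: the multiples of t from the window and from the Hermite function
  cancel, so the order rises by one at the cost of the constant \<open>a\<close>, which is 2 pi
  times the difference of the two phase space points.\<close>

lemma stft_hermite_Suc:
  "stft_hermite (Suc k) x \<omega> y \<eta> = - 2 * pi * (Complex y (- \<eta>) - Complex x (- \<omega>)) * stft_hermite k x \<omega> y \<eta>"
proof -
  define E where "E = (\<lambda>t. exp (2 * pi * \<i> * of_real ((\<omega> - \<eta>) * t)) * of_real (exp (- pi * (t - y)\<^sup>2)) :: complex)"
  define a where "a = 2 * pi * \<i> * of_real (\<omega> - \<eta>) + of_real (2 * pi * (y - x))"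
  have E: "(E has_vector_derivative (2 * pi * \<i> * of_real (\<omega> - \<eta>) - of_real (2 * pi * (t - y))) * E t) (at t)" for t
  proof -
    have "((\<lambda>z. exp (2 * pi * \<i> * of_real (\<omega> - \<eta>) * z) * exp (- of_real pi * (z - of_real y)\<^sup>2)) has_field_derivative
       (2 * pi * \<i> * of_real (\<omega> - \<eta>) - of_real (2 * pi * (t - y))) * (exp (2 * pi * \<i> * of_real (\<omega> - \<eta>) * of_real t) * exp (- of_real pi * (of_real t - of_real y)\<^sup>2))) (at (of_real t))"
      by (auto intro!: derivative_eq_intros simp: algebra_simps)
    from has_vector_derivative_real_field[OF this, of UNIV] show ?thesis
      by (simp add: E_def exp_of_real[symmetric] mult_ac)
  qed
  have H: "((\<lambda>t. complex_of_real (hermite_raw k (t - x))) has_vector_derivative of_real (hermite_raw (Suc k) (t - x) + 2 * pi * (t - x) * hermite_raw k (t - x))) (at t)" for t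
  proof (rule has_vector_derivative_of_real)
    have "((\<lambda>t. hermite_raw k (t - x)) has_real_derivative (hermite_raw (Suc k) (t - x) + 2 * pi * (t - x) * hermite_raw k (t - x)) * 1) (at t)"
      by (rule DERIV_chain2[OF hermite_raw_has_derivative]) (auto intro!: derivative_eq_intros)
    thus "((\<lambda>t. hermite_raw k (t - x)) has_real_derivative (hermite_raw (Suc k) (t - x) + 2 * pi * (t - x) * hermite_raw k (t - x))) (at t)"
      by simp
  qed
  have d0: "gaussian_decay (\<lambda>t. E t * of_real (hermite_raw k (t - x)))" for k
    unfolding E_def by (rule gaussian_decay_stft_integrand)
  have "gaussian_decay (\<lambda>t. a * (E t * of_real (hermite_raw k (t - x))))"
    by (rule gaussian_decay_mult_bounded[OF d0, of _ "norm a"]) auto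
  hence d1: "gaussian_decay (\<lambda>t. a * (E t * of_real (hermite_raw k (t - x))) + E t * of_real (hermite_raw (Suc k) (t - x)))"
    by (rule gaussian_decay_add[OF _ d0])
  have "(\<integral>t. a * (E t * of_real (hermite_raw k (t - x))) + E t * of_real (hermite_raw (Suc k) (t - x)) \<partial>lborel) = 0"
  proof (rule gaussian_decay_integral_deriv[OF d0[of k] d1])
    fix t
    have "((\<lambda>t. E t * of_real (hermite_raw k (t - x))) has_vector_derivative
       (E t * of_real (hermite_raw (Suc k) (t - x) + 2 * pi * (t - x) * hermite_raw k (t - x)) + ((2 * pi * \<i> * of_real (\<omega> - \<eta>) - of_real (2 * pi * (t - y))) * E t) * of_real (hermite_raw k (t - x)))) (at t)"
      by (rule has_vector_derivative_mult[OF E H])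
    thus "((\<lambda>t. E t * of_real (hermite_raw k (t - x))) has_vector_derivative (a * (E t * of_real (hermite_raw k (t - x))) + E t * of_real (hermite_raw (Suc k) (t - x)))) (at t)"
      by (simp add: a_def algebra_simps)
  qed
  moreover have "stft_hermite k x \<omega> y \<eta> = (\<integral>t. E t * of_real (hermite_raw k (t - x)) \<partial>lborel)" for k
    by (simp only: stft_hermite_def E_def)
  ultimately have "a * stft_hermite k x \<omega> y \<eta> + stft_hermite (Suc k) x \<omega> y \<eta> = 0"
    using gaussian_decay_integrable[OF d0[of k]] gaussian_decay_integrable[OF d0[of "Suc k"]] by simp
  moreover have "a = 2 * pi * (Complex y (- \<eta>) - Complex x (- \<omega>))"
    by (simp add: a_def complex_eq_iff algebra_simps)
  ultimately show ?thesis by (simp add: add_eq_0_iff)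
qed

lemma stft_hermite_0:
  "stft_hermite 0 x \<omega> y \<eta> = of_real (1 / sqrt 2) * exp (\<i> * pi * of_real (x * \<omega>)) * exp (- \<i> * pi * of_real (y * \<eta>)) * fock_kernel (Complex x (- \<omega>)) (Complex y (- \<eta>))"
proof -
  \<comment> \<open>The product of two equal Gaussians is a Gaussian centred at the
    midpoint.\<close>
  define m where "m = (x + y) / 2"
  have "stft_hermite 0 x \<omega> y \<eta> = (\<integral>t. exp (2 * pi * \<i> * of_real ((\<omega> - \<eta>) * (m + 1 * t))) * of_real (exp (- pi * ((m + 1 * t) - y)\<^sup>2)) * of_real (hermite_raw 0 ((m + 1 * t) - x)) \<partial>lborel)"
    unfolding stft_hermite_def by (subst lborel_integral_real_affine[where c = 1 and t = m]) auto
  also have "\<dots> = (\<integral>t. (exp (2 * pi * \<i> * of_real ((\<omega> - \<eta>) * m)) * of_real (exp (- pi * (x - y)\<^sup>2 / 2))) * (exp (- (2 * pi) * t\<^sup>2) *\<^sub>R exp (\<i> * of_real ((2 * pi * (\<omega> - \<eta>)) * t))) \<partial>lborel)"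
  proof (rule Bochner_Integration.integral_cong[OF refl])
    fix t
    have "- pi * ((m + 1 * t) - y)\<^sup>2 + - pi * ((m + 1 * t) - x)\<^sup>2 = - pi * (x - y)\<^sup>2 / 2 + - (2 * pi) * t\<^sup>2"
      by (simp add: m_def power2_eq_square field_simps)
    hence "exp (- pi * ((m + 1 * t) - y)\<^sup>2) * exp (- pi * ((m + 1 * t) - x)\<^sup>2) = exp (- pi * (x - y)\<^sup>2 / 2) * exp (- (2 * pi) * t\<^sup>2)"
      unfolding exp_add[symmetric] by simp
    moreover have "exp (2 * pi * \<i> * of_real ((\<omega> - \<eta>) * (m + 1 * t))) = exp (2 * pi * \<i> * of_real ((\<omega> - \<eta>) * m)) * exp (\<i> * of_real ((2 * pi * (\<omega> - \<eta>)) * t))"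
      unfolding exp_add[symmetric] by (simp add: algebra_simps)
    ultimately show "exp (2 * pi * \<i> * of_real ((\<omega> - \<eta>) * (m + 1 * t))) * of_real (exp (- pi * ((m + 1 * t) - y)\<^sup>2)) * of_real (hermite_raw 0 ((m + 1 * t) - x))
      = (exp (2 * pi * \<i> * of_real ((\<omega> - \<eta>) * m)) * of_real (exp (- pi * (x - y)\<^sup>2 / 2))) * (exp (- (2 * pi) * t\<^sup>2) *\<^sub>R exp (\<i> * of_real ((2 * pi * (\<omega> - \<eta>)) * t)))"
      by (simp only: hermite_raw_eq hermite_poly.simps poly_1 mult_1_left scaleR_conv_of_real mult.assoc of_real_mult[symmetric]) (simp add: mult_ac flip: of_real_mult)
  qed
  also have "\<dots> = (exp (2 * pi * \<i> * of_real ((\<omega> - \<eta>) * m)) * of_real (exp (- pi * (x - y)\<^sup>2 / 2))) * of_real (sqrt (pi / (2 * pi)) * exp (- (2 * pi * (\<omega> - \<eta>))\<^sup>2 / (4 * (2 * pi))))"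
    by (subst integral_mult_right_zero, subst gaussian_fourier_integral(3)) auto
  also have "\<dots> = of_real (1 / sqrt 2) * exp (2 * pi * \<i> * of_real ((\<omega> - \<eta>) * m) + of_real (- pi * (x - y)\<^sup>2 / 2) + of_real (- (2 * pi * (\<omega> - \<eta>))\<^sup>2 / (4 * (2 * pi))))"
    by (simp only: exp_add exp_of_real) (simp add: real_sqrt_divide mult_ac)
  also have "2 * pi * \<i> * of_real ((\<omega> - \<eta>) * m) + of_real (- pi * (x - y)\<^sup>2 / 2) + of_real (- (2 * pi * (\<omega> - \<eta>))\<^sup>2 / (4 * (2 * pi)))
    = \<i> * pi * of_real (x * \<omega>) + (- \<i> * pi * of_real (y * \<eta>)) + (pi * cnj (Complex x (- \<omega>)) * Complex y (- \<eta>) - pi * (norm (Complex x (- \<omega>)))\<^sup>2 / 2 - pi * (norm (Complex y (- \<eta>)))\<^sup>2 / 2)"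
    unfolding cmod_power2 by (simp add: complex_eq_iff m_def power2_eq_square field_simps)
  finally show ?thesis unfolding fock_kernel_def exp_add by (simp add: mult_ac)
qed

lemma stft_hermite_eq:
  "stft_hermite k x \<omega> y \<eta> = of_real ((- 2 * pi) ^ k / sqrt 2) * exp (- \<i> * pi * of_real (y * \<eta>)) *
    (exp (\<i> * pi * of_real (x * \<omega>)) * (Complex y (- \<eta>) - Complex x (- \<omega>)) ^ k * fock_kernel (Complex x (- \<omega>)) (Complex y (- \<eta>)))"
proof (induction k)
  case 0 show ?case by (simp add: stft_hermite_0)
next
  case (Suc k) thus ?case by (simp add: stft_hermite_Suc mult_ac)
qed

text \<open>Orthogonality of the short-time Fourier transform: for fixed y Plancherel is applied in
  the frequency variable, then the squared window is integrated over y. The latter gives 1 / sqrt 2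
  and, with the 1/2 from the transform of the Gaussian, the stated constant.\<close>

lemma bargmann_isometry:
  fixes x \<omega> :: "'i \<Rightarrow> real" and c :: "'i \<Rightarrow> complex"
  assumes F: "finite F"
  shows "(\<integral>\<^sup>+t. ennreal ((norm (\<Sum>i\<in>F. c i * (exp (2 * pi * \<i> * of_real (\<omega> i * t)) * of_real (hermite_raw k (t - x i)))))\<^sup>2) \<partial>lborel)
    = ennreal ((2 * pi) ^ (2 * k) / sqrt 2) *
      (fock_norm_sq k F (\<lambda>i. c i * exp (\<i> * pi * of_real (x i * \<omega> i))) (\<lambda>i. Complex (x i) (- \<omega> i)))"
proof -
  define f where "f = (\<lambda>t. \<Sum>i\<in>F. c i * (exp (2 * pi * \<i> * of_real (\<omega> i * t)) * of_real (hermite_raw k (t - x i))))"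
  define S where "S = fock_sum k F (\<lambda>i. c i * exp (\<i> * pi * of_real (x i * \<omega> i))) (\<lambda>i. Complex (x i) (- \<omega> i))"
  define g where "g = (\<lambda>y t. f t * of_real (exp (- pi * (t - y)\<^sup>2)))"
  have fd: "gaussian_decay f"
    unfolding f_def mult.assoc[symmetric]
    by (intro gaussian_decay_sum F gaussian_decay_mult_bounded[OF gaussian_decay_hermite_raw, of _ "norm (c i)" for i])
       (auto simp: norm_mult norm_exp_eq_Re intro!: continuous_intros)
  have fc: "continuous_on UNIV f" using fd by (simp add: gaussian_decay_def)
  have gd: "gaussian_decay (g y)" for y
    unfolding g_def mult.commute[of "f _"] by (rule gaussian_decay_mult_bounded[OF fd, of _ 1]) (auto intro!: continuous_intros)
  have Fg: "(\<integral>t. g y t * exp (- 2 * pi * \<i> * of_real (\<eta> * t)) \<partial>lborel) = of_real ((- 2 * pi) ^ k / sqrt 2) * exp (- \<i> * pi * of_real (y * \<eta>)) * S (Complex y (- \<eta>))" for y \<eta>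
  proof -
    have e: "exp (2 * pi * \<i> * of_real (w * t)) * exp (- 2 * pi * \<i> * of_real (\<eta> * t)) = exp (2 * pi * \<i> * of_real ((w - \<eta>) * t))" for w t
      unfolding exp_add[symmetric] by (simp add: algebra_simps)
    have "g y t * exp (- 2 * pi * \<i> * of_real (\<eta> * t)) = (\<Sum>i\<in>F. c i * (exp (2 * pi * \<i> * of_real ((\<omega> i - \<eta>) * t)) * of_real (exp (- pi * (t - y)\<^sup>2)) * of_real (hermite_raw k (t - x i))))" for t
      unfolding g_def f_def sum_distrib_right e[symmetric] by (intro sum.cong refl) (simp only: mult_ac)
    hence "(\<integral>t. g y t * exp (- 2 * pi * \<i> * of_real (\<eta> * t)) \<partial>lborel) = (\<Sum>i\<in>F. c i * stft_hermite k (x i) (\<omega> i) y \<eta>)"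
      unfolding stft_hermite_def
      by (simp only: Bochner_Integration.integral_sum[OF integrable_mult_right[OF gaussian_decay_integrable[OF gaussian_decay_stft_integrand]]] integral_mult_right_zero)
    also have "\<dots> = of_real ((- 2 * pi) ^ k / sqrt 2) * exp (- \<i> * pi * of_real (y * \<eta>)) * S (Complex y (- \<eta>))"
      unfolding S_def fock_sum_def sum_distrib_left stft_hermite_eq by (intro sum.cong refl) (simp only: mult_ac)
    finally show ?thesis .
  qed
  have Sm [measurable]: "S \<in> borel_measurable borel" unfolding S_def by (rule fock_sum_measurable)
  have norm_eq: "(norm (of_real ((- 2 * pi) ^ k / sqrt 2) * exp (- \<i> * pi * of_real (y * \<eta>)) * z))\<^sup>2 = ((2 * pi) ^ (2 * k) / 2) * (norm z)\<^sup>2" for y \<eta> z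
    by (simp add: norm_mult norm_divide norm_power norm_exp_eq_Re power_mult_distrib power_divide power_mult[symmetric] mult.commute)
  have "(\<integral>\<^sup>+w. ennreal ((norm (S w))\<^sup>2) \<partial>lborel) = ennreal \<bar>Im (cnj 1 * - \<i>)\<bar> * (\<integral>\<^sup>+p. ennreal ((norm (S (of_real (fst p) * 1 + of_real (snd p) * - \<i>)))\<^sup>2) \<partial>(lborel \<Otimes>\<^sub>M lborel))"
  proof (rule nn_integral_complex_basis)
    show "(\<lambda>w. ennreal ((norm (S w))\<^sup>2)) \<in> borel_measurable borel"
      unfolding S_def by (intro measurable_compose[OF borel_measurable_continuous_onI measurable_ennreal] continuous_intros continuous_fock_sum)
  qed simp
  also have "\<dots> = (\<integral>\<^sup>+p. ennreal ((norm (S (Complex (fst p) (- snd p))))\<^sup>2) \<partial>(lborel \<Otimes>\<^sub>M lborel))"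
  proof -
    have "of_real a * 1 + of_real b * - \<i> = Complex a (- b)" for a b by (simp add: complex_eq_iff)
    thus ?thesis by simp
  qed
  also have "\<dots> = (\<integral>\<^sup>+y. \<integral>\<^sup>+\<eta>. ennreal ((norm (S (Complex y (- \<eta>))))\<^sup>2) \<partial>lborel \<partial>lborel)"
  proof (subst lborel.nn_integral_fst[symmetric])
    have "(\<lambda>p. Complex (fst p) (- snd p)) \<in> borel_measurable (lborel \<Otimes>\<^sub>M lborel)"
      unfolding Complex_eq by (intro measurable_pair_continuous continuous_intros)
    from measurable_compose[OF this, of "\<lambda>w. ennreal ((norm (S w))\<^sup>2)"]
    show "(\<lambda>p. ennreal ((norm (S (Complex (fst p) (- snd p))))\<^sup>2)) \<in> borel_measurable (lborel \<Otimes>\<^sub>M lborel)" by measurable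
  qed simp
  finally have SS: "(\<integral>\<^sup>+y. \<integral>\<^sup>+\<eta>. ennreal ((norm (S (Complex y (- \<eta>))))\<^sup>2) \<partial>lborel \<partial>lborel) = (\<integral>\<^sup>+w. ennreal ((norm (S w))\<^sup>2) \<partial>lborel)" by simp
  have Sm1: "(\<lambda>\<eta>. ennreal ((norm (S (Complex y (- \<eta>))))\<^sup>2)) \<in> borel_measurable lborel" for y
  proof -
    have "(\<lambda>\<eta>. Complex y (- \<eta>)) \<in> borel_measurable borel" unfolding Complex_eq by (intro borel_measurable_continuous_onI continuous_intros)
    from measurable_compose[OF this Sm] show ?thesis by simp
  qed
  have Sm2: "(\<lambda>y. \<integral>\<^sup>+\<eta>. ennreal ((norm (S (Complex y (- \<eta>))))\<^sup>2) \<partial>lborel) \<in> borel_measurable lborel"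
  proof (rule lborel.borel_measurable_nn_integral)
    have "(\<lambda>p. Complex (fst p) (- snd p)) \<in> borel_measurable (lborel \<Otimes>\<^sub>M lborel)"
      unfolding Complex_eq by (intro measurable_pair_continuous continuous_intros)
    from measurable_compose[OF this Sm] show "(\<lambda>(y, \<eta>). ennreal ((norm (S (Complex y (- \<eta>))))\<^sup>2)) \<in> borel_measurable (lborel \<Otimes>\<^sub>M lborel)"
      by (simp add: case_prod_unfold)
  qed
  have "ennreal ((2 * pi) ^ (2 * k) / 2) * (\<integral>\<^sup>+w. ennreal ((norm (S w))\<^sup>2) \<partial>lborel)
     = (\<integral>\<^sup>+y. \<integral>\<^sup>+\<eta>. ennreal ((2 * pi) ^ (2 * k) / 2) * ennreal ((norm (S (Complex y (- \<eta>))))\<^sup>2) \<partial>lborel \<partial>lborel)"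
    unfolding SS[symmetric] using Sm1 Sm2 by (simp add: nn_integral_cmult)
  also have "\<dots> = (\<integral>\<^sup>+y. \<integral>\<^sup>+\<eta>. ennreal ((norm (\<integral>t. g y t * exp (- 2 * pi * \<i> * of_real (\<eta> * t)) \<partial>lborel))\<^sup>2) \<partial>lborel \<partial>lborel)"
  proof -
    have "ennreal ((2 * pi) ^ (2 * k) / 2 * (norm z)\<^sup>2) = ennreal ((2 * pi) ^ (2 * k) / 2) * ennreal ((norm z)\<^sup>2)" for z :: complex
      by (rule ennreal_mult) auto
    thus ?thesis by (simp only: Fg norm_eq)
  qed
  also have "\<dots> = (\<integral>\<^sup>+y. \<integral>\<^sup>+t. ennreal ((norm (g y t))\<^sup>2) \<partial>lborel \<partial>lborel)"
    by (simp only: plancherel_gaussian_decay[OF gd])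
  also have "\<dots> = (\<integral>\<^sup>+y. \<integral>\<^sup>+t. ennreal ((norm (f t))\<^sup>2) * ennreal (exp (- (2 * pi) * (y - t)\<^sup>2)) \<partial>lborel \<partial>lborel)"
    by (intro nn_integral_cong) (simp add: g_def norm_mult power_mult_distrib power2_commute exp_double[symmetric] flip: ennreal_mult exp_of_nat_mult)
  also have "\<dots> = (\<integral>\<^sup>+t. \<integral>\<^sup>+y. ennreal ((norm (f t))\<^sup>2) * ennreal (exp (- (2 * pi) * (y - t)\<^sup>2)) \<partial>lborel \<partial>lborel)"
  proof (rule lborel_pair.Fubini'[symmetric])
    have "(\<lambda>p. (norm (f (snd p)))\<^sup>2 * exp (- (2 * pi) * (fst p - snd p)\<^sup>2)) \<in> borel_measurable (lborel \<Otimes>\<^sub>M lborel)"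
      by (intro measurable_pair_continuous continuous_intros continuous_on_compose2[OF fc]) auto
    thus "(\<lambda>(y, t). ennreal ((norm (f t))\<^sup>2) * ennreal (exp (- (2 * pi) * (y - t)\<^sup>2))) \<in> borel_measurable (lborel \<Otimes>\<^sub>M lborel)"
      by (simp add: case_prod_unfold flip: ennreal_mult)
  qed
  also have "\<dots> = (\<integral>\<^sup>+t. ennreal ((norm (f t))\<^sup>2) * ennreal (1 / sqrt 2) \<partial>lborel)"
  proof (rule nn_integral_cong)
    fix t
    have "(\<integral>\<^sup>+y. ennreal (exp (- (2 * pi) * (y - t)\<^sup>2)) \<partial>lborel) = (\<integral>\<^sup>+y. ennreal (exp (- (2 * pi) * y\<^sup>2)) \<partial>lborel)"
      by (subst nn_integral_real_affine[where c = 1 and t = t]) auto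
    also have "\<dots> = ennreal (sqrt (pi / (2 * pi)))"
      using gaussian_fourier_integral(1,2)[of "2 * pi"] by (subst nn_integral_eq_integral) auto
    also have "sqrt (pi / (2 * pi)) = 1 / sqrt 2" by (simp add: real_sqrt_divide)
    finally show "(\<integral>\<^sup>+y. ennreal ((norm (f t))\<^sup>2) * ennreal (exp (- (2 * pi) * (y - t)\<^sup>2)) \<partial>lborel) = ennreal ((norm (f t))\<^sup>2) * ennreal (1 / sqrt 2)"
      by (subst nn_integral_cmult) auto
  qed
  also have "\<dots> = (\<integral>\<^sup>+t. ennreal ((norm (f t))\<^sup>2) \<partial>lborel) * ennreal (1 / sqrt 2)"
  proof (rule nn_integral_multc)
    show "(\<lambda>t. ennreal ((norm (f t))\<^sup>2)) \<in> borel_measurable lborel"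
      by (simp only: measurable_lborel2, intro measurable_compose[OF borel_measurable_continuous_onI measurable_ennreal] continuous_intros fc)
  qed
  finally have "ennreal (sqrt 2) * (ennreal ((2 * pi) ^ (2 * k) / 2) * (\<integral>\<^sup>+w. ennreal ((norm (S w))\<^sup>2) \<partial>lborel)) = ennreal (sqrt 2) * ((\<integral>\<^sup>+t. ennreal ((norm (f t))\<^sup>2) \<partial>lborel) * ennreal (1 / sqrt 2))"
    by simp
  moreover have "ennreal (sqrt 2) * ((\<integral>\<^sup>+t. ennreal ((norm (f t))\<^sup>2) \<partial>lborel) * ennreal (1 / sqrt 2)) = (\<integral>\<^sup>+t. ennreal ((norm (f t))\<^sup>2) \<partial>lborel)"
    by (subst mult.commute, subst mult.assoc, subst ennreal_mult[symmetric]) auto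
  moreover have "ennreal (sqrt 2) * (ennreal ((2 * pi) ^ (2 * k) / 2) * X) = ennreal ((2 * pi) ^ (2 * k) / sqrt 2) * X" for X
  proof -
    have e: "sqrt 2 * (a / 2) = a / sqrt 2" for a :: real using real_sqrt_mult_self[of 2] by (simp add: field_simps)
    have "ennreal (sqrt 2) * ennreal ((2 * pi) ^ (2 * k) / 2) = ennreal (sqrt 2 * ((2 * pi) ^ (2 * k) / 2))"
      by (rule ennreal_mult[symmetric]) simp_all
    thus ?thesis unfolding e mult.assoc[symmetric] by (rule arg_cong)
  qed
  ultimately have "(\<integral>\<^sup>+t. ennreal ((norm (f t))\<^sup>2) \<partial>lborel) = ennreal ((2 * pi) ^ (2 * k) / sqrt 2) * (\<integral>\<^sup>+w. ennreal ((norm (S w))\<^sup>2) \<partial>lborel)" by metis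
  thus ?thesis unfolding f_def S_def .
qed

section \<open>Failure of the lower bound from critical density on\<close>

lemma integral_translation_complex:
  fixes f :: "complex \<Rightarrow> complex"
  assumes "f \<in> borel_measurable borel"
  shows "(\<integral>z. f (z + d) \<partial>lborel) = (\<integral>z. f z \<partial>lborel)"
proof -
  have "(\<integral>z. f z \<partial>distr lborel borel ((+) d)) = (\<integral>z. f (d + z) \<partial>lborel)"
    by (rule integral_distr) (use assms in auto)
  thus ?thesis by (simp add: lborel_distr_plus add.commute)
qed

lemma complex_unfold_integral:
  fixes h :: "complex \<Rightarrow> complex" and \<alpha> \<beta> :: complex
  assumes V: "Im (cnj \<alpha> * \<beta>) \<noteq> 0" and h: "integrable lborel h" and hm: "h \<in> borel_measurable borel"
  shows "(\<integral>p. \<integral>i. h (of_real (fst p) * \<alpha> + of_real (snd p) * \<beta> + lpt \<alpha> \<beta> i) \<partial>count_space UNIV \<partial>unit_square) = (1 / \<bar>Im (cnj \<alpha> * \<beta>)\<bar>) *\<^sub>R (\<integral>z. h z \<partial>lborel)"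
proof -
  define v where "v = \<bar>Im (cnj \<alpha> * \<beta>)\<bar>"
  have v: "v > 0" using V unfolding v_def zero_less_abs_iff .
  define M where "M = unit_square \<Otimes>\<^sub>M count_space (UNIV :: (int \<times> int) set)"
  define T where "T = (\<lambda>(p :: real \<times> real, i). of_real (fst p) * \<alpha> + of_real (snd p) * \<beta> + lpt \<alpha> \<beta> i)"
  have L: "lborel = density (distr M borel T) (\<lambda>_. ennreal v)" unfolding M_def T_def v_def by (rule lborel_complex_unfold[OF V])
  have T: "T \<in> borel_measurable M"
  proof -
    have "(\<lambda>x. of_real (fst (fst x)) * \<alpha> + of_real (snd (fst x)) * \<beta> + lpt \<alpha> \<beta> (snd x)) \<in> borel_measurable M"
    proof (intro borel_measurable_add borel_measurable_times borel_measurable_const)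
      have f: "(\<lambda>x. fst x :: real \<times> real) \<in> borel_measurable M"
        unfolding M_def using measurable_fst[of unit_square "count_space UNIV"] measurable_cong_sets[OF refl sets_unit_square] by blast
      have "(\<lambda>p :: real \<times> real. complex_of_real (fst p)) \<in> borel_measurable borel" "(\<lambda>p :: real \<times> real. complex_of_real (snd p)) \<in> borel_measurable borel"
        by (intro borel_measurable_continuous_onI continuous_intros)+
      from this[THEN measurable_compose[OF f]]
      show "(\<lambda>x. complex_of_real (fst (fst x))) \<in> borel_measurable M" "(\<lambda>x. complex_of_real (snd (fst x))) \<in> borel_measurable M" .
      show "(\<lambda>x. lpt \<alpha> \<beta> (snd x)) \<in> borel_measurable M" unfolding M_def by measurable
    qed
    thus ?thesis by (simp add: T_def case_prod_unfold)
  qed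
  have i1: "integrable (distr M borel T) (\<lambda>z. v *\<^sub>R h z)"
    using h hm v by (subst (asm) L, subst (asm) integrable_density) auto
  have i2: "integrable (distr M borel T) h"
    using integrable_scaleR_right[OF i1, of "1 / v"] v by simp
  have i3: "integrable M (\<lambda>x. h (T x))" by (rule integrable_distr[OF T i2])
  have "(\<integral>z. h z \<partial>lborel) = (\<integral>z. v *\<^sub>R h z \<partial>distr M borel T)"
    by (subst L, subst integral_density) (use hm v in auto)
  also have "\<dots> = v *\<^sub>R (\<integral>z. h z \<partial>distr M borel T)" by simp
  also have "(\<integral>z. h z \<partial>distr M borel T) = (\<integral>x. h (T x) \<partial>M)" by (rule integral_distr[OF T]) (use hm in auto)
  also have "\<dots> = (\<integral>p. \<integral>i. h (T (p, i)) \<partial>count_space UNIV \<partial>unit_square)"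
    using square_lattice.integral_fst'[of "\<lambda>x. h (T x)"] i3 unfolding M_def by simp
  finally have "(\<integral>z. h z \<partial>lborel) = v *\<^sub>R (\<integral>p. \<integral>i. h (T (p, i)) \<partial>count_space UNIV \<partial>unit_square)" .
  hence "(1 / v) *\<^sub>R (\<integral>z. h z \<partial>lborel) = (\<integral>p. \<integral>i. h (T (p, i)) \<partial>count_space UNIV \<partial>unit_square)" using v by simp
  thus ?thesis by (simp only: v_def T_def prod.case)
qed

lemma gaussian_lattice_integrable:
  fixes \<alpha> \<beta> w :: complex
  assumes V: "Im (cnj \<alpha> * \<beta>) \<noteq> 0" and \<epsilon>: "\<epsilon> > 0"
  shows "integrable (count_space UNIV) (\<lambda>i. C * exp (- \<epsilon> * (norm (w - lpt \<alpha> \<beta> i))\<^sup>2))"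
proof -
  obtain G where "G > 0" and G: "\<And>w. (\<integral>\<^sup>+i. ennreal (exp (- \<epsilon> * (norm (w - lpt \<alpha> \<beta> i))\<^sup>2)) \<partial>count_space UNIV) \<le> ennreal G"
    by (rule gaussian_lattice_sum_bounded[OF V \<epsilon>]) blast
  from order.strict_trans1[OF G[of w] ennreal_less_top]
  have "integrable (count_space UNIV) (\<lambda>i. exp (- \<epsilon> * (norm (w - lpt \<alpha> \<beta> i))\<^sup>2))"
    by (intro integrableI_bounded) simp_all
  thus ?thesis by simp
qed

text \<open>The Fourier coefficients of the periodisation are the integrals of \<open>\<Psi>\<close>
  against the characters of the dual lattice. All of them vanish and the periodisation is
  continuous, so it is zero at the origin; convergence of its Fourier series is not in
  question.\<close>

lemma lattice_sum_zero_if_fourier_zero: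
  fixes \<Psi> :: "complex \<Rightarrow> complex" and \<alpha> \<beta> w :: complex
  assumes V: "0 < Im (cnj \<alpha> * \<beta>)" and c: "continuous_on UNIV \<Psi>" and \<epsilon>: "\<epsilon> > 0"
    and b: "\<And>z. norm (\<Psi> z) \<le> C * exp (- \<epsilon> * (norm (z - w))\<^sup>2)"
    and zero: "\<And>j. (\<integral>z. \<Psi> z * exp (2 * pi * \<i> * of_real (Im (cnj z * lpt (\<alpha> / Im (cnj \<alpha> * \<beta>)) (\<beta> / Im (cnj \<alpha> * \<beta>)) j))) \<partial>lborel) = 0"
  shows "(\<integral>i. \<Psi> (lpt \<alpha> \<beta> i) \<partial>count_space UNIV) = 0"
proof -
  have V0: "Im (cnj \<alpha> * \<beta>) \<noteq> 0" using V by linarith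
  have C0: "C \<ge> 0" using order.trans[OF norm_ge_zero b[of w]] by simp
  define v where "v = Im (cnj \<alpha> * \<beta>)"
  define Z where "Z = (\<lambda>q :: real \<times> real. of_real (fst q) * \<alpha> + of_real (snd q) * \<beta>)"
  have Zc: "continuous_on UNIV Z" unfolding Z_def by (intro continuous_intros)
  define p where "p = (\<lambda>q. \<integral>i. \<Psi> (Z q + lpt \<alpha> \<beta> i) \<partial>count_space UNIV)"
  have "p (0, 0) = 0"
  proof (rule continuous_trig_coefficients_zero_2)
    show "continuous_on UNIV p"
      unfolding continuous_on_sequentially o_def
    proof safe
      fix q :: "nat \<Rightarrow> real \<times> real" and a b'
      assume q: "q \<longlonglongrightarrow> (a, b')"
      have Zq: "(\<lambda>k. Z (q k)) \<longlonglongrightarrow> Z (a, b')" using continuous_on_tendsto_compose[OF Zc q] by auto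
      hence "Bseq (\<lambda>k. Z (q k) - Z (a, b'))" 
        by (intro convergent_imp_Bseq convergentI[of _ "Z (a, b') - Z (a, b')"] tendsto_diff tendsto_const)
      \<comment> \<open>A convergent sequence of base points stays within \<open>r\<close> of its
        limit. At half the rate and with the factor exp (\<epsilon> r^2), one Gaussian about the
        limit dominates all terms.\<close>
      then obtain r where r: "\<And>k. norm (Z (q k) - Z (a, b')) \<le> r" by (auto simp: Bseq_def)
      show "(\<lambda>k. p (q k)) \<longlonglongrightarrow> p (a, b')" unfolding p_def
      proof (rule integral_dominated_convergence[where w = "\<lambda>i. (C * exp (\<epsilon> * r\<^sup>2)) * exp (- (\<epsilon> / 2) * (norm ((w - Z (a, b')) - lpt \<alpha> \<beta> i))\<^sup>2)"])
        show "integrable (count_space UNIV) (\<lambda>i. (C * exp (\<epsilon> * r\<^sup>2)) * exp (- (\<epsilon> / 2) * (norm ((w - Z (a, b')) - lpt \<alpha> \<beta> i))\<^sup>2))"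
          using \<epsilon> by (intro gaussian_lattice_integrable V0) auto
        show "AE i in count_space UNIV. (\<lambda>k. \<Psi> (Z (q k) + lpt \<alpha> \<beta> i)) \<longlonglongrightarrow> \<Psi> (Z (a, b') + lpt \<alpha> \<beta> i)"
          by (intro AE_I2 continuous_on_tendsto_compose[OF c] tendsto_intros Zq) auto
        show "AE i in count_space UNIV. norm (\<Psi> (Z (q k) + lpt \<alpha> \<beta> i)) \<le> (C * exp (\<epsilon> * r\<^sup>2)) * exp (- (\<epsilon> / 2) * (norm ((w - Z (a, b')) - lpt \<alpha> \<beta> i))\<^sup>2)" for k
        proof (rule AE_I2)
          fix i
          define x where "x = norm (Z (q k) + lpt \<alpha> \<beta> i - w)"
          have "norm ((w - Z (a, b')) - lpt \<alpha> \<beta> i) \<le> x + r"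
          proof -
            have "(w - Z (a, b')) - lpt \<alpha> \<beta> i = - (Z (q k) + lpt \<alpha> \<beta> i - w) + (Z (q k) - Z (a, b'))" by simp
            hence "norm ((w - Z (a, b')) - lpt \<alpha> \<beta> i) \<le> norm (Z (q k) + lpt \<alpha> \<beta> i - w) + norm (Z (q k) - Z (a, b'))"
              by (metis norm_triangle_ineq norm_minus_cancel)
            thus ?thesis unfolding x_def using r[of k] by linarith
          qed
          hence "(norm ((w - Z (a, b')) - lpt \<alpha> \<beta> i))\<^sup>2 \<le> (x + r)\<^sup>2" by (intro power_mono) auto
          also have "\<dots> \<le> 2 * x\<^sup>2 + 2 * r\<^sup>2" using zero_le_power2[of "x - r"] by (simp add: power2_eq_square algebra_simps)
          finally have "\<epsilon> / 2 * (norm ((w - Z (a, b')) - lpt \<alpha> \<beta> i))\<^sup>2 \<le> \<epsilon> / 2 * (2 * x\<^sup>2 + 2 * r\<^sup>2)" using \<epsilon> by (intro mult_left_mono) auto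
          hence "exp (- \<epsilon> * x\<^sup>2) \<le> exp (\<epsilon> * r\<^sup>2) * exp (- (\<epsilon> / 2) * (norm ((w - Z (a, b')) - lpt \<alpha> \<beta> i))\<^sup>2)"
            unfolding exp_add[symmetric] by (simp add: algebra_simps)
          hence "C * exp (- \<epsilon> * x\<^sup>2) \<le> C * (exp (\<epsilon> * r\<^sup>2) * exp (- (\<epsilon> / 2) * (norm ((w - Z (a, b')) - lpt \<alpha> \<beta> i))\<^sup>2))"
            using C0 by (rule mult_left_mono)
          thus "norm (\<Psi> (Z (q k) + lpt \<alpha> \<beta> i)) \<le> (C * exp (\<epsilon> * r\<^sup>2)) * exp (- (\<epsilon> / 2) * (norm ((w - Z (a, b')) - lpt \<alpha> \<beta> i))\<^sup>2)"
            using b[of "Z (q k) + lpt \<alpha> \<beta> i"] by (simp add: x_def mult.assoc)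
        qed
      qed auto
    qed
    fix m l :: int
    \<comment> \<open>With these signs the character at the point with coordinates q is the
      exponential of frequency (m, l) on the unit square.\<close>
    define \<mu> where "\<mu> = lpt (\<alpha> / v) (\<beta> / v) (- m, - l)"
    define h where "h = (\<lambda>z :: complex. \<Psi> z * exp (2 * pi * \<i> * of_real (Im (cnj z * \<mu>))))"
    have hc: "continuous_on UNIV h" unfolding h_def by (intro continuous_intros c)
    have hm: "h \<in> borel_measurable borel" by (rule borel_measurable_continuous_onI[OF hc])
    have nh: "norm (h z) = norm (\<Psi> z)" for z by (simp add: h_def norm_mult norm_exp_eq_Re)
    have hi: "integrable lborel h"
    proof (rule Bochner_Integration.integrable_bound[where f = "\<lambda>z. C * exp (- \<epsilon> * (norm (z - w))\<^sup>2)"])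
      have mm: "(\<lambda>z :: complex. exp (- \<epsilon> * (norm (z - w))\<^sup>2)) \<in> borel_measurable lborel"
        by (simp only: measurable_lborel2, intro borel_measurable_continuous_onI continuous_intros)
      have "integrable lborel (\<lambda>z. exp (- \<epsilon> * (norm (z - w))\<^sup>2))"
        using nn_integral_gaussian_plane[OF \<epsilon>, of w] mm by (intro integrableI_bounded) auto
      thus "integrable lborel (\<lambda>z. C * exp (- \<epsilon> * (norm (z - w))\<^sup>2))" by simp
      show "h \<in> borel_measurable lborel" using hm by simp
      show "AE z in lborel. norm (h z) \<le> norm (C * exp (- \<epsilon> * (norm (z - w))\<^sup>2))"
        using b C0 by (intro AE_I2) (simp add: nh)
    qed
    have per: "exp (2 * pi * \<i> * of_real (Im (cnj (Z q + lpt \<alpha> \<beta> i) * \<mu>))) = exp (2 * pi * \<i> * (of_int m * of_real (snd q) - of_int l * of_real (fst q)))" for q i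
    proof -
      have "Im (cnj (Z q + lpt \<alpha> \<beta> i) * \<mu>) = ((of_int m * snd q - of_int l * fst q) + of_int (m * snd i - l * fst i)) * (v / v)"
      proof -
        have "\<mu> = (- (of_int m * \<alpha>) - of_int l * \<beta>) / of_real v" unfolding \<mu>_def lpt_def by (simp add: add_divide_distrib diff_divide_distrib)
        hence "Im (cnj (Z q + lpt \<alpha> \<beta> i) * \<mu>) = Im (cnj (Z q + lpt \<alpha> \<beta> i) * (- (of_int m * \<alpha>) - of_int l * \<beta>)) / v"
          by (simp only: times_divide_eq_right Im_divide_of_real)
        also have "Im (cnj (Z q + lpt \<alpha> \<beta> i) * (- (of_int m * \<alpha>) - of_int l * \<beta>)) = ((of_int m * snd q - of_int l * fst q) + of_int (m * snd i - l * fst i)) * v"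
          by (simp add: Z_def lpt_def v_def algebra_simps)
        finally show ?thesis by simp
      qed
      hence e: "Im (cnj (Z q + lpt \<alpha> \<beta> i) * \<mu>) = (of_int m * snd q - of_int l * fst q) + of_int (m * snd i - l * fst i)"
        using V0 by (simp add: v_def del: of_int_diff)
      have "exp (2 * pi * \<i> * of_real (Im (cnj (Z q + lpt \<alpha> \<beta> i) * \<mu>))) = exp (2 * pi * \<i> * (of_int m * of_real (snd q) - of_int l * of_real (fst q)) + (2 * of_int (m * snd i - l * fst i) * pi) * \<i>)"
        unfolding e by (rule arg_cong[where f = exp]) (simp add: algebra_simps)
      also have "\<dots> = exp (2 * pi * \<i> * (of_int m * of_real (snd q) - of_int l * of_real (fst q)))"
        unfolding exp_add by (subst exp_integer_2pi) auto
      finally show ?thesis .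
    qed
    have "(\<integral>q. p q * exp (2 * pi * \<i> * (of_int m * of_real (snd q) - of_int l * of_real (fst q))) \<partial>unit_square) = (\<integral>q. \<integral>i. h (Z q + lpt \<alpha> \<beta> i) \<partial>count_space UNIV \<partial>unit_square)"
      unfolding p_def h_def per by (simp only: integral_mult_left_zero)
    also have "\<dots> = (1 / \<bar>Im (cnj \<alpha> * \<beta>)\<bar>) *\<^sub>R (\<integral>z. h z \<partial>lborel)"
      unfolding Z_def by (rule complex_unfold_integral[OF V0 hi hm])
    also have "(\<integral>z. h z \<partial>lborel) = 0" unfolding h_def \<mu>_def v_def by (rule zero)
    finally show "(\<integral>q. p q * exp (2 * pi * \<i> * (of_int m * of_real (snd q) - of_int l * of_real (fst q))) \<partial>unit_square) = 0" by simp
  qed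
  thus ?thesis by (simp add: p_def Z_def)
qed

text \<open>The substitution z = y + \<mu> - a moves the zero of \<sigma> (z + a) at \<mu> to y = 0.
  With this centre the antiholomorphic linear terms of the exponent cancel, and there remain an
  entire function with a zero of order n, a power of c - cnj y and the Gaussian.\<close>

lemma (in lattice_sigma) sigma_power_fourier_zero:
  fixes a w :: complex
  assumes n: "real n * \<kappa> \<le> pi / 2" and k: "k < n"
  shows "(\<integral>z. (\<sigma> (z + a) ^ n * exp (- pi * a * cnj z) * (cnj w - cnj z) ^ k * exp (pi * z * cnj w - pi * z * cnj z)) *
      exp (2 * pi * \<i> * of_real (Im (cnj z * lpt \<alpha> \<beta> j))) \<partial>(lborel :: complex measure)) = 0"
proof -
  define \<mu> where "\<mu> = lpt \<alpha> \<beta> j"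
  define d where "d = \<mu> - a"
  define \<gamma> where "\<gamma> = cnj w - cnj \<mu> - cnj d"
  define H where "H = (\<lambda>z :: complex. (\<sigma> (z + a) ^ n * exp (- pi * a * cnj z) * (cnj w - cnj z) ^ k * exp (pi * z * cnj w - pi * z * cnj z)) * exp (2 * pi * \<i> * of_real (Im (cnj z * \<mu>))))"
  obtain s where s: "s holomorphic_on UNIV" "\<And>z. \<sigma> z = (z - \<mu>) * s z"
    "\<And>z. s z = 0 \<Longrightarrow> z \<in> range (lpt \<alpha> \<beta>) - {\<mu>}"
    by (rule sigma_factor[of j, folded \<mu>_def]) blast
  define R where "R = (\<lambda>y. s (y + \<mu>) ^ n * exp (pi * \<gamma> * y))"
  have Rh: "R holomorphic_on UNIV" unfolding R_def by (intro holomorphic_intros holomorphic_on_UNIV_compose[OF s(1)])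
  have \<sigma>R: "y ^ n * R y = \<sigma> (y + \<mu>) ^ n * exp (pi * \<gamma> * y)" for y by (simp add: R_def s(2) power_mult_distrib)
  have \<sigma>c: "continuous_on UNIV \<sigma>" by (rule holomorphic_on_imp_continuous_on[OF holomorphic_sigma])
  have Hc: "continuous_on UNIV H" unfolding H_def by (intro continuous_intros continuous_on_compose2[OF \<sigma>c]) auto
  obtain P where P: "P > 0" "\<And>z. per z \<le> P" using per_bounded by blast
  \<comment> \<open>The power of \<sigma> has rate at most pi / 2; the linear exponents are absorbed
    by completing squares. The resulting rate 3 pi / 4 leaves the margin pi / 4 demanded by the
    averaging lemma.\<close>
  have bound: "norm (y ^ n * R y) \<le> (P ^ n * exp (pi / 2 * (norm \<mu>)\<^sup>2 + pi * (norm \<mu> + norm \<gamma>)\<^sup>2)) * exp ((pi - pi / 4) * (norm y)\<^sup>2)" for y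
  proof -
    have "norm (\<sigma> (y + \<mu>)) ^ n = per (y + \<mu>) ^ n * exp (real n * \<kappa> * (norm (y + \<mu>))\<^sup>2)"
      by (simp add: norm_sigma power_mult_distrib mult.assoc flip: exp_of_nat_mult)
    also have "\<dots> \<le> P ^ n * exp (pi / 2 * (norm (y + \<mu>))\<^sup>2)"
      using P mult_right_mono[OF n zero_le_power2] by (intro mult_mono power_mono) (auto simp: per_def)
    finally have 1: "norm (\<sigma> (y + \<mu>)) ^ n \<le> P ^ n * exp (pi / 2 * (norm (y + \<mu>))\<^sup>2)" .
    have 2: "norm (exp (pi * \<gamma> * y)) \<le> exp (pi * norm \<gamma> * norm y)"
      using norm_exp[of "pi * \<gamma> * y"] by (simp add: norm_mult)
    have "norm (y ^ n * R y) \<le> (P ^ n * exp (pi / 2 * (norm (y + \<mu>))\<^sup>2)) * exp (pi * norm \<gamma> * norm y)"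
      unfolding \<sigma>R norm_mult norm_power using 1 2 P(1) by (intro mult_mono) auto
    also have "\<dots> = P ^ n * exp (pi / 2 * (norm (y + \<mu>))\<^sup>2 + pi * norm \<gamma> * norm y)" by (simp add: exp_add)
    also have "\<dots> \<le> P ^ n * exp ((pi / 2 * (norm \<mu>)\<^sup>2 + pi * (norm \<mu> + norm \<gamma>)\<^sup>2) + (pi - pi / 4) * (norm y)\<^sup>2)"
    proof (intro mult_left_mono)
      have "(norm (y + \<mu>))\<^sup>2 \<le> (norm y + norm \<mu>)\<^sup>2" by (intro power_mono norm_triangle_ineq) auto
      hence "pi / 2 * (norm (y + \<mu>))\<^sup>2 \<le> pi / 2 * (norm y + norm \<mu>)\<^sup>2" by (intro mult_left_mono) auto
      moreover have "pi * ((norm \<mu> + norm \<gamma>) * norm y) \<le> pi * ((norm \<mu> + norm \<gamma>)\<^sup>2 + (norm y)\<^sup>2 / 4)"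
        using zero_le_power2[of "(norm \<mu> + norm \<gamma>) - norm y / 2"] by (intro mult_left_mono) (auto simp: power2_eq_square algebra_simps)
      ultimately show "exp (pi / 2 * (norm (y + \<mu>))\<^sup>2 + pi * norm \<gamma> * norm y) \<le> exp ((pi / 2 * (norm \<mu>)\<^sup>2 + pi * (norm \<mu> + norm \<gamma>)\<^sup>2) + (pi - pi / 4) * (norm y)\<^sup>2)"
        by (simp add: power2_eq_square algebra_simps)
    qed (use P in auto)
    finally show ?thesis by (simp add: exp_add mult_ac)
  qed
  have Hd: "H (y + d) = exp (pi * d * (cnj w - cnj \<mu>)) * (y ^ n * R y * ((cnj w - cnj d) - cnj y) ^ k * of_real (exp (- pi * (norm y)\<^sup>2)))" for y
  proof -
    define z where "z = y + d"
    have im: "2 * pi * \<i> * of_real (Im (cnj z * \<mu>)) = pi * (cnj z * \<mu> - z * cnj \<mu>)"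
      using diff_cnj_eq[of "cnj z * \<mu>"] by (simp only: complex_cnj_mult complex_cnj_cnj) (simp add: algebra_simps)
    have ex: "- pi * a * cnj z + (pi * z * cnj w - pi * z * cnj z) + pi * (cnj z * \<mu> - z * cnj \<mu>)
        = pi * d * (cnj w - cnj \<mu>) + pi * \<gamma> * y + (- pi * (y * cnj y))"
      unfolding z_def \<gamma>_def d_def by (simp add: algebra_simps)
    have "H z = \<sigma> (y + \<mu>) ^ n * ((cnj w - cnj d) - cnj y) ^ k * exp (- pi * a * cnj z + (pi * z * cnj w - pi * z * cnj z) + pi * (cnj z * \<mu> - z * cnj \<mu>))"
      unfolding H_def im exp_add by (simp add: z_def d_def algebra_simps)
    also have "\<dots> = exp (pi * d * (cnj w - cnj \<mu>)) * ((\<sigma> (y + \<mu>) ^ n * exp (pi * \<gamma> * y)) * ((cnj w - cnj d) - cnj y) ^ k * exp (- pi * (y * cnj y)))"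
      unfolding ex exp_add by (simp only: mult_ac)
    also have "exp (- pi * (y * cnj y)) = complex_of_real (exp (- pi * (norm y)\<^sup>2))"
      unfolding exp_of_real[symmetric] by (simp add: complex_norm_square[symmetric])
    finally show ?thesis unfolding \<sigma>R z_def .
  qed
  have "(\<integral>z. H z \<partial>lborel) = (\<integral>y. H (y + d) \<partial>lborel)" by (rule integral_translation_complex[symmetric, OF borel_measurable_continuous_onI[OF Hc]])
  also have "\<dots> = exp (pi * d * (cnj w - cnj \<mu>)) * (\<integral>y. y ^ n * R y * ((cnj w - cnj d) - cnj y) ^ k * of_real (exp (- pi * (norm y)\<^sup>2)) \<partial>lborel)"
    unfolding Hd by (rule integral_mult_right_zero)
  also have "\<dots> = 0" using integral_vanishing_order[OF Rh k _ bound] by simp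
  finally show ?thesis by (simp only: H_def \<mu>_def)
qed

text \<open>Poisson summation is applied to the conjugate summand without the factor exp (- pi |w|^2
  / 2): conjugation turns \<sigma> into a holomorphic function of the summation variable. The growth
  condition leaves a Gaussian about w.\<close>

lemma (in lattice_sigma) fock_vanishing_sum:
  fixes \<alpha>' \<beta>' a w :: complex
  assumes V': "0 < Im (cnj \<alpha>' * \<beta>')" and \<alpha>: "\<alpha> = \<alpha>' / Im (cnj \<alpha>' * \<beta>')" and \<beta>: "\<beta> = \<beta>' / Im (cnj \<alpha>' * \<beta>')"
    and n: "real n * \<kappa> \<le> pi / 2" and k: "k < n"
  shows "(\<integral>i. (cnj (\<sigma> (lpt \<alpha>' \<beta>' i + a) ^ n) * exp (- pi * cnj a * lpt \<alpha>' \<beta>' i - pi * (norm (lpt \<alpha>' \<beta>' i))\<^sup>2 / 2)) * (w - lpt \<alpha>' \<beta>' i) ^ k * fock_kernel (lpt \<alpha>' \<beta>' i) w \<partial>count_space UNIV) = 0"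
proof -
  define \<Psi> where "\<Psi> = (\<lambda>z :: complex. \<sigma> (z + a) ^ n * exp (- pi * a * cnj z) * (cnj w - cnj z) ^ k * exp (pi * z * cnj w - pi * z * cnj z))"
  have \<sigma>c: "continuous_on UNIV \<sigma>" by (rule holomorphic_on_imp_continuous_on[OF holomorphic_sigma])
  have \<Psi>c: "continuous_on UNIV \<Psi>" unfolding \<Psi>_def by (intro continuous_intros continuous_on_compose2[OF \<sigma>c]) auto
  obtain P where P: "P > 0" "\<And>z. per z \<le> P" using per_bounded by blast
  have b: "norm (\<Psi> z) \<le> (P ^ n * exp (pi / 2 * ((norm w)\<^sup>2 + (norm a)\<^sup>2)) * (fact n * exp (1/2))) * exp (- 1 * (norm (z - w))\<^sup>2)" for z
  proof -
    have "norm (\<sigma> (z + a)) ^ n = per (z + a) ^ n * exp (real n * \<kappa> * (norm (z + a))\<^sup>2)"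
      by (simp add: norm_sigma power_mult_distrib mult.assoc flip: exp_of_nat_mult)
    also have "\<dots> \<le> P ^ n * exp (pi / 2 * (norm (z + a))\<^sup>2)"
      using P mult_right_mono[OF n zero_le_power2] by (intro mult_mono power_mono) (auto simp: per_def)
    finally have 1: "norm (\<sigma> (z + a)) ^ n \<le> P ^ n * exp (pi / 2 * (norm (z + a))\<^sup>2)" .
    have nk: "norm ((cnj w - cnj z) ^ k) = norm (z - w) ^ k"
      unfolding norm_power by (metis complex_cnj_diff complex_mod_cnj norm_minus_commute)
    have ee: "pi / 2 * (norm (z + a))\<^sup>2 + Re (- pi * a * cnj z) + Re (pi * z * cnj w - pi * z * cnj z) = pi / 2 * ((norm w)\<^sup>2 + (norm a)\<^sup>2) + (- pi * (norm (z - w))\<^sup>2 / 2)"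
      unfolding cmod_power2 by (simp add: power2_eq_square field_simps)
    have "norm (\<Psi> z) \<le> (P ^ n * exp (pi / 2 * (norm (z + a))\<^sup>2)) * exp (Re (- pi * a * cnj z)) * norm (z - w) ^ k * exp (Re (pi * z * cnj w - pi * z * cnj z))"
      unfolding \<Psi>_def norm_mult nk norm_exp_eq_Re norm_power[of "\<sigma> (z + a)"] using 1 by (intro mult_right_mono) auto
    also have "\<dots> = P ^ n * (exp (pi / 2 * (norm (z + a))\<^sup>2) * exp (Re (- pi * a * cnj z)) * exp (Re (pi * z * cnj w - pi * z * cnj z))) * norm (z - w) ^ k"
      by (simp only: mult_ac)
    also have "\<dots> = P ^ n * exp (pi / 2 * ((norm w)\<^sup>2 + (norm a)\<^sup>2)) * (norm (z - w) ^ k * exp (- pi * (norm (z - w))\<^sup>2 / 2))"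
      unfolding exp_add[symmetric] ee by (simp only: exp_add mult_ac)
    also have "\<dots> \<le> P ^ n * exp (pi / 2 * ((norm w)\<^sup>2 + (norm a)\<^sup>2)) * ((fact n * exp (1/2)) * exp (- (norm (z - w))\<^sup>2))"
      using P k by (intro mult_left_mono power_mult_gaussian_le) auto
    finally show ?thesis by (simp add: mult_ac)
  qed
  have "(\<integral>i. \<Psi> (lpt \<alpha>' \<beta>' i) \<partial>count_space UNIV) = 0"
  proof (rule lattice_sum_zero_if_fourier_zero[OF V' \<Psi>c _ b])
    show "(\<integral>z. \<Psi> z * exp (2 * pi * \<i> * of_real (Im (cnj z * lpt (\<alpha>' / Im (cnj \<alpha>' * \<beta>')) (\<beta>' / Im (cnj \<alpha>' * \<beta>')) j))) \<partial>lborel) = 0" for j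
      unfolding \<Psi>_def \<alpha>[symmetric] \<beta>[symmetric] by (rule sigma_power_fourier_zero[OF n k])
  qed simp
  hence "of_real (exp (- pi * (norm w)\<^sup>2 / 2)) * cnj (\<integral>i. \<Psi> (lpt \<alpha>' \<beta>' i) \<partial>count_space UNIV) = 0" by simp
  hence "(\<integral>i. of_real (exp (- pi * (norm w)\<^sup>2 / 2)) * cnj (\<Psi> (lpt \<alpha>' \<beta>' i)) \<partial>count_space UNIV) = 0"
    by (simp only: Bochner_Integration.integral_cnj integral_mult_right_zero)
  moreover have "of_real (exp (- pi * (norm w)\<^sup>2 / 2)) * cnj (\<Psi> z) = (cnj (\<sigma> (z + a) ^ n) * exp (- pi * cnj a * z - pi * (norm z)\<^sup>2 / 2)) * (w - z) ^ k * fock_kernel z w" for z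
  proof -
    have nz: "z * cnj z = of_real ((norm z)\<^sup>2)" by (simp only: complex_norm_square)
    have "of_real (exp (- pi * (norm w)\<^sup>2 / 2)) * exp (cnj (- pi * a * cnj z)) * exp (cnj (pi * z * cnj w - pi * z * cnj z))
       = exp (- pi * cnj a * z - pi * (norm z)\<^sup>2 / 2) * fock_kernel z w"
      unfolding fock_kernel_def exp_of_real[symmetric] exp_add[symmetric]
      by (rule arg_cong[where f = exp]) (use nz in \<open>simp add: algebra_simps\<close>)
    hence "(of_real (exp (- pi * (norm w)\<^sup>2 / 2)) * exp (cnj (- pi * a * cnj z)) * exp (cnj (pi * z * cnj w - pi * z * cnj z))) * (cnj (\<sigma> (z + a) ^ n) * (w - z) ^ k)
       = (exp (- pi * cnj a * z - pi * (norm z)\<^sup>2 / 2) * fock_kernel z w) * (cnj (\<sigma> (z + a) ^ n) * (w - z) ^ k)" by (rule arg_cong)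
    moreover have "cnj (\<Psi> z) = cnj (\<sigma> (z + a) ^ n) * exp (cnj (- pi * a * cnj z)) * (w - z) ^ k * exp (cnj (pi * z * cnj w - pi * z * cnj z))"
      unfolding \<Psi>_def by (simp only: complex_cnj_mult exp_cnj complex_cnj_power complex_cnj_diff complex_cnj_cnj)
    ultimately show ?thesis by (simp only: mult_ac)
  qed
  ultimately show ?thesis by (simp only:)
qed

section \<open>Finite sections of the vanishing series\<close>

lemma finite_lattice_ball:
  fixes \<alpha> \<beta> :: complex
  assumes V: "Im (cnj \<alpha> * \<beta>) \<noteq> 0"
  shows "finite {i. norm (lpt \<alpha> \<beta> i) < R}"
proof -
  define c where "c = (Im (cnj \<alpha> * \<beta>))\<^sup>2 / ((norm \<alpha>)\<^sup>2 + (norm \<beta>)\<^sup>2)"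
  have c: "c > 0" unfolding c_def by (rule norm_lattice_combination_ge(1)[OF V])
  define N where "N = \<lceil>R\<^sup>2 / c\<rceil>"
  have "i \<in> {- N..N} \<times> {- N..N}" if i: "norm (lpt \<alpha> \<beta> i) < R" for i
  proof -
    have "c * ((of_int (fst i))\<^sup>2 + (of_int (snd i))\<^sup>2) \<le> (norm (lpt \<alpha> \<beta> i))\<^sup>2"
      using norm_lattice_combination_ge(2)[OF V, of "of_int (fst i)" "of_int (snd i)"] by (simp add: c_def lpt_def)
    also have "\<dots> \<le> R\<^sup>2" using i by (intro power_mono) auto
    finally have "(of_int (fst i))\<^sup>2 + (of_int (snd i))\<^sup>2 \<le> R\<^sup>2 / c" using c by (simp add: field_simps)
    also have "\<dots> \<le> of_int N" unfolding N_def by (rule le_of_int_ceiling)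
    finally have "real_of_int ((fst i)\<^sup>2 + (snd i)\<^sup>2) \<le> of_int N" by simp
    hence le: "(fst i)\<^sup>2 + (snd i)\<^sup>2 \<le> N" by (simp only: of_int_le_iff)
    have sq: "\<bar>x\<bar> \<le> x\<^sup>2" for x :: int
      using self_le_power[of "\<bar>x\<bar>" 2] by (cases "x = 0") auto
    have "\<bar>fst i\<bar> \<le> N" using le sq[of "fst i"] zero_le_power2[of "snd i"] by linarith
    moreover have "\<bar>snd i\<bar> \<le> N" using le sq[of "snd i"] zero_le_power2[of "fst i"] by linarith
    ultimately show ?thesis by (cases i) (simp add: abs_le_iff)
  qed
  hence "{i. norm (lpt \<alpha> \<beta> i) < R} \<subseteq> {- N..N} \<times> {- N..N}" by blast
  thus ?thesis by (rule finite_subset) simp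
qed

text \<open>The coefficients \<open>b\<close> are cut off by the Lipschitz function \<open>1 - \<bar>z\<bar> / R\<close>. Since the full series vanishes,
  one may subtract the cutoff at \<open>w\<close>, which gains the factor \<open>\<bar>w - \<lambda>\<bar> / R\<close>.\<close>

lemma fock_sum_cutoff_le:
  fixes \<alpha> \<beta> w :: complex
  assumes V: "Im (cnj \<alpha> * \<beta>) \<noteq> 0" and B: "\<And>i. norm (b i) \<le> B" and k: "k < n" and R: "R > 0" and H: "H \<ge> 0"
    and zero: "(\<integral>i. b i * (w - lpt \<alpha> \<beta> i) ^ k * fock_kernel (lpt \<alpha> \<beta> i) w \<partial>count_space UNIV) = 0"
    and le: "(\<integral>\<^sup>+i. ennreal (if norm (lpt \<alpha> \<beta> i) < R \<or> norm w < R then norm (b i) * exp (- (norm (w - lpt \<alpha> \<beta> i))\<^sup>2) else 0) \<partial>count_space UNIV) \<le> ennreal H"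
  shows "norm (fock_sum k {i. norm (lpt \<alpha> \<beta> i) < R} (\<lambda>i. of_real (1 - norm (lpt \<alpha> \<beta> i) / R) * b i) (lpt \<alpha> \<beta>) w) \<le> (fact n * exp (1 / 2) / R) * H"
proof -
  define C where "C = (fact n * exp (1 / 2) :: real)"
  have C: "C > 0" by (simp add: C_def)
  define u where "u = (\<lambda>z :: complex. max 0 (1 - norm z / R))"
  define f where "f = (\<lambda>i. b i * (w - lpt \<alpha> \<beta> i) ^ k * fock_kernel (lpt \<alpha> \<beta> i) w)"
  have nf: "norm (f i) = norm (b i) * (norm (w - lpt \<alpha> \<beta> i) ^ k * exp (- pi * (norm (w - lpt \<alpha> \<beta> i))\<^sup>2 / 2))" for i
    by (simp add: f_def norm_mult norm_power norm_fock_kernel)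
  have B0: "B \<ge> 0" using order.trans[OF norm_ge_zero B] .
  have fb: "norm (f i) \<le> (B * C) * exp (- 1 * (norm (w - lpt \<alpha> \<beta> i))\<^sup>2)" for i
  proof -
    have "norm (f i) \<le> B * (C * exp (- (norm (w - lpt \<alpha> \<beta> i))\<^sup>2))"
      unfolding nf C_def using B k B0 by (intro mult_mono power_mult_gaussian_le) auto
    thus ?thesis by (simp add: mult.assoc)
  qed
  have fi: "integrable (count_space UNIV) f"
    by (rule Bochner_Integration.integrable_bound[OF gaussian_lattice_integrable[OF V, of 1 "B * C" w]])
       (use fb B0 C in auto)
  have u01: "0 \<le> u z" "u z \<le> 1" for z using R by (auto simp: u_def)
  have ui: "integrable (count_space UNIV) (\<lambda>i. of_real (u (lpt \<alpha> \<beta> i)) * f i)"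
    by (rule Bochner_Integration.integrable_bound[OF fi]) (use u01 in \<open>auto simp: norm_mult intro!: mult_left_le_one_le\<close>)
  have fin: "finite {i. norm (lpt \<alpha> \<beta> i) < R}" by (rule finite_lattice_ball[OF V])
  have u0: "u z = 0" if "\<not> norm z < R" for z using that R by (simp add: u_def)
  have u1: "u z = 1 - norm z / R" if "norm z < R" for z using that R by (simp add: u_def)
  have "fock_sum k {i. norm (lpt \<alpha> \<beta> i) < R} (\<lambda>i. of_real (1 - norm (lpt \<alpha> \<beta> i) / R) * b i) (lpt \<alpha> \<beta>) w = (\<Sum>i | norm (lpt \<alpha> \<beta> i) < R. of_real (u (lpt \<alpha> \<beta> i)) * f i)"
    unfolding fock_sum_def f_def by (intro sum.cong refl) (simp add: u1 mult.assoc)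
  also have "\<dots> = (\<integral>i. of_real (u (lpt \<alpha> \<beta> i)) * f i \<partial>count_space UNIV)"
  proof -
    have sub: "{i. of_real (u (lpt \<alpha> \<beta> i)) * f i \<noteq> 0} \<subseteq> {i. norm (lpt \<alpha> \<beta> i) < R}" using u0 by auto
    have "(\<integral>i. of_real (u (lpt \<alpha> \<beta> i)) * f i \<partial>count_space UNIV) = (\<Sum>i | i \<in> UNIV \<and> of_real (u (lpt \<alpha> \<beta> i)) * f i \<noteq> 0. of_real (u (lpt \<alpha> \<beta> i)) * f i)"
      by (rule lebesgue_integral_count_space_finite_support) (use finite_subset[OF sub fin] in simp)
    also have "\<dots> = (\<Sum>i | norm (lpt \<alpha> \<beta> i) < R. of_real (u (lpt \<alpha> \<beta> i)) * f i)"
      by (rule sum.mono_neutral_left[OF fin]) (use sub in auto)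
    finally show ?thesis by simp
  qed
  also have "\<dots> = (\<integral>i. of_real (u (lpt \<alpha> \<beta> i)) * f i \<partial>count_space UNIV) - (\<integral>i. of_real (u w) * f i \<partial>count_space UNIV)"
    using zero by (simp add: f_def)
  also have "\<dots> = (\<integral>i. of_real (u (lpt \<alpha> \<beta> i)) * f i - of_real (u w) * f i \<partial>count_space UNIV)"
    by (rule Bochner_Integration.integral_diff[symmetric, OF ui integrable_mult_right[OF fi]])
  finally have eq: "fock_sum k {i. norm (lpt \<alpha> \<beta> i) < R} (\<lambda>i. of_real (1 - norm (lpt \<alpha> \<beta> i) / R) * b i) (lpt \<alpha> \<beta>) w = (\<integral>i. of_real (u (lpt \<alpha> \<beta> i)) * f i - of_real (u w) * f i \<partial>count_space UNIV)" (is "?S = _") .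
  \<comment> \<open>If both w and the lattice point are outside the ball, both cutoffs vanish; this
    localisation is what later yields decay in w.\<close>
  have pw: "norm (of_real (u (lpt \<alpha> \<beta> i)) * f i - of_real (u w) * f i) \<le> (C / R) * (if norm (lpt \<alpha> \<beta> i) < R \<or> norm w < R then norm (b i) * exp (- (norm (w - lpt \<alpha> \<beta> i))\<^sup>2) else 0)" for i
  proof (cases "norm (lpt \<alpha> \<beta> i) < R \<or> norm w < R")
    case False
    thus ?thesis using u0 by simp
  next
    case True
    define x where "x = norm (w - lpt \<alpha> \<beta> i)"
    have "\<bar>u (lpt \<alpha> \<beta> i) - u w\<bar> \<le> \<bar>norm (lpt \<alpha> \<beta> i) / R - norm w / R\<bar>" unfolding u_def by (auto simp: max_def abs_if)
    also have "\<dots> = \<bar>norm (lpt \<alpha> \<beta> i) - norm w\<bar> / R" using R by (simp flip: diff_divide_distrib)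
    also have "\<dots> \<le> x / R" unfolding x_def using R norm_triangle_ineq3[of "lpt \<alpha> \<beta> i" w] by (intro divide_right_mono) (auto simp: norm_minus_commute)
    finally have 1: "\<bar>u (lpt \<alpha> \<beta> i) - u w\<bar> \<le> x / R" .
    have "norm (of_real (u (lpt \<alpha> \<beta> i)) * f i - of_real (u w) * f i) = \<bar>u (lpt \<alpha> \<beta> i) - u w\<bar> * norm (f i)"
      unfolding left_diff_distrib[symmetric] of_real_diff[symmetric] norm_mult norm_of_real ..
    also have "\<dots> \<le> (x / R) * norm (f i)" by (intro mult_right_mono 1) auto
    \<comment> \<open>The distance gained from the Lipschitz bound raises the power to Suc k, which
      is still at most \<open>n\<close>; hence the constant with fact n.\<close>
    also have "\<dots> = (norm (b i) / R) * (x ^ Suc k * exp (- pi * x\<^sup>2 / 2))" unfolding nf x_def[symmetric] by simp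
    also have "\<dots> \<le> (norm (b i) / R) * (C * exp (- x\<^sup>2))" unfolding C_def using k R by (intro mult_left_mono power_mult_gaussian_le) (auto simp: x_def)
    finally show ?thesis using True by (simp add: x_def mult_ac)
  qed
  have "ennreal (norm ?S) \<le> (\<integral>\<^sup>+i. ennreal (norm (of_real (u (lpt \<alpha> \<beta> i)) * f i - of_real (u w) * f i)) \<partial>count_space UNIV)"
    unfolding eq by (rule integral_norm_bound_ennreal[OF Bochner_Integration.integrable_diff[OF ui integrable_mult_right[OF fi]]])
  also have "\<dots> \<le> (\<integral>\<^sup>+i. ennreal (C / R) * ennreal (if norm (lpt \<alpha> \<beta> i) < R \<or> norm w < R then norm (b i) * exp (- (norm (w - lpt \<alpha> \<beta> i))\<^sup>2) else 0) \<partial>count_space UNIV)"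
  proof (intro nn_integral_mono)
    fix i
    have "0 \<le> (if norm (lpt \<alpha> \<beta> i) < R \<or> norm w < R then norm (b i) * exp (- (norm (w - lpt \<alpha> \<beta> i))\<^sup>2) else 0)" by simp
    from ennreal_mult[OF _ this, of "C / R"] ennreal_leI[OF pw[of i]]
    show "ennreal (norm (of_real (u (lpt \<alpha> \<beta> i)) * f i - of_real (u w) * f i)) \<le> ennreal (C / R) * ennreal (if norm (lpt \<alpha> \<beta> i) < R \<or> norm w < R then norm (b i) * exp (- (norm (w - lpt \<alpha> \<beta> i))\<^sup>2) else 0)"
      using C R by (simp only: divide_nonneg_nonneg less_imp_le)
  qed
  also have "\<dots> = ennreal (C / R) * (\<integral>\<^sup>+i. ennreal (if norm (lpt \<alpha> \<beta> i) < R \<or> norm w < R then norm (b i) * exp (- (norm (w - lpt \<alpha> \<beta> i))\<^sup>2) else 0) \<partial>count_space UNIV)"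
    by (rule nn_integral_cmult) simp
  also have "\<dots> \<le> ennreal (C / R) * ennreal H" by (intro mult_left_mono le) simp
  also have "\<dots> = ennreal (C / R * H)" using C R H by (intro ennreal_mult[symmetric]) auto
  finally show ?thesis unfolding C_def using H R by (subst (asm) ennreal_le_iff) auto
qed

lemma fock_energy_le:
  fixes a :: complex
  assumes \<epsilon>: "\<epsilon> > 0" and P: "P \<ge> 0" and le: "\<And>k w. k < n \<Longrightarrow> norm (fock_sum k F c l w) \<le> P * exp (- \<epsilon> * (norm (w - a))\<^sup>2)"
  shows "(\<Sum>k<n. fock_norm_sq k F c l) \<le> ennreal (real n * P\<^sup>2 * (pi / (2 * \<epsilon>)))"
proof -
  have m: "(\<lambda>w :: complex. ennreal (exp (- (2 * \<epsilon>) * (norm (w - a))\<^sup>2))) \<in> borel_measurable lborel"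
    by (simp only: measurable_lborel2, intro measurable_compose[OF borel_measurable_continuous_onI measurable_ennreal] continuous_intros)
  have "(fock_norm_sq k F c l) \<le> ennreal (P\<^sup>2 * (pi / (2 * \<epsilon>)))" if k: "k < n" for k
  proof -
    have "ennreal ((norm (fock_sum k F c l w))\<^sup>2) \<le> ennreal (P\<^sup>2) * ennreal (exp (- (2 * \<epsilon>) * (norm (w - a))\<^sup>2))" for w
    proof -
      have "(norm (fock_sum k F c l w))\<^sup>2 \<le> (P * exp (- \<epsilon> * (norm (w - a))\<^sup>2))\<^sup>2" by (intro power_mono le[OF k]) auto
      also have "\<dots> = P\<^sup>2 * exp (- (2 * \<epsilon>) * (norm (w - a))\<^sup>2)" unfolding power_mult_distrib exp_of_nat_mult[symmetric] by simp
      finally show ?thesis by (subst ennreal_mult[symmetric]) (auto intro: ennreal_leI)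
    qed
    hence "(fock_norm_sq k F c l) \<le> (\<integral>\<^sup>+w. ennreal (P\<^sup>2) * ennreal (exp (- (2 * \<epsilon>) * (norm (w - a))\<^sup>2)) \<partial>lborel)" by (intro nn_integral_mono)
    also have "\<dots> = ennreal (P\<^sup>2) * (\<integral>\<^sup>+w. ennreal (exp (- (2 * \<epsilon>) * (norm (w - a))\<^sup>2)) \<partial>lborel)" by (rule nn_integral_cmult[OF m])
    also have "(\<integral>\<^sup>+w. ennreal (exp (- (2 * \<epsilon>) * (norm (w - a))\<^sup>2)) \<partial>lborel) = ennreal (pi / (2 * \<epsilon>))"
      using \<epsilon> by (intro nn_integral_gaussian_plane) simp
    finally show ?thesis using \<epsilon> by (simp add: ennreal_mult[symmetric])
  qed
  hence "(\<Sum>k<n. fock_norm_sq k F c l) \<le> (\<Sum>k<n. ennreal (P\<^sup>2 * (pi / (2 * \<epsilon>))))" by (intro sum_mono) auto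
  also have "\<dots> = ennreal (\<Sum>k<n. P\<^sup>2 * (pi / (2 * \<epsilon>)))" using \<epsilon> by (intro sum_ennreal) auto
  also have "(\<Sum>k<n. P\<^sup>2 * (pi / (2 * \<epsilon>))) = real n * P\<^sup>2 * (pi / (2 * \<epsilon>))" by simp
  finally show ?thesis .
qed

text \<open>The case of density above n. The coefficients decay, so the cut-off sums are 1/R times a
  fixed Gaussian and their energy is of order 1/R^2, whereas the coefficient at the origin is
  untouched by the cutoff.\<close>

lemma fock_energy_small_decaying:
  fixes \<alpha> \<beta> a :: complex
  assumes V: "Im (cnj \<alpha> * \<beta>) \<noteq> 0" and \<tau>: "\<tau> > 0" and b: "\<And>i. norm (b i) \<le> B * exp (- \<tau> * (norm (lpt \<alpha> \<beta> i + a))\<^sup>2)"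
    and b0: "b (0, 0) \<noteq> 0" and A: "A > 0"
    and zero: "\<And>k w. k < n \<Longrightarrow> (\<integral>i. b i * (w - lpt \<alpha> \<beta> i) ^ k * fock_kernel (lpt \<alpha> \<beta> i) w \<partial>count_space UNIV) = 0"
  shows "\<exists>F c. finite F \<and> (\<Sum>k<n. fock_norm_sq k F c (lpt \<alpha> \<beta>)) < ennreal (A * (\<Sum>i\<in>F. (norm (c i))\<^sup>2))"
proof -
  obtain G where G0: "G > 0" and G: "\<And>w. (\<integral>\<^sup>+i. ennreal (exp (- (1 / 2) * (norm (w - lpt \<alpha> \<beta> i))\<^sup>2)) \<partial>count_space UNIV) \<le> ennreal G"
    by (rule gaussian_lattice_sum_bounded[OF V, of "1 / 2"]) (simp, blast)
  define C where "C = (fact n * exp (1 / 2) :: real)"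
  have C: "C > 0" by (simp add: C_def)
  have B0: "B \<ge> 0"
  proof -
    have "0 \<le> B * exp (- \<tau> * (norm (lpt \<alpha> \<beta> (0, 0) + a))\<^sup>2)" by (rule order.trans[OF norm_ge_zero b])
    thus ?thesis by (simp add: zero_le_mult_iff)
  qed
  have bB: "norm (b i) \<le> B" for i
  proof -
    have "B * exp (- \<tau> * (norm (lpt \<alpha> \<beta> i + a))\<^sup>2) \<le> B * 1" using B0 \<tau> by (intro mult_left_mono) auto
    thus ?thesis using b[of i] by simp
  qed
  define \<epsilon> where "\<epsilon> = min \<tau> 1"
  have \<epsilon>: "0 < \<epsilon>" "\<epsilon> \<le> \<tau>" "\<epsilon> \<le> 1" using \<tau> by (auto simp: \<epsilon>_def)
  define Q where "Q = real n * (C * (B * G))\<^sup>2 * (pi / (2 * (\<epsilon> / 4)))"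
  have Q0: "Q \<ge> 0" using \<epsilon> by (simp add: Q_def)
  \<comment> \<open>Chosen so that R A |b (0, 0)|^2 exceeds Q; as R >= 1, the energy Q / R^2 then
    falls below A |b (0, 0)|^2.\<close>
  define R where "R = Q / (A * (norm (b (0, 0)))\<^sup>2) + 1"
  have pos: "A * (norm (b (0, 0)))\<^sup>2 > 0" using A b0 by simp
  have R1: "R \<ge> 1" using Q0 pos by (simp add: R_def)
  define F where "F = {i. norm (lpt \<alpha> \<beta> i) < R}"
  define c where "c = (\<lambda>i. of_real (1 - norm (lpt \<alpha> \<beta> i) / R) * b i)"
  have le: "norm (fock_sum k F c (lpt \<alpha> \<beta>) w) \<le> (C / R * (B * G)) * exp (- (\<epsilon> / 4) * (norm (w - (- a)))\<^sup>2)" if k: "k < n" for k w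
  proof -
    have "norm (fock_sum k F c (lpt \<alpha> \<beta>) w) \<le> C / R * (B * G * exp (- (\<epsilon> / 4) * (norm (w + a))\<^sup>2))"
      unfolding F_def c_def C_def
    proof (rule fock_sum_cutoff_le[OF V bB k _ _ zero[OF k]])
      have pw: "(if norm (lpt \<alpha> \<beta> i) < R \<or> norm w < R then norm (b i) * exp (- (norm (w - lpt \<alpha> \<beta> i))\<^sup>2) else 0)
         \<le> (B * exp (- (\<epsilon> / 4) * (norm (w + a))\<^sup>2)) * exp (- (1 / 2) * (norm (w - lpt \<alpha> \<beta> i))\<^sup>2)" for i
      proof -
        define x where "x = norm (w - lpt \<alpha> \<beta> i)"
        define y where "y = norm (lpt \<alpha> \<beta> i + a)"
        have "norm (w + a) \<le> x + y" unfolding x_def y_def using norm_triangle_ineq[of "w - lpt \<alpha> \<beta> i" "lpt \<alpha> \<beta> i + a"] by simp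
        hence "(norm (w + a))\<^sup>2 \<le> (x + y)\<^sup>2" by (intro power_mono) auto
        also have "\<dots> \<le> 2 * x\<^sup>2 + 2 * y\<^sup>2" using zero_le_power2[of "x - y"] by (simp add: power2_eq_square algebra_simps)
        finally have "\<epsilon> / 4 * (norm (w + a))\<^sup>2 \<le> \<epsilon> / 4 * (2 * x\<^sup>2 + 2 * y\<^sup>2)" using \<epsilon> by (intro mult_left_mono) auto
        also have "\<dots> = \<epsilon> / 2 * x\<^sup>2 + \<epsilon> / 2 * y\<^sup>2" by (simp add: field_simps)
        also have "\<dots> \<le> 1 / 2 * x\<^sup>2 + \<tau> * y\<^sup>2" using \<epsilon> by (intro add_mono mult_right_mono) auto
        finally have e: "- \<tau> * y\<^sup>2 + - x\<^sup>2 \<le> - (\<epsilon> / 4) * (norm (w + a))\<^sup>2 + - (1 / 2) * x\<^sup>2" by simp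
        have "norm (b i) * exp (- x\<^sup>2) \<le> (B * exp (- \<tau> * y\<^sup>2)) * exp (- x\<^sup>2)" unfolding y_def by (intro mult_right_mono b) auto
        also have "\<dots> = B * exp (- \<tau> * y\<^sup>2 + - x\<^sup>2)" by (simp only: exp_add mult.assoc)
        also have "\<dots> \<le> B * exp (- (\<epsilon> / 4) * (norm (w + a))\<^sup>2 + - (1 / 2) * x\<^sup>2)" using e B0 by (intro mult_left_mono) auto
        also have "\<dots> = (B * exp (- (\<epsilon> / 4) * (norm (w + a))\<^sup>2)) * exp (- (1 / 2) * x\<^sup>2)" by (simp only: exp_add mult.assoc)
        finally have "norm (b i) * exp (- x\<^sup>2) \<le> (B * exp (- (\<epsilon> / 4) * (norm (w + a))\<^sup>2)) * exp (- (1 / 2) * x\<^sup>2)" .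
        thus ?thesis unfolding x_def using B0 by (auto intro: mult_nonneg_nonneg)
      qed
      have "(\<integral>\<^sup>+i. ennreal (if norm (lpt \<alpha> \<beta> i) < R \<or> norm w < R then norm (b i) * exp (- (norm (w - lpt \<alpha> \<beta> i))\<^sup>2) else 0) \<partial>count_space UNIV)
        \<le> (\<integral>\<^sup>+i. ennreal (B * exp (- (\<epsilon> / 4) * (norm (w + a))\<^sup>2)) * ennreal (exp (- (1 / 2) * (norm (w - lpt \<alpha> \<beta> i))\<^sup>2)) \<partial>count_space UNIV)"
        using B0 by (intro nn_integral_mono, subst ennreal_mult[symmetric]) (auto simp only: intro!: ennreal_leI pw mult_nonneg_nonneg exp_ge_zero)
      also have "\<dots> = ennreal (B * exp (- (\<epsilon> / 4) * (norm (w + a))\<^sup>2)) * (\<integral>\<^sup>+i. ennreal (exp (- (1 / 2) * (norm (w - lpt \<alpha> \<beta> i))\<^sup>2)) \<partial>count_space UNIV)"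
        by (rule nn_integral_cmult) simp
      also have "\<dots> \<le> ennreal (B * exp (- (\<epsilon> / 4) * (norm (w + a))\<^sup>2)) * ennreal G" by (intro mult_left_mono G) simp
      also have "\<dots> = ennreal (B * exp (- (\<epsilon> / 4) * (norm (w + a))\<^sup>2) * G)" using B0 G0 by (intro ennreal_mult[symmetric]) auto
      also have "B * exp (- (\<epsilon> / 4) * (norm (w + a))\<^sup>2) * G = B * G * exp (- (\<epsilon> / 4) * (norm (w + a))\<^sup>2)" by (simp only: mult_ac)
      finally show "(\<integral>\<^sup>+i. ennreal (if norm (lpt \<alpha> \<beta> i) < R \<or> norm w < R then norm (b i) * exp (- (norm (w - lpt \<alpha> \<beta> i))\<^sup>2) else 0) \<partial>count_space UNIV)
        \<le> ennreal (B * G * exp (- (\<epsilon> / 4) * (norm (w + a))\<^sup>2))" .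
    qed (use R1 B0 G0 in auto)
    thus ?thesis by (simp only: mult.assoc diff_minus_eq_add)
  qed
  have "(\<Sum>k<n. fock_norm_sq k F c (lpt \<alpha> \<beta>)) \<le> ennreal (real n * (C / R * (B * G))\<^sup>2 * (pi / (2 * (\<epsilon> / 4))))"
    by (rule fock_energy_le[OF _ _ le]) (use \<epsilon> C R1 B0 G0 in auto)
  also have "real n * (C / R * (B * G))\<^sup>2 * (pi / (2 * (\<epsilon> / 4))) = Q / R\<^sup>2"
    unfolding Q_def by (simp add: power_mult_distrib power_divide)
  also have "ennreal (Q / R\<^sup>2) < ennreal (A * (norm (b (0, 0)))\<^sup>2)"
  proof (rule ennreal_lessI[OF pos])
    have "Q < R * (A * (norm (b (0, 0)))\<^sup>2)" 
    proof -
      have "(Q / x + 1) * x = Q + x" if "x > 0" for x using that by (simp add: field_simps)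
      from this[OF pos] have "R * (A * (norm (b (0, 0)))\<^sup>2) = Q + A * (norm (b (0, 0)))\<^sup>2" unfolding R_def .
      thus ?thesis using pos by linarith
    qed
    also have "\<dots> \<le> R\<^sup>2 * (A * (norm (b (0, 0)))\<^sup>2)" using R1 pos by (intro mult_right_mono) (auto simp: power2_eq_square)
    finally show "Q / R\<^sup>2 < A * (norm (b (0, 0)))\<^sup>2" using R1 by (simp add: field_simps)
  qed
  also have "\<dots> \<le> ennreal (A * (\<Sum>i\<in>F. (norm (c i))\<^sup>2))"
  proof (intro ennreal_leI mult_left_mono)
    have "(0, 0) \<in> F" "c (0, 0) = b (0, 0)" using R1 by (auto simp: F_def c_def lpt_def)
    moreover have "finite F" unfolding F_def by (rule finite_lattice_ball[OF V])
    ultimately show "(norm (b (0, 0)))\<^sup>2 \<le> (\<Sum>i\<in>F. (norm (c i))\<^sup>2)" using member_le_sum[of "(0, 0)" F "\<lambda>i. (norm (c i))\<^sup>2"] by auto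
  qed (use A in auto)
  finally show ?thesis using finite_lattice_ball[OF V] F_def by blast
qed

text \<open>The critical case. Without decay the cut-off sums are of size 1/R on a disc of radius of
  order R, so the energy is bounded independently of R, while infinitely many coefficients of
  modulus at least \<open>\<delta>\<close> make the right side arbitrarily large.\<close>

lemma fock_energy_small_bounded:
  fixes \<alpha> \<beta> :: complex
  assumes V: "Im (cnj \<alpha> * \<beta>) \<noteq> 0" and b: "\<And>i. norm (b i) \<le> B"
    and \<delta>: "\<delta> > 0" "infinite {i. norm (b i) \<ge> \<delta>}" and A: "A > 0"
    and zero: "\<And>k w. k < n \<Longrightarrow> (\<integral>i. b i * (w - lpt \<alpha> \<beta> i) ^ k * fock_kernel (lpt \<alpha> \<beta> i) w \<partial>count_space UNIV) = 0"
  shows "\<exists>F c. finite F \<and> (\<Sum>k<n. fock_norm_sq k F c (lpt \<alpha> \<beta>)) < ennreal (A * (\<Sum>i\<in>F. (norm (c i))\<^sup>2))"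
proof -
  obtain G where G0: "G > 0" and G: "\<And>w. (\<integral>\<^sup>+i. ennreal (exp (- (1 / 2) * (norm (w - lpt \<alpha> \<beta> i))\<^sup>2)) \<partial>count_space UNIV) \<le> ennreal G"
    by (rule gaussian_lattice_sum_bounded[OF V, of "1 / 2"]) (simp, blast)
  define C where "C = (fact n * exp (1 / 2) :: real)"
  have C: "C > 0" by (simp add: C_def)
  have B0: "B \<ge> 0" by (rule order.trans[OF norm_ge_zero b])
  \<comment> \<open>The energy bound is free of R, since the area factor pi R^2 cancels 1 / R^2. The
    number m of large coefficients can thus be fixed before R.\<close>
  define Q where "Q = real n * (C * (B * (G * exp 2)))\<^sup>2 * (pi / 2 * 2)"
  have Q0: "Q \<ge> 0" by (simp add: Q_def)
  define m where "m = nat \<lceil>4 * Q / (A * \<delta>\<^sup>2)\<rceil> + 1"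
  have m: "Q < A * (real m * (\<delta> / 2)\<^sup>2)"
  proof -
    have "4 * Q / (A * \<delta>\<^sup>2) < real m" unfolding m_def using real_nat_ceiling_ge[of "4 * Q / (A * \<delta>\<^sup>2)"] by linarith
    thus ?thesis using A \<delta>(1) by (simp add: field_simps power_divide)
  qed
  obtain T where T: "finite T" "card T = m" "T \<subseteq> {i. norm (b i) \<ge> \<delta>}" using infinite_arbitrarily_large[OF \<delta>(2)] by blast
  \<comment> \<open>All of \<open>T\<close> lies within radius R / 2, so the cutoff keeps at least
    half of each of its coefficients.\<close>
  define R where "R = 2 + 2 * (\<Sum>i\<in>T. norm (lpt \<alpha> \<beta> i))"
  have R2: "R \<ge> 2" unfolding R_def by (simp add: sum_nonneg)
  have TR: "2 * norm (lpt \<alpha> \<beta> i) < R" if "i \<in> T" for i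
    unfolding R_def using member_le_sum[OF that, of "\<lambda>i. norm (lpt \<alpha> \<beta> i)"] T(1) by simp
  define F where "F = {i. norm (lpt \<alpha> \<beta> i) < R}"
  define c where "c = (\<lambda>i. of_real (1 - norm (lpt \<alpha> \<beta> i) / R) * b i)"
  have finF: "finite F" unfolding F_def by (rule finite_lattice_ball[OF V])
  have le: "norm (fock_sum k F c (lpt \<alpha> \<beta>) w) \<le> (C / R * (B * (G * exp 2))) * exp (- (1 / (2 * R\<^sup>2)) * (norm (w - 0))\<^sup>2)" if k: "k < n" for k w
  proof -
    have "norm (fock_sum k F c (lpt \<alpha> \<beta>) w) \<le> C / R * (B * (G * exp 2) * exp (- (1 / (2 * R\<^sup>2)) * (norm w)\<^sup>2))"
      unfolding F_def c_def C_def
    proof (rule fock_sum_cutoff_le[OF V b k _ _ zero[OF k]])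
      define E where "E = exp 2 * exp (- (1 / (2 * R\<^sup>2)) * (norm w)\<^sup>2)"
      have pw: "(if norm (lpt \<alpha> \<beta> i) < R \<or> norm w < R then norm (b i) * exp (- (norm (w - lpt \<alpha> \<beta> i))\<^sup>2) else 0)
         \<le> (B * E) * exp (- (1 / 2) * (norm (w - lpt \<alpha> \<beta> i))\<^sup>2)" for i
      proof (cases "norm (lpt \<alpha> \<beta> i) < R \<or> norm w < R")
        case True
        define x where "x = norm (w - lpt \<alpha> \<beta> i)"
        \<comment> \<open>For |w| < 2 R the left side is at most 2, the origin of exp 2. Otherwise
          the lattice point is in the ball, its distance to w is at least |w| / 2, and R >= 2 does
          the rest.\<close>
        have "(norm w)\<^sup>2 / (2 * R\<^sup>2) \<le> 2 + 1 / 2 * x\<^sup>2"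
        proof (cases "norm w < 2 * R")
          case True
          hence "(norm w)\<^sup>2 \<le> (2 * R)\<^sup>2" by (intro power_mono) auto
          hence "(norm w)\<^sup>2 / (2 * R\<^sup>2) \<le> 2" using R2 by (simp add: field_simps power_mult_distrib)
          thus ?thesis by (simp add: add_increasing2)
        next
          case False
          hence "norm (lpt \<alpha> \<beta> i) < R" using True R2 by linarith
          moreover have "norm w \<le> x + norm (lpt \<alpha> \<beta> i)" unfolding x_def using norm_triangle_ineq[of "w - lpt \<alpha> \<beta> i" "lpt \<alpha> \<beta> i"] by simp
          ultimately have "norm w / 2 \<le> x" using False by linarith
          hence "(norm w / 2)\<^sup>2 \<le> x\<^sup>2" by (intro power_mono) auto
          hence 1: "(norm w)\<^sup>2 / 8 \<le> 1 / 2 * x\<^sup>2" by (simp add: power_divide)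
          have "2\<^sup>2 \<le> R\<^sup>2" using R2 by (intro power_mono) auto
          hence "(norm w)\<^sup>2 / (2 * R\<^sup>2) \<le> (norm w)\<^sup>2 / 8" by (intro divide_left_mono) auto
          thus ?thesis using 1 by linarith
        qed
        hence "- x\<^sup>2 \<le> (2 + - (1 / (2 * R\<^sup>2)) * (norm w)\<^sup>2) + - (1 / 2) * x\<^sup>2" by simp
        hence "exp (- x\<^sup>2) \<le> exp ((2 + - (1 / (2 * R\<^sup>2)) * (norm w)\<^sup>2) + - (1 / 2) * x\<^sup>2)" by simp
        also have "\<dots> = E * exp (- (1 / 2) * x\<^sup>2)" by (simp only: E_def exp_add)
        finally have "norm (b i) * exp (- x\<^sup>2) \<le> B * (E * exp (- (1 / 2) * x\<^sup>2))" using B0 b by (intro mult_mono) auto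
        thus ?thesis unfolding x_def using True by (simp add: mult.assoc)
      qed (use B0 in \<open>simp add: E_def\<close>)
      have E0: "E \<ge> 0" by (simp add: E_def)
      have "(\<integral>\<^sup>+i. ennreal (if norm (lpt \<alpha> \<beta> i) < R \<or> norm w < R then norm (b i) * exp (- (norm (w - lpt \<alpha> \<beta> i))\<^sup>2) else 0) \<partial>count_space UNIV)
        \<le> (\<integral>\<^sup>+i. ennreal (B * E) * ennreal (exp (- (1 / 2) * (norm (w - lpt \<alpha> \<beta> i))\<^sup>2)) \<partial>count_space UNIV)"
        using B0 E0 by (intro nn_integral_mono, subst ennreal_mult[symmetric]) (auto simp only: intro!: ennreal_leI pw mult_nonneg_nonneg exp_ge_zero)
      also have "\<dots> = ennreal (B * E) * (\<integral>\<^sup>+i. ennreal (exp (- (1 / 2) * (norm (w - lpt \<alpha> \<beta> i))\<^sup>2)) \<partial>count_space UNIV)"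
        by (rule nn_integral_cmult) simp
      also have "\<dots> \<le> ennreal (B * E) * ennreal G" by (intro mult_left_mono G) simp
      also have "\<dots> = ennreal (B * E * G)" using B0 G0 E0 by (intro ennreal_mult[symmetric]) auto
      also have "B * E * G = B * (G * exp 2) * exp (- (1 / (2 * R\<^sup>2)) * (norm w)\<^sup>2)" unfolding E_def by (simp only: mult_ac)
      finally show "(\<integral>\<^sup>+i. ennreal (if norm (lpt \<alpha> \<beta> i) < R \<or> norm w < R then norm (b i) * exp (- (norm (w - lpt \<alpha> \<beta> i))\<^sup>2) else 0) \<partial>count_space UNIV)
        \<le> ennreal (B * (G * exp 2) * exp (- (1 / (2 * R\<^sup>2)) * (norm w)\<^sup>2))" .
    qed (use R2 B0 G0 in auto)
    thus ?thesis by (simp only: mult.assoc diff_0_right)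
  qed
  have "(\<Sum>k<n. fock_norm_sq k F c (lpt \<alpha> \<beta>)) \<le> ennreal (real n * (C / R * (B * (G * exp 2)))\<^sup>2 * (pi / (2 * (1 / (2 * R\<^sup>2)))))"
    by (rule fock_energy_le[OF _ _ le]) (use C R2 B0 G0 in auto)
  also have "real n * (C / R * (B * (G * exp 2)))\<^sup>2 * (pi / (2 * (1 / (2 * R\<^sup>2)))) = Q"
    using R2 unfolding Q_def by (simp add: power_mult_distrib power_divide)
  also have "ennreal Q < ennreal (A * (real m * (\<delta> / 2)\<^sup>2))" using m Q0 by (simp add: ennreal_lessI)
  also have "\<dots> \<le> ennreal (A * (\<Sum>i\<in>F. (norm (c i))\<^sup>2))"
  proof (intro ennreal_leI mult_left_mono)
    have "real m * (\<delta> / 2)\<^sup>2 = (\<Sum>i\<in>T. (\<delta> / 2)\<^sup>2)" by (simp add: T(2))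
    also have "\<dots> \<le> (\<Sum>i\<in>T. (norm (c i))\<^sup>2)"
    proof (rule sum_mono)
      fix i assume i: "i \<in> T"
      have "norm (lpt \<alpha> \<beta> i) / R \<le> 1 / 2" using TR[OF i] R2 by (simp add: field_simps)
      hence half: "1 / 2 \<le> 1 - norm (lpt \<alpha> \<beta> i) / R" by linarith
      have "1 / 2 * \<delta> \<le> (1 - norm (lpt \<alpha> \<beta> i) / R) * norm (b i)" 
      proof (rule mult_mono)
        show "\<delta> \<le> norm (b i)" using i T(3) by auto
      qed (use \<delta>(1) half in linarith)+
      also have "\<dots> \<le> norm (c i)" unfolding c_def norm_mult norm_of_real by (intro mult_right_mono) auto
      finally show "(\<delta> / 2)\<^sup>2 \<le> (norm (c i))\<^sup>2" using \<delta>(1) by (intro power_mono) auto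
    qed
    also have "\<dots> \<le> (\<Sum>i\<in>F. (norm (c i))\<^sup>2)"
    proof (rule sum_mono2[OF finF])
      have "norm (lpt \<alpha> \<beta> i) < R" if "i \<in> T" for i using TR[OF that] norm_ge_zero[of "lpt \<alpha> \<beta> i"] by linarith
      thus "T \<subseteq> F" by (auto simp: F_def)
    qed auto
    finally show "real m * (\<delta> / 2)\<^sup>2 \<le> (\<Sum>i\<in>F. (norm (c i))\<^sup>2)" .
  qed (use A in auto)
  finally show ?thesis using finF by blast
qed

text \<open>The modulus of b is a periodic function of \<open>lpt \<alpha> \<beta> i + a\<close>
  times a Gaussian of rate \<open>\<tau>\<close>, where \<open>\<tau>\<close> = pi / 2 - n
  \<open>\<kappa>\<close> is the deficit of growth. It is positive above the critical density and
  zero at it.\<close>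

lemma fock_no_lower_bound:
  fixes \<alpha> \<beta> :: complex
  assumes V: "0 < Im (cnj \<alpha> * \<beta>)" and n: "n \<ge> 1" "real n \<le> 1 / Im (cnj \<alpha> * \<beta>)" and A: "A > 0"
  shows "\<exists>F c. finite F \<and> (\<Sum>k<n. fock_norm_sq k F c (lpt \<alpha> \<beta>)) < ennreal (A * (\<Sum>i\<in>F. (norm (c i))\<^sup>2))"
proof -
  define v where "v = Im (cnj \<alpha> * \<beta>)"
  have v: "v > 0" using V by (simp only: v_def)
  have V0: "Im (cnj \<alpha> * \<beta>) \<noteq> 0" using V by linarith
  define \<alpha>' where "\<alpha>' = \<alpha> / of_real v"
  define \<beta>' where "\<beta>' = \<beta> / of_real v"
  have V': "Im (cnj \<alpha>' * \<beta>') = 1 / v"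
  proof -
    have "cnj \<alpha>' * \<beta>' = (cnj \<alpha> * \<beta>) / of_real (v * v)" by (simp add: \<alpha>'_def \<beta>'_def)
    thus ?thesis using v by (simp only: Im_divide_of_real v_def[symmetric]) simp
  qed
  obtain \<sigma> where "lattice_sigma \<alpha>' \<beta>' \<sigma> (pi / (2 * Im (cnj \<alpha>' * \<beta>')))"
  proof (rule lattice_sigma_interpretation)
    show "0 < Im (cnj \<alpha>' * \<beta>')" unfolding V' using v by simp
  qed blast
  then interpret S: lattice_sigma \<alpha>' \<beta>' \<sigma> "pi / (2 * Im (cnj \<alpha>' * \<beta>'))" .
  define \<kappa> where "\<kappa> = pi / (2 * Im (cnj \<alpha>' * \<beta>'))"
  have \<kappa>: "\<kappa> = pi * v / 2" unfolding \<kappa>_def V' using v by simp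
  have n\<kappa>: "real n * \<kappa> \<le> pi / 2" 
  proof -
    have "real n * v \<le> 1" using n(2) v unfolding v_def[symmetric] by (simp add: field_simps)
    hence "(real n * v) * (pi / 2) \<le> 1 * (pi / 2)" by (rule mult_right_mono) simp
    thus ?thesis unfolding \<kappa> by (simp add: mult_ac)
  qed
  \<comment> \<open>A third of a dual generator, so that \<sigma> does not vanish at the dual
    lattice shifted by \<open>a\<close>.\<close>
  define a where "a = of_real (1 / 3) * \<alpha>' + of_real 0 * \<beta>'"
  obtain p where p: "p > 0" "\<And>s t. frac s \<in> {1 / 3, 2 / 3} \<or> frac t \<in> {1 / 3, 2 / 3} \<Longrightarrow> p \<le> S.per (complex_of_real s * \<alpha>' + complex_of_real t * \<beta>')"
    by (rule S.per_lower_bound) blast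
  have "frac (1 / 3 :: real) = 1 / 3" by (simp add: frac_eq)
  hence pa: "p \<le> S.per a" unfolding a_def by (intro p(2)) simp
  obtain P where P: "P > 0" "\<And>z. S.per z \<le> P" by (rule S.per_bounded) blast
  define b where "b = (\<lambda>i. cnj (\<sigma> (lpt \<alpha> \<beta> i + a) ^ n) * exp (- pi * cnj a * lpt \<alpha> \<beta> i - pi * (norm (lpt \<alpha> \<beta> i))\<^sup>2 / 2))"
  define \<tau> where "\<tau> = pi / 2 - real n * \<kappa>"
  define q where "q = exp (pi / 2 * (norm a)\<^sup>2)"
  have q: "q > 0" by (simp add: q_def)
  have nb: "norm (b i) = S.per (lpt \<alpha> \<beta> i + a) ^ n * q * exp (- \<tau> * (norm (lpt \<alpha> \<beta> i + a))\<^sup>2)" for i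
  proof -
    define l where "l = lpt \<alpha> \<beta> i"
    have ns: "norm (\<sigma> (l + a)) ^ n = S.per (l + a) ^ n * exp (real n * \<kappa> * (norm (l + a))\<^sup>2)"
      unfolding S.norm_sigma \<kappa>_def[symmetric] by (simp add: power_mult_distrib mult.assoc flip: exp_of_nat_mult)
    have ee: "real n * \<kappa> * (norm (l + a))\<^sup>2 + Re (- pi * cnj a * l - pi * (norm l)\<^sup>2 / 2) = pi / 2 * (norm a)\<^sup>2 + - \<tau> * (norm (l + a))\<^sup>2"
      unfolding \<tau>_def cmod_power2 by (simp add: power2_eq_square field_simps)
    have "norm (b i) = norm (\<sigma> (l + a)) ^ n * exp (Re (- pi * cnj a * l - pi * (norm l)\<^sup>2 / 2))"
      unfolding b_def l_def[symmetric] norm_mult norm_exp_eq_Re complex_mod_cnj norm_power ..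
    also have "\<dots> = S.per (l + a) ^ n * exp (real n * \<kappa> * (norm (l + a))\<^sup>2 + Re (- pi * cnj a * l - pi * (norm l)\<^sup>2 / 2))"
      unfolding ns exp_add by (simp only: mult.assoc)
    also have "\<dots> = S.per (l + a) ^ n * q * exp (- \<tau> * (norm (l + a))\<^sup>2)" unfolding ee exp_add q_def by (simp only: mult.assoc)
    finally show ?thesis unfolding l_def .
  qed
  have per0: "0 \<le> S.per z" for z unfolding S.per_def by simp
  have bB: "norm (b i) \<le> (P ^ n * q) * exp (- \<tau> * (norm (lpt \<alpha> \<beta> i + a))\<^sup>2)" for i
    unfolding nb using q P per0 by (intro mult_right_mono power_mono) auto
  have zero: "(\<integral>i. b i * (w - lpt \<alpha> \<beta> i) ^ k * fock_kernel (lpt \<alpha> \<beta> i) w \<partial>count_space UNIV) = 0" if "k < n" for k w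
    unfolding b_def by (rule S.fock_vanishing_sum[OF V _ _ n\<kappa>[unfolded \<kappa>_def] that]) (simp_all add: \<alpha>'_def \<beta>'_def v_def)
  show ?thesis
  proof (cases "\<tau> > 0")
    case True
    have "norm (b (0, 0)) > 0" unfolding nb using pa p(1) q by (simp add: lpt_def)
    hence "b (0, 0) \<noteq> 0" by auto
    thus ?thesis by (rule fock_energy_small_decaying[OF V0 True bB _ A zero])
  next
    case False
    hence \<tau>: "\<tau> = 0" using n\<kappa> by (simp add: \<tau>_def)
    have nv: "real n * v = 1" using \<tau> unfolding \<tau>_def \<kappa> by (simp add: field_simps)
    \<comment> \<open>At critical density the dual lattice is \<open>n\<close> times the lattice,
      hence contained in it. Along its points the periodic modulus keeps its value at
      \<open>a\<close>, which supplies infinitely many large coefficients.\<close>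
    have lp: "lpt \<alpha> \<beta> (int n * t, 0) = lpt \<alpha>' \<beta>' (t, 0)" for t
    proof -
      have "\<alpha>' = of_nat n * \<alpha>"
      proof -
        have "of_nat n * of_real v = (1 :: complex)" using nv by (metis of_real_1 of_real_mult of_real_of_nat_eq)
        thus ?thesis unfolding \<alpha>'_def using v by (simp add: field_simps)
      qed
      thus ?thesis by (simp add: lpt_def)
    qed
    have "p ^ n * q \<le> norm (b (int n * t, 0))" for t
    proof -
      have "S.per (lpt \<alpha> \<beta> (int n * t, 0) + a) = S.per a" unfolding lp using S.per_lpt[of a "(t, 0)"] by (simp add: add.commute)
      thus ?thesis unfolding nb \<tau> using pa p(1) q by (simp add: power_mono)
    qed
    hence "range (\<lambda>t. (int n * t, 0)) \<subseteq> {i. p ^ n * q \<le> norm (b i)}" by auto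
    moreover have "infinite (range (\<lambda>t :: int. (int n * t, 0 :: int)))"
      using finite_imageD[of "\<lambda>t :: int. (int n * t, 0 :: int)" UNIV] infinite_UNIV_int n(1) by (auto simp: inj_on_def)
    ultimately have inf: "infinite {i. p ^ n * q \<le> norm (b i)}" using finite_subset by blast
    have "norm (b i) \<le> P ^ n * q" for i using bB[of i] by (simp add: \<tau>)
    moreover have "p ^ n * q > 0" using p(1) q by simp
    ultimately show ?thesis using inf by (intro fock_energy_small_bounded[OF V0 _ _ _ A zero])
  qed
qed

section \<open>Gabor systems of Hermite functions\<close>

text \<open>Exchanging the generators flips the orientation of the basis and only relabels the index
  set; it reduces both bounds to positively oriented bases.\<close>

lemma fock_sum_swap:
  "fock_sum k F c (lpt \<alpha> \<beta>) w = fock_sum k (prod.swap ` F) (c \<circ> prod.swap) (lpt \<beta> \<alpha>) w"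
  unfolding fock_sum_def by (subst sum.reindex) (auto simp: inj_on_def lpt_def add.commute)

lemma fock_lower_bound_unoriented:
  fixes \<alpha> \<beta> :: complex
  assumes V: "Im (cnj \<alpha> * \<beta>) \<noteq> 0" and n: "1 / \<bar>Im (cnj \<alpha> * \<beta>)\<bar> < real n"
  obtains A where "A > 0" "\<And>F c. finite F \<Longrightarrow> ennreal (A * (\<Sum>i\<in>F. (norm (c i))\<^sup>2)) \<le> (\<Sum>k<n. fock_norm_sq k F c (lpt \<alpha> \<beta>))"
proof (cases "Im (cnj \<alpha> * \<beta>) > 0")
  case True
  hence "1 / Im (cnj \<alpha> * \<beta>) < real n" using n by (simp only: abs_of_pos)
  thus thesis by (rule fock_lower_bound[OF True]) (rule that, blast+)
next
  case False
  have sw: "Im (cnj \<beta> * \<alpha>) = - Im (cnj \<alpha> * \<beta>)" by (simp add: algebra_simps)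
  have pos: "0 < Im (cnj \<beta> * \<alpha>)" using False V sw by linarith
  have "\<bar>Im (cnj \<alpha> * \<beta>)\<bar> = Im (cnj \<beta> * \<alpha>)" using pos sw by linarith
  hence "1 / Im (cnj \<beta> * \<alpha>) < real n" using n by (simp only:)
  then obtain A where A: "A > 0" "\<And>F c. finite F \<Longrightarrow> ennreal (A * (\<Sum>i\<in>F. (norm (c i))\<^sup>2)) \<le> (\<Sum>k<n. fock_norm_sq k F c (lpt \<beta> \<alpha>))"
    by (rule fock_lower_bound[OF pos]) blast
  show thesis
  proof (rule that[OF A(1)])
    fix F :: "(int \<times> int) set" and c assume "finite F"
    hence "ennreal (A * (\<Sum>i\<in>prod.swap ` F. (norm ((c \<circ> prod.swap) i))\<^sup>2)) \<le> (\<Sum>k<n. fock_norm_sq k (prod.swap ` F) (c \<circ> prod.swap) (lpt \<beta> \<alpha>))"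
      by (intro A(2)) simp
    moreover have "(\<Sum>i\<in>prod.swap ` F. (norm ((c \<circ> prod.swap) i))\<^sup>2) = (\<Sum>i\<in>F. (norm (c i))\<^sup>2)"
      by (subst sum.reindex) (auto simp: inj_on_def)
    ultimately show "ennreal (A * (\<Sum>i\<in>F. (norm (c i))\<^sup>2)) \<le> (\<Sum>k<n. fock_norm_sq k F c (lpt \<alpha> \<beta>))"
      unfolding fock_sum_swap[of _ F c \<alpha> \<beta>] by simp
  qed
qed

lemma fock_no_lower_bound_unoriented:
  fixes \<alpha> \<beta> :: complex
  assumes V: "Im (cnj \<alpha> * \<beta>) \<noteq> 0" and n: "n \<ge> 1" "real n \<le> 1 / \<bar>Im (cnj \<alpha> * \<beta>)\<bar>" and A: "A > 0"
  obtains F c where "finite F" "(\<Sum>k<n. fock_norm_sq k F c (lpt \<alpha> \<beta>)) < ennreal (A * (\<Sum>i\<in>F. (norm (c i))\<^sup>2))"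
proof (cases "Im (cnj \<alpha> * \<beta>) > 0")
  case True
  hence "real n \<le> 1 / Im (cnj \<alpha> * \<beta>)" using n(2) by (simp only: abs_of_pos)
  from fock_no_lower_bound[OF True n(1) this A] show thesis using that by blast
next
  case False
  have sw: "Im (cnj \<beta> * \<alpha>) = - Im (cnj \<alpha> * \<beta>)" by (simp add: algebra_simps)
  have pos: "0 < Im (cnj \<beta> * \<alpha>)" using False V sw by linarith
  have "\<bar>Im (cnj \<alpha> * \<beta>)\<bar> = Im (cnj \<beta> * \<alpha>)" using pos sw by linarith
  hence "real n \<le> 1 / Im (cnj \<beta> * \<alpha>)" using n(2) by (simp only:)
  from fock_no_lower_bound[OF pos n(1) this A] obtain F c where F: "finite F"
    and less: "(\<Sum>k<n. fock_norm_sq k F c (lpt \<beta> \<alpha>)) < ennreal (A * (\<Sum>i\<in>F. (norm (c i))\<^sup>2))" by blast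
  have s: "(\<Sum>i\<in>F. (norm (c i))\<^sup>2) = (\<Sum>i\<in>prod.swap ` F. (norm ((c \<circ> prod.swap) i))\<^sup>2)"
    by (subst sum.reindex) (auto simp: inj_on_def)
  show thesis using that[OF _ less[unfolded fock_sum_swap[of _ F c \<beta> \<alpha>] s]] F by simp
qed

lemma continuous_hermite_raw: "continuous_on S (\<lambda>t. hermite_raw k (t - x))"
  unfolding hermite_raw_eq by (intro continuous_intros)

text \<open>Order k is one of the summands in the upper bound for Suc k components.\<close>

lemma fock_integral_finite:
  fixes \<alpha> \<beta> :: complex
  assumes V: "Im (cnj \<alpha> * \<beta>) \<noteq> 0" and F: "finite F"
  shows "(fock_norm_sq k F c (lpt \<alpha> \<beta>)) < \<infinity>"
proof -
  obtain B where B: "B > 0" "\<And>F c. finite F \<Longrightarrow> (\<Sum>k<Suc k. fock_norm_sq k F c (lpt \<alpha> \<beta>)) \<le> ennreal (B * (\<Sum>i\<in>F. (norm (c i))\<^sup>2))"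
    by (rule fock_upper_bound[OF V, of "Suc k"]) blast
  have "(fock_norm_sq k F c (lpt \<alpha> \<beta>)) \<le> (\<Sum>k<Suc k. fock_norm_sq k F c (lpt \<alpha> \<beta>))"
    by (rule member_le_sum) auto
  also have "\<dots> \<le> ennreal (B * (\<Sum>i\<in>F. (norm (c i))\<^sup>2))" by (rule B(2)[OF F])
  also have "\<dots> < \<infinity>" by simp
  finally show ?thesis .
qed

text \<open>A vanishing or infinite norm would make the constant 0, by division by zero or by the
  default value of the integral. The isometry for a single point identifies the squared norm with a
  multiple of the integral of |w|^(2 k) exp (- pi |w|^2), which is positive and finite.\<close>

lemma hermite_const_pos: "hermite_const k > 0"
proof -
  define S where "S = fock_sum k {(0, 0) :: int \<times> int} (\<lambda>_. 1) (lpt 1 \<i>)"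
  have S: "S w = w ^ k * fock_kernel 0 w" for w by (simp add: S_def fock_sum_def lpt_def)
  have Sfin: "(\<integral>\<^sup>+w. ennreal ((norm (S w))\<^sup>2) \<partial>lborel) < \<infinity>" unfolding S_def by (rule fock_integral_finite) auto
  have Spos: "(\<integral>\<^sup>+w. ennreal ((norm (S w))\<^sup>2) \<partial>lborel) \<noteq> 0"
  proof
    assume "(\<integral>\<^sup>+w. ennreal ((norm (S w))\<^sup>2) \<partial>lborel) = 0"
    moreover have "(\<lambda>w. ennreal ((norm (S w))\<^sup>2)) \<in> borel_measurable lborel" unfolding S_def by simp
    ultimately have "AE w in lborel. ennreal ((norm (S w))\<^sup>2) = 0" by (subst (asm) nn_integral_0_iff_AE) auto
    hence "AE w in lborel. w = (0 :: complex)" by eventually_elim (simp add: S fock_kernel_def split: if_splits)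
    moreover have "AE w in lborel. w \<noteq> (0 :: complex)" by (rule AE_lborel_singleton)
    ultimately have "AE w in (lborel :: complex measure). w \<notin> UNIV" by eventually_elim simp
    hence "emeasure lborel (UNIV :: complex set) = 0" by (subst (asm) AE_iff_measurable[where N = UNIV]) auto
    thus False by simp
  qed
  have "(\<integral>\<^sup>+t. ennreal ((hermite_raw k t)\<^sup>2) \<partial>lborel) = ennreal ((2 * pi) ^ (2 * k) / sqrt 2) * (\<integral>\<^sup>+w. ennreal ((norm (S w))\<^sup>2) \<partial>lborel)"
  proof -
    have "fock_sum k {(0, 0) :: int \<times> int} (\<lambda>i. 1 * exp (\<i> * pi * of_real (0 * 0))) (\<lambda>i. Complex 0 (- 0)) w = S w" for w
      by (simp add: S fock_sum_def Complex_eq)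
    moreover have "norm (\<Sum>i\<in>{(0, 0) :: int \<times> int}. 1 * (exp (complex_of_real (2 * pi) * \<i> * complex_of_real (0 * t)) * complex_of_real (hermite_raw k (t - 0)))) = \<bar>hermite_raw k t\<bar>" for t by simp
    ultimately show ?thesis
      using bargmann_isometry[of "{(0, 0) :: int \<times> int}" "\<lambda>_. 1" "\<lambda>_. 0" k "\<lambda>_. 0"] by (simp only: power2_abs finite.intros)
  qed
  moreover have "ennreal ((2 * pi) ^ (2 * k) / sqrt 2) * (\<integral>\<^sup>+w. ennreal ((norm (S w))\<^sup>2) \<partial>lborel) < \<infinity>"
    using Sfin by (simp add: ennreal_mult_less_top)
  moreover have "ennreal ((2 * pi) ^ (2 * k) / sqrt 2) * (\<integral>\<^sup>+w. ennreal ((norm (S w))\<^sup>2) \<partial>lborel) > 0"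
    unfolding ennreal_zero_less_mult_iff
  proof
    show "0 < (\<integral>\<^sup>+w. ennreal ((norm (S w))\<^sup>2) \<partial>lborel)" using Spos zero_less_iff_neq_zero by blast
  qed simp
  ultimately have "enn2real (\<integral>\<^sup>+t. ennreal ((hermite_raw k t)\<^sup>2) \<partial>lborel) > 0" by (simp add: enn2real_positive_iff)
  moreover have "(\<lambda>t. (hermite_raw k t)\<^sup>2) \<in> borel_measurable lborel"
    using continuous_hermite_raw[of UNIV k 0] by (simp only: measurable_lborel2 diff_0_right) (intro borel_measurable_continuous_onI continuous_intros)
  ultimately have "(\<integral>t. (hermite_raw k t)\<^sup>2 \<partial>lborel) > 0" by (subst integral_eq_nn_integral) auto
  thus ?thesis by (simp add: hermite_const_def)
qed

text \<open>The time-frequency point \<open>(x, \<omega>)\<close> is identified with \<open>x - i \<omega>\<close>.\<close>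
definition lattice_gen1 :: "real^2^2 \<Rightarrow> complex" where "lattice_gen1 A = Complex (A $ 1 $ 1) (- A $ 2 $ 1)"
definition lattice_gen2 :: "real^2^2 \<Rightarrow> complex" where "lattice_gen2 A = Complex (A $ 1 $ 2) (- A $ 2 $ 2)"

text \<open>The unimodular discrepancy between a modulated translate and the corresponding symmetric
  time-frequency shift. It is absorbed into the coefficients.\<close>

definition gabor_phase :: "real^2^2 \<Rightarrow> int \<times> int \<Rightarrow> complex" where
  "gabor_phase A i = exp (\<i> * pi * of_real (lattice_point A i $ 1 * lattice_point A i $ 2))"

text \<open>The factor between the squared norm of component k and the Fock energy of order k. Only
  its positivity matters, since finitely many components occur.\<close>

definition hermite_weight :: "nat \<Rightarrow> real" where
  "hermite_weight k = (hermite_const k)\<^sup>2 * ((2 * pi) ^ (2 * k) / sqrt 2)"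

lemma hermite_weight_pos: "hermite_weight k > 0"
  using hermite_const_pos[of k] by (simp add: hermite_weight_def)

lemma norm_gabor_phase: "norm (gabor_phase A i) = 1"
  by (simp add: gabor_phase_def norm_exp_eq_Re)

text \<open>The identification with x - i \<omega> reverses the orientation of the plane, hence the
  sign; as det A may have either sign, both bounds are used in their unoriented form.\<close>

lemma Im_lattice_gen: "Im (cnj (lattice_gen1 A) * lattice_gen2 A) = - det A"
  by (simp add: lattice_gen1_def lattice_gen2_def det_2 algebra_simps)

lemma lpt_lattice_gen: "lpt (lattice_gen1 A) (lattice_gen2 A) i = Complex (lattice_point A i $ 1) (- lattice_point A i $ 2)"
  by (simp add: complex_eq_iff lpt_def lattice_gen1_def lattice_gen2_def lattice_point_def matrix_vector_mult_def sum_2 vector_2 algebra_simps)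

lemma gabor_hermite_norm:
  assumes V: "det A \<noteq> 0" and F: "finite F"
  shows "ennreal (vec_L2_norm_sq n (\<lambda>k t. \<Sum>i\<in>F. c i * gabor_hermite A i k t)) =
    (\<Sum>k<n. ennreal (hermite_weight k) * (fock_norm_sq k F (\<lambda>i. c i * gabor_phase A i) (lpt (lattice_gen1 A) (lattice_gen2 A))))"
proof -
  define g where "g = (\<lambda>k t. \<Sum>i\<in>F. c i * gabor_hermite A i k t)"
  define N where "N = (\<lambda>k. fock_norm_sq k F (\<lambda>i. c i * gabor_phase A i) (lpt (lattice_gen1 A) (lattice_gen2 A)))"
  have Nfin: "N k < \<infinity>" for k unfolding N_def by (rule fock_integral_finite[OF _ F]) (use V Im_lattice_gen[of A] in linarith)
  have ge: "ennreal (\<integral>t. (norm (g k t))\<^sup>2 \<partial>lborel) = ennreal (hermite_weight k) * N k" for k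
  proof -
    define h where "h = (\<lambda>t. \<Sum>i\<in>F. c i * (exp (complex_of_real (2 * pi) * \<i> * complex_of_real (lattice_point A i $ 2 * t)) * complex_of_real (hermite_raw k (t - lattice_point A i $ 1))))"
    have hc: "continuous_on UNIV h" unfolding h_def by (intro continuous_intros continuous_hermite_raw)
    have hm: "(\<lambda>t. (norm (h t))\<^sup>2) \<in> borel_measurable borel" by (intro borel_measurable_continuous_onI continuous_intros hc)
    have gh: "g k t = of_real (hermite_const k) * h t" for t
      unfolding g_def h_def sum_distrib_left gabor_hermite_def Let_def hermite_def by (intro sum.cong refl) (simp add: mult_ac)
    have ng: "(norm (g k t))\<^sup>2 = (hermite_const k)\<^sup>2 * (norm (h t))\<^sup>2" for t by (simp add: gh norm_mult power_mult_distrib)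
    have "(\<integral>\<^sup>+t. ennreal ((norm (h t))\<^sup>2) \<partial>lborel) = ennreal ((2 * pi) ^ (2 * k) / sqrt 2) * N k"
      unfolding h_def N_def lpt_lattice_gen[abs_def] gabor_phase_def by (rule bargmann_isometry[OF F])
    moreover have "ennreal (hermite_weight k) = ennreal ((hermite_const k)\<^sup>2) * ennreal ((2 * pi) ^ (2 * k) / sqrt 2)"
      unfolding hermite_weight_def by (rule ennreal_mult) simp_all
    ultimately have "ennreal ((hermite_const k)\<^sup>2) * (\<integral>\<^sup>+t. ennreal ((norm (h t))\<^sup>2) \<partial>lborel) = ennreal (hermite_weight k) * N k"
      by (simp only: mult.assoc)
    moreover have "(\<integral>\<^sup>+t. ennreal ((norm (g k t))\<^sup>2) \<partial>lborel) = ennreal ((hermite_const k)\<^sup>2) * (\<integral>\<^sup>+t. ennreal ((norm (h t))\<^sup>2) \<partial>lborel)"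
      using hm unfolding ng by (simp add: ennreal_mult nn_integral_cmult)
    ultimately have nn: "(\<integral>\<^sup>+t. ennreal ((norm (g k t))\<^sup>2) \<partial>lborel) = ennreal (hermite_weight k) * N k" by simp
    have "(\<integral>t. (norm (g k t))\<^sup>2 \<partial>lborel) = enn2real (\<integral>\<^sup>+t. ennreal ((norm (g k t))\<^sup>2) \<partial>lborel)"
      by (rule integral_eq_nn_integral) (use hm in \<open>auto simp: ng\<close>)
    thus ?thesis unfolding nn using Nfin[of k] by (simp add: ennreal_mult_less_top)
  qed
  have "ennreal (vec_L2_norm_sq n g) = (\<Sum>k<n. ennreal (\<integral>t. (norm (g k t))\<^sup>2 \<partial>lborel))"
    unfolding vec_L2_norm_sq_def by (rule sum_ennreal[symmetric]) simp
  thus ?thesis unfolding ge unfolding g_def N_def .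
qed

theorem theorem7:
  fixes n :: nat and A :: "real^2^2"
  assumes "n \<ge> 1" and "invertible A"
  shows "riesz_sequence n (gabor_hermite A) \<longleftrightarrow> lattice_density A < real n"
proof -
  have det: "det A \<noteq> 0" using assms(2) by (simp add: invertible_det_nz)
  define \<alpha> where "\<alpha> = lattice_gen1 A"
  define \<beta> where "\<beta> = lattice_gen2 A"
  have V: "Im (cnj \<alpha> * \<beta>) \<noteq> 0" unfolding \<alpha>_def \<beta>_def Im_lattice_gen using det by simp
  have D: "lattice_density A = 1 / \<bar>Im (cnj \<alpha> * \<beta>)\<bar>" unfolding \<alpha>_def \<beta>_def Im_lattice_gen lattice_density_def by simp
  \<comment> \<open>The components carry different weights; their minimum and maximum, which exist
    because n >= 1, make the vector norm comparable to the unweighted Fock energy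
    \<open>E\<close>.\<close>
  define q where "q = hermite_weight ` {..<n}"
  have qne: "finite q" "q \<noteq> {}" using assms(1) by (auto simp: q_def lessThan_empty_iff)
  define q\<^sub>0 where "q\<^sub>0 = Min q"
  define q\<^sub>1 where "q\<^sub>1 = Max q"
  have q0: "0 < q\<^sub>0" using Min_in[OF qne] hermite_weight_pos by (auto simp: q\<^sub>0_def q_def)
  have q1: "0 < q\<^sub>1" using Max_in[OF qne] hermite_weight_pos by (auto simp: q\<^sub>1_def q_def)
  have qle: "q\<^sub>0 \<le> hermite_weight k" "hermite_weight k \<le> q\<^sub>1" if "k < n" for k
    using that qne by (auto simp: q\<^sub>0_def q\<^sub>1_def q_def)
  define E where "E = (\<lambda>F c. \<Sum>k<n. fock_norm_sq k F c (lpt \<alpha> \<beta>))"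
  define W where "W = (\<lambda>F c. vec_L2_norm_sq n (\<lambda>k t. \<Sum>i\<in>F. c i * gabor_hermite A i k t))"
  have WE: "ennreal q\<^sub>0 * E F (\<lambda>i. c i * gabor_phase A i) \<le> ennreal (W F c)" "ennreal (W F c) \<le> ennreal q\<^sub>1 * E F (\<lambda>i. c i * gabor_phase A i)"
    if "finite F" for F c
    unfolding W_def E_def gabor_hermite_norm[OF det that] \<alpha>_def \<beta>_def sum_distrib_left
    using qle by (auto intro!: sum_mono mult_right_mono ennreal_leI)
  have W0: "0 \<le> W F c" for F c unfolding W_def vec_L2_norm_sq_def by (simp add: sum_nonneg)
  have ph: "norm (c i * gabor_phase A i) = norm (c i)" for c i by (simp add: norm_mult norm_gabor_phase)
  show ?thesis
  proof
    assume dens: "lattice_density A < real n"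
    obtain a where a: "a > 0" "\<And>F c. finite F \<Longrightarrow> ennreal (a * (\<Sum>i\<in>F. (norm (c i))\<^sup>2)) \<le> E F c"
      unfolding E_def by (rule fock_lower_bound_unoriented[OF V dens[unfolded D]]) blast
    obtain b where b: "b > 0" "\<And>F c. finite F \<Longrightarrow> E F c \<le> ennreal (b * (\<Sum>i\<in>F. (norm (c i))\<^sup>2))"
      unfolding E_def by (rule fock_upper_bound[OF V]) blast
    have lower: "q\<^sub>0 * a * (\<Sum>i\<in>F. (norm (c i))\<^sup>2) \<le> W F c" if F: "finite F" for F c
    proof -
      have "ennreal (a * (\<Sum>i\<in>F. (norm (c i))\<^sup>2)) \<le> E F (\<lambda>i. c i * gabor_phase A i)" using a(2)[OF F, of "\<lambda>i. c i * gabor_phase A i"] unfolding ph .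
      hence "ennreal q\<^sub>0 * ennreal (a * (\<Sum>i\<in>F. (norm (c i))\<^sup>2)) \<le> ennreal (W F c)" using WE(1)[OF F, of c] by (meson mult_left_mono order.trans zero_le)
      hence "ennreal (q\<^sub>0 * (a * (\<Sum>i\<in>F. (norm (c i))\<^sup>2))) \<le> ennreal (W F c)" using q0 a(1) by (simp add: ennreal_mult sum_nonneg)
      thus ?thesis using W0[of F c] by (simp add: mult.assoc)
    qed
    have upper: "W F c \<le> q\<^sub>1 * b * (\<Sum>i\<in>F. (norm (c i))\<^sup>2)" if F: "finite F" for F c
    proof -
      have "E F (\<lambda>i. c i * gabor_phase A i) \<le> ennreal (b * (\<Sum>i\<in>F. (norm (c i))\<^sup>2))" using b(2)[OF F, of "\<lambda>i. c i * gabor_phase A i"] unfolding ph .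
      hence "ennreal (W F c) \<le> ennreal q\<^sub>1 * ennreal (b * (\<Sum>i\<in>F. (norm (c i))\<^sup>2))" using WE(2)[OF F, of c] by (meson mult_left_mono order.trans zero_le)
      hence "ennreal (W F c) \<le> ennreal (q\<^sub>1 * (b * (\<Sum>i\<in>F. (norm (c i))\<^sup>2)))" using q1 b(1) by (simp add: ennreal_mult sum_nonneg)
      thus ?thesis using q1 b(1) by (subst (asm) ennreal_le_iff) (auto simp: mult.assoc sum_nonneg)
    qed
    have "q\<^sub>0 * a > 0" "q\<^sub>1 * b > 0" using q0 q1 a(1) b(1) by auto
    thus "riesz_sequence n (gabor_hermite A)"
      unfolding riesz_sequence_def using lower upper unfolding W_def by blast
  next
    assume "riesz_sequence n (gabor_hermite A)"
    then obtain a where a: "a > 0" "\<And>c. finite {i. c i \<noteq> 0} \<Longrightarrow> a * (\<Sum>i\<in>{i. c i \<noteq> 0}. (norm (c i))\<^sup>2) \<le> W {i. c i \<noteq> 0} c"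
      unfolding riesz_sequence_def W_def by blast
    show "lattice_density A < real n"
    proof (rule ccontr)
      assume "\<not> lattice_density A < real n"
      hence n: "real n \<le> 1 / \<bar>Im (cnj \<alpha> * \<beta>)\<bar>" unfolding D by linarith
      have aq: "a / q\<^sub>1 > 0" using a(1) q1 by simp
      obtain F c where F: "finite F" and less: "E F c < ennreal (a / q\<^sub>1 * (\<Sum>i\<in>F. (norm (c i))\<^sup>2))"
        unfolding E_def by (rule fock_no_lower_bound_unoriented[OF V assms(1) n aq]) blast
      \<comment> \<open>The phases are divided out so that the Gabor sum has Fock coefficients c.
        The Riesz inequality sums over the support of the coefficients, so they are set to 0 outside
        F; the support S may still be smaller than F.\<close>
      define d where "d = (\<lambda>i. if i \<in> F then c i / gabor_phase A i else 0)"
      define S where "S = {i. d i \<noteq> 0}"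
      have SF: "S \<subseteq> F" by (auto simp: S_def d_def)
      have fS: "finite S" using finite_subset[OF SF F] .
      have gp: "gabor_phase A i \<noteq> 0" for i by (simp add: gabor_phase_def)
      have nd: "norm (d i) = norm (c i)" if "i \<in> F" for i using that by (simp add: d_def norm_divide norm_gabor_phase)
      have sums: "(\<Sum>i\<in>S. (norm (d i))\<^sup>2) = (\<Sum>i\<in>F. (norm (c i))\<^sup>2)"
      proof -
        have "(\<Sum>i\<in>S. (norm (d i))\<^sup>2) = (\<Sum>i\<in>F. (norm (d i))\<^sup>2)" by (rule sum.mono_neutral_left[OF F SF]) (auto simp: S_def)
        thus ?thesis using nd by simp
      qed
      have "fock_sum k S (\<lambda>i. d i * gabor_phase A i) (lpt \<alpha> \<beta>) w = fock_sum k F c (lpt \<alpha> \<beta>) w" for k w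
      proof -
        have "fock_sum k S (\<lambda>i. d i * gabor_phase A i) (lpt \<alpha> \<beta>) w = fock_sum k F (\<lambda>i. d i * gabor_phase A i) (lpt \<alpha> \<beta>) w"
          unfolding fock_sum_def by (rule sum.mono_neutral_left[OF F SF]) (auto simp: S_def)
        also have "\<dots> = fock_sum k F c (lpt \<alpha> \<beta>) w" unfolding fock_sum_def by (intro sum.cong refl) (simp add: d_def gp)
        finally show ?thesis .
      qed
      hence ES: "E S (\<lambda>i. d i * gabor_phase A i) = E F c" by (simp add: E_def)
      have "ennreal q\<^sub>1 * ennreal (a / q\<^sub>1 * (\<Sum>i\<in>F. (norm (c i))\<^sup>2)) = ennreal (a * (\<Sum>i\<in>S. (norm (d i))\<^sup>2))"
        unfolding sums using q1 a(1) by (subst ennreal_mult[symmetric]) (auto simp: sum_nonneg)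
      also have "\<dots> \<le> ennreal (W S d)" using a(2)[of d] fS by (intro ennreal_leI) (simp add: S_def)
      also have "\<dots> \<le> ennreal q\<^sub>1 * E F c" using WE(2)[OF fS, of d] unfolding ES .
      finally have "ennreal (a / q\<^sub>1 * (\<Sum>i\<in>F. (norm (c i))\<^sup>2)) \<le> E F c" using q1 by (subst (asm) ennreal_mult_le_mult_iff) auto
      thus False using less by (simp add: not_le[symmetric])
    qed
  qed
qed

end
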